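(* Let $G$ be a connected undirected graph with $n$ vertices, $m$ edges and edge-weight function $w:E(G)\to\mathbb R_{\ge 0}$. There is an algorithm that outputs all relevant cuts of $G$, each exactly once, in non-decreasing order of weight, with delay $\mathcal O(nm\log(n^2/m))$, except that the computation time until the first output is $\mathcal O(n^2\varphi)$.
   Context: For $W\subseteq V(G)$, $E(W;G)=\{st\in E(G): s\in W,\ t\in V(G)\setminus W\}$; a cut of $G$ is a set of the form $E(W;G)$ with $\emptyset\ne W\subsetneq V(G)$, and its weight is the sum of the weights of its edges. For distinct $s,t$, an $s,t$-cut is $E(W;G)$ with $s\in W$, $t\notin W$. Cuts are identified with their incidence vectors in $GF(2)^{E(G)}$; a cut basis is a basis (over $GF(2)$) of the vector space spanned by all cuts, chosen from cuts, and a minimum cut basis is one minimizing the total weight of its cuts. A cut is relevant if it belongs to at least one minimum cut basis. $\varphi$ denotes the time to compute a minimum $s,t$-cut in an edge-weighted undirected graph with $n$ vertices and $m$ edges, for given vertices $s,t$. *)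

theory Defs
  imports Complex_Main "HOL-Library.Z2" "HOL-Library.Function_Algebras"
begin

section \<open>Undirected graphs and cuts\<close>

definition ugraph :: "'v set \<Rightarrow> 'v set set \<Rightarrow> bool" where
  "ugraph V E \<longleftrightarrow> finite V \<and> (\<forall>e\<in>E. e \<subseteq> V \<and> card e = 2)"

definition connected_ugraph :: "'v set \<Rightarrow> 'v set set \<Rightarrow> bool" where
  "connected_ugraph V E \<longleftrightarrow>
     ugraph V E \<and> V \<noteq> {} \<and> (\<forall>x\<in>V. \<forall>y\<in>V. (x, y) \<in> {(u, v). {u, v} \<in> E}\<^sup>*)"

definition cut_edges :: "'v set \<Rightarrow> 'v set set \<Rightarrow> 'v set \<Rightarrow> 'v set set" where
  "cut_edges V E W = {e \<in> E. \<exists>s\<in>W. \<exists>t\<in>V - W. e = {s, t}}"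

definition is_cut :: "'v set \<Rightarrow> 'v set set \<Rightarrow> 'v set set \<Rightarrow> bool" where
  "is_cut V E C \<longleftrightarrow> (\<exists>W. W \<noteq> {} \<and> W \<subset> V \<and> C = cut_edges V E W)"

definition is_st_cut :: "'v set \<Rightarrow> 'v set set \<Rightarrow> 'v \<Rightarrow> 'v \<Rightarrow> 'v set set \<Rightarrow> bool" where
  "is_st_cut V E s t C \<longleftrightarrow> (\<exists>W. W \<subseteq> V \<and> s \<in> W \<and> t \<in> V - W \<and> C = cut_edges V E W)"

definition cut_weight :: "('v set \<Rightarrow> real) \<Rightarrow> 'v set set \<Rightarrow> real" where
  "cut_weight w C = (\<Sum>e\<in>C. w e)"

definition is_min_st_cut ::
    "'v set \<Rightarrow> 'v set set \<Rightarrow> ('v set \<Rightarrow> real) \<Rightarrow> 'v \<Rightarrow> 'v \<Rightarrow> 'v set set \<Rightarrow> bool" where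
  "is_min_st_cut V E w s t C \<longleftrightarrow>
     is_st_cut V E s t C \<and> (\<forall>D. is_st_cut V E s t D \<longrightarrow> cut_weight w C \<le> cut_weight w D)"

section \<open>Cut bases over GF(2)\<close>

text \<open>The space of all functions into \<^typ>\<open>bit\<close> contains \<open>GF(2)\<^sup>E\<close> as the functions
  vanishing outside \<open>E\<close>; incidence vectors of subsets of \<open>E\<close> lie in it.\<close>

definition gf2_scale :: "bit \<Rightarrow> ('e \<Rightarrow> bit) \<Rightarrow> 'e \<Rightarrow> bit" where
  "gf2_scale c f = (\<lambda>e. c * f e)"

interpretation gf2: vector_space gf2_scale
  by standard (auto simp: gf2_scale_def fun_eq_iff algebra_simps)

definition incidence :: "'e set \<Rightarrow> 'e \<Rightarrow> bit" where
  "incidence C = (\<lambda>e. of_bool (e \<in> C))"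

definition cut_basis :: "'v set \<Rightarrow> 'v set set \<Rightarrow> 'v set set set \<Rightarrow> bool" where
  "cut_basis V E B \<longleftrightarrow>
     B \<subseteq> {C. is_cut V E C} \<and>
     gf2.independent (incidence ` B) \<and>
     gf2.span (incidence ` B) = gf2.span (incidence ` {C. is_cut V E C})"

definition min_cut_basis ::
    "'v set \<Rightarrow> 'v set set \<Rightarrow> ('v set \<Rightarrow> real) \<Rightarrow> 'v set set set \<Rightarrow> bool" where
  "min_cut_basis V E w B \<longleftrightarrow>
     cut_basis V E B \<and>
     (\<forall>B'. cut_basis V E B' \<longrightarrow> (\<Sum>C\<in>B. cut_weight w C) \<le> (\<Sum>C\<in>B'. cut_weight w C))"

definition relevant_cut ::
    "'v set \<Rightarrow> 'v set set \<Rightarrow> ('v set \<Rightarrow> real) \<Rightarrow> 'v set set \<Rightarrow> bool" where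
  "relevant_cut V E w C \<longleftrightarrow> (\<exists>B. min_cut_basis V E w B \<and> C \<in> B)"

section \<open>Real RAM\<close>

text \<open>A unit-cost random access machine with one memory of natural numbers, used for data
  and for addresses (indirect addressing in \<open>NLoad\<close>, \<open>NStore\<close>, \<open>RLoad\<close>, \<open>RStore\<close>), one memory
  of real numbers, and a write-only output tape. The natural-number operations are restricted to
  addition and truncated subtraction, and there is no conversion from reals to naturals
  (no rounding), so that unit cost is not abused by packing data into one large number. The only
  constants are integers, so that a program cannot contain infinite advice. The machine halts when
  the program counter leaves the program.\<close>

datatype instr =
    NConst nat nat
  | NAdd nat nat nat
  | NSub nat nat nat
  | NLoad nat nat
  | NStore nat nat
  | RConst nat int
  | RAdd nat nat nat
  | RSub nat nat nat
  | RMul nat nat nat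
  | RDiv nat nat nat
  | RLoad nat nat
  | RStore nat nat
  | Jump nat
  | JumpNLess nat nat nat
  | JumpRLess nat nat nat
  | Output nat

type_synonym program = "instr list"

record config =
  pc :: nat
  nmem :: "nat \<Rightarrow> nat"
  rmem :: "nat \<Rightarrow> real"
  tape :: "nat list"

definition set_nmem :: "nat \<Rightarrow> nat \<Rightarrow> config \<Rightarrow> config" where
  "set_nmem a x c = c\<lparr>pc := Suc (pc c), nmem := (nmem c)(a := x)\<rparr>"

definition set_rmem :: "nat \<Rightarrow> real \<Rightarrow> config \<Rightarrow> config" where
  "set_rmem a x c = c\<lparr>pc := Suc (pc c), rmem := (rmem c)(a := x)\<rparr>"

fun exec :: "instr \<Rightarrow> config \<Rightarrow> config" where
  "exec (NConst a k) c = set_nmem a k c"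
| "exec (NAdd a i j) c = set_nmem a (nmem c i + nmem c j) c"
| "exec (NSub a i j) c = set_nmem a (nmem c i - nmem c j) c"
| "exec (NLoad a i) c = set_nmem a (nmem c (nmem c i)) c"
| "exec (NStore i j) c = set_nmem (nmem c i) (nmem c j) c"
| "exec (RConst a k) c = set_rmem a (of_int k) c"
| "exec (RAdd a i j) c = set_rmem a (rmem c i + rmem c j) c"
| "exec (RSub a i j) c = set_rmem a (rmem c i - rmem c j) c"
| "exec (RMul a i j) c = set_rmem a (rmem c i * rmem c j) c"
| "exec (RDiv a i j) c = set_rmem a (rmem c i / rmem c j) c"
| "exec (RLoad a i) c = set_rmem a (rmem c (nmem c i)) c"
| "exec (RStore i j) c = set_rmem (nmem c i) (rmem c j) c"
| "exec (Jump l) c = c\<lparr>pc := l\<rparr>"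
| "exec (JumpNLess i j l) c = c\<lparr>pc := (if nmem c i < nmem c j then l else Suc (pc c))\<rparr>"
| "exec (JumpRLess i j l) c = c\<lparr>pc := (if rmem c i < rmem c j then l else Suc (pc c))\<rparr>"
| "exec (Output i) c = c\<lparr>pc := Suc (pc c), tape := tape c @ [nmem c i]\<rparr>"

definition halted :: "program \<Rightarrow> config \<Rightarrow> bool" where
  "halted P c \<longleftrightarrow> length P \<le> pc c"

definition step :: "program \<Rightarrow> config \<Rightarrow> config" where
  "step P c = (if halted P c then c else exec (P ! pc c) c)"

definition load :: "'a::zero list \<Rightarrow> nat \<Rightarrow> 'a" where
  "load xs i = (if i < length xs then xs ! i else 0)"

definition init_config :: "nat list \<times> real list \<Rightarrow> config" where
  "init_config x = \<lparr>pc = 0, nmem = load (fst x), rmem = load (snd x), tape = []\<rparr>"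

definition run :: "program \<Rightarrow> nat list \<times> real list \<Rightarrow> nat \<Rightarrow> config" where
  "run P x t = (step P ^^ t) (init_config x)"

definition halts_with_output :: "program \<Rightarrow> nat list \<times> real list \<Rightarrow> nat list \<Rightarrow> bool" where
  "halts_with_output P x ys \<longleftrightarrow> (\<exists>t. halted P (run P x t) \<and> tape (run P x t) = ys)"

text \<open>The two times below are only meaningful for a computation that halts, respectively
  writes at least \<open>k\<close> symbols.\<close>

definition halt_time :: "program \<Rightarrow> nat list \<times> real list \<Rightarrow> nat" where
  "halt_time P x = (LEAST t. halted P (run P x t))"

definition output_time :: "program \<Rightarrow> nat list \<times> real list \<Rightarrow> nat \<Rightarrow> nat" where
  "output_time P x k = (LEAST t. k \<le> length (tape (run P x t)))"

section \<open>Encoding of instances and of cuts\<close>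

text \<open>A graph on the vertices \<open>0, \<dots>, n - 1\<close> is presented as a list of its edges, each
  listed once, in arbitrary order and orientation, together with the list of their weights.
  A cut is written as its incidence vector, \<open>card E\<close> symbols in the order of that list.\<close>

definition edge_list :: "nat set set \<Rightarrow> (nat \<times> nat) list \<Rightarrow> bool" where
  "edge_list E es \<longleftrightarrow>
     distinct (map (\<lambda>(u, v). {u, v}) es) \<and> set (map (\<lambda>(u, v). {u, v}) es) = E"

definition encode_edges :: "(nat \<times> nat) list \<Rightarrow> nat list" where
  "encode_edges es = concat (map (\<lambda>(u, v). [u, v]) es)"

definition encode_weights :: "(nat set \<Rightarrow> real) \<Rightarrow> (nat \<times> nat) list \<Rightarrow> real list" where
  "encode_weights w es = map (\<lambda>(u, v). w {u, v}) es"

definition graph_input ::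
    "nat \<Rightarrow> (nat \<times> nat) list \<Rightarrow> (nat set \<Rightarrow> real) \<Rightarrow> nat list \<times> real list" where
  "graph_input n es w = (n # length es # encode_edges es, encode_weights w es)"

definition st_graph_input ::
    "nat \<Rightarrow> (nat \<times> nat) list \<Rightarrow> (nat set \<Rightarrow> real) \<Rightarrow> nat \<Rightarrow> nat \<Rightarrow> nat list \<times> real list" where
  "st_graph_input n es w s t = (n # length es # s # t # encode_edges es, encode_weights w es)"

definition encode_cut :: "(nat \<times> nat) list \<Rightarrow> nat set set \<Rightarrow> nat list" where
  "encode_cut es C = map (\<lambda>(u, v). of_bool ({u, v} \<in> C)) es"

definition min_st_cut_program :: "program \<Rightarrow> (nat \<Rightarrow> nat \<Rightarrow> nat) \<Rightarrow> bool" where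
  "min_st_cut_program P \<phi> \<longleftrightarrow>
     (\<forall>n E w es s t.
        ugraph {..<n} E \<and> (\<forall>e\<in>E. 0 \<le> w e) \<and> edge_list E es \<and> s < n \<and> t < n \<and> s \<noteq> t \<longrightarrow>
        (\<exists>C. is_min_st_cut {..<n} E w s t C \<and>
             halts_with_output P (st_graph_input n es w s t) (encode_cut es C)) \<and>
        halt_time P (st_graph_input n es w s t) \<le> \<phi> n (card E))"

text \<open>Completion time of the \<open>k\<close>-th cut written, counted from \<open>1\<close>, in a graph with \<open>m\<close> edges.\<close>

definition cut_time :: "program \<Rightarrow> nat list \<times> real list \<Rightarrow> nat \<Rightarrow> nat \<Rightarrow> nat" where
  "cut_time P x m k = output_time P x (k * m)"

end

theory Submission
  imports Defs
begin

text \<open>A cut is relevant iff it is a minimum \<open>s\<close>-\<open>t\<close>-cut for some pair of vertices. Let \<open>par v < v\<close> be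
  an earlier vertex for which the minimum cut value \<open>Lam v\<close> against \<open>v\<close> is largest. Every relevant cut
  is a minimum cut between \<open>v\<close> and \<open>par v\<close> for some \<open>v\<close>; it is charged to the smallest such \<open>v\<close> with
  \<open>Lam v\<close> equal to its weight, so the cuts charged to \<open>v\<close> are the minimum cuts that do not separate
  \<open>u\<close> from \<open>par u\<close> for \<open>u < v\<close> with \<open>Lam u = Lam v\<close>. After merging these pairs they form a ring of
  sets, and a maximal chain in it, found with \<open>O(n)\<close> minimum cut computations, cuts the vertices into
  blocks such that the cuts correspond to the ideals of a relation on the blocks. Treating the
  vertices in the order of \<open>Lam\<close> and listing the ideals of each one lexicographically takes time
  \<open>O(n m)\<close> between two cuts.

  The given minimum cut program is simulated step by step, with contracted graphs as
  inputs. Since its time bound depends on \<open>n\<close> and \<open>m\<close>, contraction must not change these numbers: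
  superfluous edges are kept with weight 0.\<close>

section \<open>Cuts of a weighted graph given by an edge list\<close>

text \<open>That a relevant cut is a minimum cut for some pair is the deeper half of the criterion:
  by uncrossing smallest minimum cuts, any other cut is a GF(2) sum of strictly lighter ones.
  Nothing is assumed about the growth of \<open>\<phi>\<close>, and its promise concerns simple
  graphs only, so contraction has to reroute edges instead of deleting or doubling them. A minimum
  cut program must write \<open>m\<close> symbols, hence \<open>m \<le> \<phi> n m\<close>; with
  \<open>n \<le> m + 1\<close> this absorbs all bookkeeping around a query. The parents take about
  \<open>n^2 / 2\<close> queries. Refining a chain needs at most two queries per vertex, because a
  vertex is compared with one earlier vertex of its block. Vertices to which no cut is charged still
  cost \<open>O(n)\<close> each between two outputs, at most \<open>O(n^2) = O(n m)\<close> in all.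
  The logarithm in the claimed delay is at least 1, since \<open>2 m \<le> n^2\<close>. Times are
  established for a structured language in which only source-level actions are counted; compiling
  multiplies them by a constant that depends on the program alone.\<close>

locale wgraph =
  fixes n m :: nat and ea eb :: "nat \<Rightarrow> nat" and wt :: "nat \<Rightarrow> real"
  assumes ends: "i < m \<Longrightarrow> ea i < n \<and> eb i < n \<and> ea i \<noteq> eb i"
    and simple: "i < m \<Longrightarrow> j < m \<Longrightarrow> {ea i, eb i} = {ea j, eb j} \<Longrightarrow> i = j"
    and wt_nonneg: "i < m \<Longrightarrow> 0 \<le> wt i"
begin

abbreviation "crosses X i \<equiv> (ea i \<in> X) \<noteq> (eb i \<in> X)"

definition d :: "nat set \<Rightarrow> real" where
  "d X = (\<Sum>i<m. if crosses X i then wt i else 0)"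

definition sep :: "nat \<Rightarrow> nat \<Rightarrow> nat set \<Rightarrow> bool" where
  "sep s t X \<longleftrightarrow> X \<subseteq> {..<n} \<and> s \<in> X \<and> t \<notin> X"

definition lam :: "nat \<Rightarrow> nat \<Rightarrow> real" where
  "lam s t = Min (d ` {X. sep s t X})"

lemma d_nonneg: "0 \<le> d X"
  unfolding d_def by (rule sum_nonneg) (use wt_nonneg in auto)

lemma d_submodular: "d (A \<inter> B) + d (A \<union> B) \<le> d A + d B"
  unfolding d_def sum.distrib[symmetric] by (rule sum_mono) (use wt_nonneg in auto)

lemma d_posimodular: "d (A - B) + d (B - A) \<le> d A + d B"
  unfolding d_def sum.distrib[symmetric] by (rule sum_mono) (use wt_nonneg in auto)

lemma d_compl: "d ({..<n} - A) = d A"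
  unfolding d_def by (rule sum.cong) (use ends in auto)

lemma finite_sep: "finite {X. sep s t X}"
  by (rule finite_subset[of _ "Pow {..<n}"]) (auto simp: sep_def)

lemma lam_le: "sep s t X \<Longrightarrow> lam s t \<le> d X"
  unfolding lam_def using finite_sep by (intro Min_le) auto

lemma lam_attained:
  assumes "s < n" "s \<noteq> t" shows "\<exists>X. sep s t X \<and> d X = lam s t"
proof -
  have "sep s t {s}" using assms by (auto simp: sep_def)
  then have "Min (d ` {X. sep s t X}) \<in> d ` {X. sep s t X}"
    using finite_sep by (intro Min_in) auto
  then show ?thesis unfolding lam_def by auto
qed

lemma lam_sym:
  assumes "s < n" "t < n" "s \<noteq> t" shows "lam s t = lam t s"
proof -
  have "lam t s \<le> lam s t" if st: "s < n" "t < n" "s \<noteq> t" for s t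
  proof -
    obtain X where X: "sep s t X" "d X = lam s t" using lam_attained[of s t] st by auto
    then have "sep t s ({..<n} - X)" using st by (auto simp: sep_def)
    then show ?thesis using lam_le d_compl X(2) by metis
  qed
  then show ?thesis using assms by (metis order_antisym)
qed

text \<open>A minimum cut between \<open>x\<close> and \<open>z\<close> puts \<open>y\<close> on one
  of its sides and therefore separates \<open>x\<close> from \<open>y\<close> or \<open>y\<close>
  from \<open>z\<close>.\<close>

lemma lam_ultrametric:
  assumes "x < n" "y < n" "x \<noteq> z"
  shows "y = x \<or> y = z \<or> min (lam x y) (lam y z) \<le> lam x z"
proof -
  obtain X where X: "sep x z X" "d X = lam x z" using lam_attained[of x z] assms by auto
  then have "sep x y X \<or> sep y z X" by (auto simp: sep_def)
  then show ?thesis using lam_le[of x y X] lam_le[of y z X] X(2) by auto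
qed

subsection \<open>The cut space\<close>

definition edges :: "nat set set" where
  "edges = (\<lambda>i. {ea i, eb i}) ` {..<m}"

abbreviation cut :: "nat set \<Rightarrow> nat set set" where
  "cut X \<equiv> cut_edges {..<n} edges X"

lemma cut_iff: "i < m \<Longrightarrow> {ea i, eb i} \<in> cut X \<longleftrightarrow> crosses X i"
  using ends[of i] unfolding cut_edges_def edges_def by (auto simp: doubleton_eq_iff)

lemma cut_subset: "cut X \<subseteq> edges"
  by (auto simp: cut_edges_def)

lemma cut_weight_eq:
  assumes w: "\<And>i. i < m \<Longrightarrow> w {ea i, eb i} = wt i"
  shows "cut_weight w (cut X) = d X"
proof -
  have "inj_on (\<lambda>i. {ea i, eb i}) {..<m}" using simple by (auto simp: inj_on_def)
  moreover have "cut X = (\<lambda>i. {ea i, eb i}) ` {i\<in>{..<m}. crosses X i}"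
  proof
    show "cut X \<subseteq> (\<lambda>i. {ea i, eb i}) ` {i\<in>{..<m}. crosses X i}"
    proof
      fix e assume e: "e \<in> cut X"
      then obtain i where "i < m" "e = {ea i, eb i}" using cut_subset by (auto simp: edges_def)
      then show "e \<in> (\<lambda>i. {ea i, eb i}) ` {i\<in>{..<m}. crosses X i}" using e cut_iff[of i X] by auto
    qed
    show "(\<lambda>i. {ea i, eb i}) ` {i\<in>{..<m}. crosses X i} \<subseteq> cut X" using cut_iff by auto
  qed
  ultimately have "cut_weight w (cut X) = (\<Sum>i\<in>{i\<in>{..<m}. crosses X i}. w {ea i, eb i})"
    unfolding cut_weight_def by (simp add: sum.reindex inj_on_def)
  also have "\<dots> = (\<Sum>i\<in>{i\<in>{..<m}. crosses X i}. wt i)" using w by (intro sum.cong) auto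
  also have "\<dots> = d X" unfolding d_def by (rule sum.inter_filter) simp
  finally show ?thesis .
qed

definition vec :: "nat set \<Rightarrow> nat set \<Rightarrow> bit" where
  "vec X = incidence (cut X)"

lemma incidence_inj: "inj incidence"
  by (auto simp: inj_def incidence_def fun_eq_iff)

lemma vec_eq_iff: "vec X = vec Y \<longleftrightarrow> cut X = cut Y"
  using incidence_inj by (auto simp: vec_def inj_def)

lemma vec_symdiff: "vec ((A - B) \<union> (B - A)) = vec A + vec B"
proof
  fix e
  show "vec ((A - B) \<union> (B - A)) e = (vec A + vec B) e"
  proof (cases "e \<in> edges")
    case True
    then obtain i where i: "i < m" "e = {ea i, eb i}" by (auto simp: edges_def)
    show ?thesis using i by (auto simp: vec_def incidence_def cut_iff)
  next
    case False
    then show ?thesis using cut_subset by (auto simp: vec_def incidence_def)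
  qed
qed

lemma vec_disjoint: "A \<inter> B = {} \<Longrightarrow> vec (A \<union> B) = vec A + vec B"
  using vec_symdiff[of A B] by (simp add: Diff_triv Int_commute)

lemma vec_empty: "vec {} = 0"
  by (auto simp: vec_def incidence_def cut_edges_def)

lemma vec_compl:
  assumes "A \<subseteq> {..<n}" shows "vec ({..<n} - A) = vec A"
proof -
  have "e \<in> cut ({..<n} - A) \<longleftrightarrow> e \<in> cut A" if e: "e \<in> edges" for e
  proof -
    obtain i where i: "i < m" "e = {ea i, eb i}" using e by (auto simp: edges_def)
    then show ?thesis unfolding i(2) cut_iff[OF i(1)] using ends[OF i(1)] by auto
  qed
  then have "cut ({..<n} - A) = cut A" using cut_subset by blast
  then show ?thesis by (simp add: vec_def)
qed

lemma vec_Union: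
  assumes "finite F" "\<And>A B. A \<in> F \<Longrightarrow> B \<in> F \<Longrightarrow> A \<noteq> B \<Longrightarrow> A \<inter> B = {}"
  shows "vec (\<Union>F) = (\<Sum>A\<in>F. vec A)"
  using assms
proof (induction F rule: finite_induct)
  case empty then show ?case by (simp add: vec_empty)
next
  case (insert A F)
  have "A \<inter> \<Union>F = {}" using insert by fastforce
  then show ?case using insert vec_disjoint[of A "\<Union>F"] by simp
qed

definition proper :: "nat set \<Rightarrow> bool" where
  "proper X \<longleftrightarrow> X \<subseteq> {..<n} \<and> X \<noteq> {} \<and> X \<noteq> {..<n}"

text \<open>Uncrossing with respect to the common vertex \<open>x\<close>. If \<open>z\<close> is in
  \<open>A\<close> or \<open>y\<close> is in \<open>B\<close>, intersection and union again separate
  suitable vertices from \<open>x\<close>, and submodularity makes the intersection a minimum cut;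
  otherwise the two differences do so by posimodularity. Smallest cardinality then forces the
  intersection or difference to be all of \<open>A\<close> or \<open>B\<close>.\<close>

lemma minimal_cuts_laminar:
  assumes y: "sep y x A" "d A = lam y x" "\<And>X. sep y x X \<Longrightarrow> d X = lam y x \<Longrightarrow> card A \<le> card X"
    and z: "sep z x B" "d B = lam z x" "\<And>X. sep z x X \<Longrightarrow> d X = lam z x \<Longrightarrow> card B \<le> card X"
  shows "A \<subseteq> B \<or> B \<subseteq> A \<or> A \<inter> B = {}"
proof -
  have fin: "finite A" "finite B" using y(1) z(1) finite_subset[of _ "{..<n}"] by (auto simp: sep_def)
  have eqA: "X = A" if "sep y x X" "d X = lam y x" "X \<subseteq> A" for X
    using card_seteq[OF fin(1) that(3)] y(3)[OF that(1,2)] by simp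
  have eqB: "X = B" if "sep z x X" "d X = lam z x" "X \<subseteq> B" for X
    using card_seteq[OF fin(2) that(3)] z(3)[OF that(1,2)] by simp
  consider "z \<in> A" "y \<in> B" | "z \<in> A" "y \<notin> B" | "z \<notin> A" "y \<in> B" | "z \<notin> A" "y \<notin> B" by blast
  then show ?thesis
  proof cases
    case 1
    have s: "sep y x (A \<inter> B)" "sep z x (A \<inter> B)" "sep y x (A \<union> B)" "sep z x (A \<union> B)"
      using y(1) z(1) 1 by (auto simp: sep_def)
    have "sep z x A" "sep y x B" using y(1) z(1) 1 by (auto simp: sep_def)
    then have "lam y x = lam z x" using lam_le y(2) z(2) by (metis order_antisym)
    then have "d (A \<inter> B) = lam y x"
      using lam_le[OF s(1)] lam_le[OF s(3)] d_submodular[of A B] y(2) z(2) by simp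
    then have "A \<inter> B = A" using eqA s(1) by blast
    then show ?thesis by blast
  next
    case 2
    have s: "sep z x (A \<inter> B)" "sep y x (A \<union> B)" using y(1) z(1) 2 by (auto simp: sep_def)
    have "d (A \<inter> B) = lam z x"
      using lam_le[OF s(1)] lam_le[OF s(2)] d_submodular[of A B] y(2) z(2) by simp
    then show ?thesis using eqB[OF s(1)] by blast
  next
    case 3
    have s: "sep y x (A \<inter> B)" "sep z x (A \<union> B)" using y(1) z(1) 3 by (auto simp: sep_def)
    have "d (A \<inter> B) = lam y x"
      using lam_le[OF s(1)] lam_le[OF s(2)] d_submodular[of A B] y(2) z(2) by simp
    then show ?thesis using eqA[OF s(1)] by blast
  next
    case 4
    have s: "sep y x (A - B)" "sep z x (B - A)" using y(1) z(1) 4 by (auto simp: sep_def)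
    have "d (A - B) = lam y x"
      using lam_le[OF s(1)] lam_le[OF s(2)] d_posimodular[of A B] y(2) z(2) by simp
    then show ?thesis using eqA[OF s(1)] by blast
  qed
qed

definition light :: "real \<Rightarrow> (nat set \<Rightarrow> bit) set" where
  "light c = vec ` {Y. proper Y \<and> d Y < c}"

text \<open>Choose for each such \<open>y\<close> a smallest minimum cut \<open>S y\<close> away
  from \<open>x\<close>. It stays inside the set, since it separates each of its members from
  \<open>x\<close> with weight below \<open>c\<close>. By laminarity the inclusion-maximal ones
  partition the set, so its vector is a sum of light ones.\<close>

lemma vec_class_compl_light:
  assumes x: "x < n"
  shows "vec {y. y < n \<and> y \<noteq> x \<and> lam y x < c} \<in> gf2.span (light c)"
proof -
  let ?Y = "{y. y < n \<and> y \<noteq> x \<and> lam y x < c}"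
  define good where
    "good y A \<longleftrightarrow> sep y x A \<and> d A = lam y x \<and> (\<forall>X. sep y x X \<longrightarrow> d X = lam y x \<longrightarrow> card A \<le> card X)" for y A
  have "\<exists>A. good y A" if "y \<in> ?Y" for y
  proof -
    have "\<exists>A. sep y x A \<and> d A = lam y x" using lam_attained[of y x] that by auto
    then obtain A where "is_arg_min card (\<lambda>A. sep y x A \<and> d A = lam y x) A"
      using ex_has_least_nat[of "\<lambda>A. sep y x A \<and> d A = lam y x" _ card] by (auto simp: is_arg_min_linorder)
    then show ?thesis by (auto simp: is_arg_min_linorder good_def)
  qed
  then obtain S where S: "\<And>y. y \<in> ?Y \<Longrightarrow> good y (S y)" by metis
  have fin: "finite (S ` ?Y)" by simp
  define F where "F = {A \<in> S ` ?Y. \<forall>B\<in>S ` ?Y. A \<subseteq> B \<longrightarrow> B = A}"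
  have finF: "finite F" using fin by (simp add: F_def)
  have disj: "A \<inter> B = {}" if AB: "A \<in> F" "B \<in> F" "A \<noteq> B" for A B
  proof -
    obtain y z where yz: "y \<in> ?Y" "z \<in> ?Y" "A = S y" "B = S z" using AB by (auto simp: F_def)
    have "A \<subseteq> B \<or> B \<subseteq> A \<or> A \<inter> B = {}"
      using minimal_cuts_laminar[of y x A z B] S[OF yz(1)] S[OF yz(2)] yz(3,4)
      by (auto simp: good_def)
    then show ?thesis using AB by (auto simp: F_def)
  qed
  have sub: "S y \<subseteq> ?Y" if "y \<in> ?Y" for y
  proof
    fix z assume "z \<in> S y"
    then have "sep z x (S y)" using S[OF that] by (auto simp: good_def sep_def)
    then show "z \<in> ?Y" using lam_le[of z x "S y"] S[OF that] that
      by (auto simp: good_def sep_def)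
  qed
  have "\<Union>F = ?Y"
  proof
    show "\<Union>F \<subseteq> ?Y" using sub by (auto simp: F_def)
    show "?Y \<subseteq> \<Union>F"
    proof
      fix y assume y: "y \<in> ?Y"
      have yS: "y \<in> S y" using S[OF y] by (simp add: good_def sep_def)
      obtain A where A: "A \<in> S ` ?Y" "S y \<subseteq> A \<and> (\<forall>B\<in>S ` ?Y. A \<subseteq> B \<longrightarrow> A = B)"
        using finite_has_maximal2[OF fin imageI[OF y]] by (elim bexE)
      then have "A \<in> F" unfolding F_def by blast
      then show "y \<in> \<Union>F" using yS A(2) by blast
    qed
  qed
  then have "vec ?Y = (\<Sum>A\<in>F. vec A)" using vec_Union[OF finF disj] by simp
  moreover have "vec A \<in> gf2.span (light c)" if AF: "A \<in> F" for A
  proof -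
    obtain y where y: "y \<in> ?Y" "A = S y" using AF by (auto simp: F_def)
    then have "proper A \<and> d A < c" using S[OF y(1)] x by (auto simp: good_def sep_def proper_def)
    then show ?thesis unfolding light_def by (intro gf2.span_base) auto
  qed
  ultimately show ?thesis using gf2.span_sum[of F vec "light c"] by simp
qed

text \<open>By the ultrametric inequality, being equal or having minimum cut value at least
  \<open>c\<close> is an equivalence on the vertices. The hypothesis makes \<open>X\<close> a union
  of its classes \<open>Z x\<close>, and a class has the same cut as its complement, which the
  preceding lemma treats.\<close>

lemma vec_in_span_light:
  assumes X: "X \<subseteq> {..<n}" and sepd: "\<And>s t. s \<in> X \<Longrightarrow> t < n \<Longrightarrow> t \<notin> X \<Longrightarrow> lam t s < c"
  shows "vec X \<in> gf2.span (light c)"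
proof -
  define Z where "Z x = {z. z < n \<and> (z = x \<or> c \<le> lam z x)}" for x
  have fin: "finite (Z ` X)" using X finite_subset by auto
  have Zsym: "y \<in> Z x \<longleftrightarrow> x \<in> Z y" if "x < n" "y < n" for x y
    using lam_sym[of x y] that by (cases "x = y") (simp_all add: Z_def eq_commute)
  have Zeq: "Z y \<subseteq> Z x" if xy: "y \<in> Z x" "x < n" for x y
  proof
    fix z assume z: "z \<in> Z y"
    show "z \<in> Z x"
      using lam_ultrametric[of z y x] z xy by (cases "z = x") (auto simp: Z_def)
  qed
  have disj: "A \<inter> B = {}" if "A \<in> Z ` X" "B \<in> Z ` X" "A \<noteq> B" for A B
  proof (rule ccontr)
    assume "A \<inter> B \<noteq> {}"
    then obtain x y z where *: "x \<in> X" "y \<in> X" "A = Z x" "B = Z y" "z \<in> Z x" "z \<in> Z y"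
      using \<open>A \<in> Z ` X\<close> \<open>B \<in> Z ` X\<close> by auto
    have lt: "x < n" "y < n" "z < n" using * X by (auto simp: Z_def)
    have "x \<in> Z z" "y \<in> Z z" using * Zsym lt by auto
    then have "Z x = Z z" "Z y = Z z" using Zeq * lt by auto
    then show False using * that(3) by auto
  qed
  have "\<Union>(Z ` X) = X"
  proof
    show "\<Union>(Z ` X) \<subseteq> X" using sepd by (force simp: Z_def)
    show "X \<subseteq> \<Union>(Z ` X)" using X by (auto simp: Z_def)
  qed
  then have "vec X = (\<Sum>A\<in>Z ` X. vec A)" using vec_Union[OF fin disj] by simp
  moreover have "vec A \<in> gf2.span (light c)" if A: "A \<in> Z ` X" for A
  proof -
    obtain x where x: "x \<in> X" "A = Z x" using A by auto
    have e: "{..<n} - A = {y. y < n \<and> y \<noteq> x \<and> lam y x < c}" using x(2) by (auto simp: Z_def)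
    have "A \<subseteq> {..<n}" using x(2) by (auto simp: Z_def)
    from vec_compl[OF this, unfolded e] vec_class_compl_light[of x c] x(1) X show ?thesis by auto
  qed
  ultimately show ?thesis using gf2.span_sum[of "Z ` X" vec "light c"] by simp
qed

end

section \<open>Minimum cut bases and the exchange argument behind relevance\<close>

locale connected_wgraph = wgraph +
  fixes w :: "nat set \<Rightarrow> real"
  assumes two: "2 \<le> n"
    and conn: "X \<subseteq> {..<n} \<Longrightarrow> X \<noteq> {} \<Longrightarrow> X \<noteq> {..<n} \<Longrightarrow> \<exists>i<m. crosses X i"
    and w: "i < m \<Longrightarrow> w {ea i, eb i} = wt i"
begin

lemmas cut_weight_cut = cut_weight_eq[of w, OF w]

text \<open>No edge crosses the symmetric difference of \<open>X\<close> and \<open>Y\<close>, so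
  connectivity leaves only the empty set and the whole vertex set for it.\<close>

lemma cut_inj:
  assumes "X \<subseteq> {..<n}" "Y \<subseteq> {..<n}" "cut X = cut Y"
  shows "X = Y \<or> X = {..<n} - Y"
proof (rule ccontr)
  let ?D = "(X - Y) \<union> (Y - X)"
  assume "\<not> ?thesis"
  then have "?D \<subseteq> {..<n}" "?D \<noteq> {}" "?D \<noteq> {..<n}" using assms(1,2) by auto
  then obtain i where "i < m" "crosses ?D i" using conn by blast
  then show False using assms(3) cut_iff[of i X] cut_iff[of i Y] by auto
qed

lemma is_cut_iff: "is_cut {..<n} edges Cc \<longleftrightarrow> (\<exists>X. proper X \<and> Cc = cut X)"
  by (auto simp: is_cut_def proper_def)

lemma cuts_eq: "{Cc. is_cut {..<n} edges Cc} = cut ` {X. proper X}"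
  by (auto simp: is_cut_iff)

lemma finite_proper: "finite {X. proper X}"
  by (rule finite_subset[of _ "Pow {..<n}"]) (auto simp: proper_def)

lemma finite_cuts: "finite {Cc. is_cut {..<n} edges Cc}"
  unfolding cuts_eq using finite_proper by simp

lemma finite_cut_basis: "cut_basis {..<n} edges B \<Longrightarrow> finite B"
  using finite_cuts finite_subset by (auto simp: cut_basis_def)

lemma min_cut_basis_exists: "\<exists>B. min_cut_basis {..<n} edges w B"
proof -
  let ?A = "{Cc. is_cut {..<n} edges Cc}"
  obtain D where D: "D \<subseteq> incidence ` ?A" "gf2.independent D" "incidence ` ?A \<subseteq> gf2.span D"
    using gf2.maximal_independent_subset[of "incidence ` ?A"] by blast
  define B where "B = {Cc \<in> ?A. incidence Cc \<in> D}"
  have B: "incidence ` B = D" using D(1) by (auto simp: B_def)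
  have "gf2.span D = gf2.span (incidence ` ?A)"
    using D gf2.span_mono[OF D(1)] gf2.span_minimal[OF D(3)] by (simp add: subset_antisym)
  then have "cut_basis {..<n} edges B" using D B by (auto simp: cut_basis_def B_def)
  moreover have fin: "finite {B. cut_basis {..<n} edges B}"
    by (rule finite_subset[of _ "Pow ?A"]) (use finite_cuts in \<open>auto simp: cut_basis_def\<close>)
  ultimately obtain B' where "is_arg_min (\<lambda>B. \<Sum>Cc\<in>B. cut_weight w Cc) (\<lambda>B. B \<in> {B. cut_basis {..<n} edges B}) B'"
    using ex_is_arg_min_if_finite[OF fin, of "\<lambda>B. \<Sum>Cc\<in>B. cut_weight w Cc"] by auto
  then show ?thesis by (auto simp: is_arg_min_linorder min_cut_basis_def)
qed

text \<open>Steinitz exchange: the vector of \<open>Cc\<close> lies in the span of the basis, but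
  not without \<open>D\<close>; so \<open>D\<close> is spanned again once \<open>Cc\<close> has
  taken its place.\<close>

lemma cut_basis_exchange:
  assumes B: "cut_basis {..<n} edges B" and D: "D \<in> B" and Cc: "is_cut {..<n} edges Cc"
    and nin: "incidence Cc \<notin> gf2.span (incidence ` (B - {D}))"
  shows "cut_basis {..<n} edges (insert Cc (B - {D}))" "Cc \<notin> B - {D}"
proof -
  let ?v = "incidence :: nat set set \<Rightarrow> _"
  let ?R = "?v ` (B - {D})"
  have ins: "?v ` B = insert (?v D) ?R" using D by auto
  have sp: "gf2.span (?v ` B) = gf2.span (?v ` {Cc. is_cut {..<n} edges Cc})"
    using B by (simp add: cut_basis_def)
  have "?v Cc \<in> gf2.span (insert (?v D) ?R)"
    unfolding ins[symmetric] sp using Cc by (intro gf2.span_base) auto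
  then have "?v D \<in> gf2.span (insert (?v Cc) ?R)" using nin gf2.in_span_insert by blast
  then have "?v ` B \<subseteq> gf2.span (insert (?v Cc) ?R)"
    unfolding ins using gf2.span_superset[of "insert (?v Cc) ?R"] by auto
  then have "gf2.span (?v ` B) \<subseteq> gf2.span (insert (?v Cc) ?R)"
    by (rule gf2.span_minimal) simp
  moreover have "insert (?v Cc) ?R \<subseteq> gf2.span (?v ` B)"
    using Cc gf2.span_superset[of "?v ` B"] unfolding sp
    by (auto intro!: gf2.span_base) (use B in \<open>auto simp: cut_basis_def\<close>)
  then have "gf2.span (insert (?v Cc) ?R) \<subseteq> gf2.span (?v ` B)"
    by (rule gf2.span_minimal) simp
  ultimately have span: "gf2.span (?v ` insert Cc (B - {D})) = gf2.span (?v ` {Cc. is_cut {..<n} edges Cc})"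
    unfolding sp[symmetric] by auto
  have "gf2.independent ?R"
    using B gf2.independent_mono[of "?v ` B" ?R] by (auto simp: cut_basis_def)
  then have "gf2.independent (?v ` insert Cc (B - {D}))"
    using nin gf2.independent_insert[of "?v Cc" ?R] by (auto dest: gf2.span_base)
  then show "cut_basis {..<n} edges (insert Cc (B - {D}))"
    using span B Cc by (auto simp: cut_basis_def)
  show "Cc \<notin> B - {D}" using nin gf2.span_base[OF imageI[of Cc "B - {D}" ?v]] by metis
qed

text \<open>Sums of cuts are cuts of symmetric differences, and the symmetric difference of sets not
  separating \<open>s\<close> from \<open>t\<close> does not separate them either. Together with
  \<open>cut_inj\<close> this keeps every separating cut out of the span of non-separating
  ones.\<close>

lemma nonseparating_span:
  assumes "\<And>Cc. Cc \<in> S \<Longrightarrow> \<exists>X\<subseteq>{..<n}. (s \<in> X) = (t \<in> X) \<and> Cc = cut X"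
    and "x \<in> gf2.span (incidence ` S)"
  shows "\<exists>X\<subseteq>{..<n}. (s \<in> X) = (t \<in> X) \<and> x = vec X"
  using assms(2)
proof (induction rule: gf2.span_induct_alt)
  case base then show ?case by (intro exI[of _ "{}"]) (simp add: vec_empty)
next
  case (step c x y)
  obtain X where X: "X \<subseteq> {..<n}" "(s \<in> X) = (t \<in> X)" "x = vec X"
    using step(1) assms(1) by (auto simp: vec_def)
  obtain Y where Y: "Y \<subseteq> {..<n}" "(s \<in> Y) = (t \<in> Y)" "y = vec Y" using step by auto
  show ?case
  proof (cases c)
    case zero
    then have "gf2_scale c x = 0" by (simp add: gf2_scale_def zero_fun_def)
    then have "gf2_scale c x + y = y" by (simp only: add_0)
    then show ?thesis using Y by metis
  next
    case one
    then have "gf2_scale c x + y = vec X + vec Y" by (simp only: gf2.scale_one X(3) Y(3))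
    then have "gf2_scale c x + y = vec ((X - Y) \<union> (Y - X))" by (simp only: vec_symdiff)
    moreover have "(X - Y) \<union> (Y - X) \<subseteq> {..<n}"
      "(s \<in> (X - Y) \<union> (Y - X)) = (t \<in> (X - Y) \<union> (Y - X))" using X(1,2) Y(1,2) by auto
    ultimately show ?thesis by metis
  qed
qed

text \<open>In one direction, a basis member that is a minimum cut for no pair lies in the span of
  lighter cuts, and exchanging it for one of them lowers the total weight. In the other, the cut is
  exchanged into a minimum basis against a member separating the same pair, which cannot be
  lighter.\<close>

theorem relevant_cut_iff:
  "relevant_cut {..<n} edges w Cc \<longleftrightarrow> (\<exists>s t X. t < n \<and> sep s t X \<and> Cc = cut X \<and> d X = lam s t)"
proof
  assume "relevant_cut {..<n} edges w Cc"
  then obtain B where B: "min_cut_basis {..<n} edges w B" "Cc \<in> B" by (auto simp: relevant_cut_def)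
  have cb: "cut_basis {..<n} edges B" using B by (simp add: min_cut_basis_def)
  then obtain X where X: "proper X" "Cc = cut X" using B(2) is_cut_iff by (auto simp: cut_basis_def)
  show "\<exists>s t X. t < n \<and> sep s t X \<and> Cc = cut X \<and> d X = lam s t"
  proof (rule ccontr)
    assume neg: "\<not> ?thesis"
    have "lam t s < d X" if st: "s \<in> X" "t < n" "t \<notin> X" for s t
    proof -
      have "sep s t X" "s < n" using st X(1) by (auto simp: sep_def proper_def)
      moreover from this have "lam s t \<noteq> d X" using neg X(2) st by metis
      ultimately show ?thesis using lam_le[of s t X] lam_sym[of s t] st by force
    qed
    then have sp: "vec X \<in> gf2.span (light (d X))"
      using vec_in_span_light X(1) by (auto simp: proper_def)
    let ?R = "incidence ` (B - {Cc})"
    have nin: "incidence Cc \<notin> gf2.span ?R"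
    proof -
      have "incidence Cc \<notin> gf2.span (incidence ` B - {incidence Cc})"
        using cb B(2) by (auto simp: cut_basis_def gf2.dependent_def)
      moreover have "incidence ` B - {incidence Cc} = ?R"
        using incidence_inj by (auto simp: inj_def)
      ultimately show ?thesis by simp
    qed
    \<comment> \<open>Some lighter cut lies outside the span of the remaining basis, for otherwise
      \<open>Cc\<close> would lie in that span as well.\<close>
    have "\<not> light (d X) \<subseteq> gf2.span ?R"
    proof
      assume "light (d X) \<subseteq> gf2.span ?R"
      then have "gf2.span (light (d X)) \<subseteq> gf2.span ?R" by (rule gf2.span_minimal) simp
      then show False using sp nin X(2) by (auto simp: vec_def)
    qed
    then obtain Y where Y: "proper Y" "d Y < d X" "vec Y \<notin> gf2.span ?R" by (auto simp: light_def)
    let ?B = "insert (cut Y) (B - {Cc})"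
    have ic: "is_cut {..<n} edges (cut Y)" using Y(1) is_cut_iff by blast
    have bas: "cut_basis {..<n} edges ?B" "cut Y \<notin> B - {Cc}"
      using cut_basis_exchange[OF cb B(2) ic] Y(3) by (simp_all add: vec_def)
    have "(\<Sum>Cc\<in>B. cut_weight w Cc) \<le> (\<Sum>Cc\<in>?B. cut_weight w Cc)"
      using B(1) bas(1) by (simp add: min_cut_basis_def)
    also have "\<dots> = d Y + (\<Sum>Cc\<in>B - {Cc}. cut_weight w Cc)"
      using bas(2) finite_cut_basis[OF cb] by (simp add: cut_weight_cut)
    also have "\<dots> < d X + (\<Sum>Cc\<in>B - {Cc}. cut_weight w Cc)" using Y by simp
    also have "\<dots> = (\<Sum>Cc\<in>B. cut_weight w Cc)"
      using finite_cut_basis[OF cb] B(2) X(2) by (simp add: sum.remove cut_weight_cut)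
    finally show False by simp
  qed
next
  assume "\<exists>s t X. t < n \<and> sep s t X \<and> Cc = cut X \<and> d X = lam s t"
  then obtain s t X where X: "t < n" "sep s t X" "Cc = cut X" "d X = lam s t" by blast
  have pX: "proper X" using X by (auto simp: sep_def proper_def)
  then have icC: "is_cut {..<n} edges Cc" using X is_cut_iff by blast
  obtain B where B: "min_cut_basis {..<n} edges w B" using min_cut_basis_exists by blast
  have cb: "cut_basis {..<n} edges B" using B by (simp add: min_cut_basis_def)
  have finB: "finite B" using finite_cut_basis[OF cb] .
  let ?v = "incidence :: nat set set \<Rightarrow> _"
  \<comment> \<open>The basis members that do not separate \<open>s\<close> from \<open>t\<close>.
    Keeping them in \<open>B'\<close> below guarantees that the member given up in the exchange does
    separate the pair.\<close>
  define B2 where "B2 = {Dd \<in> B. \<exists>Y\<subseteq>{..<n}. (s \<in> Y) = (t \<in> Y) \<and> Dd = cut Y}"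
  have n2: "?v Cc \<notin> gf2.span (?v ` B2)"
  proof
    assume "?v Cc \<in> gf2.span (?v ` B2)"
    then obtain Y where Y: "Y \<subseteq> {..<n}" "(s \<in> Y) = (t \<in> Y)" "?v Cc = vec Y"
      using nonseparating_span[of B2 s t "?v Cc"] by (auto simp: B2_def)
    then have "cut X = cut Y" using X(3) vec_eq_iff by (auto simp: vec_def)
    then show False using cut_inj[of X Y] X Y by (auto simp: sep_def)
  qed
  have f1: "finite {B'. B2 \<subseteq> B' \<and> B' \<subseteq> B \<and> ?v Cc \<notin> gf2.span (?v ` B')}"
    by (rule finite_subset[of _ "Pow B"]) (use finB in auto)
  have f2: "B2 \<in> {B'. B2 \<subseteq> B' \<and> B' \<subseteq> B \<and> ?v Cc \<notin> gf2.span (?v ` B')}"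
    using n2 by (auto simp: B2_def)
  \<comment> \<open>\<open>B'\<close> is maximal among the sets between \<open>B2\<close> and
    \<open>B\<close> that do not span \<open>Cc\<close>; adding any further member \<open>Dd\<close>
    puts \<open>Cc\<close> into the span.\<close>
  obtain B' where "B' \<in> {B'. B2 \<subseteq> B' \<and> B' \<subseteq> B \<and> ?v Cc \<notin> gf2.span (?v ` B')}"
    and max: "B2 \<subseteq> B' \<and> (\<forall>B''\<in>{B'. B2 \<subseteq> B' \<and> B' \<subseteq> B \<and> ?v Cc \<notin> gf2.span (?v ` B')}. B' \<subseteq> B'' \<longrightarrow> B' = B'')"
    using finite_has_maximal2[OF f1 f2]
    by (elim bexE)
  then have B': "B2 \<subseteq> B'" "B' \<subseteq> B" "?v Cc \<notin> gf2.span (?v ` B')" by simp_all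
  have maxi: "?v Cc \<in> gf2.span (?v ` B'')" if "B2 \<subseteq> B''" "B'' \<subseteq> B" "B' \<subseteq> B''" "B' \<noteq> B''" for B''
  proof (rule ccontr)
    assume "?v Cc \<notin> gf2.span (?v ` B'')"
    then show False using max[THEN conjunct2, rule_format, of B''] that by simp
  qed
  have "?v Cc \<in> gf2.span (?v ` B)"
    using cb icC by (auto simp: cut_basis_def intro: gf2.span_base)
  then have "B \<noteq> B'" using B'(3) by metis
  then obtain Dd where Dd: "Dd \<in> B" "Dd \<notin> B'" using B'(2) by blast
  have "?v Cc \<in> gf2.span (insert (?v Dd) (?v ` B'))"
    using maxi[of "insert Dd B'"] B'(1,2) Dd by (simp add: subset_insertI2) blast
  then have Din: "?v Dd \<in> gf2.span (insert (?v Cc) (?v ` B'))"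
    using gf2.in_span_insert B'(3) by blast
  \<comment> \<open>\<open>Dd\<close> is a combination of \<open>Cc\<close> and \<open>B'\<close>,
    so spanning \<open>Cc\<close> without \<open>Dd\<close> would make \<open>Dd\<close> dependent
    on the rest of the basis.\<close>
  have nin: "?v Cc \<notin> gf2.span (?v ` (B - {Dd}))"
  proof
    assume a: "?v Cc \<in> gf2.span (?v ` (B - {Dd}))"
    have "?v ` B' \<subseteq> gf2.span (?v ` (B - {Dd}))" using B' Dd by (auto intro: gf2.span_base)
    then have "gf2.span (insert (?v Cc) (?v ` B')) \<subseteq> gf2.span (?v ` (B - {Dd}))"
      using a by (intro gf2.span_minimal) auto
    then have "?v Dd \<in> gf2.span (?v ` (B - {Dd}))" using Din by blast
    moreover have "?v ` (B - {Dd}) = ?v ` B - {?v Dd}"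
      using incidence_inj by (auto simp: inj_def)
    ultimately show False using cb Dd(1) by (auto simp: cut_basis_def gf2.dependent_def)
  qed
  let ?B = "insert Cc (B - {Dd})"
  have bas: "cut_basis {..<n} edges ?B" "Cc \<notin> B - {Dd}"
    using cut_basis_exchange[OF cb Dd(1) icC nin] by auto
  obtain Y where Y: "proper Y" "Dd = cut Y" using cb Dd is_cut_iff by (auto simp: cut_basis_def)
  have "s < n" using X by (auto simp: sep_def)
  have "(s \<in> Y) \<noteq> (t \<in> Y)" using Dd B'(1) Y by (auto simp: B2_def proper_def)
  then have "sep s t Y \<or> sep s t ({..<n} - Y)" using Y X(1) \<open>s < n\<close> by (auto simp: sep_def proper_def)
  then have "lam s t \<le> d Y" using lam_le[of s t Y] lam_le[of s t "{..<n} - Y"] d_compl[of Y] by auto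
  then have le: "cut_weight w Cc \<le> cut_weight w Dd" using X Y by (simp add: cut_weight_cut)
  have "(\<Sum>Cc\<in>?B. cut_weight w Cc) = cut_weight w Cc + (\<Sum>Cc\<in>B - {Dd}. cut_weight w Cc)"
    using bas(2) finB by simp
  also have "\<dots> \<le> (\<Sum>Cc\<in>B. cut_weight w Cc)" using le finB Dd(1) by (simp add: sum.remove)
  finally have "min_cut_basis {..<n} edges w ?B"
    using B bas(1) unfolding min_cut_basis_def by (meson order_trans)
  then show "relevant_cut {..<n} edges w Cc" by (auto simp: relevant_cut_def)
qed

end

context wgraph
begin

subsection \<open>Minimum cuts respecting a merging of vertices\<close>

definition repr :: "(nat \<Rightarrow> nat) \<Rightarrow> bool" where
  "repr r \<longleftrightarrow> (\<forall>y<n. r y < n \<and> r (r y) = r y)"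

definition closed :: "(nat \<Rightarrow> nat) \<Rightarrow> nat set \<Rightarrow> bool" where
  "closed r X \<longleftrightarrow> (\<forall>y<n. (y \<in> X) = (r y \<in> X))"

definition fam :: "(nat \<Rightarrow> nat) \<Rightarrow> nat \<Rightarrow> nat \<Rightarrow> real \<Rightarrow> nat set set" where
  "fam r s t c = {X. sep s t X \<and> closed r X \<and> d X = c}"

definition bounded_by :: "(nat \<Rightarrow> nat) \<Rightarrow> nat \<Rightarrow> nat \<Rightarrow> real \<Rightarrow> bool" where
  "bounded_by r s t c \<longleftrightarrow> (\<forall>X. sep s t X \<longrightarrow> closed r X \<longrightarrow> c \<le> d X)"

text \<open>Intersection and union are again separating and closed, hence weigh at least
  \<open>c\<close> each; submodularity leaves no room for more.\<close>

lemma fam_lattice: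
  assumes "bounded_by r s t c" "X \<in> fam r s t c" "Y \<in> fam r s t c"
  shows "X \<inter> Y \<in> fam r s t c" "X \<union> Y \<in> fam r s t c"
proof -
  have "sep s t (X \<inter> Y)" "closed r (X \<inter> Y)" "sep s t (X \<union> Y)" "closed r (X \<union> Y)"
    using assms(2,3) by (auto simp: fam_def sep_def closed_def)
  moreover from this have "c \<le> d (X \<inter> Y)" "c \<le> d (X \<union> Y)"
    using assms(1) by (auto simp: bounded_by_def)
  ultimately show "X \<inter> Y \<in> fam r s t c" "X \<union> Y \<in> fam r s t c"
    using d_submodular[of X Y] assms(2,3) by (auto simp: fam_def)
qed

text \<open>\<open>L\<close> labels the blocks of a chain of minimum cuts, the cuts being the sets of vertices
  with label at most \<open>a\<close>, for \<open>a < k\<close>.\<close>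

definition chain :: "nat set set \<Rightarrow> (nat \<Rightarrow> nat) \<Rightarrow> nat \<Rightarrow> bool" where
  "chain M L k \<longleftrightarrow> 1 \<le> k \<and> (\<forall>y<n. L y \<le> k) \<and> (\<forall>a<k. {y. y < n \<and> L y \<le> a} \<in> M) \<and>
    (\<forall>a\<le>k. \<exists>y<n. L y = a)"

lemma chain_init:
  assumes "X \<in> fam r s t c" "t < n" "\<And>y. y < n \<Longrightarrow> L y = of_bool (y \<notin> X)"
  shows "chain (fam r s t c) L 1"
proof -
  have X: "X \<subseteq> {..<n}" "s \<in> X" "t \<notin> X" using assms(1) by (auto simp: fam_def sep_def)
  have "{y. y < n \<and> L y \<le> 0} = X" using assms(3) X by auto
  moreover have "L s = 0" "L t = 1" "s < n" using assms X by auto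
  moreover from this have "\<forall>a\<le>1. \<exists>y<n. L y = a" using assms(2) by (auto simp: le_Suc_eq)
  ultimately show ?thesis using assms(1,3) by (simp add: chain_def)
qed

text \<open>The cut \<open>X\<close> yields a new chain member consisting of all blocks below that
  of \<open>i\<close> and of the part of this block inside \<open>X\<close>. The lattice property
  makes it a member of the family, and \<open>i\<close> and \<open>p\<close> witness that both
  halves of the block are nonempty.\<close>

lemma chain_split:
  assumes b: "bounded_by r s t c" and ch: "chain (fam r s t c) L k"
    and X: "X \<in> fam r s t c" and io: "i < n" "p < n" "L i = L p" "i \<in> X" "p \<notin> X"
    and L': "\<And>y. y < n \<Longrightarrow> L' y = (if L i < L y \<or> L y = L i \<and> y \<notin> X then Suc (L y) else L y)"
  shows "chain (fam r s t c) L' (Suc k)"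
proof -
  let ?M = "fam r s t c"
  let ?P = "\<lambda>L a. {y. y < n \<and> L y \<le> (a::nat)}"
  define a where "a = L i"
  have k: "1 \<le> k" "\<And>y. y < n \<Longrightarrow> L y \<le> k" "\<And>a. a < k \<Longrightarrow> ?P L a \<in> ?M" "\<And>a. a \<le> k \<Longrightarrow> \<exists>y<n. L y = a"
    using ch by (auto simp: chain_def)
  have ak: "a \<le> k" using k(2) io by (simp add: a_def)
  have Xn: "X \<subseteq> {..<n}" using X by (auto simp: fam_def sep_def)
  have "?P L' b' \<in> ?M" if b': "b' < Suc k" for b'
  proof -
    consider "b' < a" | "b' = a" | "a < b'" by linarith
    then show ?thesis
    proof cases
      case 1
      then have "?P L' b' = ?P L b'" using L' by (auto simp: a_def split: if_splits)
      then show ?thesis using k(3) 1 ak by simp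
    next
      case 3
      then have "?P L' b' = ?P L (b' - 1)" using L' by (auto simp: a_def split: if_splits)
      then show ?thesis using k(3)[of "b' - 1"] 3 b' by simp
    next
      case 2
      have e: "?P L' b' = {y. y < n \<and> L y < a} \<union> ({y. y < n \<and> L y \<le> a} \<inter> X)"
        using L' 2 Xn by (auto simp: a_def split: if_splits)
      have low: "({y. y < n \<and> L y < a} \<union> X) \<in> ?M"
      proof (cases a)
        case 0 then show ?thesis using X by simp
      next
        case (Suc a')
        then have "{y. y < n \<and> L y < a} = ?P L a'" by auto
        then show ?thesis using fam_lattice(2)[OF b k(3)[of a'] X] Suc ak by simp
      qed
      \<comment> \<open>Union of \<open>X\<close> with the chain member below the block, then
        intersection with the one above it.\<close>
      have e2: "?P L' b' = ?P L a \<inter> ({y. y < n \<and> L y < a} \<union> X)" unfolding e by auto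
      show ?thesis
      proof (cases "a < k")
        case True
        then show ?thesis unfolding e2 using fam_lattice(1)[OF b k(3) low] by simp
      next
        \<comment> \<open>The last block has no chain member above it: label bound \<open>k\<close>
          describes the whole vertex set, which is not in the family.\<close>
        case False
        then have "?P L a = {..<n}" using k(2) ak by fastforce
        moreover have "{y. y < n \<and> L y < a} \<union> X \<subseteq> {..<n}" using Xn by auto
        ultimately have "?P L' b' = {y. y < n \<and> L y < a} \<union> X" unfolding e2 by blast
        then show ?thesis using low by simp
      qed
    qed
  qed
  moreover have "\<exists>y<n. L' y = b'" if b': "b' \<le> Suc k" for b'
  proof -
    consider "b' < a" | "b' = a" | "b' = Suc a" | "Suc a < b'" by linarith
    then show ?thesis
    proof cases
      case 1
      then obtain y where "y < n" "L y = b'" using k(4)[of b'] ak by auto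
      then show ?thesis using L'[of y] 1 by (intro exI[of _ y]) (simp add: a_def)
    next
      case 2
      then show ?thesis using L'[of i] io by (intro exI[of _ i]) (simp add: a_def)
    next
      case 3
      then show ?thesis using L'[of p] io by (intro exI[of _ p]) (simp add: a_def)
    next
      case 4
      have "b' - 1 \<le> k" using b' by simp
      from k(4)[OF this] obtain y where "y < n" "L y = b' - 1" by blast
      then show ?thesis using L'[of y] 4 by (intro exI[of _ y]) (auto simp: a_def)
    qed
  qed
  moreover have "L' y \<le> Suc k" if "y < n" for y using L'[OF that] k(2)[OF that] by simp
  ultimately show ?thesis using k(1) by (auto simp: chain_def)
qed

text \<open>The relation on blocks: a lower block joined to block \<open>j\<close> by an edge of
  positive weight has to be on the source side whenever \<open>j\<close> is.\<close>

definition ideal_edge :: "(nat \<Rightarrow> nat) \<Rightarrow> nat \<Rightarrow> nat set" where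
  "ideal_edge L j = {a. a < j \<and> (\<exists>i<m. 0 < wt i \<and>
     (L (ea i) = a \<and> L (eb i) = j \<or> L (ea i) = j \<and> L (eb i) = a))}"

text \<open>Block 0 is that of the source and block \<open>k\<close> that of the sink, which
  accounts for the two boundary conditions.\<close>

definition ideals :: "(nat \<Rightarrow> nat set) \<Rightarrow> nat \<Rightarrow> nat set set" where
  "ideals pre k = {I. I \<subseteq> {..<k} \<and> 0 \<in> I \<and> (\<forall>j\<in>I. pre j \<subseteq> I)}"

text \<open>Used with \<open>x\<close> the indicator of a set of blocks and \<open>p\<close>,
  \<open>q\<close> the end blocks of an edge: the sum runs over the chain cuts that the edge
  crosses.\<close>

lemma telescope:
  fixes x :: "nat \<Rightarrow> real"
  assumes "p \<le> q" "q \<le> k"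
  shows "(\<Sum>a<k. (x a - x (Suc a)) * of_bool (p \<le> a \<and> a < q)) = x p - x q"
proof -
  have "(\<Sum>a<k. (x a - x (Suc a)) * of_bool (p \<le> a \<and> a < q)) = (\<Sum>a\<in>{p..<q}. x a - x (Suc a))"
    by (rule sum.mono_neutral_cong_right) (use assms in auto)
  also have "\<dots> = - (\<Sum>a\<in>{p..<q}. x (Suc a) - x a)" by (simp add: sum_negf[symmetric])
  finally show ?thesis using sum_Suc_diff'[OF assms(1), of x] by simp
qed

text \<open>Orient every edge between different blocks upwards. The weight that a union of blocks sends
  upwards minus the weight it receives is a telescoping sum of weights of chain cuts, hence
  constant; so such a union is a minimum cut iff no edge of positive weight enters it.\<close>

lemma d_union_of_blocks:
  fixes L :: "nat \<Rightarrow> nat" and k :: nat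
  assumes L: "\<And>y. y < n \<Longrightarrow> L y \<le> k" and ch: "\<And>a. a < k \<Longrightarrow> d {y. y < n \<and> L y \<le> a} = c"
    and x: "0 \<in> I" "k \<notin> I"
  shows "d {y. y < n \<and> L y \<in> I} = c + 2 * (\<Sum>i<m. wt i *
    of_bool (L (ea i) < L (eb i) \<and> L (ea i) \<notin> I \<and> L (eb i) \<in> I \<or>
      L (eb i) < L (ea i) \<and> L (eb i) \<notin> I \<and> L (ea i) \<in> I))"
proof -
  define x where "x a = (of_bool (a \<in> I) :: real)" for a
  define lo hi where "lo i = min (L (ea i)) (L (eb i))" and "hi i = max (L (ea i)) (L (eb i))" for i
  have le: "lo i \<le> hi i" "hi i \<le> k" if "i < m" for i
    using ends[OF that] L by (simp_all add: lo_def hi_def min_le_iff_disj le_max_iff_disj)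
  have dP: "d {y. y < n \<and> L y \<le> a} = (\<Sum>i<m. wt i * of_bool (lo i \<le> a \<and> a < hi i))" for a
    unfolding d_def
  proof (rule sum.cong, goal_cases)
    case (2 i)
    then show ?case using ends[of i] by (auto simp: lo_def hi_def min_def max_def)
  qed simp
  have "(\<Sum>i<m. wt i * (x (lo i) - x (hi i))) =
      (\<Sum>i<m. \<Sum>a<k. (x a - x (Suc a)) * (wt i * of_bool (lo i \<le> a \<and> a < hi i)))"
  proof (rule sum.cong, goal_cases)
    case (2 i)
    have "x (lo i) - x (hi i) = (\<Sum>a<k. (x a - x (Suc a)) * of_bool (lo i \<le> a \<and> a < hi i))"
      by (rule telescope[symmetric]) (use le 2 in auto)
    then show ?case unfolding sum_distrib_left by (simp only: sum_distrib_left mult_ac)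
  qed simp
  also have "\<dots> = (\<Sum>a<k. (x a - x (Suc a)) * (\<Sum>i<m. wt i * of_bool (lo i \<le> a \<and> a < hi i)))"
    by (subst sum.swap) (simp only: sum_distrib_left)
  also have "\<dots> = (\<Sum>a<k. (x a - x (Suc a)) * c)"
    by (rule sum.cong) (simp_all add: dP[symmetric] ch)
  also have "\<dots> = c * (\<Sum>a<k. (x a - x (Suc a)) * of_bool (0 \<le> a \<and> a < k))"
    unfolding sum_distrib_left by (rule sum.cong) simp_all
  also have "\<dots> = c * (x 0 - x k)" by (subst telescope) simp_all
  also have "\<dots> = c" using x by (simp add: x_def)
  finally have net: "(\<Sum>i<m. wt i * (x (lo i) - x (hi i))) = c" .
  \<comment> \<open>An edge leaving the union upwards contributes its weight to the net flow and to
    the cut alike; one entering it contributes negatively to the flow but positively to the cut,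
    whence the factor 2.\<close>
  have "d {y. y < n \<and> L y \<in> I} = (\<Sum>i<m. wt i * (x (lo i) - x (hi i)) + 2 * (wt i *
    of_bool (L (ea i) < L (eb i) \<and> L (ea i) \<notin> I \<and> L (eb i) \<in> I \<or>
      L (eb i) < L (ea i) \<and> L (eb i) \<notin> I \<and> L (ea i) \<in> I)))"
    unfolding d_def
  proof (rule sum.cong, goal_cases)
    case (2 i)
    then have "ea i < n" "eb i < n" using ends by auto
    then show ?case
      by (cases "L (ea i)" "L (eb i)" rule: linorder_cases) (auto simp: x_def lo_def hi_def)
  qed simp
  also have "\<dots> = c + 2 * (\<Sum>i<m. wt i *
    of_bool (L (ea i) < L (eb i) \<and> L (ea i) \<notin> I \<and> L (eb i) \<in> I \<or>
      L (eb i) < L (ea i) \<and> L (eb i) \<notin> I \<and> L (ea i) \<in> I))"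
    by (simp add: sum.distrib net sum_distrib_left)
  finally show ?thesis .
qed

text \<open>By the weight formula for unions of blocks, such a union weighs \<open>c\<close> iff no
  edge of positive weight enters it from a lower block outside, which is the ideal condition.
  Conversely \<open>full\<close>, saying that no member of the family splits a block, makes every
  member a union of blocks.\<close>

lemma fam_eq_ideals:
  assumes r: "repr r" and ch: "chain (fam r s t c) L k" and t: "t < n"
    and full: "\<And>X y z. X \<in> fam r s t c \<Longrightarrow> y < n \<Longrightarrow> z < n \<Longrightarrow> L y = L z \<Longrightarrow> (y \<in> X) = (z \<in> X)"
  shows "fam r s t c = (\<lambda>I. {y. y < n \<and> L y \<in> I}) ` ideals (ideal_edge L) k"
    and "inj_on (\<lambda>I. {y. y < n \<and> L y \<in> I}) (ideals (ideal_edge L) k)"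
proof -
  let ?M = "fam r s t c"
  let ?f = "\<lambda>I. {y. y < n \<and> L y \<in> I}"
  have k: "1 \<le> k" "\<And>y. y < n \<Longrightarrow> L y \<le> k" "\<And>a. a < k \<Longrightarrow> {y. y < n \<and> L y \<le> a} \<in> ?M"
    "\<And>a. a \<le> k \<Longrightarrow> \<exists>y<n. L y = a"
    using ch by (auto simp: chain_def)
  have dP: "d {y. y < n \<and> L y \<le> a} = c" if "a < k" for a using k(3)[OF that] by (simp add: fam_def)
  have s: "s < n" "L s = 0" using k(3)[of 0] k(1) by (auto simp: fam_def sep_def)
  have Lt: "L t = k"
  proof -
    have "\<not> L t \<le> k - 1" using k(3)[of "k - 1"] k(1) t by (auto simp: fam_def sep_def)
    then show ?thesis using k(2)[OF t] by simp
  qed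
  have Lr: "L (r y) = L y" if y: "y < n" for y
  proof -
    have ry: "r y < n" using r y by (auto simp: repr_def)
    have "L y \<le> a \<longleftrightarrow> L (r y) \<le> a" if "a < k" for a
      using k(3)[OF that] y ry unfolding fam_def closed_def by blast
    then show ?thesis using k(2)[OF y] k(2)[OF ry] by (metis le_antisym linorder_not_less nless_le order_refl)
  qed
  have in_iff: "?f I \<in> ?M \<longleftrightarrow> I \<in> ideals (ideal_edge L) k" if I: "I \<subseteq> {..<k}" "0 \<in> I" for I
  proof -
    have kI: "k \<notin> I" using I by auto
    have "sep s t (?f I)" using s t Lt I kI by (auto simp: sep_def)
    moreover have "closed r (?f I)" using Lr r by (auto simp: closed_def repr_def)
    ultimately have "?f I \<in> ?M \<longleftrightarrow> d (?f I) = c" by (simp add: fam_def)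
    also have "d (?f I) = c + 2 * (\<Sum>i<m. wt i *
      of_bool (L (ea i) < L (eb i) \<and> L (ea i) \<notin> I \<and> L (eb i) \<in> I \<or>
        L (eb i) < L (ea i) \<and> L (eb i) \<notin> I \<and> L (ea i) \<in> I))" (is "_ = c + 2 * ?S")
      by (rule d_union_of_blocks) (use k(2) dP I(2) kI in auto)
    also have "c + 2 * ?S = c \<longleftrightarrow> ?S = 0" by simp
    also have "\<dots> \<longleftrightarrow> (\<forall>i<m. wt i *
      of_bool (L (ea i) < L (eb i) \<and> L (ea i) \<notin> I \<and> L (eb i) \<in> I \<or>
        L (eb i) < L (ea i) \<and> L (eb i) \<notin> I \<and> L (ea i) \<in> I) = 0)"
      by (subst sum_nonneg_eq_0_iff) (use wt_nonneg in auto)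
    also have "\<dots> \<longleftrightarrow> (\<forall>j\<in>I. ideal_edge L j \<subseteq> I)"
    proof
      assume a: "\<forall>i<m. wt i *
        of_bool (L (ea i) < L (eb i) \<and> L (ea i) \<notin> I \<and> L (eb i) \<in> I \<or>
          L (eb i) < L (ea i) \<and> L (eb i) \<notin> I \<and> L (ea i) \<in> I) = 0"
      show "\<forall>j\<in>I. ideal_edge L j \<subseteq> I"
      proof (intro ballI subsetI, rule ccontr)
        fix j b assume j: "j \<in> I" "b \<in> ideal_edge L j" "b \<notin> I"
        then obtain i where i: "i < m" "0 < wt i" "b < j"
          "L (ea i) = b \<and> L (eb i) = j \<or> L (ea i) = j \<and> L (eb i) = b" by (auto simp: ideal_edge_def)
        then show False using a[rule_format, OF i(1)] j by auto
      qed
    next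
      assume a: "\<forall>j\<in>I. ideal_edge L j \<subseteq> I"
      show "\<forall>i<m. wt i *
        of_bool (L (ea i) < L (eb i) \<and> L (ea i) \<notin> I \<and> L (eb i) \<in> I \<or>
          L (eb i) < L (ea i) \<and> L (eb i) \<notin> I \<and> L (ea i) \<in> I) = 0"
      proof (intro allI impI, rule ccontr)
        fix i assume i: "i < m" "wt i *
          of_bool (L (ea i) < L (eb i) \<and> L (ea i) \<notin> I \<and> L (eb i) \<in> I \<or>
            L (eb i) < L (ea i) \<and> L (eb i) \<notin> I \<and> L (ea i) \<in> I) \<noteq> 0"
        then have "0 < wt i" using wt_nonneg[of i] by (cases "wt i = 0") auto
        moreover have "L (ea i) < L (eb i) \<and> L (ea i) \<notin> I \<and> L (eb i) \<in> I \<or>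
            L (eb i) < L (ea i) \<and> L (eb i) \<notin> I \<and> L (ea i) \<in> I" using i(2) by (rule contrapos_np) simp
        ultimately have "L (ea i) \<in> ideal_edge L (L (eb i)) \<and> L (ea i) \<notin> I \<and> L (eb i) \<in> I \<or>
            L (eb i) \<in> ideal_edge L (L (ea i)) \<and> L (eb i) \<notin> I \<and> L (ea i) \<in> I"
          using i(1) unfolding ideal_edge_def by blast
        then show False using a by blast
      qed
    qed
    finally show ?thesis using I by (auto simp: ideals_def)
  qed
  show "inj_on ?f (ideals (ideal_edge L) k)"
  proof (rule inj_onI, rule set_eqI)
    fix I J a assume IJ: "I \<in> ideals (ideal_edge L) k" "J \<in> ideals (ideal_edge L) k" "?f I = ?f J"
    show "a \<in> I \<longleftrightarrow> a \<in> J"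
    proof (cases "a < k")
      case True
      then obtain y where "y < n" "L y = a" using k(4)[of a] by auto
      then show ?thesis using IJ(3) by blast
    next
      case False then show ?thesis using IJ by (auto simp: ideals_def)
    qed
  qed
  show "?M = ?f ` ideals (ideal_edge L) k"
  proof
    show "?f ` ideals (ideal_edge L) k \<subseteq> ?M" using in_iff by (auto simp: ideals_def)
    show "?M \<subseteq> ?f ` ideals (ideal_edge L) k"
    proof
      fix X assume X: "X \<in> ?M"
      define I where "I = L ` X"
      have Xs: "X \<subseteq> {..<n}" "s \<in> X" "t \<notin> X" using X by (auto simp: fam_def sep_def)
      have fI: "?f I = X" using full[OF X] Xs by (auto simp: I_def)
      have "L y < k" if y: "y \<in> X" for y
      proof -
        have "y < n" using y Xs by auto
        then show ?thesis using full[OF X _ t, of y] y Xs(3) Lt k(2)[of y] by (auto simp: order_le_less)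
      qed
      then have "I \<subseteq> {..<k}" unfolding I_def by blast
      moreover have "0 \<in> I" using s(2) Xs(2) unfolding I_def by (metis imageI)
      ultimately show "X \<in> ?f ` ideals (ideal_edge L) k" using in_iff[of I] fI X by blast
    qed
  qed
qed

subsection \<open>Contraction keeping the numbers of vertices and edges\<close>

definition key :: "(nat \<Rightarrow> nat) \<Rightarrow> nat \<Rightarrow> nat set" where
  "key r i = {r (ea i), r (eb i)}"

definition lead :: "(nat \<Rightarrow> nat) \<Rightarrow> nat \<Rightarrow> nat" where
  "lead r i = (LEAST j. key r j = key r i)"

text \<open>The first edge of each class of parallel edges carries their total weight and joins the
  representatives. Every other edge gets weight 0 and keeps its ends, except that an original edge
  between representatives takes over the ends given up by the first edge.\<close>

definition cends :: "(nat \<Rightarrow> nat) \<Rightarrow> nat \<Rightarrow> nat \<times> nat" where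
  "cends r i = (if r (ea i) = r (eb i) then (ea i, eb i)
     else if lead r i = i then (r (ea i), r (eb i))
     else if r (ea i) = ea i \<and> r (eb i) = eb i then (ea (lead r i), eb (lead r i))
     else (ea i, eb i))"

text \<open>The bound \<open>N\<close> lets the same formula serve as invariant of the loop that
  reads the edges one by one; the weights of the contracted graph are those for
  \<open>N = m\<close>.\<close>

definition cwt :: "(nat \<Rightarrow> nat) \<Rightarrow> nat \<Rightarrow> nat \<Rightarrow> real" where
  "cwt r N i = (if r (ea i) = r (eb i) \<or> lead r i \<noteq> i then 0
     else \<Sum>j<N. if lead r j = i then wt j else 0)"

lemma lead_key: "key r (lead r i) = key r i"
  unfolding lead_def by (rule LeastI[of _ i]) simp

lemma lead_le: "lead r i \<le> i"
  unfolding lead_def by (rule Least_le) simp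

lemma lead_cong: "key r i = key r j \<Longrightarrow> lead r i = lead r j"
  by (simp add: lead_def)

lemma lead_lead: "lead r (lead r i) = lead r i"
  using lead_cong[OF lead_key] .

lemma key_internal: "key r i = key r j \<Longrightarrow> r (ea i) = r (eb i) \<Longrightarrow> r (ea j) = r (eb j)"
  by (auto simp: key_def doubleton_eq_iff)

lemma cends_image:
  assumes "repr r" "i < m"
  shows "{r (fst (cends r i)), r (snd (cends r i))} = key r i"
proof -
  have "r (r (ea i)) = r (ea i)" "r (r (eb i)) = r (eb i)" using assms ends by (auto simp: repr_def)
  then show ?thesis using lead_key[of r i] by (auto simp: cends_def key_def)
qed

text \<open>The new ends still determine the class of an edge, so only edges of the same class could
  collide. The first edge of the class receives the pair of representatives; by simplicity at most
  one original edge has these very ends, and it moves to the place that the first edge has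
  left.\<close>

lemma cends_inj:
  assumes r: "repr r" and ij: "i < m" "j < m"
    and eq: "{fst (cends r i), snd (cends r i)} = {fst (cends r j), snd (cends r j)}"
  shows "i = j"
proof (rule ccontr)
  assume ne: "i \<noteq> j"
  have "r ` {fst (cends r i), snd (cends r i)} = r ` {fst (cends r j), snd (cends r j)}"
    using eq by simp
  then have k: "key r i = key r j" using cends_image[OF r] ij by simp
  then have l: "lead r i = lead r j" by (rule lead_cong)
  have nint: "r (ea i) \<noteq> r (eb i)"
  proof
    assume "r (ea i) = r (eb i)"
    then show False using key_internal[OF k] eq simple[OF ij] ne by (auto simp: cends_def)
  qed
  then have nintj: "r (ea j) \<noteq> r (eb j)" using key_internal[OF k[symmetric]] by blast
  \<comment> \<open>The case that \<open>i\<close> is the first edge of its class, stated for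
    arbitrary \<open>i\<close> and \<open>j\<close> so that it serves both orders.\<close>
  have sym: False if "i \<noteq> j" "i < m" "j < m" "lead r i = i" "key r i = key r j" "lead r j = i"
    "r (ea j) \<noteq> r (eb j)" "r (ea i) \<noteq> r (eb i)"
    "{fst (cends r i), snd (cends r i)} = {fst (cends r j), snd (cends r j)}" for i j
  proof -
    have ci: "cends r i = (r (ea i), r (eb i))" using that by (simp add: cends_def)
    show False
    proof (cases "r (ea j) = ea j \<and> r (eb j) = eb j")
      case True
      then have "cends r j = (ea i, eb i)" using that by (simp add: cends_def)
      then have "{ea i, eb i} = key r i" using ci that(9) by (simp add: key_def)
      moreover have "key r j = {ea j, eb j}" using True by (simp add: key_def)
      ultimately show False using simple[of i j] that by simp
    next
      case False
      then have "cends r j = (ea j, eb j)" using that by (auto simp: cends_def)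
      then have e: "{ea j, eb j} = {r (ea i), r (eb i)}" using ci that(9) by simp
      have "r (r (ea i)) = r (ea i)" "r (r (eb i)) = r (eb i)" using r ends that(2) by (auto simp: repr_def)
      then have "r (ea j) = ea j \<and> r (eb j) = eb j" using e by (auto simp: doubleton_eq_iff)
      then show False using False by simp
    qed
  qed
  consider "lead r i = i" | "lead r j = j" | "lead r i \<noteq> i" "lead r j \<noteq> j" by blast
  then show False
  proof cases
    case 1 then show False using sym[of i j] ne ij k l nint nintj eq by simp
  next
    case 2 then show False using sym[of j i] ne ij k l nint nintj eq by simp
  next
    \<comment> \<open>Neither edge is the first edge \<open>q\<close> of the class, and at most one
      of them takes over the ends of \<open>q\<close>.\<close>
    case 3
    define q where "q = lead r i"
    have q: "q < m" "q \<noteq> i" "q \<noteq> j" using lead_le[of r i] ij 3 l by (auto simp: q_def)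
    let ?R = "\<lambda>i. r (ea i) = ea i \<and> r (eb i) = eb i"
    have c: "cends r i = (if ?R i then (ea q, eb q) else (ea i, eb i))"
      "cends r j = (if ?R j then (ea q, eb q) else (ea j, eb j))"
      using 3 nint nintj l by (simp_all add: cends_def q_def)
    have "\<not> (?R i \<and> ?R j)" using k simple[OF ij] ne by (auto simp: key_def)
    then show False using c eq simple[OF ij] simple[OF q(1) ij(1)] simple[OF q(1) ij(2)] simple[OF ij(1) q(1)] q ne
      by (auto split: if_splits)
  qed
qed

lemma wgraph_contracted:
  assumes "repr r"
  shows "wgraph n m (fst \<circ> cends r) (snd \<circ> cends r) (cwt r m)"
proof
  fix i assume i: "i < m"
  have "lead r i < m" using lead_le[of r i] i by simp
  then show "(fst \<circ> cends r) i < n \<and> (snd \<circ> cends r) i < n \<and> (fst \<circ> cends r) i \<noteq> (snd \<circ> cends r) i"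
    using ends[OF i] ends[of "lead r i"] assms by (auto simp: cends_def repr_def)
  show "0 \<le> cwt r m i" unfolding cwt_def using wt_nonneg by (auto intro!: sum_nonneg)
next
  fix i j assume "i < m" "j < m" "{(fst \<circ> cends r) i, (snd \<circ> cends r) i} = {(fst \<circ> cends r) j, (snd \<circ> cends r) j}"
  then show "i = j" using cends_inj[OF assms] by simp
qed

lemma lead_crosses:
  assumes "i < m" "r (ea i) \<noteq> r (eb i)"
  shows "((fst (cends r (lead r i)) \<in> X) \<noteq> (snd (cends r (lead r i)) \<in> X)) =
    ((r (ea i) \<in> X) \<noteq> (r (eb i) \<in> X))"
proof -
  have "cends r (lead r i) = (r (ea (lead r i)), r (eb (lead r i)))"
    using key_internal[OF lead_key] assms(2) lead_lead by (auto simp: cends_def)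
  then show ?thesis using lead_key[of r i] by (auto simp: key_def doubleton_eq_iff)
qed

text \<open>Double counting: the weight collected by the first edge of each class is distributed
  back to the edges from which it comes, and by \<open>lead_crosses\<close> these cross exactly when
  the first edge does.\<close>

lemma d_contracted:
  assumes "repr r"
  shows "wgraph.d m (fst \<circ> cends r) (snd \<circ> cends r) (cwt r m) X = d {y. y < n \<and> r y \<in> X}"
proof -
  interpret c: wgraph n m "fst \<circ> cends r" "snd \<circ> cends r" "cwt r m" by (rule wgraph_contracted[OF assms])
  let ?cr = "\<lambda>i. (fst (cends r i) \<in> X) \<noteq> (snd (cends r i) \<in> X)"
  have "c.d X = (\<Sum>i<m. \<Sum>j<m. if lead r j = i \<and> r (ea j) \<noteq> r (eb j) \<and> ?cr i then wt j else 0)"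
    unfolding c.d_def
  proof (rule sum.cong, goal_cases)
    case (2 i)
    show ?case
    proof (cases "r (ea i) = r (eb i) \<or> lead r i \<noteq> i")
      case True
      have "\<not> (lead r j = i \<and> r (ea j) \<noteq> r (eb j))" for j
      proof
        assume j: "lead r j = i \<and> r (ea j) \<noteq> r (eb j)"
        then have "lead r i = i" using lead_lead[of r j] by simp
        then show False using True j key_internal[OF lead_key[of r j]] by auto
      qed
      then have z: "(if lead r j = i \<and> r (ea j) \<noteq> r (eb j) \<and> ?cr i then wt j else 0) = 0" for j
        by (meson)
      show ?thesis unfolding z using True by (simp add: cwt_def)
    next
      case False
      then have "r (ea j) \<noteq> r (eb j)" if "lead r j = i" for j
        using key_internal[of r j i] lead_key[of r j] that by auto
      then have "(if lead r j = i \<and> r (ea j) \<noteq> r (eb j) \<and> ?cr i then wt j else 0) =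
          (if ?cr i then if lead r j = i then wt j else 0 else 0)" for j by auto
      then show ?thesis using False by (simp add: cwt_def)
    qed
  qed simp
  also have "\<dots> = (\<Sum>j<m. \<Sum>i<m. if lead r j = i \<and> r (ea j) \<noteq> r (eb j) \<and> ?cr i then wt j else 0)"
    by (rule sum.swap)
  also have "\<dots> = d {y. y < n \<and> r y \<in> X}"
    unfolding d_def
  proof (rule sum.cong, goal_cases)
    case (2 j)
    have lj: "lead r j < m" using lead_le[of r j] 2 by simp
    have e: "ea j < n" "eb j < n" using ends 2 by auto
    have "(\<Sum>i<m. if lead r j = i \<and> r (ea j) \<noteq> r (eb j) \<and> ?cr i then wt j else 0) =
        (\<Sum>i<m. if i = lead r j then (if r (ea j) \<noteq> r (eb j) \<and> ?cr (lead r j) then wt j else 0) else 0)"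
      by (rule sum.cong) auto
    also have "\<dots> = (if r (ea j) \<noteq> r (eb j) \<and> ?cr (lead r j) then wt j else 0)" using lj by simp
    also have "\<dots> = (if crosses {y. y < n \<and> r y \<in> X} j then wt j else 0)"
      using lead_crosses[of j r X] 2 e by (cases "r (ea j) = r (eb j)") auto
    finally show ?case .
  qed simp
  finally show ?thesis .
qed

text \<open>In the contracted graph only the sides of representatives influence the weight, and
  pulling \<open>X\<close> back along \<open>r\<close> gives a closed set of the same weight. A
  closed set is its own pullback, so minimality carries over to all closed separating sets.\<close>

lemma contracted_min_cut:
  assumes r: "repr r" and st: "s < n" "t < n" "r s = s" "r t = t"
    and X: "sep s t X" "\<And>Y. sep s t Y \<Longrightarrow>
      wgraph.d m (fst \<circ> cends r) (snd \<circ> cends r) (cwt r m) X \<le>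
      wgraph.d m (fst \<circ> cends r) (snd \<circ> cends r) (cwt r m) Y"
    and W: "W = {y. y < n \<and> r y \<in> X}"
  shows "sep s t W" "closed r W" "bounded_by r s t (d W)"
proof -
  show "sep s t W" using X(1) st W by (auto simp: sep_def)
  show "closed r W" using r W by (auto simp: closed_def repr_def)
  have "d W \<le> d Y" if Y: "sep s t Y" "closed r Y" for Y
  proof -
    have "Y = {y. y < n \<and> r y \<in> Y}" using Y by (auto simp: sep_def closed_def)
    then show ?thesis using X(2)[OF Y(1)] d_contracted[OF r] W by metis
  qed
  then show "bounded_by r s t (d W)" by (simp add: bounded_by_def)
qed

end

subsection \<open>Enumerating ideals in lexicographic order\<close>

text \<open>The smaller set lacks the first element on which the two sets differ; hence
  \<open>{0}\<close> comes before every other ideal.\<close>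

definition lex :: "nat set \<Rightarrow> nat set \<Rightarrow> bool" where
  "lex I J \<longleftrightarrow> (\<exists>i. I \<inter> {..<i} = J \<inter> {..<i} \<and> i \<notin> I \<and> i \<in> J)"

lemma lex_irrefl: "\<not> lex I I"
  by (auto simp: lex_def)

lemma lex_trans:
  assumes "lex I J" "lex J K" shows "lex I K"
proof -
  obtain i j where i: "I \<inter> {..<i} = J \<inter> {..<i}" "i \<notin> I" "i \<in> J"
    and j: "J \<inter> {..<j} = K \<inter> {..<j}" "j \<notin> J" "j \<in> K" using assms by (auto simp: lex_def)
  have ij: "i \<noteq> j" using i j by auto
  have "I \<inter> {..<min i j} = K \<inter> {..<min i j}" using i(1) j(1) by (auto simp: set_eq_iff)
  moreover have "min i j \<notin> I \<and> min i j \<in> K"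
  proof (cases "i < j")
    case True
    then show ?thesis using i j by (auto simp: set_eq_iff min_def)
  next
    case False
    then have "j < i" using ij by simp
    then show ?thesis using i j by (auto simp: set_eq_iff min_def)
  qed
  ultimately show ?thesis unfolding lex_def by blast
qed

lemma lex_total:
  fixes I J :: "nat set"
  shows "I \<noteq> J \<Longrightarrow> \<exists>i. I \<inter> {..<i} = J \<inter> {..<i} \<and> (i \<in> I) \<noteq> (i \<in> J)"
proof -
  assume "I \<noteq> J"
  then have ex: "\<exists>i. (i \<in> I) \<noteq> (i \<in> J)" by auto
  define i where "i = (LEAST i. (i \<in> I) \<noteq> (i \<in> J))"
  have "(i \<in> I) \<noteq> (i \<in> J)" unfolding i_def using LeastI_ex[of "\<lambda>i. (i \<in> I) \<noteq> (i \<in> J)"] ex by blast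
  moreover have "(j \<in> I) = (j \<in> J)" if "j < i" for j using not_less_Least that unfolding i_def by blast
  ultimately show ?thesis by (intro exI[of _ i]) auto
qed

text \<open>All predecessors of \<open>j\<close> are below \<open>j\<close>, so cutting an ideal off
  at any height leaves an ideal. This makes lexicographic successors easy to construct.\<close>

locale ideal_enum =
  fixes pre :: "nat \<Rightarrow> nat set" and k :: nat and G :: "nat set set"
  assumes pre: "pre j \<subseteq> {..<j}" and k: "1 \<le> k"
    and G: "G = {I. I \<subseteq> {..<k} \<and> 0 \<in> I \<and> (\<forall>j\<in>I. pre j \<subseteq> I)}"
begin

text \<open>The part of the enumeration that is complete once \<open>I\<close> has been listed; the
  loop invariant tracks its growth by one element per round.\<close>

definition upto :: "nat set \<Rightarrow> nat set set" where
  "upto I = {J \<in> G. J = I \<or> lex J I}"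

lemma finite_G: "finite G"
  by (rule finite_subset[of _ "Pow {..<k}"]) (auto simp: G)

lemma first_in: "{0} \<in> G"
  using pre[of 0] k by (auto simp: G)

lemma upto_first: "upto {0} = {{0}}"
proof -
  have "\<not> lex J {0}" if "J \<in> G" for J using that by (auto simp: lex_def G)
  then show ?thesis using first_in by (auto simp: upto_def)
qed

text \<open>The first position at which a lexicographically later ideal exceeds \<open>I\<close> can
  itself be added to \<open>I\<close>: its predecessors are smaller, and below it the two ideals
  agree.\<close>

lemma candidate:
  assumes "I \<in> G" "J \<in> G" "I \<inter> {..<i} = J \<inter> {..<i}" "i \<notin> I" "i \<in> J"
  shows "1 \<le> i" "i < k" "pre i \<subseteq> I"
proof -
  show "1 \<le> i" using assms by (cases i) (auto simp: G)
  show "i < k" using assms by (auto simp: G)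
  show "pre i \<subseteq> I"
  proof
    fix x assume "x \<in> pre i"
    then have "x \<in> J \<inter> {..<i}" using assms(2,5) pre[of i] by (auto simp: G)
    then show "x \<in> I" using assms(3) by blast
  qed
qed

lemma upto_last:
  assumes I: "I \<in> G" and none: "\<And>j. 1 \<le> j \<Longrightarrow> j < k \<Longrightarrow> j \<notin> I \<Longrightarrow> \<not> pre j \<subseteq> I"
  shows "upto I = G"
proof -
  have "J = I \<or> lex J I" if J: "J \<in> G" for J
  proof (rule disjCI)
    assume "\<not> lex J I"
    show "J = I"
    proof (rule ccontr)
      assume "J \<noteq> I"
      then obtain i where i: "I \<inter> {..<i} = J \<inter> {..<i}" "(i \<in> I) \<noteq> (i \<in> J)"
        using lex_total[of I J] by auto
      then have "i \<notin> I \<and> i \<in> J" using \<open>\<not> lex J I\<close> unfolding lex_def by metis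
      then show False using candidate[OF I J i(1)] none by blast
    qed
  qed
  then show ?thesis by (auto simp: upto_def)
qed

text \<open>The successor adds the largest addable element \<open>j\<close> and drops everything
  above it. An ideal strictly in between would agree with \<open>I\<close> up to \<open>j\<close>
  and first exceed it at a larger addable element, contradicting the choice of
  \<open>j\<close>.\<close>

lemma upto_next:
  assumes I: "I \<in> G" and j: "1 \<le> j" "j < k" "j \<notin> I" "pre j \<subseteq> I"
    and max: "\<And>i. j < i \<Longrightarrow> i < k \<Longrightarrow> i \<notin> I \<Longrightarrow> \<not> pre i \<subseteq> I"
    and J: "J = insert j (I \<inter> {..<j})"
  shows "J \<in> G" "upto J = insert J (upto I)" "J \<notin> upto I"
proof -
  show JG: "J \<in> G"
  proof -
    have "pre i \<subseteq> J" if i: "i \<in> J" for i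
    proof (cases "i = j")
      case True then show ?thesis using J j(4) pre[of j] by auto
    next
      case False
      then have "i \<in> I" "i < j" using i J by auto
      then show ?thesis using I pre[of i] J by (auto simp: G)
    qed
    then show ?thesis using I j J by (auto simp: G)
  qed
  have IJ: "lex I J" unfolding lex_def using J j by (intro exI[of _ j]) auto
  have "K = I \<or> lex K I" if K: "K \<in> G" "lex K J" for K
  proof -
    obtain i where i: "K \<inter> {..<i} = J \<inter> {..<i}" "i \<notin> K" "i \<in> J" using K(2) unfolding lex_def by blast
    have "i \<le> j" using i(3) J by auto
    show ?thesis
    proof (cases "i = j")
      case False
      then have "i < j" using \<open>i \<le> j\<close> by simp
      then have "J \<inter> {..<i} = I \<inter> {..<i}" "i \<in> I" using i(3) J by auto
      then have "K \<inter> {..<i} = I \<inter> {..<i}" "i \<in> I" using i(1) by simp_all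
      then show ?thesis using i(2) unfolding lex_def by blast
    next
      case True
      have agree: "(a \<in> K) = (a \<in> I)" if "a \<le> j" for a
      proof (cases "a = j")
        case True then show ?thesis using i(2) \<open>i = j\<close> j(3) by simp
      next
        case False
        then have "a < j" using that by simp
        then have "a \<in> K \<longleftrightarrow> a \<in> J" using i(1) \<open>i = j\<close> by (metis Int_iff lessThan_iff)
        then show ?thesis using J False \<open>a < j\<close> by simp
      qed
      show ?thesis
      proof (rule disjCI)
        assume nl: "\<not> lex K I"
        show "K = I"
        proof (rule ccontr)
          assume "K \<noteq> I"
          then obtain q where q: "I \<inter> {..<q} = K \<inter> {..<q}" "(q \<in> I) \<noteq> (q \<in> K)"
            using lex_total[of I K] by auto
          then have qq: "q \<notin> I" "q \<in> K" using nl unfolding lex_def by metis+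
          have "j < q" using agree[of q] q(2) by (meson not_le)
          then show False using candidate[OF I K(1) q(1) qq] max qq by blast
        qed
      qed
    qed
  qed
  then show "upto J = insert J (upto I)"
    using JG I IJ lex_trans[of _ I J] by (auto simp: upto_def)
  show "J \<notin> upto I" using IJ lex_trans lex_irrefl unfolding upto_def by blast
qed

end

subsection \<open>Distributing the relevant cuts over the vertices\<close>

context connected_wgraph
begin

definition parents :: "(nat \<Rightarrow> nat) \<Rightarrow> (nat \<Rightarrow> real) \<Rightarrow> bool" where
  "parents par Lam \<longleftrightarrow> (\<forall>v. 0 < v \<and> v < n \<longrightarrow>
     par v < v \<and> Lam v = lam (par v) v \<and> (\<forall>u<v. lam u v \<le> Lam v))"

definition emitted :: "(nat \<Rightarrow> nat) \<Rightarrow> (nat \<Rightarrow> real) \<Rightarrow> nat \<Rightarrow> nat set set" where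
  "emitted par Lam v = {X. sep (par v) v X \<and> d X = Lam v \<and>
     (\<forall>u. 0 < u \<and> u < v \<and> Lam u = Lam v \<longrightarrow> (u \<in> X) = (par u \<in> X))}"

lemma parentsD:
  assumes "parents par Lam" "0 < v" "v < n"
  shows "par v < v" "par v < n" "Lam v = lam (par v) v" "u < v \<Longrightarrow> lam u v \<le> Lam v"
  using assms unfolding parents_def by (blast intro: order_less_trans)+

text \<open>Induction on the larger vertex. If \<open>X\<close> does not separate \<open>v\<close>
  from its parent, the parent can replace \<open>v\<close>: by the ultrametric inequality and the
  maximality of \<open>Lam v\<close>, the minimum cut value against \<open>u\<close> is still
  \<open>d X\<close>.\<close>

lemma separated_parent:
  assumes P: "parents par Lam"
  shows "u < v \<Longrightarrow> v < n \<Longrightarrow> X \<subseteq> {..<n} \<Longrightarrow> (u \<in> X) \<noteq> (v \<in> X) \<Longrightarrow> d X = lam u v \<Longrightarrow>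
    \<exists>x. 0 < x \<and> x < n \<and> Lam x = d X \<and> (x \<in> X) \<noteq> (par x \<in> X)"
proof (induction v arbitrary: u rule: less_induct)
  case (less v)
  let ?p = "par v"
  have p: "?p < v" "Lam v = lam ?p v" "lam u v \<le> Lam v"
    using parentsD[OF P, of v] less.prems by auto
  have lamle: "lam a b \<le> d X" if ab: "a < n" "b < n" "(a \<in> X) \<noteq> (b \<in> X)" for a b
  proof -
    have "sep a b X \<or> sep a b ({..<n} - X)" using ab less.prems by (auto simp: sep_def)
    then show ?thesis using lam_le[of a b X] lam_le[of a b "{..<n} - X"] d_compl[of X] by auto
  qed
  show ?case
  proof (cases "(v \<in> X) \<noteq> (?p \<in> X)")
    case True
    then have "Lam v \<le> d X" using lamle[of ?p v] p less.prems by auto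
    then have "Lam v = d X" using p less.prems by simp
    then show ?thesis using True less.prems by (intro exI[of _ v]) auto
  next
    case False
    then have sp: "(u \<in> X) \<noteq> (?p \<in> X)" using less.prems by auto
    then have ne: "u \<noteq> ?p" by auto
    have "min (lam u v) (lam v ?p) \<le> lam u ?p"
      using lam_ultrametric[of u v ?p] less.prems p ne by auto
    moreover have "lam v ?p = Lam v" using lam_sym[of v ?p] p less.prems by simp
    ultimately have "d X \<le> lam u ?p" using p less.prems by simp
    then have eq: "d X = lam u ?p" using lamle[of u ?p] sp p less.prems by auto
    show ?thesis
    proof (cases "u < ?p")
      case True
      then show ?thesis using less.IH[of ?p u] p less.prems sp eq by auto
    next
      case F2: False
      then have "?p < u" using ne by simp
      then show ?thesis using less.IH[of u ?p] p less.prems sp eq lam_sym[of u ?p] by auto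
    qed
  qed
qed

theorem relevant_cuts_eq:
  assumes P: "parents par Lam"
  shows "{Cc. relevant_cut {..<n} edges w Cc} = cut ` (\<Union>v\<in>{1..<n}. emitted par Lam v)"
proof
  show "cut ` (\<Union>v\<in>{1..<n}. emitted par Lam v) \<subseteq> {Cc. relevant_cut {..<n} edges w Cc}"
  proof
    fix Cc assume "Cc \<in> cut ` (\<Union>v\<in>{1..<n}. emitted par Lam v)"
    then obtain v X where v: "v \<in> {1..<n}" "X \<in> emitted par Lam v" "Cc = cut X" by blast
    then have "sep (par v) v X" "d X = lam (par v) v"
      using parentsD[OF P, of v] by (auto simp: emitted_def)
    then show "Cc \<in> {Cc. relevant_cut {..<n} edges w Cc}" using v relevant_cut_iff by auto
  qed
  show "{Cc. relevant_cut {..<n} edges w Cc} \<subseteq> cut ` (\<Union>v\<in>{1..<n}. emitted par Lam v)"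
  proof
    fix Cc assume "Cc \<in> {Cc. relevant_cut {..<n} edges w Cc}"
    then have "relevant_cut {..<n} edges w Cc" by simp
    then obtain s t X where X: "t < n" "sep s t X" "Cc = cut X" "d X = lam s t"
      unfolding relevant_cut_iff by blast
    have s: "s < n" "X \<subseteq> {..<n}" "(s \<in> X) \<noteq> (t \<in> X)" "s \<noteq> t" using X by (auto simp: sep_def)
    have ex: "\<exists>x. 0 < x \<and> x < n \<and> Lam x = d X \<and> (x \<in> X) \<noteq> (par x \<in> X)"
    proof (cases "s < t")
      case True then show ?thesis using separated_parent[OF P True X(1) s(2,3) X(4)] by blast
    next
      case False
      then have "t < s" using s by simp
      then show ?thesis using separated_parent[OF P _ s(1,2), of t] s X lam_sym[of s t] by auto
    qed
    define v where "v = (LEAST x. 0 < x \<and> x < n \<and> Lam x = d X \<and> (x \<in> X) \<noteq> (par x \<in> X))"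
    have v: "0 < v" "v < n" "Lam v = d X" "(v \<in> X) \<noteq> (par v \<in> X)"
      using LeastI_ex[OF ex] unfolding v_def by auto
    have least: "(u \<in> X) = (par u \<in> X)" if "0 < u \<and> u < v \<and> Lam u = Lam v" for u
      using not_less_Least[of u "\<lambda>x. 0 < x \<and> x < n \<and> Lam x = d X \<and> (x \<in> X) \<noteq> (par x \<in> X)"]
        that v unfolding v_def[symmetric] by auto
    have pv: "par v < n" using parentsD[OF P] v by auto
    have vI: "v \<in> {1..<n}" using v by simp
    show "Cc \<in> cut ` (\<Union>v\<in>{1..<n}. emitted par Lam v)"
    proof (cases "par v \<in> X")
      case True
      then have "X \<in> emitted par Lam v" using v s least by (auto simp: emitted_def sep_def)
      then show ?thesis using X(3) vI by blast
    next
      \<comment> \<open>A charged cut is represented by the side that contains the parent, so the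
        complement is taken here.\<close>
      case False
      let ?Y = "{..<n} - X"
      have "(u \<in> ?Y) = (par u \<in> ?Y)" if u: "0 < u \<and> u < v \<and> Lam u = Lam v" for u
      proof -
        have "par u < u" using parentsD[OF P, of u] u v by auto
        then show ?thesis using least[OF u] u v by auto
      qed
      moreover have "sep (par v) v ?Y" using False v pv by (auto simp: sep_def)
      ultimately have "?Y \<in> emitted par Lam v" using v d_compl[of X] by (auto simp: emitted_def)
      moreover have "cut ?Y = Cc" using vec_compl[OF s(2)] vec_eq_iff X by simp
      ultimately show ?thesis using vI by blast
    qed
  qed
qed

text \<open>Equal cuts have equal weight, hence equal \<open>Lam\<close>. A cut charged to a larger
  vertex with the same \<open>Lam\<close> does not separate \<open>v\<close> from its parent,
  whereas one charged to \<open>v\<close> does. The complementary side is excluded because the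
  parent has to lie in the set.\<close>

lemma emitted_cut_inj:
  assumes P: "parents par Lam" and v: "v \<in> {1..<n}" "v' \<in> {1..<n}"
    and X: "X \<in> emitted par Lam v" "Y \<in> emitted par Lam v'" and eq: "cut X = cut Y"
  shows "v = v' \<and> X = Y"
proof -
  have dd: "Lam v = Lam v'"
    using X cut_weight_cut[of X] cut_weight_cut[of Y] eq by (simp add: emitted_def)
  have sub: "X \<subseteq> {..<n}" "Y \<subseteq> {..<n}" using X by (auto simp: emitted_def sep_def)
  have cases: "X = Y \<or> X = {..<n} - Y" using cut_inj[OF sub eq] .
  have False if "v < v'" "v \<in> {1..<n}" "X \<in> emitted par Lam v" "Y \<in> emitted par Lam v'" "Lam v = Lam v'"
    "X = Y \<or> X = {..<n} - Y" for v v' X Y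
  proof -
    have "par v < n" using parentsD[OF P, of v] that by auto
    then have "(v \<in> X) = (par v \<in> X)" using that by (auto simp: emitted_def)
    then show False using that by (auto simp: emitted_def sep_def)
  qed
  moreover have "Y = X \<or> Y = {..<n} - X" using cases sub by auto
  ultimately have "v = v'" using v X dd cases by (metis linorder_neqE_nat)
  moreover from this have "X = Y" using cases X parentsD[OF P, of v] v by (auto simp: emitted_def sep_def)
  ultimately show ?thesis by simp
qed

text \<open>The equation for \<open>r0\<close> is a recursion because parents have smaller numbers.\<close>

lemma emitted_eq_fam:
  assumes P: "parents par Lam" and v: "0 < v" "v < n"
    and r0: "\<And>y. y < n \<Longrightarrow> r0 y = (if 0 < y \<and> y < v \<and> Lam y = Lam v then r0 (par y) else y)"
  shows "repr r0" "r0 v = v" "r0 (par v) < v" "emitted par Lam v = fam r0 (r0 (par v)) v (Lam v)"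
    "bounded_by r0 (r0 (par v)) v (Lam v)"
proof -
  have le: "y < n \<Longrightarrow> r0 y \<le> y \<and> r0 (r0 y) = r0 y" for y
  proof (induction y rule: less_induct)
    case (less y)
    show ?case
    proof (cases "0 < y \<and> y < v \<and> Lam y = Lam v")
      case True
      then have "par y < y" using parentsD[OF P, of y] less.prems by auto
      then show ?thesis using less.IH[of "par y"] less.prems r0[of y] True by auto
    next
      case False
      then have "r0 y = y" using r0[of y] less.prems by auto
      then show ?thesis by simp
    qed
  qed
  then show rp: "repr r0" by (force simp: repr_def)
  show r0v: "r0 v = v" using r0[of v] v by simp
  have pv: "par v < v" using parentsD[OF P] v by auto
  then show "r0 (par v) < v" using le[of "par v"] v by simp
  \<comment> \<open>Following the recursion, membership is passed from a merged vertex to its parent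
    until the representative is reached.\<close>
  have closed: "closed r0 X \<longleftrightarrow> (\<forall>u. 0 < u \<and> u < v \<and> Lam u = Lam v \<longrightarrow> (u \<in> X) = (par u \<in> X))" for X
  proof
    assume c: "closed r0 X"
    show "\<forall>u. 0 < u \<and> u < v \<and> Lam u = Lam v \<longrightarrow> (u \<in> X) = (par u \<in> X)"
    proof (intro allI impI)
      fix u assume u: "0 < u \<and> u < v \<and> Lam u = Lam v"
      then have "r0 u = r0 (par u)" "par u < n" using r0[of u] v parentsD[OF P, of u] by auto
      then show "(u \<in> X) = (par u \<in> X)" using c u v by (metis closed_def order_less_trans)
    qed
  next
    assume a: "\<forall>u. 0 < u \<and> u < v \<and> Lam u = Lam v \<longrightarrow> (u \<in> X) = (par u \<in> X)"
    have "y < n \<Longrightarrow> (y \<in> X) = (r0 y \<in> X)" for y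
    proof (induction y rule: less_induct)
      case (less y)
      show ?case
      proof (cases "0 < y \<and> y < v \<and> Lam y = Lam v")
        case True
        then have "par y < y" using parentsD[OF P, of y] less.prems by auto
        then show ?thesis using less.IH[of "par y"] less.prems r0[of y] True a by auto
      next
        case False
        then have "r0 y = y" using r0[of y] less.prems by auto
        then show ?thesis by simp
      qed
    qed
    then show "closed r0 X" by (simp add: closed_def)
  qed
  \<comment> \<open>A closed set contains \<open>par v\<close> iff it contains the representative of
    \<open>par v\<close>, so the source may be moved there.\<close>
  have sp: "sep (r0 (par v)) v X \<longleftrightarrow> sep (par v) v X" if "closed r0 X" for X
    using that pv v by (auto simp: sep_def closed_def)
  show "emitted par Lam v = fam r0 (r0 (par v)) v (Lam v)"
    using closed sp unfolding emitted_def fam_def by blast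
  show "bounded_by r0 (r0 (par v)) v (Lam v)"
    using sp lam_le[of "par v" v] parentsD(3)[OF P v] unfolding bounded_by_def by metis
qed

end

section \<open>A structured language for the real RAM\<close>

text \<open>Data live in scalars and in infinitely long arrays; \<open>clk\<close> counts machine steps, \<open>tk\<close> counts
  source-level actions, and \<open>lg\<close> records every output symbol with both counts. \<open>raw\<close> and \<open>rraw\<close>
  give access to the part of the machine input that is not overwritten by registers.\<close>

record hstate =
  sc :: "nat \<Rightarrow> nat"
  ar :: "nat \<Rightarrow> nat \<Rightarrow> nat"
  rs :: "nat \<Rightarrow> real"
  ra :: "nat \<Rightarrow> nat \<Rightarrow> real"
  raw :: "nat \<Rightarrow> nat"
  rraw :: "nat \<Rightarrow> real"
  bas :: nat
  clk :: nat
  tk :: nat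
  lg :: "(nat \<times> nat \<times> nat) list"

datatype nexp = Va nat | Co nat | Add nexp nexp | Sub nexp nexp | Ar nat nexp

datatype rexp = RV nat | RC int | RPlus rexp rexp | RMinus rexp rexp | RTimes rexp rexp
  | RDivide rexp rexp | RAr nat nexp

datatype cmd = Skip
  | Asg nat nexp
  | Sto nat nexp nexp
  | RAsg nat rexp
  | RSto nat nexp rexp
  | RawLd nat nexp
  | RRawLd nat nexp
  | Out nexp
  | Seq cmd cmd (infixr \<open>;;\<close> 60)
  | Ite nexp cmd cmd
  | IfR rexp rexp cmd cmd
  | Wh nexp cmd

fun ev :: "nexp \<Rightarrow> hstate \<Rightarrow> nat" where
  "ev (Va x) s = sc s x"
| "ev (Co k) s = k"
| "ev (Add a b) s = ev a s + ev b s"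
| "ev (Sub a b) s = ev a s - ev b s"
| "ev (Ar k e) s = ar s k (ev e s)"

fun rv :: "rexp \<Rightarrow> hstate \<Rightarrow> real" where
  "rv (RV x) s = rs s x"
| "rv (RC k) s = of_int k"
| "rv (RPlus a b) s = rv a s + rv b s"
| "rv (RMinus a b) s = rv a s - rv b s"
| "rv (RTimes a b) s = rv a s * rv b s"
| "rv (RDivide a b) s = rv a s / rv b s"
| "rv (RAr k e) s = ra s k (ev e s)"

text \<open>Truncated subtraction turns comparisons into the numbers 0 and 1.\<close>

definition Lt :: "nexp \<Rightarrow> nexp \<Rightarrow> nexp" where
  "Lt a b = Sub (Co 1) (Sub (Co 1) (Sub b a))"

definition Neq :: "nexp \<Rightarrow> nexp \<Rightarrow> nexp" where
  "Neq a b = Lt (Co 0) (Add (Sub a b) (Sub b a))"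

definition Eq :: "nexp \<Rightarrow> nexp \<Rightarrow> nexp" where
  "Eq a b = Sub (Co 1) (Neq a b)"

lemma ev_Lt [simp]: "ev (Lt a b) s = of_bool (ev a s < ev b s)"
  by (auto simp: Lt_def)

lemma ev_Neq [simp]: "ev (Neq a b) s = of_bool (ev a s \<noteq> ev b s)"
  by (auto simp: Neq_def)

lemma ev_Eq [simp]: "ev (Eq a b) s = of_bool (ev a s = ev b s)"
  by (auto simp: Eq_def)

text \<open>Memory layout: cells 0 to 63 hold scalars, 64 to 95 the start addresses of the arrays,
  and 96 to 127 the evaluation stack, used here from depth \<open>d\<close> on. Entry
  \<open>i\<close> of array \<open>k\<close> lies at \<open>bas + 32 * i + k\<close>, so that 32
  unbounded arrays are interleaved; the factor 32 consists of five doublings.\<close>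

fun cn :: "nat \<Rightarrow> nexp \<Rightarrow> instr list" where
  "cn d (Va x) = [NConst (96+d) 0, NAdd (96+d) (96+d) x]"
| "cn d (Co k) = [NConst (96+d) k]"
| "cn d (Add a b) = cn d a @ cn (Suc d) b @ [NAdd (96+d) (96+d) (97+d)]"
| "cn d (Sub a b) = cn d a @ cn (Suc d) b @ [NSub (96+d) (96+d) (97+d)]"
| "cn d (Ar k e) = cn d e @ replicate 5 (NAdd (96+d) (96+d) (96+d))
     @ [NAdd (96+d) (96+d) (64+k), NLoad (96+d) (96+d)]"

definition caddr :: "nat \<Rightarrow> nat \<Rightarrow> nexp \<Rightarrow> instr list" where
  "caddr d k e = cn d e @ replicate 5 (NAdd (96+d) (96+d) (96+d)) @ [NAdd (96+d) (96+d) (64+k)]"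

text \<open>Real cells 0 to 31 hold scalars and 32 to 63 the evaluation stack. The parameter
  \<open>z\<close> is the depth from which index computations may use the stack of natural numbers;
  with \<open>z = 1\<close> a pending address in cell 96 survives.\<close>

fun cr :: "nat \<Rightarrow> nat \<Rightarrow> rexp \<Rightarrow> instr list" where
  "cr z d (RV x) = [RConst (32+d) 0, RAdd (32+d) (32+d) x]"
| "cr z d (RC k) = [RConst (32+d) k]"
| "cr z d (RPlus a b) = cr z d a @ cr z (Suc d) b @ [RAdd (32+d) (32+d) (33+d)]"
| "cr z d (RMinus a b) = cr z d a @ cr z (Suc d) b @ [RSub (32+d) (32+d) (33+d)]"
| "cr z d (RTimes a b) = cr z d a @ cr z (Suc d) b @ [RMul (32+d) (32+d) (33+d)]"
| "cr z d (RDivide a b) = cr z d a @ cr z (Suc d) b @ [RDiv (32+d) (32+d) (33+d)]"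
| "cr z d (RAr k e) = caddr z k e @ [RLoad (32+d) (96+z)]"

fun wfn :: "nat \<Rightarrow> nexp \<Rightarrow> bool" where
  "wfn d (Va x) \<longleftrightarrow> x < 64 \<and> d < 32"
| "wfn d (Co k) \<longleftrightarrow> d < 32"
| "wfn d (Add a b) \<longleftrightarrow> wfn d a \<and> wfn (Suc d) b"
| "wfn d (Sub a b) \<longleftrightarrow> wfn d a \<and> wfn (Suc d) b"
| "wfn d (Ar k e) \<longleftrightarrow> k < 32 \<and> wfn d e"

fun wfr :: "nat \<Rightarrow> nat \<Rightarrow> rexp \<Rightarrow> bool" where
  "wfr z d (RV x) \<longleftrightarrow> x < 32 \<and> d < 32"
| "wfr z d (RC k) \<longleftrightarrow> d < 32"
| "wfr z d (RPlus a b) \<longleftrightarrow> wfr z d a \<and> wfr z (Suc d) b"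
| "wfr z d (RMinus a b) \<longleftrightarrow> wfr z d a \<and> wfr z (Suc d) b"
| "wfr z d (RTimes a b) \<longleftrightarrow> wfr z d a \<and> wfr z (Suc d) b"
| "wfr z d (RDivide a b) \<longleftrightarrow> wfr z d a \<and> wfr z (Suc d) b"
| "wfr z d (RAr k e) \<longleftrightarrow> k < 32 \<and> wfn z e \<and> d < 32"

fun wfc :: "cmd \<Rightarrow> bool" where
  "wfc Skip \<longleftrightarrow> True"
| "wfc (Asg x e) \<longleftrightarrow> x < 64 \<and> wfn 0 e"
| "wfc (Sto k a b) \<longleftrightarrow> k < 32 \<and> wfn 0 a \<and> wfn 1 b"
| "wfc (RAsg x r) \<longleftrightarrow> x < 32 \<and> wfr 0 0 r"
| "wfc (RSto k a r) \<longleftrightarrow> k < 32 \<and> wfn 0 a \<and> wfr 1 0 r"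
| "wfc (RawLd x e) \<longleftrightarrow> x < 64 \<and> wfn 0 e"
| "wfc (RRawLd x e) \<longleftrightarrow> x < 32 \<and> wfn 0 e"
| "wfc (Out e) \<longleftrightarrow> wfn 0 e"
| "wfc (c1 ;; c2) \<longleftrightarrow> wfc c1 \<and> wfc c2"
| "wfc (Ite e c1 c2) \<longleftrightarrow> wfn 0 e \<and> wfc c1 \<and> wfc c2"
| "wfc (IfR a b c1 c2) \<longleftrightarrow> wfr 0 0 a \<and> wfr 0 1 b \<and> wfc c1 \<and> wfc c2"
| "wfc (Wh e c) \<longleftrightarrow> wfn 0 e \<and> wfc c"

text \<open>The position \<open>p\<close> is passed along because jumps are absolute. The else
  branch stands first and ends with a jump over the other branch. Truth is tested as
  \<open>0 < v\<close> by loading 0 into cell 97.\<close>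

fun code :: "cmd \<Rightarrow> nat \<Rightarrow> instr list" where
  "code Skip p = []"
| "code (Asg x e) p = cn 0 e @ [NConst x 0, NAdd x x 96]"
| "code (Sto k a b) p = caddr 0 k a @ cn 1 b @ [NStore 96 97]"
| "code (RAsg x r) p = cr 0 0 r @ [RConst x 0, RAdd x x 32]"
| "code (RSto k a r) p = caddr 0 k a @ cr 1 0 r @ [RStore 96 32]"
| "code (RawLd x e) p = cn 0 e @ [NLoad x 96]"
| "code (RRawLd x e) p = cn 0 e @ [RLoad x 96]"
| "code (Out e) p = cn 0 e @ [Output 96]"
| "code (c1 ;; c2) p = code c1 p @ code c2 (p + length (code c1 p))"
| "code (Ite e c1 c2) p =
    (let t = cn 0 e; q = p + length t + 2; k2 = code c2 q; q1 = q + length k2 + 1; k1 = code c1 q1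
     in t @ [NConst 97 0, JumpNLess 97 96 q1] @ k2 @ [Jump (q1 + length k1)] @ k1)"
| "code (IfR a b c1 c2) p =
    (let t = cr 0 0 a @ cr 0 1 b; q = p + length t + 1; k2 = code c2 q; q1 = q + length k2 + 1;
         k1 = code c1 q1
     in t @ [JumpRLess 32 33 q1] @ k2 @ [Jump (q1 + length k1)] @ k1)"
| "code (Wh e c) p =
    (let t = cn 0 e; q = p + length t + 3; k = code c q
     in t @ [NConst 97 0, JumpNLess 97 96 q, Jump (q + length k + 1)] @ k @ [Jump p])"

definition tick :: "nat \<Rightarrow> hstate \<Rightarrow> hstate" where
  "tick d s = s\<lparr>clk := clk s + d, tk := Suc (tk s)\<rparr>"

abbreviation cost :: "cmd \<Rightarrow> nat" where
  "cost c \<equiv> length (code c 0)"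

text \<open>\<open>clk\<close> follows the compiled code exactly; the jump that closes an else
  branch or a loop body is the separate \<open>tick 1\<close>. A log entry carries the counts
  reached after the output. Raw loads are confined to the cells between the registers and
  \<open>bas\<close>.\<close>

inductive big :: "cmd \<Rightarrow> hstate \<Rightarrow> hstate \<Rightarrow> bool" where
  Skip: "big Skip s s"
| Asg: "big (Asg x e) s (tick (cost (Asg x e)) (s\<lparr>sc := (sc s)(x := ev e s)\<rparr>))"
| Sto: "big (Sto k a b) s
    (tick (cost (Sto k a b)) (s\<lparr>ar := (ar s)(k := (ar s k)(ev a s := ev b s))\<rparr>))"
| RAsg: "big (RAsg x r) s (tick (cost (RAsg x r)) (s\<lparr>rs := (rs s)(x := rv r s)\<rparr>))"
| RSto: "big (RSto k a r) s
    (tick (cost (RSto k a r)) (s\<lparr>ra := (ra s)(k := (ra s k)(ev a s := rv r s))\<rparr>))"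
| RawLd: "128 \<le> ev e s \<Longrightarrow> ev e s < bas s \<Longrightarrow>
    big (RawLd x e) s (tick (cost (RawLd x e)) (s\<lparr>sc := (sc s)(x := raw s (ev e s))\<rparr>))"
| RRawLd: "64 \<le> ev e s \<Longrightarrow> ev e s < bas s \<Longrightarrow>
    big (RRawLd x e) s (tick (cost (RRawLd x e)) (s\<lparr>rs := (rs s)(x := rraw s (ev e s))\<rparr>))"
| Out: "big (Out e) s (tick (cost (Out e))
    (s\<lparr>lg := lg s @ [(ev e s, clk s + cost (Out e), Suc (tk s))]\<rparr>))"
| Seq: "big c1 s s1 \<Longrightarrow> big c2 s1 s2 \<Longrightarrow> big (c1 ;; c2) s s2"
| IfT: "0 < ev e s \<Longrightarrow> big c1 (tick (length (cn 0 e) + 2) s) s' \<Longrightarrow> big (Ite e c1 c2) s s'"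
| IfF: "ev e s = 0 \<Longrightarrow> big c2 (tick (length (cn 0 e) + 2) s) s' \<Longrightarrow>
    big (Ite e c1 c2) s (tick 1 s')"
| IfRT: "rv a s < rv b s \<Longrightarrow> big c1 (tick (length (cr 0 0 a @ cr 0 1 b) + 1) s) s' \<Longrightarrow>
    big (IfR a b c1 c2) s s'"
| IfRF: "\<not> rv a s < rv b s \<Longrightarrow> big c2 (tick (length (cr 0 0 a @ cr 0 1 b) + 1) s) s' \<Longrightarrow>
    big (IfR a b c1 c2) s (tick 1 s')"
| WhileF: "ev e s = 0 \<Longrightarrow> big (Wh e c) s (tick (length (cn 0 e) + 3) s)"
| WhileT: "0 < ev e s \<Longrightarrow> big c (tick (length (cn 0 e) + 2) s) s1 \<Longrightarrow>
    big (Wh e c) (tick 1 s1) s2 \<Longrightarrow> big (Wh e c) s s2"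

lemmas tick_simps [simp] =
  tick_def[THEN arg_cong[where f = sc], simplified] tick_def[THEN arg_cong[where f = ar], simplified]
  tick_def[THEN arg_cong[where f = rs], simplified] tick_def[THEN arg_cong[where f = ra], simplified]
  tick_def[THEN arg_cong[where f = raw], simplified]
  tick_def[THEN arg_cong[where f = rraw], simplified]
  tick_def[THEN arg_cong[where f = bas], simplified] tick_def[THEN arg_cong[where f = lg], simplified]
  tick_def[THEN arg_cong[where f = clk], simplified] tick_def[THEN arg_cong[where f = tk], simplified]

subsection \<open>Correctness of the compiler\<close>

definition conc :: "hstate \<Rightarrow> config \<Rightarrow> bool" where
  "conc s c \<longleftrightarrow> 128 \<le> bas s \<and>
    (\<forall>x<64. nmem c x = sc s x) \<and> (\<forall>k<32. nmem c (64 + k) = bas s + k) \<and>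
    (\<forall>k<32. \<forall>i. nmem c (bas s + 32 * i + k) = ar s k i) \<and>
    (\<forall>j. 128 \<le> j \<and> j < bas s \<longrightarrow> nmem c j = raw s j) \<and>
    (\<forall>x<32. rmem c x = rs s x) \<and>
    (\<forall>k<32. \<forall>i. rmem c (bas s + 32 * i + k) = ra s k i) \<and>
    (\<forall>j. 64 \<le> j \<and> j < bas s \<longrightarrow> rmem c j = rraw s j) \<and>
    tape c = map fst (lg s)"

definition tmpeq :: "nat \<Rightarrow> nat \<Rightarrow> config \<Rightarrow> config \<Rightarrow> bool" where
  "tmpeq d z c c' \<longleftrightarrow> tape c' = tape c \<and>
     (\<forall>a. \<not> (96 + d \<le> a \<and> a < 128) \<longrightarrow> nmem c' a = nmem c a) \<and>
     (\<forall>a. \<not> (32 + z \<le> a \<and> a < 64) \<longrightarrow> rmem c' a = rmem c a)"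

lemma conc_tmpeq: "conc s c \<Longrightarrow> tmpeq d z c c' \<Longrightarrow> conc s c'"
  unfolding conc_def tmpeq_def by (auto simp: not_le)

lemma tmpeq_trans: "tmpeq d z c c' \<Longrightarrow> tmpeq d' z' c' c'' \<Longrightarrow> d \<le> d' \<Longrightarrow> z \<le> z' \<Longrightarrow> tmpeq d z c c''"
  unfolding tmpeq_def by force

fun jumpfree :: "instr \<Rightarrow> bool" where
  "jumpfree (Jump _) = False"
| "jumpfree (JumpNLess _ _ _) = False"
| "jumpfree (JumpRLess _ _ _) = False"
| "jumpfree _ = True"

abbreviation execs :: "instr list \<Rightarrow> config \<Rightarrow> config" where
  "execs is c \<equiv> fold exec is c"

lemma cn_jumpfree: "\<forall>i\<in>set (cn d e). jumpfree i"
  by (induction d e rule: cn.induct) auto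

lemma caddr_jumpfree: "\<forall>i\<in>set (caddr d k e). jumpfree i"
  using cn_jumpfree by (auto simp: caddr_def)

lemma cr_jumpfree: "\<forall>i\<in>set (cr z d r). jumpfree i"
  by (induction z d r rule: cr.induct) (use caddr_jumpfree in auto)

lemma execs_replicate_double:
  "let c' = execs (replicate k (NAdd a a a)) c in
    nmem c' = (nmem c)(a := 2 ^ k * nmem c a) \<and> rmem c' = rmem c \<and> tape c' = tape c"
  by (induction k arbitrary: c) (auto simp: set_nmem_def Let_def)

lemma caddr_step:
  assumes c1: "conc s c" "execs (cn d e) c = c1" "tmpeq d 32 c c1" "nmem c1 (96 + d) = i"
    and "k < 32" "d < 32"
  shows "tmpeq d 32 c (execs (caddr d k e) c)"
    "nmem (execs (caddr d k e) c) (96 + d) = bas s + 32 * i + k"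
proof -
  define c2 where "c2 = execs (replicate 5 (NAdd (96+d) (96+d) (96+d))) c1"
  have c2: "nmem c2 = (nmem c1)(96 + d := 32 * i)" "rmem c2 = rmem c1" "tape c2 = tape c1"
    using execs_replicate_double[of 5 "96+d" c1] c1(4) by (simp_all add: c2_def Let_def)
  have "nmem c1 (64 + k) = bas s + k"
    using conc_tmpeq[OF c1(1,3)] \<open>k < 32\<close> by (simp add: conc_def)
  moreover have c3: "execs (caddr d k e) c = exec (NAdd (96+d) (96+d) (64+k)) c2"
    by (simp add: caddr_def c2_def c1(2))
  ultimately have n: "nmem (execs (caddr d k e) c) = (nmem c1)(96 + d := bas s + 32 * i + k)"
    using \<open>k < 32\<close> c2(1) by (simp add: set_nmem_def add_ac)
  have r: "rmem (execs (caddr d k e) c) = rmem c1" "tape (execs (caddr d k e) c) = tape c1"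
    using c2 by (simp_all add: c3 set_nmem_def)
  show "tmpeq d 32 c (execs (caddr d k e) c)"
    using c1(3) n r \<open>d < 32\<close> by (simp add: tmpeq_def)
  show "nmem (execs (caddr d k e) c) (96 + d) = bas s + 32 * i + k" using n by simp
qed

lemma wfn_less: "wfn d e \<Longrightarrow> d < 32"
  by (induction e arbitrary: d) auto

lemma cn_correct:
  "conc s c \<Longrightarrow> wfn d e \<Longrightarrow>
    tmpeq d 32 c (execs (cn d e) c) \<and> nmem (execs (cn d e) c) (96 + d) = ev e s"
proof (induction e arbitrary: d c)
  case (Va x) then show ?case by (auto simp: set_nmem_def tmpeq_def conc_def)
next
  case (Co k) then show ?case by (auto simp: set_nmem_def tmpeq_def)
next
  case (Add a b)
  let ?c1 = "execs (cn d a) c"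
  let ?c2 = "execs (cn (Suc d) b) ?c1"
  have 1: "tmpeq d 32 c ?c1" "nmem ?c1 (96 + d) = ev a s" using Add by auto
  have 2: "tmpeq (Suc d) 32 ?c1 ?c2" "nmem ?c2 (97 + d) = ev b s"
    using Add.IH(2)[of ?c1 "Suc d"] Add.prems conc_tmpeq[OF _ 1(1)] by auto
  have 3: "nmem ?c2 (96 + d) = ev a s" using 1 2 by (auto simp: tmpeq_def)
  show ?case using 1 2 3 tmpeq_trans[OF 1(1) 2(1)] wfn_less Add.prems(2)
    by (auto simp: set_nmem_def tmpeq_def)
next
  case (Sub a b)
  let ?c1 = "execs (cn d a) c"
  let ?c2 = "execs (cn (Suc d) b) ?c1"
  have 1: "tmpeq d 32 c ?c1" "nmem ?c1 (96 + d) = ev a s" using Sub by auto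
  have 2: "tmpeq (Suc d) 32 ?c1 ?c2" "nmem ?c2 (97 + d) = ev b s"
    using Sub.IH(2)[of ?c1 "Suc d"] Sub.prems conc_tmpeq[OF _ 1(1)] by auto
  have 3: "nmem ?c2 (96 + d) = ev a s" using 1 2 by (auto simp: tmpeq_def)
  show ?case using 1 2 3 tmpeq_trans[OF 1(1) 2(1)] wfn_less Sub.prems(2)
    by (auto simp: set_nmem_def tmpeq_def)
next
  case (Ar k e)
  let ?c2 = "execs (caddr d k e) c"
  have d: "d < 32" "k < 32" using Ar.prems(2) wfn_less by auto
  have 1: "tmpeq d 32 c ?c2" "nmem ?c2 (96 + d) = bas s + 32 * ev e s + k"
    using caddr_step[OF Ar.prems(1) refl, of d e] Ar d by auto
  have "nmem ?c2 (bas s + 32 * ev e s + k) = ar s k (ev e s)"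
    using conc_tmpeq[OF Ar.prems(1) 1(1)] d by (simp add: conc_def)
  moreover have "execs (cn d (Ar k e)) c = exec (NLoad (96+d) (96+d)) ?c2"
    by (simp add: caddr_def)
  ultimately show ?case using 1 d by (simp add: set_nmem_def tmpeq_def)
qed

lemma caddr_correct:
  assumes "conc s c" "wfn d e" "k < 32"
  shows "tmpeq d 32 c (execs (caddr d k e) c) \<and>
    nmem (execs (caddr d k e) c) (96 + d) = bas s + 32 * ev e s + k"
proof -
  have c: "tmpeq d 32 c (execs (cn d e) c)" "nmem (execs (cn d e) c) (96 + d) = ev e s"
    using cn_correct[OF assms(1,2)] by auto
  show ?thesis
    using caddr_step[OF assms(1) refl c assms(3) wfn_less[OF assms(2)]] by (rule conjI)
qed

lemma cr_binop:
  assumes "conc s c" "wfr z d a" "wfr z (Suc d) b"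
    and "\<And>c d. conc s c \<Longrightarrow> wfr z d a \<Longrightarrow>
      tmpeq z d c (execs (cr z d a) c) \<and> rmem (execs (cr z d a) c) (32 + d) = rv a s"
    and "\<And>c d. conc s c \<Longrightarrow> wfr z d b \<Longrightarrow>
      tmpeq z d c (execs (cr z d b) c) \<and> rmem (execs (cr z d b) c) (32 + d) = rv b s"
  shows "\<exists>c2. execs (cr z (Suc d) b) (execs (cr z d a) c) = c2 \<and> tmpeq z d c c2 \<and>
    rmem c2 (32 + d) = rv a s \<and> rmem c2 (33 + d) = rv b s \<and> d < 32"
proof -
  let ?c1 = "execs (cr z d a) c"
  let ?c2 = "execs (cr z (Suc d) b) ?c1"
  have 1: "tmpeq z d c ?c1" "rmem ?c1 (32 + d) = rv a s" using assms by auto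
  have 2: "tmpeq z (Suc d) ?c1 ?c2" "rmem ?c2 (33 + d) = rv b s"
    using assms(5)[of ?c1 "Suc d"] assms conc_tmpeq[OF _ 1(1)] by auto
  have "rmem ?c2 (32 + d) = rv a s" using 1 2 by (auto simp: tmpeq_def)
  moreover have "d < 32" using assms(2) by (induction a arbitrary: d) auto
  ultimately show ?thesis using 1 2 tmpeq_trans[OF 1(1) 2(1)] by auto
qed

lemma cr_correct:
  "conc s c \<Longrightarrow> wfr z d e \<Longrightarrow>
    tmpeq z d c (execs (cr z d e) c) \<and> rmem (execs (cr z d e) c) (32 + d) = rv e s"
proof (induction e arbitrary: d c)
  case (RV x) then show ?case by (auto simp: set_rmem_def tmpeq_def conc_def)
next
  case (RC k) then show ?case by (auto simp: set_rmem_def tmpeq_def)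
next
  case (RPlus a b)
  from cr_binop[OF RPlus.prems(1) _ _ RPlus.IH] RPlus.prems(2) show ?case
    by (auto simp: set_rmem_def tmpeq_def)
next
  case (RMinus a b)
  from cr_binop[OF RMinus.prems(1) _ _ RMinus.IH] RMinus.prems(2) show ?case
    by (auto simp: set_rmem_def tmpeq_def)
next
  case (RTimes a b)
  from cr_binop[OF RTimes.prems(1) _ _ RTimes.IH] RTimes.prems(2) show ?case
    by (auto simp: set_rmem_def tmpeq_def)
next
  case (RDivide a b)
  from cr_binop[OF RDivide.prems(1) _ _ RDivide.IH] RDivide.prems(2) show ?case
    by (auto simp: set_rmem_def tmpeq_def)
next
  case (RAr k e)
  let ?c1 = "execs (caddr z k e) c"
  have 1: "tmpeq z 32 c ?c1" "nmem ?c1 (96 + z) = bas s + 32 * ev e s + k"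
    using caddr_correct[of s c z e k] RAr.prems by auto
  have "rmem ?c1 (bas s + 32 * ev e s + k) = rmem c (bas s + 32 * ev e s + k)"
    using 1(1) by (auto simp: tmpeq_def)
  then show ?case using RAr.prems 1 by (auto simp: set_rmem_def tmpeq_def conc_def)
qed

definition code_at :: "program \<Rightarrow> nat \<Rightarrow> instr list \<Rightarrow> bool" where
  "code_at Q p is \<longleftrightarrow> (\<exists>xs ys. Q = xs @ is @ ys \<and> length xs = p)"

lemma code_at_append [simp]: "code_at Q p (a @ b) \<longleftrightarrow> code_at Q p a \<and> code_at Q (p + length a) b"
proof
  assume "code_at Q p (a @ b)"
  then show "code_at Q p a \<and> code_at Q (p + length a) b"
    unfolding code_at_def by (metis append.assoc length_append)
next
  assume "code_at Q p a \<and> code_at Q (p + length a) b"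
  then obtain xs ys us vs where "Q = xs @ a @ ys" "length xs = p" "Q = us @ b @ vs"
    "length us = p + length a"
    unfolding code_at_def by blast
  moreover from this have "us = xs @ a" "ys = b @ vs"
    using append_eq_append_conv[of "xs @ a" us ys "b @ vs"] by auto
  ultimately show "code_at Q p (a @ b)" unfolding code_at_def by auto
qed

lemma code_at_Cons [simp]: "b \<noteq> [] \<Longrightarrow> code_at Q p (i # b) \<longleftrightarrow> code_at Q p [i] \<and> code_at Q (Suc p) b"
  using code_at_append[of Q p "[i]" b] by simp

lemma code_at_step:
  assumes "code_at Q p [i]" "pc c = p"
  shows "step Q c = exec i c"
proof -
  obtain xs ys where "Q = xs @ [i] @ ys" "length xs = p" using assms unfolding code_at_def by blast
  then have "Q ! pc c = i" "pc c < length Q"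
    using assms(2) nth_append_length[of xs i ys] by auto
  then show ?thesis by (simp add: step_def halted_def)
qed

lemma pc_execs:
  "\<forall>i\<in>set is. jumpfree i \<Longrightarrow> pc (execs is c) = pc c + length is"
proof (induction "is" arbitrary: c)
  case (Cons i "is")
  then show ?case by (cases i) (auto simp: set_nmem_def set_rmem_def)
qed simp

lemma steps_jumpfree:
  "code_at Q p is \<Longrightarrow> pc c = p \<Longrightarrow> \<forall>i\<in>set is. jumpfree i \<Longrightarrow>
    (step Q ^^ length is) c = execs is c"
proof (induction "is" arbitrary: c p)
  case (Cons i "is")
  have "code_at Q p [i] \<and> code_at Q (Suc p) is" using Cons.prems(1) code_at_append[of Q p "[i]" "is"] by simp
  moreover have "pc (exec i c) = Suc p"
    using pc_execs[of "[i]" c] Cons.prems by simp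
  ultimately show ?case
    using Cons.IH[of "Suc p" "exec i c"] Cons.prems code_at_step[of Q p i c]
    by (simp add: funpow_swap1 del: funpow.simps) (simp add: funpow_swap1)
qed simp

lemma run_add: "run Q x (t + k) = (step Q ^^ k) (run Q x t)"
  by (simp add: run_def add.commute[of t] funpow_add)

lemma tape_step: "length (tape c) \<le> length (tape (step Q c))"
proof -
  have "length (tape c) \<le> length (tape (exec i c))" for i
    by (cases i) (auto simp: set_nmem_def set_rmem_def)
  then show ?thesis by (simp add: step_def)
qed

lemma tape_step_le: "length (tape (step Q c)) \<le> Suc (length (tape c))"
proof -
  have "length (tape (exec i c)) \<le> Suc (length (tape c))" for i
    by (cases i) (auto simp: set_nmem_def set_rmem_def)
  then show ?thesis by (simp add: step_def)
qed

lemma tape_run_mono: "t \<le> t' \<Longrightarrow> length (tape (run Q x t)) \<le> length (tape (run Q x t'))"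
proof (induction t' rule: dec_induct)
  case (step k)
  then show ?case using tape_step[of "run Q x k" Q] run_add[of Q x k 1] by simp
qed simp

text \<open>The symbol with index \<open>i\<close> is on the tape at the logged step and missing one
  step earlier, so the logged clock value is its exact output time.\<close>

definition logok :: "program \<Rightarrow> nat list \<times> real list \<Rightarrow> hstate \<Rightarrow> bool" where
  "logok Q x s \<longleftrightarrow> (\<forall>i<length (lg s). 0 < fst (snd (lg s ! i)) \<and>
     i < length (tape (run Q x (fst (snd (lg s ! i))))) \<and>
     length (tape (run Q x (fst (snd (lg s ! i)) - 1))) \<le> i)"

definition sync :: "program \<Rightarrow> nat list \<times> real list \<Rightarrow> hstate \<Rightarrow> nat \<Rightarrow> bool" where
  "sync Q x s p \<longleftrightarrow> conc s (run Q x (clk s)) \<and> pc (run Q x (clk s)) = p \<and> logok Q x s"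

lemma sync_execs:
  assumes "sync Q x s p" "code_at Q p is" "\<forall>i\<in>set is. jumpfree i"
  shows "run Q x (clk s + length is) = execs is (run Q x (clk s))"
    "pc (run Q x (clk s + length is)) = p + length is"
proof -
  have "pc (run Q x (clk s)) = p" using assms(1) by (simp only: sync_def)
  then show "run Q x (clk s + length is) = execs is (run Q x (clk s))"
    using steps_jumpfree[OF assms(2) _ assms(3)] run_add by metis
  then show "pc (run Q x (clk s + length is)) = p + length is"
    using pc_execs[OF assms(3)] \<open>pc (run Q x (clk s)) = p\<close> by simp
qed

lemma sync_advance:
  assumes "sync Q x s p" "code_at Q p is" "\<forall>i\<in>set is. jumpfree i"
    and "conc s' (execs is (run Q x (clk s)))" "clk s' = clk s + length is" "lg s' = lg s"
  shows "sync Q x s' (p + length is)"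
proof -
  have "run Q x (clk s') = execs is (run Q x (clk s))" "pc (run Q x (clk s')) = p + length is"
    unfolding assms(5) by (rule sync_execs[OF assms(1-3)])+
  moreover have "logok Q x s'" using assms(1,6) unfolding sync_def logok_def by metis
  ultimately show ?thesis using assms(4) unfolding sync_def by metis
qed

text \<open>The position enters the code only through jump targets. Costs can therefore be measured
  at position 0.\<close>

lemma code_length: "length (code c p) = length (code c q)"
  proof (induction c arbitrary: p q)
    case (Seq c1 c2)
    show ?case using Seq(1)[of p q] Seq(2)[of "p + length (code c1 p)" "q + length (code c1 q)"]
      by simp
  next
    case (Ite e c1 c2)
    show ?case using Ite(1)[of "p + length (cn 0 e) + 2 + length (code c2 (p + length (cn 0 e) + 2)) + 1"
        "q + length (cn 0 e) + 2 + length (code c2 (q + length (cn 0 e) + 2)) + 1"]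
        Ite(2)[of "p + length (cn 0 e) + 2" "q + length (cn 0 e) + 2"] by (simp add: Let_def)
  next
    case (IfR a b c1 c2)
    let ?t = "cr 0 0 a @ cr 0 1 b"
    show ?case using IfR(1)[of "p + length ?t + 1 + length (code c2 (p + length ?t + 1)) + 1"
        "q + length ?t + 1 + length (code c2 (q + length ?t + 1)) + 1"]
        IfR(2)[of "p + length ?t + 1" "q + length ?t + 1"] by (simp add: Let_def)
  next
    case (Wh e c)
    show ?case using Wh[of "p + length (cn 0 e) + 3" "q + length (cn 0 e) + 3"]
      by (simp add: Let_def)
  qed auto

lemma conc_sc:
  "conc s c \<Longrightarrow> x < 64 \<Longrightarrow> nmem c' = (nmem c)(x := v) \<Longrightarrow> rmem c' = rmem c \<Longrightarrow> tape c' = tape c \<Longrightarrow>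
    conc (s\<lparr>sc := (sc s)(x := v)\<rparr>) c'"
  unfolding conc_def by auto

lemma conc_rs:
  "conc s c \<Longrightarrow> x < 32 \<Longrightarrow> nmem c' = nmem c \<Longrightarrow> rmem c' = (rmem c)(x := v) \<Longrightarrow> tape c' = tape c \<Longrightarrow>
    conc (s\<lparr>rs := (rs s)(x := v)\<rparr>) c'"
  unfolding conc_def by auto

text \<open>Index and array number are quotient and remainder modulo 32, so interleaved arrays do
  not overlap.\<close>

lemma addr_inj: "k < 32 \<Longrightarrow> k' < 32 \<Longrightarrow> 32 * i + k = 32 * i' + k' \<longleftrightarrow> i = i' \<and> k = (k' :: nat)"
  by (metis add.commute mod_less mod_mult_self2 add_right_cancel mult_left_cancel zero_neq_numeral)

lemma conc_ar:
  assumes "conc s c" "k < 32" "nmem c' = (nmem c)(bas s + 32 * i + k := v)" "rmem c' = rmem c"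
    "tape c' = tape c"
  shows "conc (s\<lparr>ar := (ar s)(k := (ar s k)(i := v))\<rparr>) c'"
proof -
  have "nmem c' (bas s + 32 * i' + k') = ((ar s)(k := (ar s k)(i := v))) k' i'" if "k' < 32" for i' k'
    using assms(1,3) that addr_inj[OF that assms(2), of i' i] by (auto simp: conc_def add.assoc)
  moreover have "nmem c' a = nmem c a" if "a < bas s" for a using assms(3) that by auto
  ultimately show ?thesis using assms(1,4,5) unfolding conc_def by auto
qed

lemma conc_ra:
  assumes "conc s c" "k < 32" "rmem c' = (rmem c)(bas s + 32 * i + k := v)" "nmem c' = nmem c"
    "tape c' = tape c"
  shows "conc (s\<lparr>ra := (ra s)(k := (ra s k)(i := v))\<rparr>) c'"
proof -
  have "rmem c' (bas s + 32 * i' + k') = ((ra s)(k := (ra s k)(i := v))) k' i'" if "k' < 32" for i' k'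
    using assms(1,3) that addr_inj[OF that assms(2), of i' i] by (auto simp: conc_def add.assoc)
  moreover have "rmem c' a = rmem c a" if "a < bas s" for a using assms(3) that by auto
  ultimately show ?thesis using assms(1,4,5) unfolding conc_def by auto
qed

lemma conc_tick [simp]: "conc (tick d s) = conc s"
  by (auto simp: conc_def fun_eq_iff)

lemma conc_clk [simp]: "conc (s\<lparr>clk := a\<rparr>) = conc s"
  by (auto simp: conc_def fun_eq_iff)

lemma sync_tick_clk: "sync Q x (tick d s) p \<longleftrightarrow> sync Q x (s\<lparr>clk := clk s + d\<rparr>) p"
  by (simp add: sync_def logok_def)

lemma sync_exec_jump:
  assumes "sync Q x s p" "code_at Q p [i]"
    and "exec i (run Q x (clk s)) = (run Q x (clk s))\<lparr>pc := p'\<rparr>"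
  shows "sync Q x (tick 1 s) p'"
proof -
  have "run Q x (Suc (clk s)) = (run Q x (clk s))\<lparr>pc := p'\<rparr>"
    using run_add[of Q x "clk s" 1] code_at_step[OF assms(2)] assms(1,3) by (simp add: sync_def)
  then show ?thesis using assms(1) by (simp add: sync_def logok_def conc_def)
qed

lemma sync_Jump: "sync Q x s p \<Longrightarrow> code_at Q p [Jump p'] \<Longrightarrow> sync Q x (tick 1 s) p'"
  by (rule sync_exec_jump) auto

lemma sync_test:
  assumes "sync Q x s p" "wfn 0 e" "code_at Q p (cn 0 e @ [NConst 97 0, JumpNLess 97 96 q])"
  shows "sync Q x (tick (length (cn 0 e) + 2) s)
    (if 0 < ev e s then q else p + length (cn 0 e) + 2)"
proof -
  let ?is = "cn 0 e @ [NConst 97 0]"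
  let ?s = "s\<lparr>clk := clk s + length ?is\<rparr>"
  let ?c = "execs ?is (run Q x (clk s))"
  have jf: "\<forall>i\<in>set ?is. jumpfree i" using cn_jumpfree by auto
  have at: "code_at Q p ?is" using assms(3) by simp
  have c: "conc s (run Q x (clk s))" using assms(1) by (simp add: sync_def)
  have t: "tmpeq 0 32 (run Q x (clk s)) ?c" and v: "nmem ?c 97 = 0" "nmem ?c 96 = ev e s"
    using cn_correct[OF c assms(2)] by (auto simp: tmpeq_def set_nmem_def)
  have "sync Q x ?s (p + length ?is)"
    by (rule sync_advance[OF assms(1) at jf]) (use conc_tmpeq[OF c t] in auto)
  moreover have "run Q x (clk ?s) = ?c" using sync_execs(1)[OF assms(1) at jf] by simp
  ultimately have "sync Q x (tick 1 ?s) (if 0 < ev e s then q else Suc (pc ?c))"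
    by (rule_tac sync_exec_jump[where i = "JumpNLess 97 96 q"]) (use assms(3) v in auto)
  then show ?thesis
    using pc_execs[OF jf, of "run Q x (clk s)"] assms(1)
    by (simp add: sync_tick_clk sync_def logok_def numeral_3_eq_3)
qed

lemma sync_testR:
  assumes "sync Q x s p" "wfr 0 0 a" "wfr 0 1 b"
    "code_at Q p ((cr 0 0 a @ cr 0 1 b) @ [JumpRLess 32 33 q])"
  shows "sync Q x (tick (length (cr 0 0 a @ cr 0 1 b) + 1) s)
    (if rv a s < rv b s then q else p + length (cr 0 0 a @ cr 0 1 b) + 1)"
proof -
  let ?is = "cr 0 0 a @ cr 0 1 b"
  let ?s = "s\<lparr>clk := clk s + length ?is\<rparr>"
  let ?c1 = "execs (cr 0 0 a) (run Q x (clk s))"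
  let ?c = "execs ?is (run Q x (clk s))"
  have jf: "\<forall>i\<in>set ?is. jumpfree i" using cr_jumpfree by auto
  have at: "code_at Q p ?is" using assms(4) by simp
  have c: "conc s (run Q x (clk s))" using assms(1) by (simp add: sync_def)
  have t1: "tmpeq 0 0 (run Q x (clk s)) ?c1" and v1: "rmem ?c1 32 = rv a s"
    using cr_correct[OF c assms(2)] by auto
  have c1: "conc s ?c1" using c t1 by (rule conc_tmpeq)
  have t2: "tmpeq 0 1 ?c1 ?c" and v2: "rmem ?c 33 = rv b s"
    using cr_correct[OF c1 assms(3)] by auto
  have v: "rmem ?c 32 = rv a s" using t2 v1 unfolding tmpeq_def by simp
  have "sync Q x ?s (p + length ?is)"
    by (rule sync_advance[OF assms(1) at jf]) (use conc_tmpeq[OF c1 t2] in auto)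
  moreover have "run Q x (clk ?s) = ?c" using sync_execs(1)[OF assms(1) at jf] by simp
  ultimately have "sync Q x (tick 1 ?s) (if rv a s < rv b s then q else Suc (pc ?c))"
    by (rule_tac sync_exec_jump[where i = "JumpRLess 32 33 q"]) (use assms(4) v v2 in \<open>auto simp: add.assoc\<close>)
  then show ?thesis
    using pc_execs[OF jf, of "run Q x (clk s)"] assms(1)
    by (simp add: sync_tick_clk sync_def logok_def numeral_3_eq_3)
qed

lemma sync_basic:
  assumes "sync Q x s p" "code_at Q p is" "\<forall>i\<in>set is. jumpfree i"
    and "conc s' (execs is (run Q x (clk s)))" "lg s' = lg s" "clk s' = clk s"
  shows "sync Q x (tick (length is) s') (p + length is)"
  by (rule sync_advance[OF assms(1-3)]) (simp_all add: assms(4-6))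

lemma code_at_ConsD: "code_at Q p (i # b) \<Longrightarrow> code_at Q p [i] \<and> code_at Q (Suc p) b"
  using code_at_append[of Q p "[i]" b] by simp

text \<open>Induction over the source execution, which unfolds a loop into its iterations; what
  remains for branches and loops is the arithmetic of jump targets.\<close>

lemma big_sync:
  "big c s s' \<Longrightarrow> wfc c \<Longrightarrow> code_at Q p (code c p) \<Longrightarrow> sync Q x s p \<Longrightarrow> sync Q x s' (p + cost c)"
proof (induction arbitrary: p rule: big.induct)
  case (Skip s) then show ?case by simp
next
  case (Asg y e s)
  have c: "conc s (run Q x (clk s))" using Asg by (simp add: sync_def)
  let ?c = "execs (cn 0 e) (run Q x (clk s))"
  have t: "tmpeq 0 32 (run Q x (clk s)) ?c" and v: "nmem ?c 96 = ev e s"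
    using cn_correct[OF c, of 0 e] Asg.prems(1) by auto
  have "conc (s\<lparr>sc := (sc s)(y := ev e s)\<rparr>) (execs (code (Asg y e) p) (run Q x (clk s)))"
    by (rule conc_sc[OF conc_tmpeq[OF c t]]) (use Asg.prems(1) v in \<open>auto simp: set_nmem_def\<close>)
  from sync_basic[OF Asg.prems(3,2) _ this] show ?case
    using code_length[of "Asg y e" p 0] by (simp add: ball_Un cn_jumpfree caddr_jumpfree cr_jumpfree)
next
  case (Sto k a b s)
  have c: "conc s (run Q x (clk s))" using Sto by (simp add: sync_def)
  let ?c1 = "execs (caddr 0 k a) (run Q x (clk s))"
  let ?c = "execs (cn 1 b) ?c1"
  have t1: "tmpeq 0 32 (run Q x (clk s)) ?c1" and v1: "nmem ?c1 96 = bas s + 32 * ev a s + k"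
    using caddr_correct[OF c, of 0 a k] Sto.prems(1) by auto
  have c1: "conc s ?c1" using c t1 by (rule conc_tmpeq)
  have t: "tmpeq 1 32 ?c1 ?c" and v: "nmem ?c 97 = ev b s"
    using cn_correct[OF c1, of 1 b] Sto.prems(1) by auto
  have v0: "nmem ?c 96 = bas s + 32 * ev a s + k" using t v1 unfolding tmpeq_def by simp
  have "conc (s\<lparr>ar := (ar s)(k := (ar s k)(ev a s := ev b s))\<rparr>)
      (execs (code (Sto k a b) p) (run Q x (clk s)))"
    by (rule conc_ar[OF conc_tmpeq[OF c1 t]])
      (use Sto.prems(1) v v0 in \<open>auto simp: set_nmem_def\<close>)
  from sync_basic[OF Sto.prems(3,2) _ this] show ?case
    using code_length[of "Sto k a b" p 0] by (simp add: ball_Un cn_jumpfree caddr_jumpfree cr_jumpfree)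
next
  case (RAsg y r s)
  have c: "conc s (run Q x (clk s))" using RAsg by (simp add: sync_def)
  let ?c = "execs (cr 0 0 r) (run Q x (clk s))"
  have t: "tmpeq 0 0 (run Q x (clk s)) ?c" and v: "rmem ?c 32 = rv r s"
    using cr_correct[OF c, of 0 0 r] RAsg.prems(1) by auto
  have "conc (s\<lparr>rs := (rs s)(y := rv r s)\<rparr>) (execs (code (RAsg y r) p) (run Q x (clk s)))"
    by (rule conc_rs[OF conc_tmpeq[OF c t]]) (use RAsg.prems(1) v in \<open>auto simp: set_rmem_def\<close>)
  from sync_basic[OF RAsg.prems(3,2) _ this] show ?case
    using code_length[of "RAsg y r" p 0] by (simp add: ball_Un cn_jumpfree caddr_jumpfree cr_jumpfree)
next
  case (RSto k a r s)
  have c: "conc s (run Q x (clk s))" using RSto by (simp add: sync_def)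
  let ?c1 = "execs (caddr 0 k a) (run Q x (clk s))"
  let ?c = "execs (cr 1 0 r) ?c1"
  have t1: "tmpeq 0 32 (run Q x (clk s)) ?c1" and v1: "nmem ?c1 96 = bas s + 32 * ev a s + k"
    using caddr_correct[OF c, of 0 a k] RSto.prems(1) by auto
  have c1: "conc s ?c1" using c t1 by (rule conc_tmpeq)
  have t: "tmpeq 1 0 ?c1 ?c" and v: "rmem ?c 32 = rv r s"
    using cr_correct[OF c1, of 1 0 r] RSto.prems(1) by auto
  have v0: "nmem ?c 96 = bas s + 32 * ev a s + k" using t v1 unfolding tmpeq_def by simp
  have "conc (s\<lparr>ra := (ra s)(k := (ra s k)(ev a s := rv r s))\<rparr>)
      (execs (code (RSto k a r) p) (run Q x (clk s)))"
    by (rule conc_ra[OF conc_tmpeq[OF c1 t]])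
      (use RSto.prems(1) v v0 in \<open>auto simp: set_rmem_def\<close>)
  from sync_basic[OF RSto.prems(3,2) _ this] show ?case
    using code_length[of "RSto k a r" p 0] by (simp add: ball_Un cn_jumpfree caddr_jumpfree cr_jumpfree)
next
  case (RawLd e s y)
  have c: "conc s (run Q x (clk s))" using RawLd by (simp add: sync_def)
  let ?c = "execs (cn 0 e) (run Q x (clk s))"
  have t: "tmpeq 0 32 (run Q x (clk s)) ?c" and v: "nmem ?c 96 = ev e s"
    using cn_correct[OF c, of 0 e] RawLd.prems(1) by auto
  have c': "conc s ?c" using c t by (rule conc_tmpeq)
  then have w: "nmem ?c (ev e s) = raw s (ev e s)" using RawLd by (auto simp: conc_def)
  have "conc (s\<lparr>sc := (sc s)(y := raw s (ev e s))\<rparr>)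
      (execs (code (RawLd y e) p) (run Q x (clk s)))"
    by (rule conc_sc[OF c']) (use RawLd.prems(1) v w in \<open>auto simp: set_nmem_def\<close>)
  from sync_basic[OF RawLd.prems(3,2) _ this] show ?case
    using code_length[of "RawLd y e" p 0] by (simp add: ball_Un cn_jumpfree caddr_jumpfree cr_jumpfree)
next
  case (RRawLd e s y)
  have c: "conc s (run Q x (clk s))" using RRawLd by (simp add: sync_def)
  let ?c = "execs (cn 0 e) (run Q x (clk s))"
  have t: "tmpeq 0 32 (run Q x (clk s)) ?c" and v: "nmem ?c 96 = ev e s"
    using cn_correct[OF c, of 0 e] RRawLd.prems(1) by auto
  have c': "conc s ?c" using c t by (rule conc_tmpeq)
  then have w: "rmem ?c (ev e s) = rraw s (ev e s)" using RRawLd by (auto simp: conc_def)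
  have "conc (s\<lparr>rs := (rs s)(y := rraw s (ev e s))\<rparr>)
      (execs (code (RRawLd y e) p) (run Q x (clk s)))"
    by (rule conc_rs[OF c']) (use RRawLd.prems(1) v w in \<open>auto simp: set_rmem_def\<close>)
  from sync_basic[OF RRawLd.prems(3,2) _ this] show ?case
    using code_length[of "RRawLd y e" p 0] by (simp add: ball_Un cn_jumpfree caddr_jumpfree cr_jumpfree)
next
  case (Out e s)
  have c: "conc s (run Q x (clk s))" using Out by (simp add: sync_def)
  let ?is = "cn 0 e @ [Output 96]"
  let ?c = "execs (cn 0 e) (run Q x (clk s))"
  have t: "tmpeq 0 32 (run Q x (clk s)) ?c" and v: "nmem ?c 96 = ev e s"
    using cn_correct[OF c, of 0 e] Out.prems(1) by auto
  have c': "conc s ?c" using c t by (rule conc_tmpeq)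
  have at: "code_at Q p ?is" "code_at Q p (cn 0 e)" using Out.prems(2) by auto
  have jf: "\<forall>i\<in>set ?is. jumpfree i" "\<forall>i\<in>set (cn 0 e). jumpfree i"
    using cn_jumpfree by auto
  have r1: "run Q x (clk s + length (cn 0 e)) = ?c"
    using sync_execs(1)[OF Out.prems(3) at(2) jf(2)] .
  have r2: "run Q x (Suc (clk s + length (cn 0 e))) = exec (Output 96) ?c"
    using sync_execs(1)[OF Out.prems(3) at(1) jf(1)] by simp
  have p: "pc (run Q x (Suc (clk s + length (cn 0 e)))) = Suc (p + length (cn 0 e))"
    using sync_execs(2)[OF Out.prems(3) at(1) jf(1)] by simp
  have "logok Q x s" using Out.prems(3) by (simp add: sync_def)
  then show ?case
    using c' r1 r2 v p
    by (auto simp: sync_def logok_def conc_def nth_append less_Suc_eq)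
next
  case (Seq c1 s s1 c2 s2)
  have a: "code_at Q p (code c1 p)" "code_at Q (p + cost c1) (code c2 (p + cost c1))"
    using Seq.prems(2) code_length[of c1 p 0] by auto
  have "sync Q x s1 (p + cost c1)" using Seq.IH(1)[OF _ a(1)] Seq.prems by simp
  then have "sync Q x s2 (p + cost c1 + cost c2)" using Seq.IH(2)[OF _ a(2)] Seq.prems by simp
  then show ?case using code_length[of c2 "cost c1" 0] by (simp add: add.assoc)
next
  case (IfT e s c1 s' c2)
  let ?q = "p + length (cn 0 e) + 2"
  let ?q1 = "?q + cost c2 + 1"
  have l: "length (code c2 ?q) = cost c2" "length (code c1 ?q1) = cost c1" by (rule code_length)+
  have a: "code_at Q p (cn 0 e @ [NConst 97 0, JumpNLess 97 96 ?q1])" "code_at Q ?q1 (code c1 ?q1)"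
    using IfT.prems(2) l code_at_ConsD[of Q "?q + cost c2" "Jump (?q1 + cost c1)" "code c1 ?q1"]
    by (auto simp: Let_def)
  have "sync Q x (tick (length (cn 0 e) + 2) s) ?q1"
    using sync_test[OF IfT.prems(3) _ a(1)] IfT.prems(1) IfT.hyps(1) by simp
  then have "sync Q x s' (?q1 + cost c1)" using IfT.IH[OF _ a(2)] IfT.prems(1) by simp
  moreover have "p + cost (Ite e c1 c2) = ?q1 + cost c1"
    using code_length[of c2 "length (cn 0 e) + 2" 0]
      code_length[of c1 "length (cn 0 e) + 2 + cost c2 + 1" 0] by (simp add: Let_def)
  ultimately show ?case by (simp only:)
next
  case (IfF e s c2 s' c1)
  let ?q = "p + length (cn 0 e) + 2"
  let ?q1 = "?q + cost c2 + 1"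
  have l: "length (code c2 ?q) = cost c2" "length (code c1 ?q1) = cost c1" by (rule code_length)+
  have a: "code_at Q p (cn 0 e @ [NConst 97 0, JumpNLess 97 96 ?q1])" "code_at Q ?q (code c2 ?q)"
    "code_at Q (?q + cost c2) [Jump (?q1 + cost c1)]"
    using IfF.prems(2) l code_at_ConsD[of Q "?q + cost c2" "Jump (?q1 + cost c1)" "code c1 ?q1"]
    by (auto simp: Let_def)
  have "sync Q x (tick (length (cn 0 e) + 2) s) ?q"
    using sync_test[OF IfF.prems(3) _ a(1)] IfF.prems(1) IfF.hyps(1) by simp
  then have "sync Q x s' (?q + cost c2)" using IfF.IH[OF _ a(2)] IfF.prems(1) by simp
  then have "sync Q x (tick 1 s') (?q1 + cost c1)" using a(3) by (rule sync_Jump)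
  moreover have "p + cost (Ite e c1 c2) = ?q1 + cost c1"
    using code_length[of c2 "length (cn 0 e) + 2" 0]
      code_length[of c1 "length (cn 0 e) + 2 + cost c2 + 1" 0] by (simp add: Let_def)
  ultimately show ?case by (simp only:)
next
  case (IfRT a s b c1 s' c2)
  let ?t = "cr 0 0 a @ cr 0 1 b"
  let ?q = "p + length ?t + 1"
  let ?q1 = "?q + cost c2 + 1"
  have l: "length (code c2 ?q) = cost c2" "length (code c1 ?q1) = cost c1" by (rule code_length)+
  have a: "code_at Q p (?t @ [JumpRLess 32 33 ?q1])" "code_at Q ?q1 (code c1 ?q1)"
    using IfRT.prems(2) l code_at_ConsD[of Q "?q + cost c2" "Jump (?q1 + cost c1)" "code c1 ?q1"]
    by (auto simp: Let_def add.assoc)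
  have "sync Q x (tick (length ?t + 1) s) ?q1"
    using sync_testR[OF IfRT.prems(3) _ _ a(1)] IfRT.prems(1) IfRT.hyps(1) by simp
  then have "sync Q x s' (?q1 + cost c1)" using IfRT.IH[OF _ a(2)] IfRT.prems(1) by simp
  moreover have "p + cost (IfR a b c1 c2) = ?q1 + cost c1"
    using code_length[of c2 "length ?t + 1" 0]
      code_length[of c1 "length ?t + 1 + cost c2 + 1" 0] by (simp add: Let_def)
  ultimately show ?case by (simp only:)
next
  case (IfRF a s b c2 s' c1)
  let ?t = "cr 0 0 a @ cr 0 1 b"
  let ?q = "p + length ?t + 1"
  let ?q1 = "?q + cost c2 + 1"
  have l: "length (code c2 ?q) = cost c2" "length (code c1 ?q1) = cost c1" by (rule code_length)+
  have a: "code_at Q p (?t @ [JumpRLess 32 33 ?q1])" "code_at Q ?q (code c2 ?q)"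
    "code_at Q (?q + cost c2) [Jump (?q1 + cost c1)]"
    using IfRF.prems(2) l code_at_ConsD[of Q "?q + cost c2" "Jump (?q1 + cost c1)" "code c1 ?q1"]
    by (auto simp: Let_def add.assoc)
  have "sync Q x (tick (length ?t + 1) s) ?q"
    using sync_testR[OF IfRF.prems(3) _ _ a(1)] IfRF.prems(1) IfRF.hyps(1) by simp
  then have "sync Q x s' (?q + cost c2)" using IfRF.IH[OF _ a(2)] IfRF.prems(1) by simp
  then have "sync Q x (tick 1 s') (?q1 + cost c1)" using a(3) by (rule sync_Jump)
  moreover have "p + cost (IfR a b c1 c2) = ?q1 + cost c1"
    using code_length[of c2 "length ?t + 1" 0]
      code_length[of c1 "length ?t + 1 + cost c2 + 1" 0] by (simp add: Let_def)
  ultimately show ?case by (simp only:)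
next
  case (WhileF e s c)
  let ?q = "p + length (cn 0 e) + 3"
  have l: "length (code c ?q) = cost c" by (rule code_length)
  have a: "code_at Q p (cn 0 e @ [NConst 97 0, JumpNLess 97 96 ?q])"
    "code_at Q (p + length (cn 0 e) + 2) [Jump (?q + cost c + 1)]"
    using WhileF.prems(2) l by (auto simp: Let_def)
  have "sync Q x (tick (length (cn 0 e) + 2) s) (p + length (cn 0 e) + 2)"
    using sync_test[OF WhileF.prems(3) _ a(1)] WhileF.prems(1) WhileF.hyps(1) by simp
  then have "sync Q x (tick 1 (tick (length (cn 0 e) + 2) s)) (?q + cost c + 1)"
    using a(2) by (rule sync_Jump)
  then have "sync Q x (tick (length (cn 0 e) + 3) s) (?q + cost c + 1)"
    by (simp add: sync_tick_clk sync_def logok_def numeral_3_eq_3)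
  moreover have "p + cost (Wh e c) = ?q + cost c + 1"
    using code_length[of c "length (cn 0 e) + 3" 0] by (simp add: Let_def)
  ultimately show ?case by (simp only:)
next
  case (WhileT e s c s1 s2)
  let ?q = "p + length (cn 0 e) + 3"
  have l: "length (code c ?q) = cost c" by (rule code_length)
  have a: "code_at Q p (cn 0 e @ [NConst 97 0, JumpNLess 97 96 ?q])"
    "code_at Q ?q (code c ?q)" "code_at Q (?q + cost c) [Jump p]"
    using WhileT.prems(2) l by (auto simp: Let_def numeral_3_eq_3)
  have "sync Q x (tick (length (cn 0 e) + 2) s) ?q"
    using sync_test[OF WhileT.prems(3) _ a(1)] WhileT.prems(1) WhileT.hyps(1) by simp
  then have "sync Q x s1 (?q + cost c)" using WhileT.IH(1)[OF _ a(2)] WhileT.prems(1) by simp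
  then have "sync Q x (tick 1 s1) p" using a(3) by (rule sync_Jump)
  then show ?case using WhileT.IH(2)[OF WhileT.prems(1,2)] by blast
qed

subsection \<open>Ticks against machine steps\<close>

text \<open>\<open>u\<close> bounds the machine steps for which a single tick can stand; it depends
  on the program text only.\<close>

fun bnd :: "nat \<Rightarrow> cmd \<Rightarrow> bool" where
  "bnd u (c1 ;; c2) \<longleftrightarrow> bnd u c1 \<and> bnd u c2"
| "bnd u (Ite e c1 c2) \<longleftrightarrow> length (cn 0 e) + 2 \<le> u \<and> bnd u c1 \<and> bnd u c2"
| "bnd u (IfR a b c1 c2) \<longleftrightarrow> length (cr 0 0 a @ cr 0 1 b) + 1 \<le> u \<and> bnd u c1 \<and> bnd u c2"
| "bnd u (Wh e c) \<longleftrightarrow> length (cn 0 e) + 3 \<le> u \<and> bnd u c"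
| "bnd u c \<longleftrightarrow> cost c \<le> u"

lemma bnd_mono: "bnd u c \<Longrightarrow> u \<le> u' \<Longrightarrow> bnd u' c"
  by (induction c) auto

lemma bnd_exists: "\<exists>u. bnd u c"
proof (induction c)
  case (Seq c1 c2)
  then obtain u v where "bnd u c1" "bnd v c2" by auto
  then have "bnd (max u v) (c1 ;; c2)" using bnd_mono by auto
  then show ?case by blast
next
  case (Ite e c1 c2)
  then obtain u v where "bnd u c1" "bnd v c2" by auto
  then have "bnd (max (length (cn 0 e) + 2) (max u v)) (Ite e c1 c2)"
    using bnd_mono by (auto simp: le_max_iff_disj)
  then show ?case by blast
next
  case (IfR a b c1 c2)
  then obtain u v where "bnd u c1" "bnd v c2" by auto
  then have "bnd (max (length (cr 0 0 a @ cr 0 1 b) + 1) (max u v)) (IfR a b c1 c2)"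
    using bnd_mono by (auto simp: le_max_iff_disj)
  then show ?case by blast
next
  case (Wh e c)
  then obtain u where "bnd u c" by auto
  then have "bnd (max (length (cn 0 e) + 3) u) (Wh e c)"
    using bnd_mono by (auto simp: le_max_iff_disj)
  then show ?case by blast
qed (auto intro: exI[of _ "cost c" for c])

text \<open>The pairs consist of machine steps and ticks: ticks do not decrease, and steps grow at
  most \<open>u\<close> times as fast.\<close>

definition pace :: "nat \<Rightarrow> nat \<times> nat \<Rightarrow> nat \<times> nat \<Rightarrow> bool" where
  "pace u a b \<longleftrightarrow> snd a \<le> snd b \<and> fst b \<le> fst a + u * (snd b - snd a)"

text \<open>\<open>sorted_wrt\<close> relates all pairs of positions, including the start and the
  current time. The machine time between any two outputs is thus controlled by the ticks between
  them.\<close>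

definition paced :: "nat \<Rightarrow> hstate \<Rightarrow> bool" where
  "paced u s \<longleftrightarrow> 0 < u \<and> sorted_wrt (pace u) ((0, 0) # map snd (lg s) @ [(clk s, tk s)])"

lemma paced_upd [simp]:
  "paced u (s\<lparr>sc := f\<rparr>) = paced u s" "paced u (s\<lparr>ar := g\<rparr>) = paced u s"
  "paced u (s\<lparr>rs := h\<rparr>) = paced u s" "paced u (s\<lparr>ra := k\<rparr>) = paced u s"
  by (simp_all add: paced_def)

lemma pace_Suc: "pace u a (c, t) \<Longrightarrow> d \<le> u \<Longrightarrow> pace u a (c + d, Suc t)"
  by (simp add: pace_def Suc_diff_le)

lemma pace_refl: "pace u a a"
  by (simp add: pace_def)

lemma paced_tick: "paced u s \<Longrightarrow> d \<le> u \<Longrightarrow> paced u (tick d s)"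
  by (auto simp: paced_def sorted_wrt_append intro: pace_Suc)

lemma paced_out:
  "paced u s \<Longrightarrow> d \<le> u \<Longrightarrow> paced u (tick d (s\<lparr>lg := lg s @ [(v, clk s + d, Suc (tk s))]\<rparr>))"
  by (auto simp: paced_def sorted_wrt_append intro: pace_Suc pace_refl)

lemma big_paced: "big c s s' \<Longrightarrow> bnd u c \<Longrightarrow> paced u s \<Longrightarrow> paced u s'"
proof (induction rule: big.induct)
  case (Out e s) then show ?case using paced_out[of u s "cost (Out e)"] by simp
next
  case (IfF e s c2 s' c1)
  then have "paced u s'" by (simp add: paced_tick)
  moreover from this have "0 < u" by (simp add: paced_def)
  ultimately show ?case using paced_tick by simp
next
  case (IfRF a s b c2 s' c1)
  then have "paced u s'" by (simp add: paced_tick)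
  moreover from this have "0 < u" by (simp add: paced_def)
  ultimately show ?case using paced_tick by simp
next
  case (WhileT e s c s1 s2)
  then have "paced u s1" by (simp add: paced_tick)
  moreover from this have "0 < u" by (simp add: paced_def)
  ultimately show ?case using paced_tick WhileT by simp
qed (auto intro!: paced_tick)

subsection \<open>Total correctness\<close>

declare code.simps [simp del]

definition wp :: "cmd \<Rightarrow> (hstate \<Rightarrow> bool) \<Rightarrow> hstate \<Rightarrow> bool" where
  "wp c q s \<longleftrightarrow> (\<exists>s'. big c s s' \<and> q s')"

inductive_cases bigE:
  "big Skip s s'" "big (Asg x e) s s'" "big (Sto k a b) s s'" "big (RAsg x r) s s'"
  "big (RSto k a r) s s'" "big (RawLd x e) s s'" "big (RRawLd x e) s s'" "big (Out e) s s'"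
  "big (c1 ;; c2) s s'" "big (Ite e c1 c2) s s'" "big (IfR f g c1 c2) s s'"

lemma big_iffs:
  "big Skip s s' \<longleftrightarrow> s' = s"
  "big (Asg x e) s s' \<longleftrightarrow> s' = tick (cost (Asg x e)) (s\<lparr>sc := (sc s)(x := ev e s)\<rparr>)"
  "big (Sto k a b) s s' \<longleftrightarrow>
    s' = tick (cost (Sto k a b)) (s\<lparr>ar := (ar s)(k := (ar s k)(ev a s := ev b s))\<rparr>)"
  "big (RAsg x r) s s' \<longleftrightarrow> s' = tick (cost (RAsg x r)) (s\<lparr>rs := (rs s)(x := rv r s)\<rparr>)"
  "big (RSto k a r) s s' \<longleftrightarrow>
    s' = tick (cost (RSto k a r)) (s\<lparr>ra := (ra s)(k := (ra s k)(ev a s := rv r s))\<rparr>)"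
  "big (RawLd x e) s s' \<longleftrightarrow> 128 \<le> ev e s \<and> ev e s < bas s \<and>
    s' = tick (cost (RawLd x e)) (s\<lparr>sc := (sc s)(x := raw s (ev e s))\<rparr>)"
  "big (RRawLd x e) s s' \<longleftrightarrow> 64 \<le> ev e s \<and> ev e s < bas s \<and>
    s' = tick (cost (RRawLd x e)) (s\<lparr>rs := (rs s)(x := rraw s (ev e s))\<rparr>)"
  "big (Out e) s s' \<longleftrightarrow> s' = tick (cost (Out e))
    (s\<lparr>lg := lg s @ [(ev e s, clk s + cost (Out e), Suc (tk s))]\<rparr>)"
  "big (c1 ;; c2) s s' \<longleftrightarrow> (\<exists>s1. big c1 s s1 \<and> big c2 s1 s')"
  by (blast elim: bigE intro: big.intros)+

lemma wp_Ite: "wp (Ite e c1 c2) q s = (if 0 < ev e s then wp c1 q (tick (length (cn 0 e) + 2) s)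
     else wp c2 (\<lambda>s. q (tick 1 s)) (tick (length (cn 0 e) + 2) s))"
proof (cases "0 < ev e s")
  case True
  then have "big (Ite e c1 c2) s s' \<longleftrightarrow> big c1 (tick (length (cn 0 e) + 2) s) s'" for s'
    by (auto elim!: bigE(10) intro: big.IfT)
  then show ?thesis using True by (simp add: wp_def)
next
  case False
  then have "big (Ite e c1 c2) s s' \<longleftrightarrow> (\<exists>t. big c2 (tick (length (cn 0 e) + 2) s) t \<and> s' = tick 1 t)" for s'
    by (auto elim!: bigE(10) intro: big.IfF[simplified])
  then show ?thesis using False unfolding wp_def by auto
qed

lemma wp_IfR: "wp (IfR f g c1 c2) q s = (if rv f s < rv g s
     then wp c1 q (tick (length (cr 0 0 f @ cr 0 1 g) + 1) s)
     else wp c2 (\<lambda>s. q (tick 1 s)) (tick (length (cr 0 0 f @ cr 0 1 g) + 1) s))"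
proof (cases "rv f s < rv g s")
  case True
  then have "big (IfR f g c1 c2) s s' \<longleftrightarrow> big c1 (tick (length (cr 0 0 f @ cr 0 1 g) + 1) s) s'" for s'
    by (auto elim!: bigE(11) intro: big.IfRT[simplified])
  then show ?thesis using True by (simp add: wp_def)
next
  case False
  then have "big (IfR f g c1 c2) s s' \<longleftrightarrow>
      (\<exists>t. big c2 (tick (length (cr 0 0 f @ cr 0 1 g) + 1) s) t \<and> s' = tick 1 t)" for s'
    by (auto elim!: bigE(11) intro: big.IfRF[simplified])
  then show ?thesis using False unfolding wp_def by auto
qed

lemma wp_simps [simp]:
  "wp Skip q = q"
  "wp (Asg x e) q = (\<lambda>s. q (tick (cost (Asg x e)) (s\<lparr>sc := (sc s)(x := ev e s)\<rparr>)))"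
  "wp (Sto k a b) q = (\<lambda>s.
    q (tick (cost (Sto k a b)) (s\<lparr>ar := (ar s)(k := (ar s k)(ev a s := ev b s))\<rparr>)))"
  "wp (RAsg x r) q = (\<lambda>s. q (tick (cost (RAsg x r)) (s\<lparr>rs := (rs s)(x := rv r s)\<rparr>)))"
  "wp (RSto k a r) q = (\<lambda>s.
    q (tick (cost (RSto k a r)) (s\<lparr>ra := (ra s)(k := (ra s k)(ev a s := rv r s))\<rparr>)))"
  "wp (RawLd x e) q = (\<lambda>s. 128 \<le> ev e s \<and> ev e s < bas s \<and>
    q (tick (cost (RawLd x e)) (s\<lparr>sc := (sc s)(x := raw s (ev e s))\<rparr>)))"
  "wp (RRawLd x e) q = (\<lambda>s. 64 \<le> ev e s \<and> ev e s < bas s \<and>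
    q (tick (cost (RRawLd x e)) (s\<lparr>rs := (rs s)(x := rraw s (ev e s))\<rparr>)))"
  "wp (Out e) q = (\<lambda>s. q (tick (cost (Out e))
    (s\<lparr>lg := lg s @ [(ev e s, clk s + cost (Out e), Suc (tk s))]\<rparr>)))"
  "wp (c1 ;; c2) q = wp c1 (wp c2 q)"
  "wp (Ite e c1 c2) q = (\<lambda>s. if 0 < ev e s then wp c1 q (tick (length (cn 0 e) + 2) s)
     else wp c2 (\<lambda>s. q (tick 1 s)) (tick (length (cn 0 e) + 2) s))"
  "wp (IfR f g c1 c2) q = (\<lambda>s. if rv f s < rv g s
     then wp c1 q (tick (length (cr 0 0 f @ cr 0 1 g) + 1) s)
     else wp c2 (\<lambda>s. q (tick 1 s)) (tick (length (cr 0 0 f @ cr 0 1 g) + 1) s))"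
  by (auto simp: wp_def big_iffs fun_eq_iff wp_Ite[unfolded wp_def] wp_IfR[unfolded wp_def])

lemma wp_mono: "wp c q s \<Longrightarrow> (\<And>s'. q s' \<Longrightarrow> q' s') \<Longrightarrow> wp c q' s"
  by (auto simp: wp_def)

lemma wp_Wh:
  fixes \<mu> :: "hstate \<Rightarrow> nat"
  assumes "I s"
    and "\<And>s. I s \<Longrightarrow> ev e s = 0 \<Longrightarrow> q (tick (length (cn 0 e) + 3) s)"
    and "\<And>s. I s \<Longrightarrow> 0 < ev e s \<Longrightarrow>
      wp c (\<lambda>s'. I (tick 1 s') \<and> \<mu> (tick 1 s') < \<mu> s) (tick (length (cn 0 e) + 2) s)"
  shows "wp (Wh e c) q s"
  using assms(1)
proof (induction "\<mu> s" arbitrary: s rule: less_induct)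
  case less
  show ?case
  proof (cases "ev e s = 0")
    case True
    then show ?thesis using assms(2)[OF less.prems] big.WhileF unfolding wp_def by blast
  next
    case False
    then obtain s1 where s1: "big c (tick (length (cn 0 e) + 2) s) s1" "I (tick 1 s1)"
      "\<mu> (tick 1 s1) < \<mu> s"
      using assms(3)[OF less.prems] unfolding wp_def by blast
    then show ?thesis using less.hyps[OF s1(3,2)] False big.WhileT unfolding wp_def by blast
  qed
qed

fun wsc :: "cmd \<Rightarrow> nat set" where
  "wsc (Asg x e) = {x}"
| "wsc (RawLd x e) = {x}"
| "wsc (c1 ;; c2) = wsc c1 \<union> wsc c2"
| "wsc (Ite e c1 c2) = wsc c1 \<union> wsc c2"
| "wsc (IfR a b c1 c2) = wsc c1 \<union> wsc c2"
| "wsc (Wh e c) = wsc c"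
| "wsc _ = {}"

fun war :: "cmd \<Rightarrow> nat set" where
  "war (Sto k a b) = {k}"
| "war (c1 ;; c2) = war c1 \<union> war c2"
| "war (Ite e c1 c2) = war c1 \<union> war c2"
| "war (IfR a b c1 c2) = war c1 \<union> war c2"
| "war (Wh e c) = war c"
| "war _ = {}"

fun wrs :: "cmd \<Rightarrow> nat set" where
  "wrs (RAsg x e) = {x}"
| "wrs (RRawLd x e) = {x}"
| "wrs (c1 ;; c2) = wrs c1 \<union> wrs c2"
| "wrs (Ite e c1 c2) = wrs c1 \<union> wrs c2"
| "wrs (IfR a b c1 c2) = wrs c1 \<union> wrs c2"
| "wrs (Wh e c) = wrs c"
| "wrs _ = {}"

fun wra :: "cmd \<Rightarrow> nat set" where
  "wra (RSto k a b) = {k}"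
| "wra (c1 ;; c2) = wra c1 \<union> wra c2"
| "wra (Ite e c1 c2) = wra c1 \<union> wra c2"
| "wra (IfR a b c1 c2) = wra c1 \<union> wra c2"
| "wra (Wh e c) = wra c"
| "wra _ = {}"

fun silent :: "cmd \<Rightarrow> bool" where
  "silent (Out e) = False"
| "silent (c1 ;; c2) \<longleftrightarrow> silent c1 \<and> silent c2"
| "silent (Ite e c1 c2) \<longleftrightarrow> silent c1 \<and> silent c2"
| "silent (IfR a b c1 c2) \<longleftrightarrow> silent c1 \<and> silent c2"
| "silent (Wh e c) = silent c"
| "silent _ = True"

text \<open>A frame read off from the syntactic write sets. It spares the specification of each
  command the list of everything that it leaves unchanged.\<close>

definition frm :: "cmd \<Rightarrow> hstate \<Rightarrow> hstate \<Rightarrow> bool" where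
  "frm c s s' \<longleftrightarrow> (\<forall>x. x \<notin> wsc c \<longrightarrow> sc s' x = sc s x) \<and> (\<forall>k. k \<notin> war c \<longrightarrow> ar s' k = ar s k) \<and>
    (\<forall>x. x \<notin> wrs c \<longrightarrow> rs s' x = rs s x) \<and> (\<forall>k. k \<notin> wra c \<longrightarrow> ra s' k = ra s k) \<and>
    raw s' = raw s \<and> rraw s' = rraw s \<and> bas s' = bas s \<and> (silent c \<longrightarrow> lg s' = lg s)"

lemma big_frm: "big c s s' \<Longrightarrow> frm c s s'"
  by (induction rule: big.induct) (auto simp: frm_def)

lemma wp_conseq:
  assumes "wp c q s" "\<And>s'. q s' \<Longrightarrow> frm c s s' \<Longrightarrow> q' s'"
  shows "wp c q' s"
  using assms big_frm unfolding wp_def by blast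

definition For :: "nat \<Rightarrow> nexp \<Rightarrow> cmd \<Rightarrow> cmd" where
  "For x e c = Asg x (Co 0) ;; Wh (Lt (Va x) e) (c ;; Asg x (Add (Va x) (Co 1)))"

lemma For_sets [simp]:
  "wsc (For x e c) = insert x (wsc c)" "war (For x e c) = war c" "wrs (For x e c) = wrs c"
  "wra (For x e c) = wra c" "silent (For x e c) = silent c"
  by (auto simp: For_def)

lemma wfc_For [simp]: "wfc (For x e c) \<longleftrightarrow> x < 64 \<and> wfn 2 (Sub e (Va x)) \<and> wfc c"
  by (auto simp: For_def Lt_def numeral_2_eq_2)

text \<open>Per iteration the test, the increment and the jump back add 3 ticks to \<open>B\<close>;
  the initial assignment and the last test give the final 2. The bound expression is evaluated anew
  in each iteration, hence the hypothesis that its value stays \<open>N\<close>.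
  \<open>stable\<close> says that \<open>J\<close> looks neither at the counter nor at the
  clocks.\<close>

lemma wp_For:
  assumes J0: "J 0 s"
    and bound: "\<And>i t. i \<le> N \<Longrightarrow> J i t \<Longrightarrow> frm (For x e c) s t \<Longrightarrow> ev e t = N"
    and x: "x \<notin> wsc c"
    and body: "\<And>i t. i < N \<Longrightarrow> J i t \<Longrightarrow> sc t x = i \<Longrightarrow> frm (For x e c) s t \<Longrightarrow>
      wp c (\<lambda>t'. tk t' \<le> tk t + B \<and> J (Suc i) t') t"
    and stable: "\<And>i t v a b. J i t \<Longrightarrow> J i (t\<lparr>sc := (sc t)(x := v), clk := a, tk := b\<rparr>)"
  shows "wp (For x e c) (\<lambda>t. J N t \<and> sc t x = N \<and> frm (For x e c) s t \<and>
    tk t \<le> tk s + N * (B + 3) + 2) s"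
proof -
  let ?I = "\<lambda>t. \<exists>i\<le>N. J i t \<and> sc t x = i \<and> frm (For x e c) s t \<and> tk t \<le> tk s + i * (B + 3) + 1"
  have tick: "tick d t = t\<lparr>sc := (sc t)(x := sc t x), clk := clk t + d, tk := Suc (tk t)\<rparr>" for d t
    by (simp add: tick_def)
  have Jt: "J i (tick d t)" if "J i t" for i d t
    unfolding tick by (rule stable[OF that])
  have Jx: "J i (tick d (t\<lparr>sc := (sc t)(x := v)\<rparr>))" if "J i t" for i d t v
    using stable[OF that, where v = v and a = "clk t + d" and b = "Suc (tk t)"] by (simp add: tick_def)
  have ft: "frm (For x e c) s (tick d t)" if "frm (For x e c) s t" for d t
    using that by (simp add: frm_def)
  have "wp (Wh (Lt (Va x) e) (c ;; Asg x (Add (Va x) (Co 1))))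
     (\<lambda>t. J N t \<and> sc t x = N \<and> frm (For x e c) s t \<and> tk t \<le> tk s + N * (B + 3) + 2)
     (tick (cost (Asg x (Co 0))) (s\<lparr>sc := (sc s)(x := 0)\<rparr>))"
  proof (rule wp_Wh[where I = ?I and \<mu> = "\<lambda>t. N - sc t x"], goal_cases)
    case 1
    show ?case by (rule exI[of _ 0]) (use Jx[OF J0] in \<open>auto simp: frm_def\<close>)
  next
    case (2 t)
    then obtain i where i: "i \<le> N" "J i t" "sc t x = i" "frm (For x e c) s t"
      "tk t \<le> tk s + i * (B + 3) + 1" by auto
    moreover from bound[OF i(1,2,4)] this have "i = N" using 2(2) by simp
    ultimately show ?case using Jt ft by (auto)
  next
    case (3 t)
    then obtain i where i: "i \<le> N" "J i t" "sc t x = i" "frm (For x e c) s t"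
      "tk t \<le> tk s + i * (B + 3) + 1" by auto
    have iN: "i < N" using bound[OF i(1,2,4)] 3(2) i(3) by simp
    let ?t = "tick (length (cn 0 (Lt (Va x) e)) + 2) t"
    have "wp c (\<lambda>t'. tk t' \<le> tk ?t + B \<and> J (Suc i) t') ?t"
      using body[OF iN Jt[OF i(2)] _ ft[OF i(4)]] i(3) by simp
    then have "wp c (\<lambda>s'. ?I (tick 1 (tick (cost (Asg x (Add (Va x) (Co 1))))
         (s'\<lparr>sc := (sc s')(x := sc s' x + 1)\<rparr>))) \<and> N - (sc s' x + 1) < N - sc t x) ?t"
    proof (rule wp_conseq)
      fix s' assume a: "tk s' \<le> tk ?t + B \<and> J (Suc i) s'" "frm c ?t s'"
      have "sc s' x = i" using a(2) x i(3) by (simp add: frm_def)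
      moreover have "frm (For x e c) s s'" using a(2) i(4) by (auto simp: frm_def)
      ultimately show "?I (tick 1 (tick (cost (Asg x (Add (Va x) (Co 1))))
         (s'\<lparr>sc := (sc s')(x := sc s' x + 1)\<rparr>))) \<and> N - (sc s' x + 1) < N - sc t x"
        using a i iN Jt[OF Jx[of "Suc i" s']] ft
        by (intro conjI exI[of _ "Suc i"]) (auto simp: frm_def)
    qed
    then show ?case by (simp)
  qed
  then show ?thesis by (simp add: For_def)
qed

subsection \<open>Start-up code\<close>

text \<open>Nothing but the input cells holds known data at the start, and a free cell can only be reached
  through an address computed from \<open>n\<close> and \<open>m\<close>: \<open>n + 2 m\<close> lies behind the input when
  \<open>n \<ge> 2\<close>. For \<open>n = 1\<close> that address is cell 1 itself, and the register for \<open>n\<close> ends up as 0.\<close>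

definition pro1 :: program where
  "pro1 = [NAdd 0 0 1, NAdd 0 0 1, NStore 0 1, NConst 1 128, NAdd 0 0 1, NStore 0 2, NSub 2 0 1,
     NLoad 2 2]"

text \<open>Cell 2 has been saved by \<open>pro1\<close>; with \<open>r = 125\<close> the cells 3 to
  127 follow. The copies are 32 cells apart and thereby form array 0.\<close>

definition pro2 :: "nat \<Rightarrow> program" where
  "pro2 r = concat (map (\<lambda>j. [NConst 1 32, NAdd 0 0 1, NStore 0 j]) [3..<r+3])"

text \<open>4000 is \<open>32 * 125\<close>, the distance covered by the pointer in cell 0, which
  thus returns to the array base. Cell 3 becomes the pointer for saving the reals, in strides of the
  32 in cell 4.\<close>

definition pro3 :: program where
  "pro3 = [NConst 1 4000, NSub 0 0 1, NConst 3 0, NAdd 3 3 0, NConst 4 32]"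

definition pro4 :: "nat \<Rightarrow> program" where
  "pro4 r = concat (map (\<lambda>j. [RStore 3 j, NAdd 3 3 4]) [0..<r])"

definition pro5 :: "nat \<Rightarrow> program" where
  "pro5 r = concat (map (\<lambda>k. [NConst 1 k, NAdd (64 + k) 0 1]) [0..<r])"

definition pro6 :: program where
  "pro6 = [NConst 1 128, NSub 0 0 1, NSub 0 0 2, NSub 0 0 2, NConst 1 0, NAdd 1 1 2]"

definition pro :: program where
  "pro = pro1 @ pro2 125 @ pro3 @ pro4 64 @ pro5 32 @ pro6"

lemma pro2_exec:
  assumes "128 \<le> nmem c 0" "r \<le> 125"
  shows "\<exists>c'. execs (pro2 r) c = c' \<and>
    nmem c' 0 = nmem c 0 + 32 * r \<and> rmem c' = rmem c \<and> tape c' = tape c \<and>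
    (\<forall>i. 1 \<le> i \<and> i \<le> r \<longrightarrow> nmem c' (nmem c 0 + 32 * i) = nmem c (i + 2)) \<and>
    (\<forall>a\<ge>2. (\<forall>i. 1 \<le> i \<and> i \<le> r \<longrightarrow> a \<noteq> nmem c 0 + 32 * i) \<longrightarrow> nmem c' a = nmem c a)"
  unfolding pro2_def using assms(2)
proof (induction r)
  case 0 then show ?case by simp
next
  case (Suc r)
  let ?f = "\<lambda>j. [NConst 1 32, NAdd 0 0 1, NStore 0 j]"
  let ?c1 = "execs (concat (map ?f [3..<r+3])) c"
  have u: "[3..<Suc r + 3] = [3..<r + 3] @ [r + 3]" by (subst add_Suc, rule upt_Suc_append) simp
  have e: "execs (concat (map ?f [3..<Suc r+3])) c = execs (?f (r+3)) ?c1"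
    unfolding u by (simp only: map_append concat_append fold_append list.map concat.simps
        append_Nil2 comp_apply)
  have 1: "nmem ?c1 0 = nmem c 0 + 32 * r" "rmem ?c1 = rmem c" "tape ?c1 = tape c"
    and 2: "\<forall>i. 1 \<le> i \<and> i \<le> r \<longrightarrow> nmem ?c1 (nmem c 0 + 32 * i) = nmem c (i + 2)"
    and 3: "\<forall>a\<ge>2. (\<forall>i. 1 \<le> i \<and> i \<le> r \<longrightarrow> a \<noteq> nmem c 0 + 32 * i) \<longrightarrow> nmem ?c1 a = nmem c a"
    using Suc by auto
  have 4: "nmem ?c1 (r + 3) = nmem c (r + 3)" using 3 Suc.prems assms(1) by auto
  let ?c2 = "execs (?f (r+3)) ?c1"
  have n: "nmem ?c2 = ((nmem ?c1)(1 := 32, 0 := nmem c 0 + 32 * Suc r))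
      (nmem c 0 + 32 * Suc r := nmem c (r + 3))"
    using 1 4 assms(1) by (simp add: set_nmem_def add_ac)
  show ?case
  proof (intro exI conjI, rule e)
    show "nmem ?c2 0 = nmem c 0 + 32 * Suc r" using n assms(1) by simp
    show "rmem ?c2 = rmem c" "tape ?c2 = tape c" using 1 by (simp_all add: set_nmem_def)
    show "\<forall>i. 1 \<le> i \<and> i \<le> Suc r \<longrightarrow> nmem ?c2 (nmem c 0 + 32 * i) = nmem c (i + 2)"
    proof (intro allI impI)
      fix i assume i: "1 \<le> i \<and> i \<le> Suc r"
      show "nmem ?c2 (nmem c 0 + 32 * i) = nmem c (i + 2)"
        unfolding n using i 2 assms(1) by (cases "i = Suc r") (auto simp: numeral_3_eq_3)
    qed
    show "\<forall>a\<ge>2. (\<forall>i. 1 \<le> i \<and> i \<le> Suc r \<longrightarrow> a \<noteq> nmem c 0 + 32 * i) \<longrightarrow> nmem ?c2 a = nmem c a"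
    proof (intro allI impI)
      fix a assume a: "2 \<le> a" "\<forall>i. 1 \<le> i \<and> i \<le> Suc r \<longrightarrow> a \<noteq> nmem c 0 + 32 * i"
      have "a \<noteq> nmem c 0 + 32 * Suc r" using a(2)[rule_format, of "Suc r"] by simp
      then show "nmem ?c2 a = nmem c a" unfolding n using a 3 by auto
    qed
  qed
qed

lemma pro4_exec:
  assumes "128 \<le> nmem c 3" "nmem c 4 = 32" "r \<le> 64"
  shows "\<exists>c'. execs (pro4 r) c = c' \<and>
    nmem c' = (nmem c)(3 := nmem c 3 + 32 * r) \<and> tape c' = tape c \<and>
    (\<forall>i. i < r \<longrightarrow> rmem c' (nmem c 3 + 32 * i) = rmem c i) \<and>
    (\<forall>a. (\<forall>i. i < r \<longrightarrow> a \<noteq> nmem c 3 + 32 * i) \<longrightarrow> rmem c' a = rmem c a)"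
  unfolding pro4_def using assms(3)
proof (induction r)
  case 0 then show ?case by (auto simp: fun_eq_iff)
next
  case (Suc r)
  let ?f = "\<lambda>j. [RStore 3 j, NAdd 3 3 4]"
  let ?c1 = "execs (concat (map ?f [0..<r])) c"
  have e: "execs (concat (map ?f [0..<Suc r])) c = execs (?f r) ?c1" by simp
  have 1: "nmem ?c1 = (nmem c)(3 := nmem c 3 + 32 * r)" "tape ?c1 = tape c"
    and 2: "\<forall>i. i < r \<longrightarrow> rmem ?c1 (nmem c 3 + 32 * i) = rmem c i"
    and 3: "\<forall>a. (\<forall>i. i < r \<longrightarrow> a \<noteq> nmem c 3 + 32 * i) \<longrightarrow> rmem ?c1 a = rmem c a"
    using Suc by auto
  have 4: "rmem ?c1 r = rmem c r" using 3 Suc.prems assms(1) by auto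
  let ?c2 = "execs (?f r) ?c1"
  have n: "rmem ?c2 = (rmem ?c1)(nmem c 3 + 32 * r := rmem c r)"
    using 1 4 by (simp add: set_nmem_def set_rmem_def)
  show ?case
  proof (intro exI conjI, rule e)
    show "nmem ?c2 = (nmem c)(3 := nmem c 3 + 32 * Suc r)"
      using 1 assms by (simp add: set_nmem_def set_rmem_def fun_eq_iff)
    show "tape ?c2 = tape c" using 1 by (simp add: set_nmem_def set_rmem_def)
    show "\<forall>i. i < Suc r \<longrightarrow> rmem ?c2 (nmem c 3 + 32 * i) = rmem c i"
      unfolding n using 2 by (auto simp: less_Suc_eq)
    show "\<forall>a. (\<forall>i. i < Suc r \<longrightarrow> a \<noteq> nmem c 3 + 32 * i) \<longrightarrow> rmem ?c2 a = rmem c a"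
      unfolding n using 3 by auto
  qed
qed

lemma pro5_exec:
  shows "\<exists>c'. execs (pro5 r) c = c' \<and>
    rmem c' = rmem c \<and> tape c' = tape c \<and> (\<forall>k<r. nmem c' (64 + k) = nmem c 0 + k) \<and>
    (\<forall>a. a \<noteq> 1 \<and> \<not> (64 \<le> a \<and> a < 64 + r) \<longrightarrow> nmem c' a = nmem c a)"
  unfolding pro5_def
proof (induction r)
  case 0 then show ?case by simp
next
  case (Suc r)
  then show ?case by (auto simp: set_nmem_def less_Suc_eq)
qed

lemma pro_jumpfree: "\<forall>i\<in>set pro. jumpfree i"
  by (auto simp: pro_def pro1_def pro2_def pro3_def pro4_def pro5_def pro6_def)

text \<open>Cell \<open>b - 128\<close> is where \<open>m\<close> is parked, so it is exempt from
  the claims about unchanged contents. The value 128 of \<open>m'\<close> is what is read back if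
  this is cell 1, which has meanwhile been reused for a constant.\<close>

lemma pro_exec:
  assumes "128 \<le> b" "b = nmem c 0 + 2 * nmem c 1 + 128"
    and m': "m' = (if nmem c 0 + 2 * nmem c 1 = 1 then 128 else nmem c 1)"
    and "nmem c 0 + 2 * nmem c 1 = 1 \<or> 4 \<le> nmem c 0 + 2 * nmem c 1"
  shows "\<exists>c'. execs pro c = c' \<and> tape c' = tape c \<and>
    nmem c' 0 = b - 128 - 2 * m' \<and> nmem c' 1 = m' \<and> (\<forall>k<32. nmem c' (64 + k) = b + k) \<and>
    (\<forall>i\<le>125. i + 2 \<noteq> b - 128 \<longrightarrow> nmem c' (b + 32 * i) = nmem c (i + 2)) \<and>
    (\<forall>a\<ge>128. (\<forall>i\<le>125. a \<noteq> b + 32 * i) \<longrightarrow> a \<noteq> b - 128 \<longrightarrow> nmem c' a = nmem c a) \<and>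
    (\<forall>i<64. rmem c' (b + 32 * i) = rmem c i) \<and>
    (\<forall>a. (\<forall>i<64. a \<noteq> b + 32 * i) \<longrightarrow> rmem c' a = rmem c a)"
proof -
  define q where "q = nmem c 0 + 2 * nmem c 1"
  have q: "b = q + 128" "q = 1 \<or> 4 \<le> q" using assms by (auto simp: q_def)
  define c1 where "c1 = execs pro1 c"
  have c1: "rmem c1 = rmem c" "tape c1 = tape c" by (simp_all add: c1_def pro1_def set_nmem_def)
  have q': "nmem c 0 + nmem c 1 + nmem c 1 = q" by (simp add: q_def)
  have nn: "nmem c1 = (nmem c)(0 := q, q := nmem c 1, 1 := 128, 0 := b, b := nmem c 2, 2 := m')"
  proof (cases "q = 1")
    case True
    then show ?thesis using q q' m'
      by (simp add: c1_def pro1_def set_nmem_def q_def[symmetric] del: One_nat_def)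
  next
    case False
    then have "4 \<le> q" using q by simp
    then show ?thesis using q q' m'
      by (simp add: c1_def pro1_def set_nmem_def q_def[symmetric] del: One_nat_def)
  qed
  have n1: "nmem c1 0 = b" "nmem c1 1 = 128" "nmem c1 2 = m'" "nmem c1 b = nmem c 2"
    "\<And>a. 3 \<le> a \<Longrightarrow> a \<noteq> b \<Longrightarrow> a \<noteq> q \<Longrightarrow> nmem c1 a = nmem c a"
    using q by (simp_all add: nn)
  have b0: "128 \<le> nmem c1 0" using n1 assms by simp
  define c2 where "c2 = execs (pro2 125) c1"
  have c2: "nmem c2 0 = b + 4000" "rmem c2 = rmem c" "tape c2 = tape c"
    and c2i: "\<And>i. 1 \<le> i \<Longrightarrow> i \<le> 125 \<Longrightarrow> nmem c2 (b + 32 * i) = nmem c1 (i + 2)"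
    and c2a: "\<And>a. 2 \<le> a \<Longrightarrow> (\<And>i. 1 \<le> i \<Longrightarrow> i \<le> 125 \<Longrightarrow> a \<noteq> b + 32 * i) \<Longrightarrow> nmem c2 a = nmem c1 a"
    using pro2_exec[OF b0, of 125] n1(1) c1 unfolding c2_def by auto
  define c3 where "c3 = execs pro3 c2"
  have c3: "rmem c3 = rmem c" "tape c3 = tape c" "nmem c3 = (nmem c2)(1 := 4000, 0 := b, 3 := b, 4 := 32)"
    using c2 by (simp_all add: c3_def pro3_def set_nmem_def fun_eq_iff)
  have b3: "128 \<le> nmem c3 3" "nmem c3 4 = 32" using c3 assms by auto
  define c4 where "c4 = execs (pro4 64) c3"
  have c4: "nmem c4 = (nmem c3)(3 := b + 32 * 64)" "tape c4 = tape c"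
    and c4i: "\<And>i. i < 64 \<Longrightarrow> rmem c4 (b + 32 * i) = rmem c i"
    and c4a: "\<And>a. (\<And>i. i < 64 \<Longrightarrow> a \<noteq> b + 32 * i) \<Longrightarrow> rmem c4 a = rmem c a"
    using pro4_exec[OF b3, of 64] c3 unfolding c4_def by auto
  define c5 where "c5 = execs (pro5 32) c4"
  have c5: "rmem c5 = rmem c4" "tape c5 = tape c" "\<And>k. k < 32 \<Longrightarrow> nmem c5 (64 + k) = b + k"
    "\<And>a. a \<noteq> 1 \<Longrightarrow> \<not> (64 \<le> a \<and> a < 96) \<Longrightarrow> nmem c5 a = nmem c4 a"
    using pro5_exec[of 32 c4] c4 c3 unfolding c5_def by auto
  have p: "execs pro c = execs pro6 c5"
    by (simp add: pro_def c1_def c2_def c3_def c4_def c5_def)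
  have n5: "nmem c5 0 = b" "nmem c5 2 = m'" using c5 c4 c3 c2a[of 2] n1 assms(1) by auto
  have n6: "nmem (execs pro6 c5) = (nmem c5)(0 := b - 128 - 2 * m', 1 := m')"
    using n5 by (simp add: pro6_def set_nmem_def fun_eq_iff)
  have r6: "rmem (execs pro6 c5) = rmem c4" "tape (execs pro6 c5) = tape c"
    using c5 by (simp_all add: pro6_def set_nmem_def)
  have big: "nmem c5 a = nmem c2 a" if "128 \<le> a" for a using that c5 c4 c3 by auto
  show ?thesis
  proof (intro exI conjI, rule p)
    show "tape (execs pro6 c5) = tape c" by (rule r6)
    show "nmem (execs pro6 c5) 0 = b - 128 - 2 * m'" "nmem (execs pro6 c5) 1 = m'"
      by (simp_all add: n6)
    show "\<forall>k<32. nmem (execs pro6 c5) (64 + k) = b + k" using c5 by (simp add: n6)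
    show "\<forall>i\<le>125. i + 2 \<noteq> b - 128 \<longrightarrow> nmem (execs pro6 c5) (b + 32 * i) = nmem c (i + 2)"
    proof (intro allI impI)
      fix i assume i: "i \<le> 125" "i + 2 \<noteq> b - 128"
      have "nmem (execs pro6 c5) (b + 32 * i) = nmem c2 (b + 32 * i)"
        using n6 big assms(1) by simp
      also have "\<dots> = nmem c (i + 2)"
      proof (cases "i = 0")
        case True then show ?thesis using c2a[of b] n1 assms(1) by (simp add: numeral_2_eq_2)
      next
        case False
        then show ?thesis using c2i[of i] n1(5)[of "i + 2"] i q assms(1) by simp
      qed
      finally show "nmem (execs pro6 c5) (b + 32 * i) = nmem c (i + 2)" .
    qed
    show "\<forall>a\<ge>128. (\<forall>i\<le>125. a \<noteq> b + 32 * i) \<longrightarrow> a \<noteq> b - 128 \<longrightarrow> nmem (execs pro6 c5) a = nmem c a"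
    proof (intro allI impI)
      fix a assume a: "128 \<le> a" "\<forall>i\<le>125. a \<noteq> b + 32 * i" "a \<noteq> b - 128"
      have "a \<noteq> b" using a(2)[rule_format, of 0] by simp
      then show "nmem (execs pro6 c5) a = nmem c a"
        using n6 big c2a[of a] n1(5)[of a] a q by simp
    qed
    show "\<forall>i<64. rmem (execs pro6 c5) (b + 32 * i) = rmem c i" using c4i r6 by simp
    show "\<forall>a. (\<forall>i<64. a \<noteq> b + 32 * i) \<longrightarrow> rmem (execs pro6 c5) a = rmem c a"
      using c4a r6 by simp
  qed
qed

definition hinit :: "nat \<Rightarrow> config \<Rightarrow> nat \<Rightarrow> hstate" where
  "hinit b c t = \<lparr>sc = nmem c, ar = (\<lambda>k i. nmem c (b + 32 * i + k)), rs = rmem c,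
     ra = (\<lambda>k i. rmem c (b + 32 * i + k)), raw = nmem c, rraw = rmem c, bas = b, clk = t, tk = t,
     lg = []\<rparr>"

definition prog :: "cmd \<Rightarrow> program" where
  "prog c = pro @ code c (length pro)"

text \<open>Input that lay in register cells is found in array 0, the rest at its original place.
  The thresholds are the numbers of saved cells: 126 naturals from cell 2 to cell 127, and 64
  reals.\<close>

definition inited :: "nat list \<times> real list \<Rightarrow> nat \<Rightarrow> nat \<Rightarrow> hstate \<Rightarrow> bool" where
  "inited x n m s \<longleftrightarrow> sc s 0 = n \<and> sc s 1 = m \<and> 2 * m + 128 < bas s \<and>
    (\<forall>j<2*m. if j < 126 then ar s 0 j = fst x ! (j + 2) else raw s (j + 2) = fst x ! (j + 2)) \<and>
    (\<forall>k. 1 \<le> k \<and> k < 32 \<longrightarrow> ar s k = (\<lambda>_. 0)) \<and>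
    (\<forall>e<m. if e < 64 then ra s 0 e = snd x ! e else rraw s e = snd x ! e)"

lemma prog_start:
  fixes x :: "nat list \<times> real list"
  assumes x: "x = (n # m # es, ws)" and l: "length es = 2 * m" "length ws = m"
    and nm: "n = 1 \<and> m = 0 \<or> 2 \<le> n \<and> 1 \<le> m"
  shows "\<exists>s. sync (prog c) x s (length pro) \<and> lg s = [] \<and> clk s = length pro \<and> tk s = length pro \<and>
    (if 2 \<le> n then inited x n m s else sc s 0 = 0)"
proof -
  let ?c = "init_config x"
  have c0: "nmem ?c 0 = n" "nmem ?c 1 = m" "tape ?c = []" by (simp_all add: init_config_def x load_def)
  have ci: "nmem ?c a = 0" if "2 * m + 2 \<le> a" for a
    using that by (simp add: init_config_def x load_def l)
  have cj: "nmem ?c (j + 2) = fst x ! (j + 2)" if "j < 2 * m" for j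
    using that by (simp add: init_config_def x load_def l)
  have re: "rmem ?c e = snd x ! e" if "e < m" for e
    using that by (simp add: init_config_def x load_def l)
  define b where "b = n + 2 * m + 128"
  define m' where "m' = (if n + 2 * m = 1 then 128 else m)"
  obtain c' where c': "execs pro ?c = c'" "tape c' = []" "nmem c' 0 = b - 128 - 2 * m'"
    "nmem c' 1 = m'" "\<forall>k<32. nmem c' (64 + k) = b + k"
    and sv: "\<forall>i\<le>125. i + 2 \<noteq> b - 128 \<longrightarrow> nmem c' (b + 32 * i) = nmem ?c (i + 2)"
    and oth: "\<forall>a\<ge>128. (\<forall>i\<le>125. a \<noteq> b + 32 * i) \<longrightarrow> a \<noteq> b - 128 \<longrightarrow> nmem c' a = nmem ?c a"
    and rsv: "\<forall>i<64. rmem c' (b + 32 * i) = rmem ?c i"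
    and roth: "\<forall>a. (\<forall>i<64. a \<noteq> b + 32 * i) \<longrightarrow> rmem c' a = rmem ?c a"
    using pro_exec[of b ?c m'] c0 nm by (auto simp: b_def m'_def)
  let ?s = "hinit b c' (length pro)"
  have at: "code_at (prog c) 0 pro" by (auto simp: code_at_def prog_def)
  have "(step (prog c) ^^ length pro) ?c = c'"
    using steps_jumpfree[OF at _ pro_jumpfree, of ?c] c'(1) by (simp add: init_config_def)
  then have r: "run (prog c) x (length pro) = c'" by (simp add: run_def)
  have "pc c' = length pro"
    using pc_execs[OF pro_jumpfree, of ?c] c'(1) by (simp add: init_config_def)
  then have "sync (prog c) x ?s (length pro)"
    using r c' by (simp add: sync_def logok_def conc_def hinit_def b_def)
  moreover have "inited x n m ?s" if n: "2 \<le> n"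
  proof -
    have m'm: "m' = m" using n by (simp add: m'_def)
    have q: "b - 128 = n + 2 * m" by (simp add: b_def)
    \<comment> \<open>Such a cell lies behind the input and, by its remainder modulo 32, is not an
      entry of array 0; the start-up code has not touched it.\<close>
    have "nmem c' (b + 32 * i + k) = 0" if k: "1 \<le> k" "k < 32" for i k
    proof -
      have "b + 32 * i + k \<noteq> b + 32 * i'" for i'
        using addr_inj[of k 0 i i'] k by auto
      then show ?thesis using oth ci[of "b + 32 * i + k"] n by (simp add: b_def)
    qed
    then have ar: "\<forall>k. 1 \<le> k \<and> k < 32 \<longrightarrow> ar ?s k = (\<lambda>_. 0)" by (auto simp: hinit_def)
    have e: "if j < 126 then ar ?s 0 j = fst x ! (j + 2) else raw ?s (j + 2) = fst x ! (j + 2)"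
      if j: "j < 2 * m" for j
      using cj[OF j] sv[rule_format, of j] oth[rule_format, of "j + 2"] j n
      by (auto simp: hinit_def b_def)
    have w: "if e < 64 then ra ?s 0 e = snd x ! e else rraw ?s e = snd x ! e" if e: "e < m" for e
      using re[OF e] rsv[rule_format, of e] roth[rule_format, of e] e
      by (auto simp: hinit_def b_def)
    have "sc ?s 0 = n" "sc ?s 1 = m" "2 * m + 128 < bas ?s"
      using c'(3,4) m'm q n by (simp_all add: hinit_def b_def)
    then show ?thesis unfolding inited_def using ar e w by blast
  qed
  moreover have "sc ?s 0 = 0" if "\<not> 2 \<le> n"
    using that nm c'(3) by (simp add: hinit_def b_def m'_def)
  ultimately show ?thesis by (auto simp: hinit_def)
qed

lemma output_time_eq:
  assumes "length (tape (run Q x (t - 1))) < k" "k \<le> length (tape (run Q x t))"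
  shows "output_time Q x k = t"
  unfolding output_time_def
proof (rule Least_equality)
  show "k \<le> length (tape (run Q x t))" by (rule assms)
  fix t' assume "k \<le> length (tape (run Q x t'))"
  then have "\<not> t' \<le> t - 1" using assms(1) tape_run_mono[of t' "t - 1" Q x] by linarith
  then show "t \<le> t'" by simp
qed

lemma prog_result:
  assumes s: "sync (prog c) x s (length pro)" "lg s = []" "clk s = length pro" "tk s = length pro"
    and c: "big c s s'" "wfc c" "bnd u c" "0 < u"
  shows "halts_with_output (prog c) x (map fst (lg s'))"
    and "halt_time (prog c) x \<le> clk s'"
    and "\<And>i. i < length (lg s') \<Longrightarrow> output_time (prog c) x (Suc i) = fst (snd (lg s' ! i))"
    and "paced u s'"
proof -
  have at: "code_at (prog c) (length pro) (code c (length pro))"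
    unfolding code_at_def prog_def by (intro exI[of _ pro] exI[of _ "[]"]) simp
  have y: "sync (prog c) x s' (length pro + cost c)" by (rule big_sync[OF c(1,2) at s(1)])
  have h: "halted (prog c) (run (prog c) x (clk s'))"
    using y code_length[of c "length pro" 0] by (simp add: sync_def halted_def prog_def)
  have t: "tape (run (prog c) x (clk s')) = map fst (lg s')" using y by (simp add: sync_def conc_def)
  show "halts_with_output (prog c) x (map fst (lg s'))"
    unfolding halts_with_output_def using h t by blast
  show "halt_time (prog c) x \<le> clk s'" unfolding halt_time_def using h by (rule Least_le)
  show "output_time (prog c) x (Suc i) = fst (snd (lg s' ! i))" if "i < length (lg s')" for i
    by (rule output_time_eq) (use y that in \<open>auto simp: sync_def logok_def less_Suc_eq_le\<close>)
  have "paced u s" using s(2-4) c(4) by (simp add: paced_def pace_def)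
  then show "paced u s'" by (rule big_paced[OF c(1,3)])
qed

section \<open>Simulating the given program\<close>

text \<open>The memory of the simulated program lives in array 20. A cell counts as written only if its
  stamp equals the number of the current run, so that no run has to clean up.\<close>

definition pmN :: "hstate \<Rightarrow> nat \<Rightarrow> nat" where
  "pmN s a = (if ar s 21 a = sc s 22 then ar s 20 a else 0)"

definition pmR :: "hstate \<Rightarrow> nat \<Rightarrow> real" where
  "pmR s a = (if ar s 23 a = sc s 22 then ra s 20 a else 0)"

text \<open>As no stamp exceeds the number of the current run, raising that number by one makes
  every cell unwritten.\<close>

definition stok :: "hstate \<Rightarrow> bool" where
  "stok s \<longleftrightarrow> (\<forall>a. ar s 21 a \<le> sc s 22 \<and> ar s 23 a \<le> sc s 22)"

definition rdN :: "nat \<Rightarrow> nexp \<Rightarrow> cmd" where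
  "rdN x e = Ite (Eq (Ar 21 e) (Va 22)) (Asg x (Ar 20 e)) (Asg x (Co 0))"

definition rdR :: "nat \<Rightarrow> nexp \<Rightarrow> cmd" where
  "rdR x e = Ite (Eq (Ar 23 e) (Va 22)) (RAsg x (RAr 20 e)) (RAsg x (RC 0))"

definition wrN :: "nexp \<Rightarrow> nexp \<Rightarrow> cmd" where
  "wrN a b = Sto 20 a b ;; Sto 21 a (Va 22)"

definition wrR :: "nexp \<Rightarrow> rexp \<Rightarrow> cmd" where
  "wrR a r = RSto 20 a r ;; Sto 23 a (Va 22)"

definition inc :: cmd where
  "inc = Asg 40 (Add (Va 40) (Co 1))"

text \<open>Scalar 40 is the simulated program counter, and 43 counts the symbols written so far,
  which array 24 collects in place of a tape.\<close>

fun simI :: "instr \<Rightarrow> cmd" where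
  "simI (NConst a k) = wrN (Co a) (Co k) ;; inc"
| "simI (NAdd a i j) = rdN 41 (Co i) ;; rdN 42 (Co j) ;; wrN (Co a) (Add (Va 41) (Va 42)) ;; inc"
| "simI (NSub a i j) = rdN 41 (Co i) ;; rdN 42 (Co j) ;; wrN (Co a) (Sub (Va 41) (Va 42)) ;; inc"
| "simI (NLoad a i) = rdN 41 (Co i) ;; rdN 42 (Va 41) ;; wrN (Co a) (Va 42) ;; inc"
| "simI (NStore i j) = rdN 41 (Co i) ;; rdN 42 (Co j) ;; wrN (Va 41) (Va 42) ;; inc"
| "simI (RConst a k) = wrR (Co a) (RC k) ;; inc"
| "simI (RAdd a i j) = rdR 10 (Co i) ;; rdR 11 (Co j) ;; wrR (Co a) (RPlus (RV 10) (RV 11)) ;; inc"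
| "simI (RSub a i j) = rdR 10 (Co i) ;; rdR 11 (Co j) ;; wrR (Co a) (RMinus (RV 10) (RV 11)) ;; inc"
| "simI (RMul a i j) = rdR 10 (Co i) ;; rdR 11 (Co j) ;; wrR (Co a) (RTimes (RV 10) (RV 11)) ;; inc"
| "simI (RDiv a i j) = rdR 10 (Co i) ;; rdR 11 (Co j) ;; wrR (Co a) (RDivide (RV 10) (RV 11)) ;; inc"
| "simI (RLoad a i) = rdN 41 (Co i) ;; rdR 10 (Va 41) ;; wrR (Co a) (RV 10) ;; inc"
| "simI (RStore i j) = rdN 41 (Co i) ;; rdR 10 (Co j) ;; wrR (Va 41) (RV 10) ;; inc"
| "simI (Jump l) = Asg 40 (Co l)"
| "simI (JumpNLess i j l) = rdN 41 (Co i) ;; rdN 42 (Co j) ;; Ite (Lt (Va 41) (Va 42)) (Asg 40 (Co l)) inc"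
| "simI (JumpRLess i j l) = rdR 10 (Co i) ;; rdR 11 (Co j) ;; IfR (RV 10) (RV 11) (Asg 40 (Co l)) inc"
| "simI (Output i) = rdN 41 (Co i) ;; Sto 24 (Va 43) (Va 41) ;; Asg 43 (Add (Va 43) (Co 1)) ;; inc"

text \<open>Linear search for the current instruction. The number of comparisons is at most the
  length of the simulated program, a constant for the resulting program.\<close>

fun disp :: "nat \<Rightarrow> program \<Rightarrow> cmd" where
  "disp i [] = Skip"
| "disp i (p # ps) = Ite (Lt (Va 40) (Co (Suc i))) (simI p) (disp (Suc i) ps)"

definition sim :: "program \<Rightarrow> cmd" where
  "sim P = Asg 40 (Co 0) ;; Asg 43 (Co 0) ;; Wh (Lt (Va 40) (Co (length P))) (disp 0 P)"

definition simrel :: "hstate \<Rightarrow> config \<Rightarrow> bool" where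
  "simrel s c \<longleftrightarrow> sc s 40 = pc c \<and> pmN s = nmem c \<and> pmR s = rmem c \<and> sc s 43 = length (tape c) \<and>
    (\<forall>i<length (tape c). ar s 24 i = tape c ! i)"

lemma ev_time [simp]:
  "ev e (s\<lparr>clk := a\<rparr>) = ev e s" "ev e (s\<lparr>tk := b\<rparr>) = ev e s" "ev e (tick d s) = ev e s"
  by (induction e) (simp_all add: tick_def)

lemma rv_time [simp]:
  "rv e (s\<lparr>clk := a\<rparr>) = rv e s" "rv e (s\<lparr>tk := b\<rparr>) = rv e s" "rv e (tick d s) = rv e s"
  by (induction e) (simp_all add: tick_def)

lemma wp_rdN:
  assumes "\<And>a b. b \<le> tk s + 3 \<Longrightarrow> q (s\<lparr>sc := (sc s)(x := pmN s (ev e s)), clk := a, tk := b\<rparr>)"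
  shows "wp (rdN x e) q s"
  unfolding rdN_def using assms
  by (cases "ar s 21 (ev e s) = sc s 22") (simp_all add: tick_def pmN_def)

lemma wp_rdR:
  assumes "\<And>a b. b \<le> tk s + 3 \<Longrightarrow> q (s\<lparr>rs := (rs s)(x := pmR s (ev e s)), clk := a, tk := b\<rparr>)"
  shows "wp (rdR x e) q s"
  unfolding rdR_def using assms
  by (cases "ar s 23 (ev e s) = sc s 22") (simp_all add: tick_def pmR_def)

lemma wp_wrN:
  assumes "\<And>t. sc t = sc s \<Longrightarrow> rs t = rs s \<Longrightarrow> ra t = ra s \<Longrightarrow> (\<And>k. k \<noteq> 20 \<Longrightarrow> k \<noteq> 21 \<Longrightarrow> ar t k = ar s k) \<Longrightarrow>
      ar t 20 = (ar s 20)(ev a s := ev b s) \<Longrightarrow> ar t 21 = (ar s 21)(ev a s := sc s 22) \<Longrightarrow>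
      tk t = tk s + 2 \<Longrightarrow> q t" and "ev a (tick (cost (Sto 20 a b)) (s\<lparr>ar := (ar s)(20 := (ar s 20)(ev a s := ev b s))\<rparr>)) = ev a s"
  shows "wp (wrN a b) q s"
  unfolding wrN_def using assms by simp

lemma wp_wrR:
  assumes "\<And>t. sc t = sc s \<Longrightarrow> rs t = rs s \<Longrightarrow> (\<And>k. k \<noteq> 20 \<Longrightarrow> ra t k = ra s k) \<Longrightarrow> (\<And>k. k \<noteq> 23 \<Longrightarrow> ar t k = ar s k) \<Longrightarrow>
      ra t 20 = (ra s 20)(ev a s := rv b s) \<Longrightarrow> ar t 23 = (ar s 23)(ev a s := sc s 22) \<Longrightarrow>
      tk t = tk s + 2 \<Longrightarrow> q t" and "ev a (tick (cost (RSto 20 a b)) (s\<lparr>ra := (ra s)(20 := (ra s 20)(ev a s := rv b s))\<rparr>)) = ev a s"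
  shows "wp (wrR a b) q s"
  unfolding wrR_def using assms by simp

lemma simrel_cong:
  assumes "sc t 40 = sc s 40" "sc t 43 = sc s 43" "sc t 22 = sc s 22" "ar t 20 = ar s 20"
    "ar t 21 = ar s 21" "ar t 23 = ar s 23" "ar t 24 = ar s 24" "ra t 20 = ra s 20"
  shows "simrel t c = simrel s c" "stok t = stok s"
proof -
  have "pmN t = pmN s" "pmR t = pmR s" using assms by (auto simp: pmN_def pmR_def fun_eq_iff)
  then show "simrel t c = simrel s c" using assms by (simp add: simrel_def)
  show "stok t = stok s" using assms by (simp add: stok_def)
qed

lemma simrel_tick [simp]: "simrel (tick d s) c = simrel s c" "stok (tick d s) = stok s"
  by (rule simrel_cong; simp)+

lemma simrel_upd [simp]:
  "f 22 = sc s 22 \<Longrightarrow> f 40 = sc s 40 \<Longrightarrow> f 43 = sc s 43 \<Longrightarrow>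
    simrel (s\<lparr>sc := f, clk := a, tk := b\<rparr>) c = simrel s c"
  "f 22 = sc s 22 \<Longrightarrow> stok (s\<lparr>sc := f, clk := a, tk := b\<rparr>) = stok s"
  "f 22 = sc s 22 \<Longrightarrow> f 40 = sc s 40 \<Longrightarrow> f 43 = sc s 43 \<Longrightarrow>
    simrel (s\<lparr>sc := f, rs := g, clk := a, tk := b\<rparr>) c = simrel s c"
  "f 22 = sc s 22 \<Longrightarrow> stok (s\<lparr>sc := f, rs := g, clk := a, tk := b\<rparr>) = stok s"
  "simrel (s\<lparr>rs := g, clk := a, tk := b\<rparr>) c = simrel s c"
  "stok (s\<lparr>rs := g, clk := a, tk := b\<rparr>) = stok s"
  "f 22 = sc s 22 \<Longrightarrow> f 40 = sc s 40 \<Longrightarrow> f 43 = sc s 43 \<Longrightarrow> simrel (s\<lparr>sc := f\<rparr>) c = simrel s c"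
  "f 22 = sc s 22 \<Longrightarrow> stok (s\<lparr>sc := f\<rparr>) = stok s"
  by ((rule simrel_cong(1); simp) | simp add: stok_def)+

lemma pm_upd [simp]:
  "f 22 = sc s 22 \<Longrightarrow> pmN (s\<lparr>sc := f, clk := a, tk := b\<rparr>) = pmN s"
  "f 22 = sc s 22 \<Longrightarrow> pmR (s\<lparr>sc := f, clk := a, tk := b\<rparr>) = pmR s"
  "pmN (s\<lparr>rs := g, clk := a, tk := b\<rparr>) = pmN s"
  "pmR (s\<lparr>rs := g, clk := a, tk := b\<rparr>) = pmR s"
  by (auto simp: pmN_def pmR_def fun_eq_iff)

lemma pm_40:
  "pmN (tick d (t\<lparr>sc := (sc t)(40 := z)\<rparr>)) = pmN t"
  "pmR (tick d (t\<lparr>sc := (sc t)(40 := z)\<rparr>)) = pmR t"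
  by (auto simp: pmN_def pmR_def fun_eq_iff)

lemma wrN_inc:
  assumes "simrel s c" "stok s" "ev a s = i" "ev b s = v" "a = Co i \<or> a = Va 41" "B \<ge> tk s + 3"
    "c' = set_nmem i v c"
  shows "wp (wrN a b ;; inc) (\<lambda>t. simrel t c' \<and> stok t \<and> tk t \<le> B) s"
  unfolding wp_simps
proof (rule wp_wrN)
  fix t :: hstate assume t: "sc t = sc s" "ra t = ra s" "\<And>k. k \<noteq> 20 \<Longrightarrow> k \<noteq> 21 \<Longrightarrow> ar t k = ar s k"
    "ar t 20 = (ar s 20)(ev a s := ev b s)" "ar t 21 = (ar s 21)(ev a s := sc s 22)" "tk t = tk s + 2"
  have "pmN t = (pmN s)(i := v)" "pmR t = pmR s"
    using t assms by (auto simp: pmN_def pmR_def fun_eq_iff)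
  then show "wp inc (\<lambda>t. simrel t c' \<and> stok t \<and> tk t \<le> B) t"
    using t assms by (simp add: inc_def simrel_def stok_def set_nmem_def pm_40)
qed (use assms(5) in \<open>elim disjE; simp\<close>)

lemma wrR_inc:
  assumes "simrel s c" "stok s" "ev a s = i" "rv b s = v" "a = Co i \<or> a = Va 41" "B \<ge> tk s + 3"
    "c' = set_rmem i v c"
  shows "wp (wrR a b ;; inc) (\<lambda>t. simrel t c' \<and> stok t \<and> tk t \<le> B) s"
  unfolding wp_simps
proof (rule wp_wrR)
  fix t :: hstate assume t: "sc t = sc s" "\<And>k. k \<noteq> 20 \<Longrightarrow> ra t k = ra s k" "\<And>k. k \<noteq> 23 \<Longrightarrow> ar t k = ar s k"
    "ra t 20 = (ra s 20)(ev a s := rv b s)" "ar t 23 = (ar s 23)(ev a s := sc s 22)" "tk t = tk s + 2"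
  have "pmR t = (pmR s)(i := v)" "pmN t = pmN s"
    using t assms by (auto simp: pmN_def pmR_def fun_eq_iff)
  then show "wp inc (\<lambda>t. simrel t c' \<and> stok t \<and> tk t \<le> B) t"
    using t assms by (simp add: inc_def simrel_def stok_def set_rmem_def pm_40)
qed (use assms(5) in \<open>elim disjE; simp\<close>)

lemma simI_correct:
  assumes "simrel s c" "stok s"
  shows "wp (simI p) (\<lambda>t. simrel t (exec p c) \<and> stok t \<and> tk t \<le> tk s + 12) s"
proof -
  have pm: "pmN s = nmem c" "pmR s = rmem c" using assms(1) by (simp_all add: simrel_def)
  show ?thesis
  proof (cases p)
    case (NConst a k)
    then show ?thesis unfolding NConst simI.simps
      by (intro wrN_inc[OF assms]) auto
  next
    case (NAdd a i j)
    show ?thesis unfolding NAdd simI.simps wp_simps(9)[of "rdN _ _"]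
      by (intro wp_rdN wrN_inc[where c = c]) (use assms pm in auto)
  next
    case (NSub a i j)
    show ?thesis unfolding NSub simI.simps wp_simps(9)[of "rdN _ _"]
      by (intro wp_rdN wrN_inc[where c = c]) (use assms pm in auto)
  next
    case (NLoad a i)
    show ?thesis unfolding NLoad simI.simps wp_simps(9)[of "rdN _ _"]
      by (intro wp_rdN wrN_inc[where c = c]) (use assms pm in auto)
  next
    case (NStore i j)
    show ?thesis unfolding NStore simI.simps wp_simps(9)[of "rdN _ _"]
      by (intro wp_rdN wrN_inc[where c = c]) (use assms pm in auto)
  next
    case (RConst a k)
    then show ?thesis unfolding RConst simI.simps
      by (intro wrR_inc[OF assms]) auto
  next
    case (RAdd a i j)
    show ?thesis unfolding RAdd simI.simps wp_simps(9)[of "rdR _ _"]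
      by (intro wp_rdR wrR_inc[where c = c]) (use assms pm in auto)
  next
    case (RSub a i j)
    show ?thesis unfolding RSub simI.simps wp_simps(9)[of "rdR _ _"]
      by (intro wp_rdR wrR_inc[where c = c]) (use assms pm in auto)
  next
    case (RMul a i j)
    show ?thesis unfolding RMul simI.simps wp_simps(9)[of "rdR _ _"]
      by (intro wp_rdR wrR_inc[where c = c]) (use assms pm in auto)
  next
    case (RDiv a i j)
    show ?thesis unfolding RDiv simI.simps wp_simps(9)[of "rdR _ _"]
      by (intro wp_rdR wrR_inc[where c = c]) (use assms pm in auto)
  next
    case (RLoad a i)
    show ?thesis unfolding RLoad simI.simps wp_simps(9)[of "rdR _ _"] wp_simps(9)[of "rdN _ _"]
      by (intro wp_rdN wp_rdR wrR_inc[where c = c]) (use assms pm in auto)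
  next
    case (RStore i j)
    show ?thesis unfolding RStore simI.simps wp_simps(9)[of "rdR _ _"] wp_simps(9)[of "rdN _ _"]
      by (intro wp_rdN wp_rdR wrR_inc[where c = c]) (use assms pm in auto)
  next
    case (Jump l)
    have "pmN (tick d (s\<lparr>sc := (sc s)(40 := l)\<rparr>)) = pmN s" "pmR (tick d (s\<lparr>sc := (sc s)(40 := l)\<rparr>)) = pmR s" for d
      by (auto simp: pmN_def pmR_def fun_eq_iff)
    then show ?thesis using assms unfolding Jump by (simp add: simrel_def stok_def)
  next
    case (JumpNLess i j l)
    have "pmN (tick d t) = pmN t" "pmR (tick d t) = pmR t"
      "pmN (t\<lparr>sc := (sc t)(40 := l)\<rparr>) = pmN t" "pmR (t\<lparr>sc := (sc t)(40 := l)\<rparr>) = pmR t" for d t l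
      by (auto simp: pmN_def pmR_def fun_eq_iff)
    note [simp] = this
    show ?thesis unfolding JumpNLess simI.simps wp_simps(9)
      by (intro wp_rdN) (use assms pm in \<open>simp add: simrel_def stok_def inc_def\<close>)
  next
    case (JumpRLess i j l)
    have "pmN (tick d t) = pmN t" "pmR (tick d t) = pmR t"
      "pmN (t\<lparr>sc := (sc t)(40 := l)\<rparr>) = pmN t" "pmR (t\<lparr>sc := (sc t)(40 := l)\<rparr>) = pmR t" for d t l
      by (auto simp: pmN_def pmR_def fun_eq_iff)
    note [simp] = this
    show ?thesis unfolding JumpRLess simI.simps wp_simps(9)
      by (intro wp_rdR) (use assms pm in \<open>simp add: simrel_def stok_def inc_def\<close>)
  next
    case (Output i)
    have "pmN (tick d t) = pmN t" "pmR (tick d t) = pmR t"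
      "pmN (t\<lparr>sc := (sc t)(40 := l)\<rparr>) = pmN t" "pmR (t\<lparr>sc := (sc t)(40 := l)\<rparr>) = pmR t"
      "pmN (t\<lparr>sc := (sc t)(43 := l)\<rparr>) = pmN t" "pmR (t\<lparr>sc := (sc t)(43 := l)\<rparr>) = pmR t"
      "pmN (t\<lparr>ar := (ar t)(24 := f)\<rparr>) = pmN t" "pmR (t\<lparr>ar := (ar t)(24 := f)\<rparr>) = pmR t" for d t l f
      by (auto simp: pmN_def pmR_def fun_eq_iff)
    note [simp] = this
    show ?thesis unfolding Output simI.simps wp_simps(9)[of "rdN _ _"]
      by (intro wp_rdN) (use assms pm in \<open>auto simp: simrel_def stok_def inc_def nth_append less_Suc_eq\<close>)
  qed
qed

lemma disp_correct:
  "simrel s c \<Longrightarrow> stok s \<Longrightarrow> pc c = i + j \<Longrightarrow> j < length ps \<Longrightarrow>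
    wp (disp i ps) (\<lambda>t. simrel t (exec (ps ! j) c) \<and> stok t \<and> tk t \<le> tk s + 2 * j + 13) s"
proof (induction ps arbitrary: i j s)
  case (Cons p ps)
  have pc: "sc s 40 = i + j" using Cons.prems by (simp add: simrel_def)
  show ?case
  proof (cases j)
    case 0
    show ?thesis using pc 0 simI_correct[of "tick d s" c p for d] Cons.prems
      by (simp) (rule wp_mono, assumption, simp)
  next
    case (Suc j')
    let ?s = "tick (length (cn 0 (Lt (Va 40) (Co (Suc i)))) + 2) s"
    have "wp (disp (Suc i) ps) (\<lambda>t. simrel t (exec (ps ! j') c) \<and> stok t \<and> tk t \<le> tk ?s + 2 * j' + 13) ?s"
      by (rule Cons.IH) (use Cons.prems Suc in auto)
    then have "wp (disp (Suc i) ps) (\<lambda>t. simrel (tick 1 t) (exec ((p # ps) ! j) c) \<and> stok (tick 1 t) \<and>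
        tk (tick 1 t) \<le> tk s + 2 * j + 13) ?s"
      by (rule wp_mono) (use Suc in auto)
    then show ?thesis using pc Suc by simp
  qed
qed simp

text \<open>The invariant is indexed by the number of iterations made so far, of which at most
  \<open>T\<close> are possible. It suits loops whose remaining length is not visible in the
  state.\<close>

lemma wp_Wh_upto:
  assumes "I k s" and "k \<le> T"
    and fin: "\<And>k s. k \<le> T \<Longrightarrow> I k s \<Longrightarrow> ev e s = 0 \<Longrightarrow> q (tick (length (cn 0 e) + 3) s)"
    and step: "\<And>k s. k \<le> T \<Longrightarrow> I k s \<Longrightarrow> 0 < ev e s \<Longrightarrow>
      k < T \<and> wp c (\<lambda>s'. I (Suc k) (tick 1 s')) (tick (length (cn 0 e) + 2) s)"
  shows "wp (Wh e c) q s"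
  using assms(1,2)
proof (induction "T - k" arbitrary: k s)
  case 0
  then have "ev e s = 0" using step[of k s] by (cases "ev e s = 0") auto
  then show ?case using fin[of k s] 0 big.WhileF unfolding wp_def by blast
next
  case (Suc i)
  show ?case
  proof (cases "ev e s = 0")
    case True
    then show ?thesis using fin[of k s] Suc.prems big.WhileF unfolding wp_def by blast
  next
    case False
    then obtain s1 where s1: "k < T" "big c (tick (length (cn 0 e) + 2) s) s1" "I (Suc k) (tick 1 s1)"
      using step[of k s] Suc.prems unfolding wp_def by blast
    then have "wp (Wh e c) q (tick 1 s1)" using Suc.hyps(1)[of "Suc k" "tick 1 s1"] Suc.hyps(2) by simp
    then show ?thesis using s1(2) False big.WhileT unfolding wp_def by blast
  qed
qed

text \<open>A simulated step costs at most two ticks for each comparison in the search for its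
  instruction, and a constant for the instruction itself.\<close>

lemma sim_correct:
  assumes init: "pmN s = nmem (init_config x)" "pmR s = rmem (init_config x)" and st: "stok s"
    and halt: "halted P (run P x T)" and first: "\<And>t. t < T \<Longrightarrow> \<not> halted P (run P x t)"
  shows "wp (sim P) (\<lambda>t. simrel t (run P x T) \<and> stok t \<and>
    tk t \<le> tk s + (T + 1) * (2 * length P + 20)) s"
proof -
  let ?K = "2 * length P + 20"
  let ?s = "tick (cost (Asg 43 (Co 0))) (tick (cost (Asg 40 (Co 0))) (s\<lparr>sc := (sc s)(40 := 0)\<rparr>)
    \<lparr>sc := (sc s)(40 := 0, 43 := 0)\<rparr>)"
  let ?I = "\<lambda>k t. simrel t (run P x k) \<and> stok t \<and> tk t \<le> tk s + 2 + k * ?K"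
  have step: "run P x (Suc k) = exec (P ! pc (run P x k)) (run P x k)" "pc (run P x k) < length P" if "k < T" for k
    using first[OF that] run_add[of P x k 1] by (auto simp: step_def halted_def)
  have "wp (Wh (Lt (Va 40) (Co (length P))) (disp 0 P)) (\<lambda>t. simrel t (run P x T) \<and> stok t \<and>
    tk t \<le> tk s + (T + 1) * ?K) ?s"
  proof (rule wp_Wh_upto[where I = ?I and k = 0 and T = T], goal_cases)
    case 1
    have "pmN ?s = pmN s" "pmR ?s = pmR s" by (auto simp: pmN_def pmR_def fun_eq_iff)
    moreover have "stok ?s" using st by (simp add: stok_def)
    ultimately show ?case using init by (simp add: simrel_def run_def init_config_def)
  next
    case 2 then show ?case by simp
  next
    case (3 k t)
    have "\<not> pc (run P x k) < length P" using 3 by (simp add: simrel_def)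
    then have "k = T" using step(2)[of k] 3(1) by (cases "k = T") auto
    then show ?case using 3 by simp
  next
    case (4 k t)
    have pck: "pc (run P x k) < length P" using 4 by (simp add: simrel_def)
    then have kT: "k < T" using halt 4(1) by (cases "k = T") (auto simp: halted_def)
    let ?t = "tick (length (cn 0 (Lt (Va 40) (Co (length P)))) + 2) t"
    have "wp (disp 0 P) (\<lambda>t'. simrel t' (exec (P ! pc (run P x k)) (run P x k)) \<and> stok t' \<and>
        tk t' \<le> tk ?t + 2 * pc (run P x k) + 13) ?t"
      by (rule disp_correct) (use 4 pck in auto)
    then have "wp (disp 0 P) (\<lambda>t'. ?I (Suc k) (tick 1 t')) ?t"
      by (rule wp_mono) (use 4 step[OF kT] pck in auto)
    then show ?case using kT by blast
  qed
  then show ?thesis by (simp add: sim_def tick_def)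
qed

lemma simI_sets:
  "wsc (simI p) \<subseteq> {40..43}" "war (simI p) \<subseteq> {20, 21, 23, 24}" "wrs (simI p) \<subseteq> {10, 11}"
  "wra (simI p) \<subseteq> {20}" "silent (simI p)" "wfc (simI p)"
  by (cases p; simp add: rdN_def rdR_def wrN_def wrR_def inc_def Eq_def Neq_def Lt_def)+

lemma disp_sets:
  "wsc (disp i ps) \<subseteq> {40..43} \<and> war (disp i ps) \<subseteq> {20, 21, 23, 24} \<and> wrs (disp i ps) \<subseteq> {10, 11} \<and>
    wra (disp i ps) \<subseteq> {20} \<and> silent (disp i ps) \<and> wfc (disp i ps)"
  by (induction i ps rule: disp.induct) (use simI_sets in \<open>auto simp: Lt_def\<close>)

lemma sim_sets [simp]:
  "x < 40 \<or> 43 < x \<Longrightarrow> x \<notin> wsc (sim P)" "k < 20 \<or> 24 < k \<or> k = 22 \<Longrightarrow> k \<notin> war (sim P)"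
  "x < 10 \<or> 11 < x \<Longrightarrow> x \<notin> wrs (sim P)" "k \<noteq> 20 \<Longrightarrow> k \<notin> wra (sim P)"
  "silent (sim P)" "wfc (sim P)"
  using disp_sets[of 0 P] by (auto simp: sim_def Lt_def)

section \<open>The program\<close>

text \<open>Scalars 0 and 1 hold \<open>n\<close> and \<open>m\<close>. Arrays 1 and 2 hold the ends of the edges, 3 the products
  \<open>v n\<close> (the machine cannot multiply), 5 to 7 a spanning tree along which the sides of a cut are read
  off its incidence vector, 8 the representatives of the current contraction, 12 the sides of the last
  cut found, 13 the parents, 15 the block labels of the current vertex, 16 and 17 the number of blocks
  and the labels of every vertex, 18 the vertices already treated, 19 the current ideal, and 20 to 23
  the simulated memory. Real arrays 1 and 2 hold the edge weights and the values \<open>Lam\<close>.\<close>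

definition copyin :: cmd where
  "copyin = For 10 (Va 1) (
     Ite (Lt (Add (Va 10) (Va 10)) (Co 126)) (Asg 11 (Ar 0 (Add (Va 10) (Va 10))))
       (RawLd 11 (Add (Add (Va 10) (Va 10)) (Co 2))) ;;
     Sto 1 (Va 10) (Va 11) ;;
     Ite (Lt (Add (Add (Va 10) (Va 10)) (Co 1)) (Co 126)) (Asg 11 (Ar 0 (Add (Add (Va 10) (Va 10)) (Co 1))))
       (RawLd 11 (Add (Add (Va 10) (Va 10)) (Co 3))) ;;
     Sto 2 (Va 10) (Va 11) ;;
     Ite (Lt (Va 10) (Co 64)) (RAsg 0 (RAr 0 (Va 10))) (RRawLd 0 (Va 10)) ;;
     RSto 1 (Va 10) (RV 0))"

definition rows :: cmd where
  "rows = Asg 11 (Co 0) ;; For 10 (Va 0) (Sto 3 (Va 10) (Va 11) ;; Asg 11 (Add (Va 11) (Va 0)))"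

definition tree_find :: cmd where
  "tree_find = For 10 (Va 1) (Ite (Neq (Ar 4 (Ar 1 (Va 10))) (Ar 4 (Ar 2 (Va 10)))) (Asg 13 (Va 10)) Skip)"

definition tree_add :: cmd where
  "tree_add =
     Ite (Ar 4 (Ar 1 (Va 13))) (Asg 14 (Ar 1 (Va 13)) ;; Asg 15 (Ar 2 (Va 13)))
       (Asg 14 (Ar 2 (Va 13)) ;; Asg 15 (Ar 1 (Va 13))) ;;
     Sto 5 (Va 12) (Va 14) ;; Sto 6 (Va 12) (Va 15) ;; Sto 7 (Va 12) (Va 13) ;; Sto 4 (Va 15) (Co 1)"

definition tree :: cmd where
  "tree = Sto 4 (Co 0) (Co 1) ;; For 12 (Sub (Va 0) (Co 1)) (tree_find ;; tree_add)"

text \<open>Array 11 is a table indexed by pairs of representatives that is never cleared. An entry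
  is trusted only if it names an earlier edge whose key, kept in array 9, is the same. Stale entries
  are therefore harmless, and no query pays for clearing \<open>n^2\<close> cells.\<close>

definition build_edge :: cmd where
  "build_edge =
   Asg 30 (Ar 8 (Ar 1 (Va 10))) ;; Asg 31 (Ar 8 (Ar 2 (Va 10))) ;;
   Ite (Lt (Va 31) (Va 30)) (Asg 32 (Add (Ar 3 (Va 31)) (Va 30))) (Asg 32 (Add (Ar 3 (Va 30)) (Va 31))) ;;
   Sto 9 (Va 10) (Va 32) ;;
   Asg 33 (Ar 1 (Va 10)) ;; Asg 34 (Ar 2 (Va 10)) ;; RAsg 2 (RC 0) ;;
   Ite (Neq (Va 30) (Va 31)) (
      Asg 35 (Ar 11 (Va 32)) ;;
      Asg 36 (Va 10) ;;
      Ite (Lt (Va 35) (Va 10)) (Ite (Eq (Ar 9 (Va 35)) (Va 32)) (Asg 36 (Va 35)) Skip) Skip ;;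
      Sto 10 (Va 10) (Va 36) ;;
      Ite (Lt (Va 36) (Va 10))
        (RSto 20 (Va 36) (RPlus (RAr 20 (Va 36)) (RAr 1 (Va 10))) ;;
         Ite (Eq (Va 30) (Va 33))
           (Ite (Eq (Va 31) (Va 34)) (Asg 33 (Ar 1 (Va 36)) ;; Asg 34 (Ar 2 (Va 36))) Skip) Skip)
        (Sto 11 (Va 32) (Va 10) ;; RAsg 2 (RAr 1 (Va 10)) ;; Asg 33 (Va 30) ;; Asg 34 (Va 31)))
     Skip ;;
   wrR (Va 10) (RV 2) ;;
   wrN (Add (Co 4) (Add (Va 10) (Va 10))) (Va 33) ;; wrN (Add (Co 5) (Add (Va 10) (Va 10))) (Va 34)"

definition build :: cmd where
  "build = Asg 22 (Add (Va 22) (Co 1)) ;;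
     wrN (Co 0) (Va 0) ;; wrN (Co 1) (Va 1) ;; wrN (Co 2) (Va 20) ;; wrN (Co 3) (Va 21) ;;
     For 10 (Va 1) build_edge"

text \<open>An edge inside a class never crosses; any other edge crosses iff the first edge of its
  class does, whose bit is in the simulated output. Along the tree, a child is on the other side
  than its parent iff the tree edge crosses.\<close>

definition decode :: cmd where
  "decode = Sto 12 (Co 0) (Co 0) ;; For 12 (Sub (Va 0) (Co 1)) (
     Asg 13 (Ar 7 (Va 12)) ;; Asg 14 (Co 0) ;;
     Ite (Neq (Ar 8 (Ar 1 (Va 13))) (Ar 8 (Ar 2 (Va 13)))) (Asg 14 (Ar 24 (Ar 10 (Va 13)))) Skip ;;
     Sto 12 (Ar 6 (Va 12)) (Neq (Ar 12 (Ar 5 (Va 12))) (Va 14)))"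

text \<open>The simulated program returns a cut but no weight, so the weight is computed from the
  sides of the vertices and the original edges.\<close>

definition cutval :: cmd where
  "cutval = RAsg 1 (RC 0) ;; For 10 (Va 1) (
     Ite (Neq (Ar 12 (Ar 1 (Va 10))) (Ar 12 (Ar 2 (Va 10)))) (RAsg 1 (RPlus (RV 1) (RAr 1 (Va 10)))) Skip)"

definition query :: "program \<Rightarrow> cmd" where
  "query P = build ;; sim P ;; decode ;; cutval"

lemma run_halted: "t \<le> t' \<Longrightarrow> halted P (run P x t) \<Longrightarrow> run P x t' = run P x t"
proof (induction t' rule: dec_induct)
  case (step k)
  then show ?case using run_add[of P x k 1] by (simp add: step_def)
qed simp

section \<open>Reading the input, growing a spanning tree, and legality of contracted
  queries\<close>

context connected_wgraph
begin

text \<open>The tree is rooted at vertex 0; edge \<open>te j\<close> attaches the child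
  \<open>tc j\<close> to a vertex \<open>tp j\<close> reached before.\<close>

definition tree_ok :: "(nat \<Rightarrow> nat) \<Rightarrow> (nat \<Rightarrow> nat) \<Rightarrow> (nat \<Rightarrow> nat) \<Rightarrow> bool" where
  "tree_ok tp tc te \<longleftrightarrow> (\<forall>j<n-1. te j < m \<and> {tp j, tc j} = {ea (te j), eb (te j)} \<and>
     tp j \<in> insert 0 (tc ` {..<j})) \<and> insert 0 (tc ` {..<n-1}) = {..<n}"

definition env :: "hstate \<Rightarrow> bool" where
  "env s \<longleftrightarrow> sc s 0 = n \<and> sc s 1 = m \<and> (\<forall>e<m. ar s 1 e = ea e \<and> ar s 2 e = eb e \<and> ra s 1 e = wt e) \<and>
    (\<forall>i<n. ar s 3 i = i * n) \<and> tree_ok (ar s 5) (ar s 6) (ar s 7)"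

lemma env_frm:
  assumes "frm c s t" "0 \<notin> wsc c" "1 \<notin> wsc c" "1 \<notin> war c" "2 \<notin> war c" "3 \<notin> war c" "5 \<notin> war c"
    "6 \<notin> war c" "7 \<notin> war c" "1 \<notin> wra c" "env s"
  shows "env t"
proof -
  have "sc t 0 = sc s 0" "sc t 1 = sc s 1" "ar t 1 = ar s 1" "ar t 2 = ar s 2" "ar t 3 = ar s 3"
    "ar t 5 = ar s 5" "ar t 6 = ar s 6" "ar t 7 = ar s 7" "ra t 1 = ra s 1"
    using assms unfolding frm_def by blast+
  then show ?thesis using assms(11) unfolding env_def by metis
qed

lemma m_pos: "0 < m"
proof -
  have "{0} \<noteq> {..<n}"
  proof
    assume "{0} = {..<n}"
    then have "1 \<notin> {..<n}" by force
    then show False using two by simp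
  qed
  then show ?thesis using conn[of "{0}"] two by auto
qed

lemma copyin_correct:
  assumes i: "inited x n m s"
    and x: "\<And>e. e < m \<Longrightarrow> fst x ! (2 * e + 2) = ea e \<and> fst x ! (2 * e + 3) = eb e \<and> snd x ! e = wt e"
  shows "wp copyin (\<lambda>t. (\<forall>e<m. ar t 1 e = ea e \<and> ar t 2 e = eb e \<and> ra t 1 e = wt e) \<and>
    tk t \<le> tk s + m * 20 + 2) s"
  unfolding copyin_def
proof (rule wp_mono[OF wp_For[where N = m and B = 17 and
        J = "\<lambda>i t. \<forall>e<i. ar t 1 e = ea e \<and> ar t 2 e = eb e \<and> ra t 1 e = wt e"]], goal_cases)
  case (2 i t)
  then show ?case using i by (simp add: frm_def inited_def)
next
  case (4 e t)
  have t: "ar t 0 = ar s 0" "raw t = raw s" "bas t = bas s" "ra t 0 = ra s 0" "rraw t = rraw s"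
    using 4(4) by (simp_all add: frm_def)
  have h: "\<forall>j<2*m. if j < 126 then ar s 0 j = fst x ! (j + 2) else raw s (j + 2) = fst x ! (j + 2)"
      "\<forall>e<m. if e < 64 then ra s 0 e = snd x ! e else rraw s e = snd x ! e" "2 * m + 128 < bas s"
    using i unfolding inited_def by blast+
  have lt: "e + e < 2 * m" "e + e + 1 < 2 * m" using 4(1) by simp_all
  have x1: "fst x ! (e + e + 2) = ea e" "fst x ! (e + e + 1 + 2) = eb e" "snd x ! e = wt e"
    using x[OF 4(1)] by (simp_all add: mult_2 numeral_3_eq_3)
  have j1: "if e + e < 126 then ar s 0 (e + e) = ea e else raw s (e + e + 2) = ea e"
    using h(1)[rule_format, OF lt(1)] unfolding x1 .
  have j2: "if e + e + 1 < 126 then ar s 0 (e + e + 1) = eb e else raw s (e + e + 3) = eb e"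
  proof -
    have "e + e + 1 + 2 = e + e + 3" by simp
    from h(1)[rule_format, OF lt(2), unfolded x1, unfolded this] show ?thesis .
  qed
  have j3: "if e < 64 then ra s 0 e = wt e else rraw s e = wt e"
    using h(2)[rule_format, OF 4(1)] unfolding x1 .
  have b: "e + e + 3 < bas s" using h(3) 4(1) by simp
  show ?case
  \<comment> \<open>The ends of edge 63 have indices 126 and 127 and are the first to be read from
    their original cells, while its weight is still among the 64 saved ones.\<close>
  proof (cases "e < 63")
    case True
    then have "ar s 0 (e + e) = ea e" "ar s 0 (Suc (e + e)) = eb e" "ra s 0 e = wt e"
      using j1 j2 j3 by auto
    then show ?thesis using True t 4(2,3) by (simp add: less_Suc_eq)
  next
    case False
    then have "raw s (e + e + 2) = ea e" "raw s (e + e + 3) = eb e" using j1 j2 by auto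
    then show ?thesis using False t 4(2,3) b j3
      by (cases "e < 64") (simp_all add: less_Suc_eq)
  qed
qed auto

lemma rows_correct:
  assumes "sc s 0 = n"
  shows "wp rows (\<lambda>t. (\<forall>i<n. ar t 3 i = i * n) \<and> tk t \<le> tk s + n * 6 + 4) s"
  unfolding rows_def wp_simps
proof (rule wp_mono[OF wp_For[where N = n and B = 3 and
        J = "\<lambda>i t. (\<forall>j<i. ar t 3 j = j * n) \<and> sc t 11 = i * n"]], goal_cases)
  case (2 i t)
  then show ?case using assms by (simp add: frm_def)
next
  case (4 i t)
  have "sc t 0 = n" using 4(4) assms by (simp add: frm_def)
  then show ?case using 4 by (simp add: less_Suc_eq)
qed auto

lemma tree_find_correct:
  assumes "sc s 1 = m" "\<And>e. e < m \<Longrightarrow> ar s 1 e = ea e \<and> ar s 2 e = eb e"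
    and v: "\<And>y. y < n \<Longrightarrow> ar s 4 y = of_bool (y \<in> S)" and ex: "\<exists>e<m. crosses S e"
  shows "wp tree_find (\<lambda>t. sc t 13 < m \<and> crosses S (sc t 13) \<and> tk t \<le> tk s + m * 6 + 2) s"
  unfolding tree_find_def
proof (rule wp_mono[OF wp_For[where N = m and B = 3 and
        J = "\<lambda>i t. (\<exists>e<i. crosses S e) \<longrightarrow> sc t 13 < m \<and> crosses S (sc t 13)"]], goal_cases)
  case (2 i t)
  then show ?case using assms(1) by (simp add: frm_def)
next
  case (4 e t)
  have t: "ar t 1 = ar s 1" "ar t 2 = ar s 2" "ar t 4 = ar s 4" using 4(4) by (simp_all add: frm_def)
  have a: "ar s 1 e = ea e" "ar s 2 e = eb e" "ar s 4 (ea e) = of_bool (ea e \<in> S)" "ar s 4 (eb e) = of_bool (eb e \<in> S)"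
    using assms(2)[OF 4(1)] v ends[OF 4(1)] by auto
  show ?case using t a 4(1-3) by (auto simp: less_Suc_eq)
next
  case (6 t)
  then show ?case using ex by simp
qed auto

text \<open>After \<open>j\<close> rounds the set \<open>S\<close> of reached vertices has
  \<open>j + 1\<close> elements. As long as it is proper, connectivity supplies a crossing edge, and
  its outer end is attached.\<close>

lemma tree_correct:
  assumes "sc s 0 = n" "sc s 1 = m" "\<And>e. e < m \<Longrightarrow> ar s 1 e = ea e \<and> ar s 2 e = eb e" "ar s 4 = (\<lambda>_. 0)"
  shows "wp tree (\<lambda>t. tree_ok (ar t 5) (ar t 6) (ar t 7) \<and> tk t \<le> tk s + n * (m * 6 + 20) + 4) s"
  unfolding tree_def wp_simps(9) wp_simps(3)
proof (rule wp_mono[OF wp_For[where N = "n - 1" and B = "m * 6 + 16" and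
        J = "\<lambda>j t. let S = insert 0 (ar t 6 ` {..<j}) in S \<subseteq> {..<n} \<and> card S = Suc j \<and>
          (\<forall>y<n. ar t 4 y = of_bool (y \<in> S)) \<and> (\<forall>i<j. ar t 7 i < m \<and>
            {ar t 5 i, ar t 6 i} = {ea (ar t 7 i), eb (ar t 7 i)} \<and> ar t 5 i \<in> insert 0 (ar t 6 ` {..<i}))"]], goal_cases)
  case 1
  show ?case using assms two by (auto simp: Let_def)
next
  case (2 i t)
  then show ?case using assms(1) by (simp add: frm_def tree_find_def tree_add_def)
next
  case 3
  show ?case by (simp add: tree_find_def tree_add_def)
next
  case (4 j t)
  define S where "S = insert 0 (ar t 6 ` {..<j})"
  have J: "S \<subseteq> {..<n}" "card S = Suc j" "\<And>y. y < n \<Longrightarrow> ar t 4 y = of_bool (y \<in> S)"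
    "\<And>i. i < j \<Longrightarrow> ar t 7 i < m \<and> {ar t 5 i, ar t 6 i} = {ea (ar t 7 i), eb (ar t 7 i)} \<and>
       ar t 5 i \<in> insert 0 (ar t 6 ` {..<i})"
    using 4(2) unfolding S_def Let_def by auto
  have t: "sc t 1 = m" "\<And>e. e < m \<Longrightarrow> ar t 1 e = ea e \<and> ar t 2 e = eb e"
    using 4(4) assms by (simp_all add: frm_def tree_find_def tree_add_def)
  have "S \<noteq> {..<n}" using J(2) 4(1) by auto
  then have ex: "\<exists>e<m. crosses S e" using conn[OF J(1)] by (auto simp: S_def)
  have tf: "wp tree_find (\<lambda>u. sc u 13 < m \<and> crosses S (sc u 13) \<and> tk u \<le> tk t + m * 6 + 2) t"
    by (rule tree_find_correct) (use t J(3) ex in auto)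
  show ?case unfolding wp_simps(9)
  proof (rule wp_conseq[OF tf], goal_cases)
    case (1 t')
    define f where "f = sc t' 13"
    have f: "f < m" "crosses S f" "tk t' \<le> tk t + m * 6 + 2" using 1 by (auto simp: f_def)
    have ft: "\<And>k. ar t' k = ar t k" "sc t' 12 = j"
      using 1(2) 4(3) by (simp_all add: frm_def tree_find_def)
    have ef: "ea f < n" "eb f < n" "ar t 1 f = ea f" "ar t 2 f = eb f" using ends[OF f(1)] t(2)[OF f(1)] by auto
    define p q where "p = (if ea f \<in> S then ea f else eb f)" and "q = (if ea f \<in> S then eb f else ea f)"
    have pq: "p \<in> S" "q \<notin> S" "q < n" "{p, q} = {ea f, eb f}" using f(2) ef by (auto simp: p_def q_def)
    have finS: "finite S" using J(1) finite_subset by blast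
    have img: "insert 0 ((ar t 6)(j := q) ` {..<Suc j}) = insert q S"
      by (auto simp: S_def lessThan_Suc)
    have img2: "insert 0 ((ar t 6)(j := q) ` {..<i}) = insert 0 (ar t 6 ` {..<i})" if "i \<le> j" for i
      using that by auto
    have fin: "wp tree_add (\<lambda>u. ar u 5 = (ar t 5)(j := p) \<and> ar u 6 = (ar t 6)(j := q) \<and>
        ar u 7 = (ar t 7)(j := f) \<and> ar u 4 = (ar t 4)(q := 1) \<and> tk u \<le> tk t' + 12) t'"
      using ft ef J(3)[of "ea f"] J(3)[of "eb f"] f(2)
      by (simp add: tree_add_def f_def[symmetric] p_def q_def)
    show ?case
    proof (rule wp_mono[OF fin], goal_cases)
      case (1 u)
      have "{ar u 5 i, ar u 6 i} = {ea (ar u 7 i), eb (ar u 7 i)} \<and> ar u 7 i < m \<and>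
          ar u 5 i \<in> insert 0 (ar u 6 ` {..<i})" if "i < Suc j" for i
      proof (cases "i = j")
        case True
        then show ?thesis using 1 pq(1,4) f(1) img2[of j] by (simp add: S_def)
      next
        case False
        then show ?thesis using 1 J(4)[of i] img2[of i] that by (simp del: image_insert)
      qed
      moreover have "card (insert q S) = Suc (Suc j)" using J(2) pq(2) finS by simp
      moreover have "insert q S \<subseteq> {..<n}" using J(1) pq by auto
      moreover have "\<forall>y<n. ar u 4 y = of_bool (y \<in> insert q S)" using 1 J(3) by auto
      ultimately show ?case using 1 f(3) unfolding Let_def by (simp only: img) auto
    qed
  qed
next
  case (5 i t v a b)
  then show ?case by (simp add: Let_def)
next
  case (6 t)
  let ?S = "insert 0 (ar t 6 ` {..<n-1})"
  have "?S \<subseteq> {..<n}" "card ?S = n" using 6 two by (auto simp: Let_def)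
  then have "?S = {..<n}" by (intro card_subset_eq) auto
  moreover have "(n - 1) * (m * 6 + 16 + 3) \<le> n * (m * 6 + 20)" by (intro mult_le_mono) auto
  ultimately show ?case using 6 by (auto simp: tree_ok_def Let_def)
qed

text \<open>The unordered pair of representatives as a number below \<open>n^2\<close>, which serves
  as table index; the machine takes the product from array 3.\<close>

definition kn :: "(nat \<Rightarrow> nat) \<Rightarrow> nat \<Rightarrow> nat" where
  "kn r e = (if r (eb e) < r (ea e) then r (eb e) * n + r (ea e) else r (ea e) * n + r (eb e))"

lemma kn_eq:
  assumes r: "repr r" and e: "e < m" "e' < m"
  shows "kn r e = kn r e' \<longleftrightarrow> key r e = key r e'"
proof -
  have k: "kn r e = min (r (ea e)) (r (eb e)) * n + max (r (ea e)) (r (eb e))" for e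
    by (auto simp: kn_def min_def max_def)
  have lt: "r (ea e) < n" "r (eb e) < n" if "e < m" for e using r ends[OF that] by (auto simp: repr_def)
  have dm: "kn r e div n = min (r (ea e)) (r (eb e))" "kn r e mod n = max (r (ea e)) (r (eb e))" if "e < m" for e
    using lt[OF that] by (simp_all add: k)
  show ?thesis
  proof
    assume "kn r e = kn r e'"
    then have "min (r (ea e)) (r (eb e)) = min (r (ea e')) (r (eb e'))"
      "max (r (ea e)) (r (eb e)) = max (r (ea e')) (r (eb e'))" using dm e by metis+
    then show "key r e = key r e'" by (auto simp: key_def min_def max_def doubleton_eq_iff split: if_splits)
  next
    assume "key r e = key r e'"
    then show "kn r e = kn r e'" by (auto simp: k key_def doubleton_eq_iff min.commute max.commute)
  qed
qed

text \<open>The contracted edges form a simple graph with the same \<open>n\<close> and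
  \<open>m\<close>, so the promise about \<open>P\<close> applies with the bound
  \<open>\<phi> n m\<close>. \<open>T\<close> is the first halting time, at which the simulation
  loop stops.\<close>

lemma min_cut_call:
  assumes P: "min_st_cut_program P \<phi>" and r: "repr r" and st: "s < n" "t < n" "s \<noteq> t"
    and x: "x = (n # m # s # t # encode_edges (map (cends r) [0..<m]), map (cwt r m) [0..<m])"
  shows "\<exists>X T. sep s t X \<and> (\<forall>Y. sep s t Y \<longrightarrow>
      wgraph.d m (fst \<circ> cends r) (snd \<circ> cends r) (cwt r m) X \<le>
      wgraph.d m (fst \<circ> cends r) (snd \<circ> cends r) (cwt r m) Y) \<and>
    halted P (run P x T) \<and> (\<forall>t<T. \<not> halted P (run P x t)) \<and> T \<le> \<phi> n m \<and>
    tape (run P x T) = map (\<lambda>i. of_bool ((fst (cends r i) \<in> X) \<noteq> (snd (cends r i) \<in> X))) [0..<m]"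
proof -
  interpret c: wgraph n m "fst \<circ> cends r" "snd \<circ> cends r" "cwt r m" by (rule wgraph_contracted[OF r])
  let ?es = "map (cends r) [0..<m]"
  let ?f = "\<lambda>i. {(fst \<circ> cends r) i, (snd \<circ> cends r) i}"
  \<comment> \<open>The promise speaks of weights of vertex pairs, the contraction of weights of
    indices; distinctness of the contracted edges allows the translation.\<close>
  define w' where "w' e = cwt r m (inv_into {..<m} ?f e)" for e
  have inj: "inj_on ?f {..<m}" using c.simple by (auto simp: inj_on_def)
  have w': "w' (?f i) = cwt r m i" if "i < m" for i
    unfolding w'_def using inv_into_f_f[OF inj] that by simp
  have sete: "(\<lambda>(u, v). {u, v}) \<circ> cends r = ?f" by (auto simp: fun_eq_iff case_prod_beta)
  have m1: "map (\<lambda>(u, v). {u, v}) ?es = map ?f [0..<m]" by (simp add: sete)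
  have el: "edge_list c.edges ?es"
    unfolding edge_list_def m1 using inj by (auto simp: distinct_map c.edges_def atLeast0LessThan)
  have ug: "ugraph {..<n} c.edges"
    unfolding ugraph_def c.edges_def using c.ends by (auto simp: card_2_iff)
  have nn: "\<forall>e\<in>c.edges. 0 \<le> w' e" using c.wt_nonneg w' by (auto simp: c.edges_def)
  have ce: "card c.edges = m" unfolding c.edges_def using card_image[OF inj] by simp
  have xe: "st_graph_input n ?es w' s t = x"
  proof -
    have "encode_weights w' ?es = map (cwt r m) [0..<m]"
      unfolding encode_weights_def using w' by (auto simp: case_prod_beta)
    then show ?thesis unfolding st_graph_input_def x by simp
  qed
  have "ugraph {..<n} c.edges \<and> (\<forall>e\<in>c.edges. 0 \<le> w' e) \<and> edge_list c.edges ?es \<and> s < n \<and> t < n \<and> s \<noteq> t"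
    using ug nn el st by blast
  then obtain Cc where C: "is_min_st_cut {..<n} c.edges w' s t Cc" "halts_with_output P x (encode_cut ?es Cc)"
    and ht: "halt_time P x \<le> \<phi> n m"
    using P[unfolded min_st_cut_program_def, rule_format, of n c.edges w' ?es s t] unfolding xe ce by blast
  obtain X where X: "X \<subseteq> {..<n}" "s \<in> X" "t \<in> {..<n} - X" "Cc = c.cut X"
    using C(1) by (auto simp: is_min_st_cut_def is_st_cut_def)
  have mini: "c.d X \<le> c.d Y" if Y: "sep s t Y" for Y
  proof -
    have "is_st_cut {..<n} c.edges s t (c.cut Y)" using Y st by (auto simp: is_st_cut_def sep_def)
    then show ?thesis using C(1) X(4) c.cut_weight_eq[of w', OF w'] by (auto simp: is_min_st_cut_def)
  qed
  define T where "T = halt_time P x"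
  obtain T' where T': "halted P (run P x T')" "tape (run P x T') = encode_cut ?es Cc"
    using C(2) by (auto simp: halts_with_output_def)
  have hT: "halted P (run P x T)" unfolding T_def halt_time_def using T'(1) by (rule LeastI)
  have fT: "\<forall>t<T. \<not> halted P (run P x t)" unfolding T_def halt_time_def using not_less_Least by blast
  have "T \<le> T'" unfolding T_def halt_time_def using T'(1) by (rule Least_le)
  then have tp: "tape (run P x T) = encode_cut ?es Cc" using run_halted[OF _ hT] T'(2) by metis
  have e: "encode_cut ?es Cc = map (\<lambda>i. of_bool ((fst (cends r i) \<in> X) \<noteq> (snd (cends r i) \<in> X))) [0..<m]"
    unfolding encode_cut_def using c.cut_iff[of _ X] X(4) by (auto simp: case_prod_beta)
  have sX: "sep s t X" using X by (auto simp: sep_def)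
  have TT: "T \<le> \<phi> n m" using ht by (simp add: T_def)
  show ?thesis
    by (intro exI[of _ X] exI[of _ T] conjI allI impI sX mini hT TT)
      (assumption, use fT in blast, use tp e in simp)
qed

end

lemma encode_edges_nth:
  "length (encode_edges es) = 2 * length es"
  "e < length es \<Longrightarrow> encode_edges es ! (e + e) = fst (es ! e)"
  "e < length es \<Longrightarrow> encode_edges es ! Suc (e + e) = snd (es ! e)"
proof -
  show "length (encode_edges es) = 2 * length es"
    by (induction es) (auto simp: encode_edges_def)
  have "e < length es \<Longrightarrow> encode_edges es ! (e + e) = fst (es ! e) \<and> encode_edges es ! Suc (e + e) = snd (es ! e)"
  proof (induction es arbitrary: e)
    case (Cons p es)
    then show ?case by (cases e) (auto simp: encode_edges_def case_prod_beta)
  qed simp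
  then show "e < length es \<Longrightarrow> encode_edges es ! (e + e) = fst (es ! e)"
    "e < length es \<Longrightarrow> encode_edges es ! Suc (e + e) = snd (es ! e)" by auto
qed

section \<open>Building the contracted instance and evaluating a query\<close>

context connected_wgraph
begin

text \<open>After \<open>i\<close> edges the weights are the partial sums \<open>cwt r i\<close>,
  and besides older stamps exactly the header and the cells of these edges carry the current
  one.\<close>

definition binv :: "(nat \<Rightarrow> nat) \<Rightarrow> nat \<Rightarrow> nat \<Rightarrow> hstate \<Rightarrow> nat \<Rightarrow> hstate \<Rightarrow> bool" where
  "binv r a b s0 i t \<longleftrightarrow> (\<forall>e<i. ar t 9 e = kn r e) \<and>
    (\<forall>e<i. r (ea e) \<noteq> r (eb e) \<longrightarrow> ar t 11 (kn r e) = lead r e \<and> ar t 10 e = lead r e) \<and>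
    (\<forall>e<i. ra t 20 e = cwt r i e) \<and>
    (\<forall>e<i. ar t 20 (4 + (e + e)) = fst (cends r e) \<and> ar t 20 (5 + (e + e)) = snd (cends r e)) \<and>
    (ar t 20 0 = n \<and> ar t 20 1 = m \<and> ar t 20 2 = a \<and> ar t 20 3 = b) \<and>
    (\<forall>x. ar t 21 x = (if x < 4 + (i + i) then sc s0 22 else ar s0 21 x)) \<and>
    (\<forall>x. ar t 23 x = (if x < i then sc s0 22 else ar s0 23 x))"

lemma binvD:
  assumes "binv r a b s0 i t"
  shows "\<And>e. e < i \<Longrightarrow> ar t 9 e = kn r e"
    "\<And>e. e < i \<Longrightarrow> r (ea e) \<noteq> r (eb e) \<Longrightarrow> ar t 11 (kn r e) = lead r e"
    "\<And>e. e < i \<Longrightarrow> r (ea e) \<noteq> r (eb e) \<Longrightarrow> ar t 10 e = lead r e"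
    "\<And>e. e < i \<Longrightarrow> ra t 20 e = cwt r i e"
    "\<And>e. e < i \<Longrightarrow> ar t 20 (4 + (e + e)) = fst (cends r e)"
    "\<And>e. e < i \<Longrightarrow> ar t 20 (5 + (e + e)) = snd (cends r e)"
    "ar t 20 0 = n" "ar t 20 1 = m" "ar t 20 2 = a" "ar t 20 3 = b"
    "\<And>x. ar t 21 x = (if x < 4 + (i + i) then sc s0 22 else ar s0 21 x)"
    "\<And>x. ar t 23 x = (if x < i then sc s0 22 else ar s0 23 x)"
  using assms unfolding binv_def by blast+

text \<open>The effect of one pass as a relation between arrays. It separates the symbolic execution
  of the code from the combinatorial argument that the invariant is kept.\<close>

definition beff :: "(nat \<Rightarrow> nat) \<Rightarrow> nat \<Rightarrow> hstate \<Rightarrow> hstate \<Rightarrow> bool" where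
  "beff r i t u \<longleftrightarrow> ar u 9 = (ar t 9)(i := kn r i) \<and>
    ar u 20 = (ar t 20)(4 + (i + i) := fst (cends r i), 5 + (i + i) := snd (cends r i)) \<and>
    ar u 21 = (ar t 21)(4 + (i + i) := sc t 22, 5 + (i + i) := sc t 22) \<and>
    ar u 23 = (ar t 23)(i := sc t 22) \<and>
    (if r (ea i) = r (eb i) then ar u 10 = ar t 10 \<and> ar u 11 = ar t 11 \<and> ra u 20 = (ra t 20)(i := 0)
     else if lead r i < i then ar u 10 = (ar t 10)(i := lead r i) \<and> ar u 11 = ar t 11 \<and>
       ra u 20 = (ra t 20)(lead r i := ra t 20 (lead r i) + wt i, i := 0)
     else ar u 10 = (ar t 10)(i := i) \<and> ar u 11 = (ar t 11)(kn r i := i) \<and> ra u 20 = (ra t 20)(i := wt i))"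

text \<open>Three cases: an edge inside a class; a repetition, whose table entry the invariant
  confirms; and the first edge of a class, for which no earlier edge has the same key.\<close>

lemma build_edge_effect:
  assumes env: "env t" and r: "repr r" "ar t 8 = r" and inv: "binv r a b s0 i t" and i: "sc t 10 = i" "i < m"
  shows "wp build_edge (\<lambda>u. beff r i t u \<and> tk u \<le> tk t + 40) t"
proof -
  have ti: "ar t 1 i = ea i" "ar t 2 i = eb i" "ra t 1 i = wt i" using env i(2) by (auto simp: env_def)
  have rl: "r (ea i) < n" "r (eb i) < n" using r(1) ends[OF i(2)] by (auto simp: repr_def)
  have row: "ar t 3 (r (ea i)) = r (ea i) * n" "ar t 3 (r (eb i)) = r (eb i) * n"
    using env rl by (auto simp: env_def)
  have kni: "(if r (eb i) < r (ea i) then r (eb i) * n + r (ea i) else r (ea i) * n + r (eb i)) = kn r i"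
    by (simp add: kn_def)
  consider (int) "r (ea i) = r (eb i)" | (dup) "r (ea i) \<noteq> r (eb i)" "lead r i < i" | (new) "r (ea i) \<noteq> r (eb i)" "lead r i = i"
    using lead_le[of r i] by fastforce
  then show ?thesis
  proof cases
    case int
    then have c: "cends r i = (ea i, eb i)" "kn r i = r (ea i) * n + r (eb i)" by (simp_all add: cends_def kn_def)
    show ?thesis using int c ti row i(1) r(2)
      by (simp add: build_edge_def wrN_def wrR_def beff_def)
  next
    case dup
    define l where "l = lead r i"
    have l: "l < i" "l < m" using dup i(2) by (auto simp: l_def)
    have kl: "key r l = key r i" by (simp add: l_def lead_key)
    have knl: "kn r l = kn r i" using kn_eq[OF r(1) l(2) i(2)] kl by simp
    have nl: "r (ea l) \<noteq> r (eb l)" using key_internal[OF kl] dup(1) by blast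
    have look: "ar t 11 (kn r i) = l" "ar t 9 l = kn r i"
      using binvD(2)[OF inv l(1) nl] binvD(1)[OF inv l(1)] lead_lead[of r i] knl by (simp_all add: l_def)
    have tl: "ar t 1 l = ea l" "ar t 2 l = eb l" using env l(2) by (auto simp: env_def)
    have c: "cends r i = (if r (ea i) = ea i \<and> r (eb i) = eb i then (ea l, eb l) else (ea i, eb i))"
      using dup l by (simp add: cends_def l_def)
    have k2: "r (eb i) < r (ea i) \<Longrightarrow> kn r i = r (eb i) * n + r (ea i)"
      "\<not> r (eb i) < r (ea i) \<Longrightarrow> kn r i = r (ea i) * n + r (eb i)" by (simp_all add: kn_def)
    show ?thesis
      using dup c ti tl row i(1) r(2) l(1) look
      by (cases "r (eb i) < r (ea i)"; cases "r (ea i) = ea i"; cases "r (eb i) = eb i")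
        (simp_all add: build_edge_def wrN_def wrR_def beff_def k2 l_def[symmetric])
  next
    case new
    \<comment> \<open>Whatever the table holds at this key, possibly left over from an earlier
      contraction; the comparison with array 9 rejects it.\<close>
    define q where "q = ar t 11 (kn r i)"
    have nq: "ar t 9 q \<noteq> kn r i" if "q < i"
    proof
      assume a: "ar t 9 q = kn r i"
      have "kn r q = kn r i" using binvD(1)[OF inv that] a by simp
      then have "key r q = key r i" using kn_eq[OF r(1), of q i] that i(2) by simp
      then have "lead r i = lead r q" using lead_cong by metis
      then show False using lead_le[of r q] new(2) that by simp
    qed
    have c: "cends r i = (r (ea i), r (eb i))" using new by (simp add: cends_def)
    have k2: "r (eb i) < r (ea i) \<Longrightarrow> kn r i = r (eb i) * n + r (ea i)"
      "\<not> r (eb i) < r (ea i) \<Longrightarrow> kn r i = r (ea i) * n + r (eb i)" by (simp_all add: kn_def)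
    have q': "ar t 11 (r (eb i) * n + r (ea i)) = q" if "r (eb i) < r (ea i)"
      using that k2 by (simp add: q_def)
    have q'': "ar t 11 (r (ea i) * n + r (eb i)) = q" if "\<not> r (eb i) < r (ea i)"
      using that k2 by (simp add: q_def)
    show ?thesis
      using new c ti row i(1) r(2) nq
      by (cases "r (eb i) < r (ea i)"; cases "q < i")
        (simp_all add: build_edge_def wrN_def wrR_def beff_def k2 q' q'')
  qed
qed

text \<open>Reading edge \<open>i\<close> changes the partial sums only at \<open>lead r i\<close>,
  and a first edge of a class starts from an empty sum because every \<open>lead\<close> is at most
  its edge.\<close>

lemma binv_step:
  assumes inv: "binv r a b s0 i t" and e: "beff r i t u" and v: "sc t 22 = sc s0 22" and i: "i < m"
    and r: "repr r"
  shows "binv r a b s0 (Suc i) u"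
proof -
  note D = binvD[OF inv]
  have E: "ar u 9 = (ar t 9)(i := kn r i)"
    "ar u 20 = (ar t 20)(4 + (i + i) := fst (cends r i), 5 + (i + i) := snd (cends r i))"
    "ar u 21 = (ar t 21)(4 + (i + i) := sc t 22, 5 + (i + i) := sc t 22)"
    "ar u 23 = (ar t 23)(i := sc t 22)" using e unfolding beff_def by blast+
  have 1: "ar u 9 e = kn r e" if "e < Suc i" for e using that D(1) E(1) by (auto simp: less_Suc_eq)
  have 2: "ar u 11 (kn r e) = lead r e \<and> ar u 10 e = lead r e" if e': "e < Suc i" "r (ea e) \<noteq> r (eb e)" for e
  proof (cases "r (ea i) = r (eb i)")
    case True
    then have "e < i" using e' by (auto simp: less_Suc_eq)
    then show ?thesis using D(2,3) e' e True by (auto simp: beff_def)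
  next
    case False
    show ?thesis
    proof (cases "lead r i < i")
      case True
      have U: "ar u 10 = (ar t 10)(i := lead r i)" "ar u 11 = ar t 11" using e False True by (auto simp: beff_def)
      show ?thesis
      proof (cases "e = i")
        case True
        let ?l = "lead r i"
        have l: "?l < i" "?l < m" "r (ea ?l) \<noteq> r (eb ?l)"
          using \<open>lead r i < i\<close> i key_internal[OF lead_key[of r i]] False by auto
        have "kn r ?l = kn r i" using kn_eq[OF r l(2) i] lead_key by simp
        then show ?thesis using D(2)[OF l(1,3)] U True lead_lead[of r i] by simp
      next
        case ne: False
        then show ?thesis using D(2,3)[of e] e' U by auto
      qed
    next
      case new: False
      then have li: "lead r i = i" using lead_le[of r i] by simp
      have U: "ar u 10 = (ar t 10)(i := i)" "ar u 11 = (ar t 11)(kn r i := i)"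
        using e False new by (auto simp: beff_def)
      show ?thesis
      proof (cases "e = i")
        case True then show ?thesis using U li by simp
      next
        case ne: False
        then have ei: "e < i" using e' by simp
        have "kn r e \<noteq> kn r i"
        proof
          assume "kn r e = kn r i"
          then have "key r e = key r i" using kn_eq[OF r, of e i] ei i by simp
          then have "lead r i = lead r e" using lead_cong by metis
          then show False using lead_le[of r e] li ei by simp
        qed
        then show ?thesis using D(2,3)[OF ei e'(2)] U ei by simp
      qed
    qed
  qed
  have 3: "ra u 20 e = cwt r (Suc i) e" if e': "e < Suc i" for e
  proof -
    have lead_ne: "lead r j \<noteq> i" if "j < i" for j using lead_le[of r j] that by simp
    have lti: "(\<Sum>j<i. if lead r j = i then wt j else 0) = 0" using lead_ne by (intro sum.neutral) auto
    have ci: "cwt r (Suc i) i = (if r (ea i) = r (eb i) \<or> lead r i \<noteq> i then 0 else wt i)"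
      using lti by (auto simp: cwt_def)
    have ce: "cwt r (Suc i) e = cwt r i e + (if r (ea e) = r (eb e) \<or> lead r e \<noteq> e \<or> lead r i \<noteq> e then 0 else wt i)"
      by (auto simp: cwt_def)
    show ?thesis
    proof (cases "e = i")
      case True
      then show ?thesis using e ci lead_le[of r i] by (auto simp: beff_def split: if_splits)
    next
      case ne: False
      then have ei: "e < i" using e' by simp
      show ?thesis
      proof (cases "lead r i = e")
        case True
        then have "key r e = key r i" "lead r e = e" using lead_key lead_lead by metis+
        then have "r (ea e) = r (eb e) \<longleftrightarrow> r (ea i) = r (eb i)" using key_internal by metis
        then show ?thesis using D(4)[OF ei] e ce True \<open>lead r e = e\<close> ei by (auto simp: beff_def split: if_splits)
      next
        case F: False
        have "ra u 20 e = ra t 20 e" using e ne F by (auto simp: beff_def split: if_splits)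
        then show ?thesis using D(4)[OF ei] ce F by simp
      qed
    qed
  qed
  have 4: "ar u 20 (4 + (e + e)) = fst (cends r e) \<and> ar u 20 (5 + (e + e)) = snd (cends r e)" if "e < Suc i" for e
  proof (cases "e = i")
    case True then show ?thesis using E(2) by simp
  next
    case False
    then have "e < i" using that by simp
    moreover have "4 + (e + e) \<noteq> 5 + (i + i)" "5 + (e + e) \<noteq> 4 + (i + i)" by presburger+
    ultimately show ?thesis using E(2) D(5,6)[of e] by simp
  qed
  have 6: "ar u 21 x = (if x < 4 + (Suc i + Suc i) then sc s0 22 else ar s0 21 x)" for x
    using E(3) D(11)[of x] v by auto
  have 7: "ar u 23 x = (if x < Suc i then sc s0 22 else ar s0 23 x)" for x
    using E(4) D(12)[of x] v by auto
  have 8: "ar u 20 0 = n" "ar u 20 1 = m" "ar u 20 2 = a" "ar u 20 3 = b" using D(7-10) E(2) by simp_all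
  show ?thesis unfolding binv_def using 1 2 3 4 6 7 8 by blast
qed

lemma build_edge_sets [simp]:
  "wsc build_edge = {30, 31, 32, 33, 34, 35, 36}" "war build_edge = {9, 10, 11, 20, 21, 23}"
  "wrs build_edge = {2}" "wra build_edge = {20}" "silent build_edge"
  by (auto simp: build_edge_def wrN_def wrR_def)

lemma build_sets [simp]:
  "wsc build = {10, 22, 30, 31, 32, 33, 34, 35, 36}" "war build = {9, 10, 11, 20, 21, 23}"
  "wrs build = {2}" "wra build = {20}" "silent build"
  by (auto simp: build_def wrN_def wrR_def)

text \<open>The cells stamped in this run hold the encoded input, and all others count as 0, exactly
  as in an initial configuration. Older stamps differ because the run number is raised before
  anything is written.\<close>

lemma build_correct:
  assumes env: "env s" and r: "repr r" "ar s 8 = r" and st: "stok s" and ab: "sc s 20 = a" "sc s 21 = b"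
    and x: "x = (n # m # a # b # encode_edges (map (cends r) [0..<m]), map (cwt r m) [0..<m])"
  shows "wp build (\<lambda>t. stok t \<and> pmN t = nmem (init_config x) \<and> pmR t = rmem (init_config x) \<and>
    (\<forall>e<m. r (ea e) \<noteq> r (eb e) \<longrightarrow> ar t 10 e = lead r e) \<and> tk t \<le> tk s + m * 43 + 20) s"
proof -
  have n1: "sc s 0 = n" "sc s 1 = m" using env by (simp_all add: env_def)
  have start: "wp (Asg 22 (Add (Va 22) (Co 1)) ;;
     wrN (Co 0) (Va 0) ;; wrN (Co 1) (Va 1) ;; wrN (Co 2) (Va 20) ;; wrN (Co 3) (Va 21))
     (\<lambda>t. sc t = (sc s)(22 := Suc (sc s 22)) \<and> (\<forall>k. k \<noteq> 20 \<and> k \<noteq> 21 \<longrightarrow> ar t k = ar s k) \<and> ra t = ra s \<and>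
       ar t 20 = (ar s 20)(0 := n, 1 := m, 2 := a, 3 := b) \<and>
       ar t 21 = (ar s 21)(0 := Suc (sc s 22), 1 := Suc (sc s 22), 2 := Suc (sc s 22), 3 := Suc (sc s 22)) \<and>
       tk t = tk s + 9) s"
    using n1 ab by (simp add: wrN_def)
  have split: "wp build q s = wp (Asg 22 (Add (Va 22) (Co 1)) ;;
     wrN (Co 0) (Va 0) ;; wrN (Co 1) (Va 1) ;; wrN (Co 2) (Va 20) ;; wrN (Co 3) (Va 21)) (wp (For 10 (Va 1) build_edge) q) s" for q
    by (simp add: build_def)
  show ?thesis unfolding split
  proof (rule wp_mono[OF start])
    fix s0 :: hstate assume s0: "sc s0 = (sc s)(22 := Suc (sc s 22)) \<and> (\<forall>k. k \<noteq> 20 \<and> k \<noteq> 21 \<longrightarrow> ar s0 k = ar s k) \<and> ra s0 = ra s \<and>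
       ar s0 20 = (ar s 20)(0 := n, 1 := m, 2 := a, 3 := b) \<and>
       ar s0 21 = (ar s 21)(0 := Suc (sc s 22), 1 := Suc (sc s 22), 2 := Suc (sc s 22), 3 := Suc (sc s 22)) \<and>
       tk s0 = tk s + 9"
    have env0: "env s0" using env s0 by (simp add: env_def)
    have small: "x < 4 \<longleftrightarrow> x = 0 \<or> x = 1 \<or> x = 2 \<or> x = (3::nat)" for x by auto
    have b0: "binv r a b s0 0 s0" using s0 by (auto simp: binv_def small)
    show "wp (For 10 (Va 1) build_edge) (\<lambda>t. stok t \<and> pmN t = nmem (init_config x) \<and> pmR t = rmem (init_config x) \<and>
      (\<forall>e<m. r (ea e) \<noteq> r (eb e) \<longrightarrow> ar t 10 e = lead r e) \<and> tk t \<le> tk s + m * 43 + 20) s0"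
    proof (rule wp_mono[OF wp_For[where N = m and B = 40 and J = "binv r a b s0"]], goal_cases)
      case 1 show ?case by (rule b0)
    next
      case (2 i t) then show ?case using s0 n1 by (simp add: frm_def)
    next
      case 3 show ?case by simp
    next
      case (4 i t)
      have et: "env t" using env_frm[OF 4(4) _ _ _ _ _ _ _ _ _ env0] by simp
      have t: "ar t 8 = r" "sc t 22 = sc s0 22" using 4(4) s0 r by (simp_all add: frm_def)
      show ?case
        by (rule wp_mono[OF build_edge_effect[OF et r(1) t(1) 4(2,3,1)]])
          (use binv_step[OF 4(2) _ t(2) 4(1) r(1)] in auto)
    next
      case (5 i t v y z) then show ?case by (simp add: binv_def)
    next
      case (6 t)
      note D = binvD[OF conjunct1[OF 6]]
      have v: "sc t 22 = sc s0 22" "sc s0 22 = Suc (sc s 22)" using 6 s0 by (simp_all add: frm_def)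
      have old: "ar s0 21 y \<le> sc s0 22" "ar s0 23 y \<le> sc s0 22" "4 \<le> y \<Longrightarrow> ar s0 21 y \<noteq> sc s0 22" "ar s0 23 y \<noteq> sc s0 22" for y
        using st s0 by (auto simp: stok_def le_SucI dest: spec[of _ y])
      have pmN: "pmN t y = nmem (init_config x) y" for y
      proof (cases "y < 4 + (m + m)")
        case True
        show ?thesis
        proof (cases "y < 4")
          case T4: True
          have h: "nmem (init_config x) 0 = n" "nmem (init_config x) 1 = m" "nmem (init_config x) 2 = a"
            "nmem (init_config x) 3 = b"
            by (simp_all add: x init_config_def load_def)
          have "ar t 20 y = nmem (init_config x) y" using T4 D(7-10) h unfolding small by metis
          then show ?thesis using D(11)[of y] True v(1) by (simp add: pmN_def)
        next
          case F4: False
          \<comment> \<open>Behind the header of four cells, cell \<open>y\<close> holds an end of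
            edge \<open>(y - 4) div 2\<close>.\<close>
          define e where "e = (y - 4) div 2"
          have e: "e < m" "y = 4 + (e + e) \<or> y = 5 + (e + e)" using True F4 unfolding e_def by presburger+
          have l: "nmem (init_config x) (4 + z) = encode_edges (map (cends r) [0..<m]) ! z" if "z < m + m" for z
            using that by (simp add: x init_config_def load_def encode_edges_nth numeral_eq_Suc)
          have "nmem (init_config x) (4 + (e + e)) = fst (cends r e)"
            "nmem (init_config x) (4 + Suc (e + e)) = snd (cends r e)"
            using l[of "e + e"] l[of "Suc (e + e)"] e(1) encode_edges_nth(2,3)[of e "map (cends r) [0..<m]"] by auto
          moreover have "4 + Suc (e + e) = 5 + (e + e)" by simp
          ultimately have "nmem (init_config x) y = ar t 20 y" using D(5,6)[OF e(1)] e(2) by metis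
          then show ?thesis using D(11)[of y] True v by (simp add: pmN_def)
        qed
      next
        case False
        then show ?thesis using D(11)[of y] old(3)[of y] v
          by (simp add: pmN_def x init_config_def load_def encode_edges_nth)
      qed
      have pmR: "pmR t y = rmem (init_config x) y" for y
      proof (cases "y < m")
        case True
        then show ?thesis using D(12)[of y] D(4)[of y] v by (simp add: pmR_def x init_config_def load_def)
      next
        case False
        then show ?thesis using D(12)[of y] old(4)[of y] v by (simp add: pmR_def x init_config_def load_def)
      qed
      have "stok t" unfolding stok_def using D(11,12) v old by auto
      then show ?case using pmN pmR D(3) 6 s0 by (auto simp: fun_eq_iff)
    qed
  qed
qed

text \<open>Sides are recorded relative to vertex 0, the root of the tree; the later code only
  compares the entries of two vertices.\<close>

lemma decode_correct:
  assumes env: "env s" and r: "ar s 8 = r"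
    and W: "\<And>y. y < n \<Longrightarrow> (y \<in> W) = (r y \<in> W)"
    and bits: "\<And>e. e < m \<Longrightarrow> r (ea e) \<noteq> r (eb e) \<Longrightarrow> ar s 24 (ar s 10 e) = of_bool (crosses W e)"
  shows "wp decode (\<lambda>t. (\<forall>y<n. ar t 12 y = of_bool ((y \<in> W) \<noteq> (0 \<in> W))) \<and> tk t \<le> tk s + n * 13 + 3) s"
  unfolding decode_def wp_simps(9) wp_simps(3)
proof (rule wp_mono[OF wp_For[where N = "n - 1" and B = 10 and
        J = "\<lambda>j t. \<forall>y\<in>insert 0 (ar s 6 ` {..<j}). ar t 12 y = of_bool ((y \<in> W) \<noteq> (0 \<in> W))"]], goal_cases)
  case 1 show ?case by simp
next
  case (2 i t) then show ?case using env by (simp add: frm_def env_def)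
next
  case (4 j t)
  have t: "\<And>k. k \<noteq> 12 \<Longrightarrow> ar t k = ar s k" using 4(4) by (simp add: frm_def)
  have tree: "ar s 7 j < m" "{ar s 5 j, ar s 6 j} = {ea (ar s 7 j), eb (ar s 7 j)}" "ar s 5 j \<in> insert 0 (ar s 6 ` {..<j})"
    using env 4(1) by (auto simp: env_def tree_ok_def)
  define e where "e = ar s 7 j"
  have te: "e < m" "ar s 1 e = ea e" "ar s 2 e = eb e" using env tree(1) by (auto simp: env_def e_def)
  have en: "ea e < n" "eb e < n" using ends[OF te(1)] by auto
  have bit: "(if r (ea e) \<noteq> r (eb e) then ar s 24 (ar s 10 e) else 0) = of_bool (crosses W e)"
    using bits[OF te(1)] W[OF en(1)] W[OF en(2)] by auto
  have p: "ar t 12 (ar s 5 j) = of_bool ((ar s 5 j \<in> W) \<noteq> (0 \<in> W))" using 4(2) tree(3) by blast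
  have cr: "crosses W e = ((ar s 5 j \<in> W) \<noteq> (ar s 6 j \<in> W))"
    using tree(2) unfolding e_def[symmetric] by (auto simp: doubleton_eq_iff)
  have new: "of_bool (ar t 12 (ar s 5 j) \<noteq> (if r (ea e) \<noteq> r (eb e) then ar s 24 (ar s 10 e) else 0)) =
      (of_bool ((ar s 6 j \<in> W) \<noteq> (0 \<in> W)) :: nat)"
    unfolding bit p cr by auto
  have J: "\<forall>y\<in>insert 0 (ar s 6 ` {..<Suc j}). ((ar t 12)(ar s 6 j := of_bool ((ar s 6 j \<in> W) \<noteq> (0 \<in> W)))) y =
      of_bool ((y \<in> W) \<noteq> (0 \<in> W))"
    using 4(2) by (auto simp: lessThan_Suc)
  have "wp (Asg 13 (Ar 7 (Va 12)) ;; Asg 14 (Co 0) ;;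
     Ite (Neq (Ar 8 (Ar 1 (Va 13))) (Ar 8 (Ar 2 (Va 13)))) (Asg 14 (Ar 24 (Ar 10 (Va 13)))) Skip ;;
     Sto 12 (Ar 6 (Va 12)) (Neq (Ar 12 (Ar 5 (Va 12))) (Va 14)))
     (\<lambda>u. tk u \<le> tk t + 10 \<and> ar u 12 = (ar t 12)(ar s 6 j := of_bool ((ar s 6 j \<in> W) \<noteq> (0 \<in> W)))) t"
    unfolding new[symmetric]
    by (cases "r (ea e) = r (eb e)") (use t te 4(3) r in \<open>simp_all add: e_def[symmetric]\<close>)
  then show ?case by (rule wp_mono) (use J in metis)
next
  case (6 t)
  have "insert 0 (ar s 6 ` {..<n - 1}) = {..<n}" using env by (auto simp: env_def tree_ok_def)
  then have "\<forall>y<n. ar t 12 y = of_bool ((y \<in> W) \<noteq> (0 \<in> W))" using 6 by auto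
  moreover have "tk t \<le> tk s + n * 13 + 3"
  proof -
    have "(n - 1) * 13 \<le> n * 13" by simp
    moreover have "tk t \<le> tk s + 3 + (n - 1) * 13" using 6 by simp
    ultimately show ?thesis by linarith
  qed
  ultimately show ?case by blast
qed auto

lemma cutval_correct:
  assumes env: "env s" and W: "\<And>y. y < n \<Longrightarrow> ar s 12 y = of_bool ((y \<in> W) \<noteq> (0 \<in> W))"
  shows "wp cutval (\<lambda>t. rs t 1 = d W \<and> tk t \<le> tk s + m * 6 + 3) s"
  unfolding cutval_def wp_simps(9) wp_simps(4)
proof (rule wp_mono[OF wp_For[where N = m and B = 3 and
        J = "\<lambda>i t. rs t 1 = (\<Sum>e<i. if crosses W e then wt e else 0)"]], goal_cases)
  case (2 i t) then show ?case using env by (simp add: frm_def env_def)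
next
  case (4 e t)
  have t: "ar t = ar s" "ra t = ra s" using 4(4) by (auto simp: frm_def)
  have a: "ar s 1 e = ea e" "ar s 2 e = eb e" "ra s 1 e = wt e" "ea e < n" "eb e < n"
    using env 4(1) ends[OF 4(1)] by (auto simp: env_def)
  show ?case using t a W[OF a(4)] W[OF a(5)] 4(2,3) by auto
next
  case (6 t) then show ?case by (simp add: d_def)
qed auto

text \<open>Tick bound of a query: linear terms for building, decoding and weighing, and up to
  \<open>\<phi> n m + 1\<close> rounds of simulation.\<close>

definition QT :: "program \<Rightarrow> (nat \<Rightarrow> nat \<Rightarrow> nat) \<Rightarrow> nat" where
  "QT P \<phi> = m * 49 + n * 13 + 26 + (\<phi> n m + 1) * (2 * length P + 20)"

lemma query_sets [simp]:
  "x < 10 \<or> 15 < x \<and> x < 22 \<Longrightarrow> x \<notin> wsc (query P)" "x = 37 \<or> 22 < x \<and> x < 30 \<Longrightarrow> x \<notin> wsc (query P)"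
  "k < 9 \<or> 12 < k \<and> k < 20 \<Longrightarrow> k \<notin> war (query P)" "k \<noteq> 20 \<Longrightarrow> k \<notin> wra (query P)" "silent (query P)"
  by (auto simp: query_def decode_def cutval_def)

lemma query_correct:
  assumes P: "min_st_cut_program P \<phi>"
    and env: "env s" and r: "ar s 8 = r" "repr r" and st: "stok s" and ab: "sc s 20 = a" "sc s 21 = b"
    and ab': "a < n" "b < n" "a \<noteq> b" "r a = a" "r b = b"
  shows "wp (query P) (\<lambda>t. \<exists>W. sep a b W \<and> closed r W \<and> bounded_by r a b (d W) \<and> rs t 1 = d W \<and>
    (\<forall>y<n. ar t 12 y = of_bool ((y \<in> W) \<noteq> (0 \<in> W))) \<and> stok t \<and> tk t \<le> tk s + QT P \<phi>) s"
proof -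
  define x where "x = (n # m # a # b # encode_edges (map (cends r) [0..<m]), map (cwt r m) [0..<m])"
  obtain X T where X: "sep a b X" "\<forall>Y. sep a b Y \<longrightarrow>
      wgraph.d m (fst \<circ> cends r) (snd \<circ> cends r) (cwt r m) X \<le>
      wgraph.d m (fst \<circ> cends r) (snd \<circ> cends r) (cwt r m) Y"
    and T: "halted P (run P x T)" "\<forall>t<T. \<not> halted P (run P x t)" "T \<le> \<phi> n m"
    and tp: "tape (run P x T) = map (\<lambda>i. of_bool ((fst (cends r i) \<in> X) \<noteq> (snd (cends r i) \<in> X))) [0..<m]"
    using min_cut_call[OF P r(2) ab'(1,2,3) x_def] by blast
  define W where "W = {y. y < n \<and> r y \<in> X}"
  have Wp: "sep a b W" "closed r W" "bounded_by r a b (d W)"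
    using contracted_min_cut[OF r(2) ab'(1,2,4,5) X(1) _ W_def] X(2) by blast+
  have Wr: "(y \<in> W) = (r y \<in> W)" if "y < n" for y using Wp(2) that by (simp add: closed_def)
  have seq: "wp (query P) q s = wp build (wp (sim P) (wp decode (wp cutval q))) s" for q
    by (simp add: query_def)
  show ?thesis unfolding seq
  proof (rule wp_conseq[OF build_correct[OF env r(2,1) st ab x_def]], goal_cases)
    case (1 t1)
    have e1: "env t1" using env_frm[OF 1(2) _ _ _ _ _ _ _ _ _ env] by simp
    have f1: "ar t1 8 = r" using 1(2) r by (simp add: frm_def)
    have s1: "wp (sim P) (\<lambda>t. simrel t (run P x T) \<and> stok t \<and> tk t \<le> tk t1 + (T + 1) * (2 * length P + 20)) t1"
      by (rule sim_correct) (use 1(1) T in auto)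
    show ?case
    proof (rule wp_conseq[OF s1], goal_cases)
      case (1 t2)
      have e2: "env t2" using env_frm[OF 1(2) _ _ _ _ _ _ _ _ _ e1] by simp
      have f2: "ar t2 8 = r" "ar t2 10 = ar t1 10" using 1(2) f1 by (simp_all add: frm_def)
      have bits: "ar t2 24 (ar t2 10 e) = of_bool (crosses W e)" if e: "e < m" "r (ea e) \<noteq> r (eb e)" for e
      proof -
        have l: "lead r e < m" using lead_le[of r e] e by simp
        have "ar t2 10 e = lead r e" using \<open>_ \<and> _ \<and> _ \<and> (\<forall>e<m. _) \<and> _\<close> e f2 by auto
        moreover have "ar t2 24 (lead r e) = of_bool ((fst (cends r (lead r e)) \<in> X) \<noteq> (snd (cends r (lead r e)) \<in> X))"
          using 1(1) l tp by (auto simp: simrel_def)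
        moreover have "crosses W e = ((r (ea e) \<in> X) \<noteq> (r (eb e) \<in> X))" using ends[OF e(1)] by (simp add: W_def)
        ultimately show ?thesis using lead_crosses[OF e, of X] by simp
      qed
      have s2: "wp decode (\<lambda>t. (\<forall>y<n. ar t 12 y = of_bool ((y \<in> W) \<noteq> (0 \<in> W))) \<and> tk t \<le> tk t2 + n * 13 + 3) t2"
        by (rule decode_correct[OF e2 f2(1)]) (use Wr bits in auto)
      have t12: "tk t2 \<le> tk s + m * 43 + 20 + (T + 1) * (2 * length P + 20)"
        using 1(1) \<open>_ \<and> _ \<and> _ \<and> (\<forall>e<m. _) \<and> _\<close> by auto
      have st2: "stok t2" using 1 by simp
      show ?case
      proof (rule wp_conseq[OF s2], goal_cases)
        case (1 t3)
        have e3: "env t3" using env_frm[OF 1(2) _ _ _ _ _ _ _ _ _ e2] by (simp add: decode_def)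
        have t3: "\<forall>y<n. ar t3 12 y = of_bool ((y \<in> W) \<noteq> (0 \<in> W))" "tk t3 \<le> tk t2 + n * 13 + 3"
          using 1(1) by auto
        have st3: "stok t3" using 1(2) st2 by (simp add: frm_def stok_def decode_def)
        have s3: "wp cutval (\<lambda>t. rs t 1 = d W \<and> tk t \<le> tk t3 + m * 6 + 3) t3"
          by (rule cutval_correct[OF e3]) (use 1(1) in auto)
        show ?case
        proof (rule wp_conseq[OF s3], goal_cases)
          case (1 t4)
          have "stok t4" "ar t4 12 = ar t3 12" using 1(2) st3 by (simp_all add: frm_def stok_def cutval_def)
          moreover have "(T + 1) * (2 * length P + 20) \<le> (\<phi> n m + 1) * (2 * length P + 20)"
            using T(3) by (intro mult_le_mono1) simp
          moreover from this have "tk t4 \<le> tk s + QT P \<phi>"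
            using 1(1) t3 t12 unfolding QT_def by linarith
          ultimately show ?case using Wp 1(1) t3 by (intro exI[of _ W]) simp
        qed
      qed
    qed
  qed
qed

end

section \<open>Computing parents and chains of blocks\<close>

definition lam_step :: "program \<Rightarrow> cmd" where
  "lam_step P = For 5 (Va 0) (Sto 8 (Va 5) (Va 5)) ;; Asg 20 (Va 3) ;; Asg 21 (Va 2) ;; query P ;;
     IfR (RAr 2 (Va 2)) (RV 1) (RSto 2 (Va 2) (RV 1) ;; Sto 13 (Va 2) (Va 3)) Skip"

text \<open>The start value -1 is below every cut weight, so the first candidate for a parent is
  always accepted.\<close>

definition phase1a :: "program \<Rightarrow> cmd" where
  "phase1a P = For 2 (Va 0) (RSto 2 (Va 2) (RC (-1)) ;; For 3 (Va 2) (lam_step P))"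

text \<open>Equality of reals is tested by two strict comparisons. As parents are smaller and the
  loop runs upwards, the entry copied from the parent is already final.\<close>

definition set_r0 :: cmd where
  "set_r0 = For 5 (Va 0) (Sto 14 (Va 5) (Va 5) ;; Ite (Lt (Va 5) (Va 2)) (Ite (Va 5)
     (IfR (RAr 2 (Va 5)) (RAr 2 (Va 2)) Skip (IfR (RAr 2 (Va 2)) (RAr 2 (Va 5)) Skip
        (Sto 14 (Va 5) (Ar 14 (Ar 13 (Va 5)))))) Skip) Skip)"

text \<open>Merging the class of scalar 8 with the source and that of scalar 9 with the sink
  restricts the next query to cuts with the one inside and the other outside.\<close>

definition set_split :: cmd where
  "set_split = For 5 (Va 0) (Ite (Eq (Ar 14 (Va 5)) (Va 9)) (Sto 8 (Va 5) (Va 21))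
     (Ite (Eq (Ar 14 (Va 5)) (Va 8)) (Sto 8 (Va 5) (Va 20)) (Sto 8 (Va 5) (Ar 14 (Va 5)))))"

definition do_split :: cmd where
  "do_split = Asg 37 (Ar 15 (Va 8)) ;;
     For 5 (Va 0) (
       Ite (Lt (Va 37) (Ar 15 (Va 5))) (Sto 15 (Va 5) (Add (Ar 15 (Va 5)) (Co 1)))
         (Ite (Eq (Ar 15 (Va 5)) (Va 37)) (Ite (Neq (Ar 12 (Va 5)) (Ar 12 (Va 20)))
            (Sto 15 (Va 5) (Add (Ar 15 (Va 5)) (Co 1))) Skip) Skip)) ;;
     Asg 6 (Add (Va 6) (Co 1))"

text \<open>A query value above \<open>Lam\<close> shows that no cut of the family has the first
  vertex inside and the second outside. The guards skip vertices in different blocks, and pairs that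
  would force the source out or the sink in.\<close>

definition trysplit :: "program \<Rightarrow> cmd" where
  "trysplit P = Ite (Eq (Ar 15 (Va 8)) (Ar 15 (Va 9))) (Ite (Neq (Va 9) (Va 20)) (Ite (Neq (Va 8) (Va 21))
     (set_split ;; query P ;; IfR (RAr 2 (Va 2)) (RV 1) Skip do_split) Skip) Skip) Skip"

text \<open>One earlier representative of the same block is enough, since at this stage all of them
  lie on the same side of every cut of the family. The value \<open>n\<close> stands for
  none.\<close>

definition find_anchor :: cmd where
  "find_anchor = Asg 7 (Va 0) ;; For 5 (Va 4) (Ite (Eq (Ar 14 (Va 5)) (Va 5))
     (Ite (Eq (Ar 15 (Va 5)) (Ar 15 (Va 4))) (Asg 7 (Va 5)) Skip) Skip)"

text \<open>Both orientations of the pair are tried, at one query each, so the refinement for one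
  sink takes at most \<open>2 n\<close> queries.\<close>

definition refine :: "program \<Rightarrow> cmd" where
  "refine P = Ite (Eq (Ar 14 (Va 4)) (Va 4)) (find_anchor ;;
     Ite (Lt (Va 7) (Va 0)) (Asg 8 (Va 7) ;; Asg 9 (Va 4) ;; trysplit P ;;
       Asg 8 (Va 4) ;; Asg 9 (Va 7) ;; trysplit P) Skip) Skip"

definition make_chain :: "program \<Rightarrow> cmd" where
  "make_chain P = For 5 (Va 0) (Sto 15 (Va 5) (Neq (Ar 12 (Va 5)) (Ar 12 (Va 20)))) ;;
     Asg 6 (Co 1) ;; For 4 (Va 0) (refine P) ;; Sto 16 (Va 2) (Va 6) ;;
     For 5 (Va 0) (Sto 17 (Add (Ar 3 (Va 2)) (Va 5)) (Ar 15 (Va 5)))"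

text \<open>The first query decides whether any cut is charged to this vertex; a stored number 0
  records that there is none.\<close>

definition one_vertex :: "program \<Rightarrow> cmd" where
  "one_vertex P = set_r0 ;; Asg 20 (Ar 14 (Ar 13 (Va 2))) ;; Asg 21 (Va 2) ;;
     For 5 (Va 0) (Sto 8 (Va 5) (Ar 14 (Va 5))) ;; query P ;;
     IfR (RAr 2 (Va 2)) (RV 1) (Sto 16 (Va 2) (Co 0)) (make_chain P)"

definition phase1b :: "program \<Rightarrow> cmd" where
  "phase1b P = For 2 (Va 0) (Ite (Va 2) (one_vertex P) Skip)"

lemma fill:
  assumes "ev b s = N" and b: "b = Va y" "y \<noteq> x"
    and f: "\<And>i t. i < N \<Longrightarrow> sc t = (sc s)(x := i) \<Longrightarrow> (\<And>k'. k' \<noteq> k \<Longrightarrow> ar t k' = ar s k') \<Longrightarrow>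
      rs t = rs s \<Longrightarrow> ra t = ra s \<Longrightarrow> ev e t = f i \<and> ev g t = h i"
    and h: "inj_on h {..<N}"
  shows "wp (For x b (Sto k g e)) (\<lambda>t. (\<forall>i<N. ar t k (h i) = f i) \<and>
    (\<forall>z. z \<notin> h ` {..<N} \<longrightarrow> ar t k z = ar s k z) \<and> tk t \<le> tk s + N * 4 + 2) s"
proof (rule wp_mono[OF wp_For[where N = N and B = 1 and
        J = "\<lambda>i t. (\<forall>j<i. ar t k (h j) = f j) \<and> (\<forall>z. z \<notin> h ` {..<i} \<longrightarrow> ar t k z = ar s k z)"]], goal_cases)
  case (2 i t)
  then show ?case using assms(1) b by (simp add: frm_def)
next
  case (4 i t)
  have "sc t = (sc s)(x := i)" using 4(3,4) by (auto simp: frm_def)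
  moreover have "\<And>k'. k' \<noteq> k \<Longrightarrow> ar t k' = ar s k'" "rs t = rs s" "ra t = ra s"
    using 4(4) by (auto simp: frm_def)
  ultimately have "ev e t = f i" "ev g t = h i" using f[OF 4(1)] by auto
  moreover have "h j \<noteq> h i" if "j < i" for j using inj_onD[OF h, of i j] that 4(1) by auto
  ultimately show ?case using 4(2) by (auto simp: less_Suc_eq lessThan_Suc)
qed auto

section \<open>Correctness of the parents and of the single refinement operations\<close>

context connected_wgraph
begin

text \<open>If the labels differ, the chain cut belonging to the smaller label separates the two
  vertices.\<close>

lemma chain_label_eq:
  assumes "chain M L k" "y < n" "z < n" "\<And>X. X \<in> M \<Longrightarrow> (y \<in> X) = (z \<in> X)"
  shows "L y = L z"
proof (rule ccontr)
  assume "L y \<noteq> L z"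
  moreover have False if "L y < L z" "y < n" "z < n" "\<And>X. X \<in> M \<Longrightarrow> (y \<in> X) = (z \<in> X)" for y z
  proof -
    have "{x. x < n \<and> L x \<le> L y} \<in> M" using assms(1) that by (auto simp: chain_def)
    then show False using that(4) that(1,2) by fastforce
  qed
  ultimately show False using assms(2-4) by (metis linorder_neqE_nat)
qed

text \<open>The labels from 0 to \<open>k\<close> name \<open>k + 1\<close> nonempty blocks.\<close>

lemma chain_length:
  assumes "chain M L k" shows "k < n"
proof -
  have "{..k} \<subseteq> L ` {..<n}" using assms by (fastforce simp: chain_def)
  then have "card {..k} \<le> card (L ` {..<n})" by (intro card_mono) auto
  also have "\<dots> \<le> n" using card_image_le[of "{..<n}" L] by simp
  finally show ?thesis by simp
qed

text \<open>The side condition "\<open>i\<close> inside and \<open>p\<close> outside" turns into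
  closedness under a further merging, so that an ordinary query can enforce it.\<close>

lemma split_closed:
  assumes r0: "repr r0" "r0 a = a" "r0 b = b" "a < n" "b < n" and i: "i < n" "p < n" "r0 i = i" "r0 p = p" "i \<noteq> p"
    and ne: "p \<noteq> a" "i \<noteq> b" "a \<noteq> b"
    and r: "\<And>z. z < n \<Longrightarrow> r z = (if r0 z = p then b else if r0 z = i then a else r0 z)"
  shows "repr r" "r a = a" "r b = b"
    "sep a b X \<Longrightarrow> closed r X \<longleftrightarrow> closed r0 X \<and> i \<in> X \<and> p \<notin> X"
proof -
  show ra: "r a = a" and rb: "r b = b" using r r0 i ne by auto
  show "repr r" unfolding repr_def
  proof (intro allI impI)
    fix y assume y: "y < n"
    have ry: "r0 y < n" "r0 (r0 y) = r0 y" using r0(1) y by (auto simp: repr_def)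
    show "r y < n \<and> r (r y) = r y" using r[OF y] r[OF ry(1)] ry ra rb r0 by auto
  qed
  assume X: "sep a b X"
  have lt: "r0 y < n" "r0 (r0 y) = r0 y" if "y < n" for y using r0(1) that by (auto simp: repr_def)
  show "closed r X \<longleftrightarrow> closed r0 X \<and> i \<in> X \<and> p \<notin> X"
  proof
    assume c: "closed r X"
    have ii: "i \<in> X" using c i r[of i] X by (auto simp: closed_def sep_def)
    have pp: "p \<notin> X" using c i r[of p] X by (auto simp: closed_def sep_def)
    have "(y \<in> X) = (r0 y \<in> X)" if y: "y < n" for y
      using c y r[OF y] ii pp X unfolding closed_def sep_def by metis
    then show "closed r0 X \<and> i \<in> X \<and> p \<notin> X" using ii pp by (simp add: closed_def)
  next
    assume c: "closed r0 X \<and> i \<in> X \<and> p \<notin> X"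
    show "closed r X" unfolding closed_def
    proof (intro allI impI)
      fix y assume y: "y < n"
      then have "(y \<in> X) = (r0 y \<in> X)" using c by (simp add: closed_def)
      then show "(y \<in> X) = (r y \<in> X)" using r[OF y] c X by (auto simp: sep_def)
    qed
  qed
qed

lemma lam_step_sets [simp]:
  "x \<in> {0, 1, 2, 3, 4} \<Longrightarrow> x \<notin> wsc (lam_step P)" "k < 8 \<or> 13 < k \<and> k < 20 \<Longrightarrow> k \<notin> war (lam_step P)"
  "k \<noteq> 2 \<and> k \<noteq> 20 \<Longrightarrow> k \<notin> wra (lam_step P)" "silent (lam_step P)"
  by (auto simp: lam_step_def)

lemma lam_step_correct:
  assumes P: "min_st_cut_program P \<phi>" and env: "env s" and st: "stok s"
    and u: "sc s 3 = u" "sc s 2 = v" "u < v" "v < n"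
  shows "wp (lam_step P) (\<lambda>t. stok t \<and>
    (if ra s 2 v < lam u v then ra t 2 = (ra s 2)(v := lam u v) \<and> ar t 13 = (ar s 13)(v := u)
     else ra t 2 = ra s 2 \<and> ar t 13 = ar s 13) \<and> tk t \<le> tk s + QT P \<phi> + n * 4 + 10) s"
proof -
  have f: "wp (For 5 (Va 0) (Sto 8 (Va 5) (Va 5))) (\<lambda>t. (\<forall>i<n. ar t 8 i = i) \<and>
      (\<forall>z. z \<notin> (\<lambda>i. i) ` {..<n} \<longrightarrow> ar t 8 z = ar s 8 z) \<and> tk t \<le> tk s + n * 4 + 2) s"
    by (rule fill) (use env in \<open>auto simp: env_def\<close>)
  show ?thesis unfolding lam_step_def wp_simps(9)[of "For _ _ _"]
  proof (rule wp_conseq[OF f], goal_cases)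
    case (1 t1)
    let ?t = "tick (cost (Asg 21 (Va 2))) ((tick (cost (Asg 20 (Va 3))) (t1\<lparr>sc := (sc t1)(20 := u)\<rparr>))\<lparr>sc := (sc t1)(20 := u, 21 := v)\<rparr>)"
    have fr: "sc t1 3 = u" "sc t1 2 = v" using 1(2) u by (simp_all add: frm_def)
    have e: "env t1" using env_frm[OF 1(2) _ _ _ _ _ _ _ _ _ env] by simp
    then have et: "env ?t" by (simp add: env_def)
    have stt: "stok ?t" using 1(2) st by (simp add: frm_def stok_def)
    have id: "\<And>y. y < n \<Longrightarrow> ar ?t 8 y = y" using 1 by simp
    have rep: "repr (ar ?t 8)" using id by (simp add: repr_def)
    have cl: "closed (ar ?t 8) X" for X using id by (simp add: closed_def)
    have un: "u < n" using u by simp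
    have q: "wp (query P) (\<lambda>t. \<exists>W. sep u v W \<and> closed (ar ?t 8) W \<and> bounded_by (ar ?t 8) u v (d W) \<and> rs t 1 = d W \<and>
      (\<forall>y<n. ar t 12 y = of_bool ((y \<in> W) \<noteq> (0 \<in> W))) \<and> stok t \<and> tk t \<le> tk ?t + QT P \<phi>) ?t"
      by (rule query_correct[OF P et refl rep stt]) (use u id un in auto)
    have "wp (query P) (wp (IfR (RAr 2 (Va 2)) (RV 1) (RSto 2 (Va 2) (RV 1) ;; Sto 13 (Va 2) (Va 3)) Skip)
      (\<lambda>t. stok t \<and> (if ra s 2 v < lam u v then ra t 2 = (ra s 2)(v := lam u v) \<and> ar t 13 = (ar s 13)(v := u)
       else ra t 2 = ra s 2 \<and> ar t 13 = ar s 13) \<and> tk t \<le> tk s + QT P \<phi> + n * 4 + 10)) ?t"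
    proof (rule wp_conseq[OF q], goal_cases)
      case (1 t2)
      then obtain W where W: "sep u v W" "bounded_by (ar ?t 8) u v (d W)" "rs t2 1 = d W" "stok t2"
        "tk t2 \<le> tk ?t + QT P \<phi>" by blast
      obtain X where X: "sep u v X" "d X = lam u v" using lam_attained[of u v] u un by auto
      have "d W \<le> lam u v" using W(2) X cl by (auto simp: bounded_by_def)
      then have val: "rs t2 1 = lam u v" using lam_le[OF W(1)] W(3) by simp
      have f2: "ra t2 2 = ra s 2" "ar t2 13 = ar s 13" "sc t2 2 = v" "sc t2 3 = u"
        using 1(2) \<open>frm _ s t1\<close> fr by (simp_all add: frm_def)
      have tk2: "tk t2 \<le> tk s + n * 4 + 4 + QT P \<phi>" using W(5) \<open>_ \<and> _ \<and> tk t1 \<le> _\<close> by simp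
      show ?case using f2 val W(4) tk2 by (simp add: stok_def)
    qed
    then show ?case using fr by simp
  qed
qed

lemma phase1a_sets [simp]:
  "x \<in> {0, 1} \<Longrightarrow> x \<notin> wsc (phase1a P)" "k < 8 \<or> 13 < k \<and> k < 20 \<Longrightarrow> k \<notin> war (phase1a P)"
  "k \<noteq> 2 \<and> k \<noteq> 20 \<Longrightarrow> k \<notin> wra (phase1a P)" "silent (phase1a P)"
  by (auto simp: phase1a_def)

lemma phase1a_correct:
  assumes P: "min_st_cut_program P \<phi>" and env: "env s" and st: "stok s"
  shows "wp (phase1a P) (\<lambda>t. stok t \<and> parents (ar t 13) (ra t 2) \<and>
    tk t \<le> tk s + n * (n * (QT P \<phi> + n * 4 + 13) + 6) + 2) s"
proof -
  define ok where "ok t v \<longleftrightarrow> ar t 13 v < v \<and> ra t 2 v = lam (ar t 13 v) v \<and> (\<forall>u<v. lam u v \<le> ra t 2 v)" for t :: hstate and v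
  have okupd: "ok (t\<lparr>sc := f, clk := a, tk := b\<rparr>) v = ok t v" for t f a b v by (simp add: ok_def)
  show ?thesis unfolding phase1a_def
  proof (rule wp_mono[OF wp_For[where N = n and B = "n * (QT P \<phi> + n * 4 + 13) + 3" and
          J = "\<lambda>v t. stok t \<and> (\<forall>v'. 0 < v' \<and> v' < v \<longrightarrow> ok t v')"]], goal_cases)
    case 1 show ?case using st by simp
  next
    case (2 i t) then show ?case using env by (simp add: frm_def env_def)
  next
    case 3 show ?case by simp
  next
    case (4 v t)
    have e: "env t" using env_frm[OF 4(4) _ _ _ _ _ _ _ _ _ env] by simp
    let ?t = "tick (cost (RSto 2 (Va 2) (RC (-1)))) (t\<lparr>ra := (ra t)(2 := (ra t 2)(v := -1))\<rparr>)"
    have et: "env ?t" using e by (simp add: env_def)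
    have "wp (For 3 (Va 2) (lam_step P)) (\<lambda>t'. tk t' \<le> tk t + (n * (QT P \<phi> + n * 4 + 13) + 3) \<and>
        stok t' \<and> (\<forall>v'. 0 < v' \<and> v' < Suc v \<longrightarrow> ok t' v')) ?t"
    proof (rule wp_mono[OF wp_For[where N = v and B = "QT P \<phi> + n * 4 + 10" and
            J = "\<lambda>u t'. stok t' \<and> (\<forall>v'. 0 < v' \<and> v' < v \<longrightarrow> ok t' v') \<and> (u = 0 \<longrightarrow> ra t' 2 v = -1) \<and>
              (0 < u \<longrightarrow> ar t' 13 v < u \<and> ra t' 2 v = lam (ar t' 13 v) v \<and> (\<forall>u'<u. lam u' v \<le> ra t' 2 v))"]], goal_cases)
      case 1 show ?case using 4(2) by (auto simp: ok_def stok_def)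
    next
      case (2 i t') then show ?case using 4(3) by (simp add: frm_def)
    next
      case 3 show ?case by simp
    next
      case u4: (4 u t')
      have e': "env t'" using env_frm[OF u4(4) _ _ _ _ _ _ _ _ _ et] by simp
      have vv: "sc t' 2 = v" using u4(4) 4(3) by (simp add: frm_def)
      have stt: "stok t'" using u4(2) by simp
      show ?case
      proof (rule wp_mono[OF lam_step_correct[OF P e' stt u4(3) vv u4(1) 4(1)]], goal_cases)
        case (1 t2)
        have ne: "v' \<noteq> v" if "v' < v" for v' using that by simp
        have keep: "\<forall>v'. 0 < v' \<and> v' < v \<longrightarrow> ok t2 v'"
          using u4(2) 1 by (auto simp: ok_def split: if_splits)
        \<comment> \<open>Nonnegativity lets the first comparison with -1 succeed, so a parent is
          recorded from the first round on.\<close>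
        have "0 \<le> lam u v"
          using lam_attained[of u v] u4(1) 4(1) d_nonneg by (metis nat_neq_iff order_less_trans)
        then have new: "ar t2 13 v < Suc u \<and> ra t2 2 v = lam (ar t2 13 v) v \<and> (\<forall>u'<Suc u. lam u' v \<le> ra t2 2 v)"
          using u4(2) 1 by (cases "u = 0") (auto simp: less_Suc_eq split: if_splits)
        show ?case
        proof (intro conjI impI)
          show "tk t2 \<le> tk t' + (QT P \<phi> + n * 4 + 10)" "stok t2" using 1 by auto
        qed (use keep new in blast)+
      qed
    next
      case (5 u t' x y z) then show ?case by (auto simp: okupd)
    next
      case (6 t')
      have "v * (QT P \<phi> + n * 4 + 10 + 3) \<le> n * (QT P \<phi> + n * 4 + 13)"
        using 4(1) by (intro mult_le_mono) auto
      then show ?case using 6 by (auto simp: less_Suc_eq ok_def)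
    qed
    then show ?case using 4(3) by simp
  next
    case (5 i t v a b) then show ?case by (simp add: okupd)
  next
    case (6 t)
    then have "parents (ar t 13) (ra t 2)" by (auto simp: parents_def ok_def)
    then show ?case using 6 by (simp add: add.commute)
  qed
qed

lemma set_r0_correct:
  assumes "sc s 0 = n" "sc s 2 = v" and P: "parents (ar s 13) (ra s 2)"
  shows "wp set_r0 (\<lambda>t. (\<forall>y<n. ar t 14 y =
      (if 0 < y \<and> y < v \<and> ra s 2 y = ra s 2 v then ar t 14 (ar s 13 y) else y)) \<and> tk t \<le> tk s + n * 15 + 2) s"
  unfolding set_r0_def
proof (rule wp_mono[OF wp_For[where N = n and B = 12 and
        J = "\<lambda>i t. \<forall>y<i. ar t 14 y = (if 0 < y \<and> y < v \<and> ra s 2 y = ra s 2 v then ar t 14 (ar s 13 y) else y)"]], goal_cases)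
  case (2 i t) then show ?case using assms by (simp add: frm_def)
next
  case (4 i t)
  have t: "sc t 2 = v" "ar t 13 = ar s 13" "ra t = ra s" using 4(4) assms by (auto simp: frm_def)
  have p: "0 < y \<Longrightarrow> y \<le> i \<Longrightarrow> ar s 13 y < y" for y using parentsD(1)[OF P, of y] 4(1) by simp
  have eq: "\<forall>y<Suc i. ((ar t 14)(i := z)) y =
        (if 0 < y \<and> y < v \<and> ra s 2 y = ra s 2 v then ((ar t 14)(i := z)) (ar s 13 y) else y)"
    if z: "(if 0 < i \<and> i < v \<and> ra s 2 i = ra s 2 v then ar t 14 (ar s 13 i) else i) = z" for z
  proof (intro allI impI)
    fix y assume y: "y < Suc i"
    show "((ar t 14)(i := z)) y =
        (if 0 < y \<and> y < v \<and> ra s 2 y = ra s 2 v then ((ar t 14)(i := z)) (ar s 13 y) else y)"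
    proof (cases "y = i")
      case True
      then show ?thesis using z p[of i] by (auto split: if_splits)
    next
      case False
      then have "y < i" using y by simp
      then show ?thesis using 4(2) p[of y] by (cases "y = 0") auto
    qed
  qed
  have "wp (Sto 14 (Va 5) (Va 5) ;; Ite (Lt (Va 5) (Va 2)) (Ite (Va 5)
     (IfR (RAr 2 (Va 5)) (RAr 2 (Va 2)) Skip (IfR (RAr 2 (Va 2)) (RAr 2 (Va 5)) Skip
        (Sto 14 (Va 5) (Ar 14 (Ar 13 (Va 5)))))) Skip) Skip)
     (\<lambda>u. tk u \<le> tk t + 12 \<and> ar u 14 = (ar t 14)(i := if 0 < i \<and> i < v \<and> ra s 2 i = ra s 2 v then ar t 14 (ar s 13 i) else i)) t"
    using t 4(3) p[of i] by auto
  then show ?case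
  proof (rule wp_mono)
    fix u assume u: "tk u \<le> tk t + 12 \<and> ar u 14 = (ar t 14)(i := if 0 < i \<and> i < v \<and> ra s 2 i = ra s 2 v then ar t 14 (ar s 13 i) else i)"
    show "tk u \<le> tk t + 12 \<and> (\<forall>y<Suc i. ar u 14 y =
        (if 0 < y \<and> y < v \<and> ra s 2 y = ra s 2 v then ar u 14 (ar s 13 y) else y))"
      using eq[OF refl] u by (simp only: simp_thms)
  qed
qed auto

lemma set_split_correct:
  assumes "sc s 0 = n"
  shows "wp set_split (\<lambda>t. (\<forall>z<n. ar t 8 z = (if ar s 14 z = sc s 9 then sc s 21 else if ar s 14 z = sc s 8 then sc s 20
    else ar s 14 z)) \<and> tk t \<le> tk s + n * 12 + 2) s"
  unfolding set_split_def
proof (rule wp_mono[OF wp_For[where N = n and B = 9 and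
        J = "\<lambda>i t. \<forall>z<i. ar t 8 z = (if ar s 14 z = sc s 9 then sc s 21 else if ar s 14 z = sc s 8 then sc s 20
    else ar s 14 z)"]], goal_cases)
  case (2 i t) then show ?case using assms by (simp add: frm_def)
next
  case (4 i t)
  have t: "sc t 8 = sc s 8" "sc t 9 = sc s 9" "sc t 20 = sc s 20" "sc t 21 = sc s 21" "ar t 14 = ar s 14"
    using 4(4) by (simp_all add: frm_def)
  show ?case using t 4(2,3) by (simp add: less_Suc_eq)
qed auto

lemma do_split_correct:
  assumes "sc s 0 = n"
  shows "wp do_split (\<lambda>t. (\<forall>y<n. ar t 15 y = (if ar s 15 (sc s 8) < ar s 15 y \<or>
      ar s 15 y = ar s 15 (sc s 8) \<and> ar s 12 y \<noteq> ar s 12 (sc s 20) then Suc (ar s 15 y) else ar s 15 y)) \<and>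
      sc t 6 = Suc (sc s 6) \<and> tk t \<le> tk s + n * 12 + 4) s"
  unfolding do_split_def wp_simps(9) wp_simps(2)
proof (rule wp_conseq[OF wp_For[where N = n and B = 9 and
        J = "\<lambda>i t. \<forall>y<n. ar t 15 y = (if y < i \<and> (ar s 15 (sc s 8) < ar s 15 y \<or>
      ar s 15 y = ar s 15 (sc s 8) \<and> ar s 12 y \<noteq> ar s 12 (sc s 20)) then Suc (ar s 15 y) else ar s 15 y)"]], goal_cases)
  case (2 i t) then show ?case using assms by (simp add: frm_def)
next
  case (4 i t)
  have t: "sc t 37 = ar s 15 (sc s 8)" "sc t 20 = sc s 20" "ar t 12 = ar s 12" using 4(4) by (simp_all add: frm_def)
  have a: "ar t 15 i = ar s 15 i" using 4(1,2) by simp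
  show ?case using t a 4(2,3) by (auto simp: less_Suc_eq)
next
  case (6 t)
  have "sc t 6 = sc s 6" using 6(2) by (simp add: frm_def)
  then show ?case using 6(1) by simp
qed auto

end

section \<open>The chain of blocks of a single vertex\<close>

context connected_wgraph
begin

text \<open>The situation while the cuts of \<open>v\<close> are computed: source \<open>a\<close>
  and sink \<open>v\<close> in scalars 20 and 21, the merging \<open>r0\<close> in array 14, and
  \<open>c\<close>, the stored value \<open>Lam v\<close>, as lower bound for all admissible
  cuts.\<close>

definition vctx :: "nat \<Rightarrow> (nat \<Rightarrow> nat) \<Rightarrow> nat \<Rightarrow> real \<Rightarrow> hstate \<Rightarrow> bool" where
  "vctx v r0 a c s \<longleftrightarrow> env s \<and> stok s \<and> sc s 2 = v \<and> ar s 14 = r0 \<and> sc s 20 = a \<and> sc s 21 = v \<and> ra s 2 v = c \<and>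
    bounded_by r0 a v c \<and> repr r0 \<and> a < n \<and> v < n \<and> a \<noteq> v \<and> r0 a = a \<and> r0 v = v"

lemma vctx_frm:
  assumes "frm k s t" "0 \<notin> wsc k" "1 \<notin> wsc k" "2 \<notin> wsc k" "20 \<notin> wsc k" "21 \<notin> wsc k"
    "1 \<notin> war k" "2 \<notin> war k" "3 \<notin> war k" "5 \<notin> war k" "6 \<notin> war k" "7 \<notin> war k" "14 \<notin> war k" "1 \<notin> wra k" "2 \<notin> wra k"
    "vctx v r0 a c s" "stok t"
  shows "vctx v r0 a c t"
proof -
  have "env t" using env_frm[OF assms(1)] assms unfolding vctx_def by blast
  moreover have "sc t 2 = sc s 2" "ar t 14 = ar s 14" "sc t 20 = sc s 20" "sc t 21 = sc s 21" "ra t 2 = ra s 2"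
    using assms unfolding frm_def by blast+
  ultimately show ?thesis using assms(16,17) unfolding vctx_def by metis
qed

lemma trysplit_sets [simp]:
  "x < 5 \<or> 6 < x \<and> x < 10 \<or> 15 < x \<and> x < 22 \<Longrightarrow> x \<notin> wsc (trysplit P)"
  "k < 8 \<or> 12 < k \<and> k < 15 \<or> 15 < k \<and> k < 20 \<Longrightarrow> k \<notin> war (trysplit P)"
  "k \<noteq> 20 \<Longrightarrow> k \<notin> wra (trysplit P)" "silent (trysplit P)"
  by (auto simp: trysplit_def set_split_def do_split_def)

text \<open>If the labels of \<open>i\<close> and \<open>p\<close> end up equal, then either the
  query found no cut of weight \<open>c\<close>, or a guard fired because every cut contains the
  source or none contains the sink. In each case a cut containing \<open>i\<close> contains
  \<open>p\<close>.\<close>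

lemma trysplit_correct:
  assumes P: "min_st_cut_program P \<phi>" and v: "vctx v r0 a c s" and M: "M = fam r0 a v c"
    and ch: "chain M (ar s 15) (sc s 6)"
    and i: "sc s 8 = i" "sc s 9 = p" "i < n" "p < n" "r0 i = i" "r0 p = p" "i \<noteq> p"
  shows "wp (trysplit P) (\<lambda>t. stok t \<and> chain M (ar t 15) (sc t 6) \<and>
    (\<forall>y<n. \<forall>z<n. ar t 15 y = ar t 15 z \<longrightarrow> ar s 15 y = ar s 15 z) \<and>
    (ar t 15 i = ar t 15 p \<longrightarrow> (\<forall>X\<in>M. i \<in> X \<longrightarrow> p \<in> X)) \<and> tk t \<le> tk s + QT P \<phi> + n * 24 + 20) s"
proof -
  have V: "env s" "stok s" "sc s 2 = v" "ar s 14 = r0" "sc s 20 = a" "sc s 21 = v" "ra s 2 v = c"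
    "bounded_by r0 a v c" "repr r0" "a < n" "v < n" "a \<noteq> v" "r0 a = a" "r0 v = v"
    using v unfolding vctx_def by blast+
  have Mab: "a \<in> X" "v \<notin> X" if "X \<in> M" for X using that by (auto simp: M fam_def sep_def)
  let ?Q = "\<lambda>t. stok t \<and> chain M (ar t 15) (sc t 6) \<and>
    (\<forall>y<n. \<forall>z<n. ar t 15 y = ar t 15 z \<longrightarrow> ar s 15 y = ar s 15 z) \<and>
    (ar t 15 i = ar t 15 p \<longrightarrow> (\<forall>X\<in>M. i \<in> X \<longrightarrow> p \<in> X)) \<and> tk t \<le> tk s + QT P \<phi> + n * 24 + 20"
  show ?thesis
  proof (cases "ar s 15 i = ar s 15 p \<and> p \<noteq> a \<and> i \<noteq> v")
    case False
    then show ?thesis using i V ch Mab by (auto simp: trysplit_def)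
  next
    case True
    define s1 where "s1 = tick (length (cn 0 (Neq (Va 8) (Va 21))) + 2) (tick (length (cn 0 (Neq (Va 9) (Va 20))) + 2)
        (tick (length (cn 0 (Eq (Ar 15 (Va 8)) (Ar 15 (Va 9)))) + 2) s))"
    have red: "wp (trysplit P) q s = wp (set_split ;; query P ;; IfR (RAr 2 (Va 2)) (RV 1) Skip do_split) q s1" for q
      using True i V by (simp add: trysplit_def s1_def)
    have s1: "sc s1 = sc s" "ar s1 = ar s" "ra s1 = ra s" "tk s1 = tk s + 3" by (simp_all add: s1_def)
    have n0: "sc s1 0 = n" using V(1) s1 by (simp add: env_def)
    show ?thesis unfolding red wp_simps(9)
    proof (rule wp_conseq[OF set_split_correct[OF n0]], goal_cases)
      case (1 t1)
      define r where "r = ar t1 8"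
      have rz: "r z = (if r0 z = p then v else if r0 z = i then a else r0 z)" if "z < n" for z
        using 1(1) that i V s1 by (simp add: r_def)
      have split: "repr r" "r a = a" "r v = v"
        and scl: "sep a v X \<Longrightarrow> closed r X \<longleftrightarrow> closed r0 X \<and> i \<in> X \<and> p \<notin> X" for X
        using split_closed[OF V(9,13,14,10,11) i(3-7) _ _ V(12) rz] True by auto
      have f1: "sc t1 20 = a" "sc t1 21 = v" "sc t1 2 = v" "sc t1 8 = i" "sc t1 6 = sc s 6" "ar t1 15 = ar s 15" "ra t1 2 v = c"
        "sc t1 0 = n"
        using 1(2) s1 V i n0 by (simp_all add: frm_def set_split_def)
      have st1: "stok t1" using 1(2) s1 V(2) by (simp add: frm_def set_split_def stok_def)
      have es: "env s1" using V(1) by (simp add: env_def s1)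
      have e1: "env t1" using env_frm[OF 1(2) _ _ _ _ _ _ _ _ _ es] by (simp add: set_split_def)
      have tk1: "tk t1 \<le> tk s + n * 12 + 5" using 1(1) s1 by simp
      have q: "wp (query P) (\<lambda>t. \<exists>W. sep a v W \<and> closed r W \<and> bounded_by r a v (d W) \<and> rs t 1 = d W \<and>
        (\<forall>y<n. ar t 12 y = of_bool ((y \<in> W) \<noteq> (0 \<in> W))) \<and> stok t \<and> tk t \<le> tk t1 + QT P \<phi>) t1"
        by (rule query_correct[OF P e1 r_def[symmetric] split(1) st1 f1(1,2) V(10,11,12) split(2,3)])
      show ?case
      proof (rule wp_conseq[OF q], goal_cases)
        case (1 t2)
        then obtain W where W: "sep a v W" "closed r W" "bounded_by r a v (d W)" "rs t2 1 = d W"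
          "\<forall>y<n. ar t2 12 y = of_bool ((y \<in> W) \<noteq> (0 \<in> W))" "stok t2" "tk t2 \<le> tk t1 + QT P \<phi>" by blast
        have f2: "sc t2 2 = v" "sc t2 8 = i" "sc t2 20 = a" "sc t2 6 = sc s 6" "ar t2 15 = ar s 15" "ra t2 2 v = c" "sc t2 0 = n"
          using 1(2) f1 by (simp_all add: frm_def)
        show ?case
        proof (cases "c < d W")
          case True
          have "\<not> (i \<in> X \<and> p \<notin> X)" if X: "X \<in> M" for X
          proof
            assume a: "i \<in> X \<and> p \<notin> X"
            have "sep a v X" "closed r0 X" "d X = c" using X by (auto simp: M fam_def)
            then have "d W \<le> c" using W(3) a scl[of X] by (auto simp: bounded_by_def)
            then show False using True by simp
          qed
          then have none: "\<forall>X\<in>M. i \<in> X \<longrightarrow> p \<in> X" by blast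
          show ?thesis using True f2 W(4,6,7) ch tk1 none by simp
        next
          case False
          have W0: "closed r0 W" "i \<in> W" "p \<notin> W" using scl[OF W(1)] W(2) by auto
          then have "c \<le> d W" using V(8) W(1) by (simp add: bounded_by_def)
          then have WM: "W \<in> M" using False W(1) W0 by (simp add: M fam_def)
          let ?t = "tick (length (cr 0 0 (RAr 2 (Va 2)) @ cr 0 1 (RV 1)) + 1) t2"
          have n2: "sc ?t 0 = n" using f2 by simp
          have aW: "a \<in> W" using W(1) by (simp add: sep_def)
          have side: "ar t2 12 y \<noteq> ar t2 12 a \<longleftrightarrow> y \<notin> W" if "y < n" for y
            using W(5) that V(10) aW by auto
          have "wp do_split (\<lambda>t. ?Q (tick 1 t)) ?t"
          proof (rule wp_conseq[OF do_split_correct[OF n2]], goal_cases)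
            case (1 t3)
            have L: "ar t3 15 y = (if ar s 15 i < ar s 15 y \<or> ar s 15 y = ar s 15 i \<and> y \<notin> W then Suc (ar s 15 y) else ar s 15 y)"
              if "y < n" for y
              using 1(1) that f2 side[OF that] by simp
            have "chain M (ar t3 15) (Suc (sc s 6))"
              unfolding M by (rule chain_split[OF V(8) ch[unfolded M] WM[unfolded M] i(3,4) _ W0(2,3) L])
                (use \<open>ar s 15 i = ar s 15 p \<and> p \<noteq> a \<and> i \<noteq> v\<close> in auto)
            moreover have "\<forall>y<n. \<forall>z<n. ar t3 15 y = ar t3 15 z \<longrightarrow> ar s 15 y = ar s 15 z"
              using L by (auto split: if_splits)
            moreover have "ar t3 15 i \<noteq> ar t3 15 p"
              using L[OF i(3)] L[OF i(4)] W0 \<open>ar s 15 i = ar s 15 p \<and> p \<noteq> a \<and> i \<noteq> v\<close> by simp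
            moreover have "stok t3" using 1(2) W(6) by (simp add: frm_def do_split_def stok_def)
            moreover have "tk t3 \<le> tk s + QT P \<phi> + n * 24 + 19" using 1(1) W(7) tk1 by simp
            ultimately show ?case using 1(1) f2 by simp
          qed
          then show ?thesis using False f2 W(4) by simp
        qed
      qed
    qed
  qed
qed

lemma find_anchor_sets [simp]:
  "wsc find_anchor = {5, 7}" "war find_anchor = {}" "wrs find_anchor = {}" "wra find_anchor = {}" "silent find_anchor"
  by (auto simp: find_anchor_def)

lemma find_anchor_correct:
  assumes "sc s 0 = n" "sc s 4 = y"
  shows "wp find_anchor (\<lambda>t. (sc t 7 = n \<and> (\<forall>z<y. ar s 14 z = z \<longrightarrow> ar s 15 z \<noteq> ar s 15 y) \<or>
      sc t 7 < y \<and> ar s 14 (sc t 7) = sc t 7 \<and> ar s 15 (sc t 7) = ar s 15 y) \<and> tk t \<le> tk s + y * 10 + 3) s"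
  unfolding find_anchor_def wp_simps(9) wp_simps(2)
proof (rule wp_mono[OF wp_For[where N = y and B = 7 and
        J = "\<lambda>i t. sc t 7 = n \<and> (\<forall>z<i. ar s 14 z = z \<longrightarrow> ar s 15 z \<noteq> ar s 15 y) \<or>
      sc t 7 < i \<and> ar s 14 (sc t 7) = sc t 7 \<and> ar s 15 (sc t 7) = ar s 15 y"]], goal_cases)
  case 1 show ?case using assms by simp
next
  case (2 i t) then show ?case using assms by (simp add: frm_def)
next
  case (4 i t)
  have t: "ar t = ar s" "sc t 4 = y" using 4(4) assms by (auto simp: frm_def)
  show ?case using t 4(2,3) by (auto simp: less_Suc_eq)
qed auto

lemma refine_sets [simp]:
  "x < 5 \<or> 15 < x \<and> x < 22 \<Longrightarrow> x \<notin> wsc (refine P)"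
  "k < 8 \<or> 12 < k \<and> k < 15 \<or> 15 < k \<and> k < 20 \<Longrightarrow> k \<notin> war (refine P)"
  "k \<noteq> 20 \<Longrightarrow> k \<notin> wra (refine P)" "silent (refine P)"
  by (auto simp: refine_def)

text \<open>Progress of the refinement, stated for representatives below \<open>y\<close>; all other
  vertices follow their representatives because members of the family are closed.\<close>

definition merged :: "(nat \<Rightarrow> nat) \<Rightarrow> nat set set \<Rightarrow> nat \<Rightarrow> (nat \<Rightarrow> nat) \<Rightarrow> bool" where
  "merged r0 M y L \<longleftrightarrow> (\<forall>y1<y. \<forall>y2<y. r0 y1 = y1 \<longrightarrow> r0 y2 = y2 \<longrightarrow> L y1 = L y2 \<longrightarrow> (\<forall>X\<in>M. (y1 \<in> X) = (y2 \<in> X)))"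

text \<open>After both attempts, \<open>y\<close> and its anchor have different labels or are
  separated by no cut of the family. Earlier representatives of the same block behave like the
  anchor, so one comparison settles them all.\<close>

lemma refine_correct:
  assumes P: "min_st_cut_program P \<phi>" and v: "vctx v r0 a c s" and M: "M = fam r0 a v c"
    and ch: "chain M (ar s 15) (sc s 6)" and y: "sc s 4 = y" "y < n" and mg: "merged r0 M y (ar s 15)"
  shows "wp (refine P) (\<lambda>t. stok t \<and> chain M (ar t 15) (sc t 6) \<and> merged r0 M (Suc y) (ar t 15) \<and>
    tk t \<le> tk s + 2 * QT P \<phi> + n * 58 + 60) s"
proof -
  have V: "env s" "stok s" "sc s 2 = v" "ar s 14 = r0" "sc s 20 = a" "sc s 21 = v" "repr r0"
    using v unfolding vctx_def by blast+
  let ?Q = "\<lambda>t. stok t \<and> chain M (ar t 15) (sc t 6) \<and> merged r0 M (Suc y) (ar t 15) \<and>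
    tk t \<le> tk s + 2 * QT P \<phi> + n * 58 + 60"
  show ?thesis
  proof (cases "r0 y = y")
    case False
    then have "merged r0 M (Suc y) (ar s 15)" using mg unfolding merged_def less_Suc_eq by metis
    then show ?thesis using False V y ch by (simp add: refine_def)
  next
    case True
    let ?s = "tick (length (cn 0 (Eq (Ar 14 (Va 4)) (Va 4))) + 2) s"
    let ?I = "Ite (Lt (Va 7) (Va 0)) (Asg 8 (Va 7) ;; Asg 9 (Va 4) ;; trysplit P ;;
       Asg 8 (Va 4) ;; Asg 9 (Va 7) ;; trysplit P) Skip"
    have n0: "sc ?s 0 = n" "sc ?s 4 = y" using V(1) y by (simp_all add: env_def)
    have "wp find_anchor (wp ?I ?Q) ?s"
    proof (rule wp_conseq[OF find_anchor_correct[OF n0]], goal_cases)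
      case (1 t1)
      have f1: "sc t1 0 = n" "sc t1 4 = y" "ar t1 = ar s" "sc t1 6 = sc s 6" "ra t1 = ra s"
        using 1(2) n0 by (auto simp: frm_def)
      have st1: "stok t1" using 1(2) V(2) by (simp add: frm_def stok_def)
      have vs: "vctx v r0 a c ?s" using v by (simp add: vctx_def env_def)
      have v1: "vctx v r0 a c t1" using vctx_frm[OF 1(2) _ _ _ _ _ _ _ _ _ _ _ _ _ _ vs st1] by simp
      have tk1: "tk t1 \<le> tk s + n * 10 + 4"
      proof -
        have "y * 10 \<le> n * 10" using y by simp
        then show ?thesis using 1(1) by simp
      qed
      show ?case
      proof (cases "sc t1 7 < n")
        case False
        then have "\<forall>z<y. r0 z = z \<longrightarrow> ar s 15 z \<noteq> ar s 15 y" using 1(1) V(4) y by auto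
        then have "merged r0 M (Suc y) (ar s 15)" using mg unfolding merged_def less_Suc_eq by metis
        then show ?thesis using False f1 st1 ch tk1 by simp
      next
        case T7: True
        define u where "u = sc t1 7"
        have u: "u < y" "r0 u = u" "ar s 15 u = ar s 15 y" using 1(1) T7 V(4) by (auto simp: u_def)
        have un: "u < n" "u \<noteq> y" using u y by auto
        define t2 where "t2 = tick (cost (Asg 9 (Va 4))) (tick (cost (Asg 8 (Va 7))) (tick (length (cn 0 (Lt (Va 7) (Va 0))) + 2) t1
            \<lparr>sc := (sc t1)(8 := u)\<rparr>)\<lparr>sc := (sc t1)(8 := u, 9 := y)\<rparr>)"
        have t2: "sc t2 = (sc t1)(8 := u, 9 := y)" "ar t2 = ar s" "ra t2 = ra s" "tk t2 = tk t1 + 3"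
          using f1 by (simp_all add: t2_def)
        have v2: "vctx v r0 a c t2" using v1 f1 by (simp add: vctx_def env_def stok_def t2)
        have red: "wp ?I ?Q t1 = wp (trysplit P) (wp (Asg 8 (Va 4) ;; Asg 9 (Va 7) ;; trysplit P) ?Q) t2"
          using T7 f1 by (simp add: t2_def u_def)
        have c2: "chain M (ar t2 15) (sc t2 6)" "sc t2 8 = u" "sc t2 9 = y" using ch f1 t2 by simp_all
        show ?thesis unfolding red
        proof (rule wp_conseq[OF trysplit_correct[OF P v2 M c2 un(1) y(2) u(2) True un(2)]], goal_cases)
          case (1 t3)
          have f3: "sc t3 4 = y" "sc t3 7 = u" using 1(2) f1 t2 by (simp_all add: frm_def u_def)
          have st3: "stok t3" using 1(1) by simp
          have v3: "vctx v r0 a c t3" using vctx_frm[OF 1(2) _ _ _ _ _ _ _ _ _ _ _ _ _ _ v2 st3] by simp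
          define t4 where "t4 = tick (cost (Asg 9 (Va 7))) (tick (cost (Asg 8 (Va 4))) (t3\<lparr>sc := (sc t3)(8 := y)\<rparr>)
              \<lparr>sc := (sc t3)(8 := y, 9 := u)\<rparr>)"
          have t4: "sc t4 = (sc t3)(8 := y, 9 := u)" "ar t4 = ar t3" "ra t4 = ra t3" "tk t4 = tk t3 + 2"
            by (simp_all add: t4_def)
          have v4: "vctx v r0 a c t4" using v3 by (simp add: vctx_def env_def stok_def t4)
          have red2: "wp (Asg 8 (Va 4) ;; Asg 9 (Va 7) ;; trysplit P) ?Q t3 = wp (trysplit P) ?Q t4"
            using f3 by (simp add: t4_def)
          have c4: "chain M (ar t4 15) (sc t4 6)" "sc t4 8 = y" "sc t4 9 = u" using 1(1) t4 by simp_all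
          have L3: "ar t3 15 y1 = ar t3 15 y2 \<Longrightarrow> ar s 15 y1 = ar s 15 y2" if "y1 < n" "y2 < n" for y1 y2
            using 1(1)[unfolded t2(2)] that by blast
          have s3: "ar t3 15 u = ar t3 15 y \<Longrightarrow> X \<in> M \<Longrightarrow> u \<in> X \<Longrightarrow> y \<in> X" for X using 1(1) by blast
          have tk3: "tk t3 \<le> tk s + n * 34 + 27 + QT P \<phi>" using 1(1) t2 tk1 by simp
          show ?case unfolding red2
          proof (rule wp_mono[OF trysplit_correct[OF P v4 M c4 y(2) un(1) True u(2) un(2)[symmetric]]], goal_cases)
            case (1 t5)
            have L5: "ar t5 15 y1 = ar t5 15 y2 \<Longrightarrow> ar t3 15 y1 = ar t3 15 y2" if "y1 < n" "y2 < n" for y1 y2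
              using 1[unfolded t4(2)] that by blast
            have s5: "ar t5 15 y = ar t5 15 u \<Longrightarrow> X \<in> M \<Longrightarrow> y \<in> X \<Longrightarrow> u \<in> X" for X using 1 by blast
            have ch5: "chain M (ar t5 15) (sc t5 6)" using 1 by blast
            have old: "(y1 \<in> X) = (y2 \<in> X)" if "y1 < y" "y2 < y" "r0 y1 = y1" "r0 y2 = y2" "ar s 15 y1 = ar s 15 y2" "X \<in> M" for y1 y2 X
              using mg that unfolding merged_def by blast
            \<comment> \<open>Labels only become finer, so \<open>y1\<close> shared the block of
              \<open>y\<close> from the beginning and is inseparable from the anchor
              \<open>u\<close>. Inseparable vertices have equal labels in any chain, hence
              \<open>u\<close> and \<open>y\<close> still share a label, and both failed attempts
              apply.\<close>
            have new: "(y1 \<in> X) = (y \<in> X)" if y1: "y1 < y" "r0 y1 = y1" "ar t5 15 y1 = ar t5 15 y" "X \<in> M" for y1 X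
            proof -
              have y1n: "y1 < n" using y1(1) y(2) by simp
              have "ar s 15 y1 = ar s 15 y" using L3[OF y1n y(2) L5[OF y1n y(2) y1(3)]] .
              then have o: "(y1 \<in> Z) = (u \<in> Z)" if "Z \<in> M" for Z using old[OF y1(1) u(1) y1(2) u(2)] u(3) that by simp
              then have "ar t5 15 y1 = ar t5 15 u" using chain_label_eq[OF ch5 y1n un(1)] by blast
              then have "ar t5 15 u = ar t5 15 y" using y1 by simp
              moreover from this have "ar t3 15 u = ar t3 15 y" using L5 un y(2) by blast
              ultimately have "(u \<in> X) = (y \<in> X)" using s3[OF _ y1(4)] s5[OF _ y1(4)] by auto
              then show ?thesis using o[OF y1(4)] by simp
            qed
            have "merged r0 M (Suc y) (ar t5 15)"
              unfolding merged_def
            proof (intro allI impI ballI)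
              fix y1 y2 X assume a: "y1 < Suc y" "y2 < Suc y" "r0 y1 = y1" "r0 y2 = y2" "ar t5 15 y1 = ar t5 15 y2" "X \<in> M"
              show "(y1 \<in> X) = (y2 \<in> X)"
              proof (cases "y1 = y"; cases "y2 = y")
                assume "y1 \<noteq> y" "y2 \<noteq> y"
                then show ?thesis using old[of y1 y2 X] a L5[of y1 y2] L3[of y1 y2] y(2) by simp
              next
                assume "y1 \<noteq> y" "y2 = y"
                then show ?thesis using new[of y1 X] a by simp
              next
                assume "y1 = y" "y2 \<noteq> y"
                then show ?thesis using new[of y2 X] a by simp
              qed simp
            qed
            then show ?case using 1 t4 tk3 by simp
          qed
        qed
      qed
    qed
    then show ?thesis using True V y by (simp add: refine_def)
  qed
qed

text \<open>What is stored for \<open>v\<close>: the number 0 for no cuts, or a labelling under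
  which the charged cuts correspond bijectively to ideals.\<close>

definition rowok :: "(nat \<Rightarrow> nat) \<Rightarrow> (nat \<Rightarrow> real) \<Rightarrow> nat \<Rightarrow> nat \<Rightarrow> (nat \<Rightarrow> nat) \<Rightarrow> bool" where
  "rowok par Lam v k L \<longleftrightarrow> (if k = 0 then emitted par Lam v = {}
     else emitted par Lam v = (\<lambda>I. {y. y < n \<and> L y \<in> I}) ` ideals (ideal_edge L) k \<and>
       inj_on (\<lambda>I. {y. y < n \<and> L y \<in> I}) (ideals (ideal_edge L) k) \<and> k < n \<and> (\<forall>y<n. L y \<le> k))"

lemma ideal_edge_cong:
  assumes "\<And>y. y < n \<Longrightarrow> L y = L' y"
  shows "ideal_edge L = ideal_edge L'"
proof
  fix j
  have "L (ea i) = L' (ea i)" "L (eb i) = L' (eb i)" if "i < m" for i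
    using ends[OF that] assms by auto
  then show "ideal_edge L j = ideal_edge L' j" unfolding ideal_edge_def by auto
qed

lemma rowok_cong: "(\<And>y. y < n \<Longrightarrow> L y = L' y) \<Longrightarrow> rowok par Lam v k L = rowok par Lam v k L'"
proof -
  assume a: "\<And>y. y < n \<Longrightarrow> L y = L' y"
  have "{y. y < n \<and> L y \<in> I} = {y. y < n \<and> L' y \<in> I}" for I using a by auto
  then show ?thesis using a ideal_edge_cong[OF a] by (simp add: rowok_def)
qed

lemma make_chain_sets [simp]:
  "x < 4 \<or> 15 < x \<and> x < 22 \<Longrightarrow> x \<notin> wsc (make_chain P)"
  "k < 8 \<or> 12 < k \<and> k < 15 \<or> 17 < k \<and> k < 20 \<Longrightarrow> k \<notin> war (make_chain P)"
  "k \<noteq> 20 \<Longrightarrow> k \<notin> wra (make_chain P)" "silent (make_chain P)"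
  by (auto simp: make_chain_def)

text \<open>Once all vertices have been treated, no cut of the family splits a block; this is the
  hypothesis \<open>full\<close> of \<open>fam_eq_ideals\<close>.\<close>

lemma make_chain_correct:
  assumes P: "min_st_cut_program P \<phi>" and v: "vctx v r0 a c s" and M: "M = fam r0 a v c"
    and W: "W \<in> M" "\<And>y. y < n \<Longrightarrow> ar s 12 y = of_bool ((y \<in> W) \<noteq> (0 \<in> W))"
    and em: "emitted par Lam v = M"
  shows "wp (make_chain P) (\<lambda>t. stok t \<and> (\<exists>k L. ar t 16 = (ar s 16)(v := k) \<and> rowok par Lam v k L \<and>
     (\<forall>y<n. ar t 17 (v * n + y) = L y) \<and> (\<forall>z. z < v * n \<longrightarrow> ar t 17 z = ar s 17 z)) \<and>
    tk t \<le> tk s + n * (2 * QT P \<phi> + n * 58 + 63) + n * 8 + 8) s"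
proof -
  have V: "env s" "stok s" "sc s 2 = v" "ar s 14 = r0" "sc s 20 = a" "sc s 21 = v" "ra s 2 v = c"
    "bounded_by r0 a v c" "repr r0" "a < n" "v < n" "a \<noteq> v" "r0 a = a" "r0 v = v"
    using v unfolding vctx_def by blast+
  have n0: "sc s 0 = n" using V(1) by (simp add: env_def)
  have aW: "a \<in> W" using W(1) by (simp add: M fam_def sep_def)
  have f: "wp (For 5 (Va 0) (Sto 15 (Va 5) (Neq (Ar 12 (Va 5)) (Ar 12 (Va 20))))) (\<lambda>t. (\<forall>i<n. ar t 15 i = of_bool (i \<notin> W)) \<and>
      (\<forall>z. z \<notin> (\<lambda>i. i) ` {..<n} \<longrightarrow> ar t 15 z = ar s 15 z) \<and> tk t \<le> tk s + n * 4 + 2) s"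
    by (rule fill) (use n0 V W(2) aW in auto)
  show ?thesis unfolding make_chain_def wp_simps(9)
  proof (rule wp_conseq[OF f], goal_cases)
    case (1 t1)
    let ?t = "tick (cost (Asg 6 (Co 1))) (t1\<lparr>sc := (sc t1)(6 := 1)\<rparr>)"
    have st1: "stok t1" using 1(2) V(2) by (simp add: frm_def stok_def)
    have v1: "vctx v r0 a c t1" using vctx_frm[OF 1(2) _ _ _ _ _ _ _ _ _ _ _ _ _ _ v st1] by simp
    have vt: "vctx v r0 a c ?t" using v1 by (simp add: vctx_def env_def stok_def)
    have ch0: "chain M (ar ?t 15) (sc ?t 6)"
      using chain_init[OF W(1)[unfolded M] V(11), of "ar t1 15"] 1(1) M by simp
    have f16: "ar t1 16 = ar s 16" "ar t1 17 = ar s 17" using 1(2) by (simp_all add: frm_def)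
    have tk1: "tk t1 \<le> tk s + n * 4 + 2" using 1(1) by simp
    have "wp (For 4 (Va 0) (refine P)) (\<lambda>t. (stok t \<and> chain M (ar t 15) (sc t 6) \<and> merged r0 M n (ar t 15)) \<and> sc t 4 = n \<and>
        frm (For 4 (Va 0) (refine P)) ?t t \<and> tk t \<le> tk ?t + n * (2 * QT P \<phi> + n * 58 + 60 + 3) + 2) ?t"
    proof (rule wp_For[where J = "\<lambda>y t. stok t \<and> chain M (ar t 15) (sc t 6) \<and> merged r0 M y (ar t 15)"], goal_cases)
      case 1 show ?case using vt ch0 by (simp add: vctx_def merged_def)
    next
      case (2 i t)
      have "vctx v r0 a c t" using vctx_frm[OF 2(3) _ _ _ _ _ _ _ _ _ _ _ _ _ _ vt] 2 by simp
      then show ?case by (simp add: vctx_def env_def)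
    next
      case 3 show ?case by simp
    next
      case (4 y t)
      have "vctx v r0 a c t" using vctx_frm[OF 4(4) _ _ _ _ _ _ _ _ _ _ _ _ _ _ vt] 4 by simp
      then show ?case
        by (rule wp_mono[OF refine_correct[OF P _ M _ 4(3,1)]]) (use 4(2) in auto)
    next
      case (5 i t x y z) then show ?case by simp
    qed
    then have "wp (For 4 (Va 0) (refine P)) (wp (Sto 16 (Va 2) (Va 6)) (wp (For 5 (Va 0) (Sto 17 (Add (Ar 3 (Va 2)) (Va 5)) (Ar 15 (Va 5))))
      (\<lambda>t. stok t \<and> (\<exists>k L. ar t 16 = (ar s 16)(v := k) \<and> rowok par Lam v k L \<and>
     (\<forall>y<n. ar t 17 (v * n + y) = L y) \<and> (\<forall>z. z < v * n \<longrightarrow> ar t 17 z = ar s 17 z)) \<and>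
      tk t \<le> tk s + n * (2 * QT P \<phi> + n * 58 + 63) + n * 8 + 8))) ?t"
    proof (rule wp_mono, goal_cases)
      case (1 t2)
      then have st2: "stok t2" and ch2: "chain M (ar t2 15) (sc t2 6)" and mg2: "merged r0 M n (ar t2 15)"
        and fr2: "frm (For 4 (Va 0) (refine P)) ?t t2" by auto
      have tk2: "tk t2 \<le> tk s + n * 4 + 5 + n * (2 * QT P \<phi> + n * 58 + 63)" using 1 tk1 by (simp add: algebra_simps)
      have v2: "vctx v r0 a c t2" using vctx_frm[OF fr2 _ _ _ _ _ _ _ _ _ _ _ _ _ _ vt st2] by simp
      then have e2: "env t2" "sc t2 2 = v" by (simp_all add: vctx_def)
      have f2: "ar t2 16 = ar s 16" "ar t2 17 = ar s 17" using fr2 f16 by (simp_all add: frm_def)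
      define k L where "k = sc t2 6" and "L = ar t2 15"
      \<comment> \<open>A vertex agrees with its representative in label and in membership, and
        \<open>merged\<close> compares the representatives.\<close>
      have full: "(y \<in> X) = (z \<in> X)" if yz: "X \<in> M" "y < n" "z < n" "L y = L z" for X y z
      proof -
        have r: "r0 y < n" "r0 (r0 y) = r0 y" "r0 z < n" "r0 (r0 z) = r0 z" using V(9) yz by (auto simp: repr_def)
        have c: "(x \<in> Z) = (r0 x \<in> Z)" if "x < n" "Z \<in> M" for x Z using that by (auto simp: M fam_def closed_def)
        have lab: "L x = L (r0 x)" if "x < n" "r0 x < n" for x
          using chain_label_eq[OF ch2, of x "r0 x"] c that by (simp add: L_def)
        have "L (r0 y) = L (r0 z)" using lab[OF yz(2) r(1)] lab[OF yz(3) r(3)] yz(4) by metis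
        then have "(r0 y \<in> X) = (r0 z \<in> X)" using mg2 r yz(1) unfolding merged_def L_def by blast
        then show ?thesis using c[OF yz(2,1)] c[OF yz(3,1)] by metis
      qed
      have chL: "chain (fam r0 a v c) L k" using ch2 by (simp add: M k_def L_def)
      have row: "rowok par Lam v k L"
      proof -
        have k: "k \<noteq> 0" "\<forall>y<n. L y \<le> k" using chL by (auto simp: chain_def)
        have kn: "k < n" using chain_length[OF chL] .
        have F: "\<And>X y z. X \<in> fam r0 a v c \<Longrightarrow> y < n \<Longrightarrow> z < n \<Longrightarrow> L y = L z \<Longrightarrow> (y \<in> X) = (z \<in> X)"
          using full unfolding M by blast
        note i = fam_eq_ideals[OF V(9) chL V(11) F]
        show ?thesis unfolding rowok_def if_not_P[OF k(1)] em M
          by (intro conjI kn k(2) i)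
      qed
      let ?t3 = "tick (cost (Sto 16 (Va 2) (Va 6))) (t2\<lparr>ar := (ar t2)(16 := (ar t2 16)(v := k))\<rparr>)"
      have n3: "sc t2 0 = n" "ar t2 3 v = v * n" using e2 V(11) by (simp_all add: env_def)
      have g: "wp (For 5 (Va 0) (Sto 17 (Add (Ar 3 (Va 2)) (Va 5)) (Ar 15 (Va 5)))) (\<lambda>t. (\<forall>i<n. ar t 17 (v * n + i) = L i) \<and>
        (\<forall>z. z \<notin> (\<lambda>i. v * n + i) ` {..<n} \<longrightarrow> ar t 17 z = ar ?t3 17 z) \<and> tk t \<le> tk ?t3 + n * 4 + 2) ?t3"
        by (rule fill) (use n3 e2 in \<open>auto simp: L_def\<close>)
      have "wp (For 5 (Va 0) (Sto 17 (Add (Ar 3 (Va 2)) (Va 5)) (Ar 15 (Va 5))))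
       (\<lambda>t. stok t \<and> (\<exists>k L. ar t 16 = (ar s 16)(v := k) \<and> rowok par Lam v k L \<and>
       (\<forall>y<n. ar t 17 (v * n + y) = L y) \<and> (\<forall>z. z < v * n \<longrightarrow> ar t 17 z = ar s 17 z)) \<and>
        tk t \<le> tk s + n * (2 * QT P \<phi> + n * 58 + 63) + n * 8 + 8) ?t3"
      proof (rule wp_conseq[OF g], goal_cases)
        case (1 t4)
        have "stok t4" using 1(2) st2 by (simp add: frm_def stok_def)
        moreover have "ar t4 16 = (ar s 16)(v := k)" using 1(2) f2 by (simp add: frm_def)
        moreover have "ar t4 17 z = ar s 17 z" if z: "z < v * n" for z
        proof -
          have "z \<notin> (\<lambda>i. v * n + i) ` {..<n}" using z by force
          then have "ar t4 17 z = ar ?t3 17 z" using 1(1) by blast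
          then show ?thesis using f2 by simp
        qed
        moreover have "tk t4 \<le> tk s + n * (2 * QT P \<phi> + n * 58 + 63) + n * 8 + 8" using 1(1) tk2 by simp
        ultimately show ?case using row 1(1) by blast
      qed
      then show ?case using e2 by (simp add: k_def)
    qed
    then show ?case by simp
  qed
qed

lemma one_vertex_sets [simp]:
  "x < 4 \<or> 15 < x \<and> x < 20 \<Longrightarrow> x \<notin> wsc (one_vertex P)"
  "k < 8 \<or> k = 13 \<or> 17 < k \<and> k < 20 \<Longrightarrow> k \<notin> war (one_vertex P)"
  "k \<noteq> 20 \<Longrightarrow> k \<notin> wra (one_vertex P)" "silent (one_vertex P)"
  by (auto simp: one_vertex_def set_r0_def)

lemma one_vertex_correct:
  assumes P: "min_st_cut_program P \<phi>" and env: "env s" and st: "stok s"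
    and par: "parents (ar s 13) (ra s 2)" and v: "sc s 2 = v" "0 < v" "v < n"
  shows "wp (one_vertex P) (\<lambda>t. stok t \<and> (\<exists>k L. ar t 16 = (ar s 16)(v := k) \<and> rowok (ar s 13) (ra s 2) v k L \<and>
     (\<forall>y<n. ar t 17 (v * n + y) = L y) \<and> (\<forall>z. z < v * n \<longrightarrow> ar t 17 z = ar s 17 z)) \<and>
    tk t \<le> tk s + n * (2 * QT P \<phi> + n * 58 + 63) + QT P \<phi> + n * 27 + 20) s"
proof -
  have n0: "sc s 0 = n" using env by (simp add: env_def)
  show ?thesis unfolding one_vertex_def wp_simps(9)
  proof (rule wp_conseq[OF set_r0_correct[OF n0 v(1) par]], goal_cases)
    case (1 t1)
    define r0 where "r0 = ar t1 14"
    define a where "a = r0 (ar s 13 v)"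
    define c where "c = ra s 2 v"
    have r0: "r0 y = (if 0 < y \<and> y < v \<and> ra s 2 y = ra s 2 v then r0 (ar s 13 y) else y)" if "y < n" for y
      using 1(1) that by (simp add: r0_def)
    note E = emitted_eq_fam[OF par v(2,3) r0]
    have R: "repr r0" "r0 v = v" "a < v" "emitted (ar s 13) (ra s 2) v = fam r0 a v c" "bounded_by r0 a v c"
      using E by (simp_all add: a_def c_def)
    have an: "a < n" "a \<noteq> v" using R(3) v by auto
    have pn: "ar s 13 v < n" using parentsD(2)[OF par v(2,3)] .
    have ra: "r0 a = a" using R(1) pn by (simp add: repr_def a_def)
    have f1: "sc t1 2 = v" "ar t1 13 = ar s 13" "ra t1 = ra s" "ar t1 16 = ar s 16" "ar t1 17 = ar s 17" "ar t1 14 = r0"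
      using 1(2) v by (auto simp: frm_def set_r0_def r0_def)
    have e1: "env t1" using env_frm[OF 1(2) _ _ _ _ _ _ _ _ _ env] by (simp add: set_r0_def)
    have st1: "stok t1" using 1(2) st by (simp add: frm_def stok_def set_r0_def)
    have tk1: "tk t1 \<le> tk s + n * 15 + 2" using 1(1) by simp
    define t2 where "t2 = tick (cost (Asg 21 (Va 2))) (tick (cost (Asg 20 (Ar 14 (Ar 13 (Va 2))))) (t1\<lparr>sc := (sc t1)(20 := a)\<rparr>)
        \<lparr>sc := (sc t1)(20 := a, 21 := v)\<rparr>)"
    have t2: "sc t2 = (sc t1)(20 := a, 21 := v)" "ar t2 = ar t1" "ra t2 = ra t1" "tk t2 = tk t1 + 2" by (simp_all add: t2_def)
    have v2: "vctx v r0 a c t2" using e1 st1 f1 R an ra v by (simp add: vctx_def env_def stok_def t2 c_def)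
    have n2: "sc t2 0 = n" using v2 by (simp add: vctx_def env_def)
    have f: "wp (For 5 (Va 0) (Sto 8 (Va 5) (Ar 14 (Va 5)))) (\<lambda>t. (\<forall>i<n. ar t 8 i = r0 i) \<and>
        (\<forall>z. z \<notin> (\<lambda>i. i) ` {..<n} \<longrightarrow> ar t 8 z = ar t2 8 z) \<and> tk t \<le> tk t2 + n * 4 + 2) t2"
      by (rule fill) (use n2 f1 t2 in auto)
    let ?Q = "\<lambda>t. stok t \<and> (\<exists>k L. ar t 16 = (ar s 16)(v := k) \<and> rowok (ar s 13) (ra s 2) v k L \<and>
     (\<forall>y<n. ar t 17 (v * n + y) = L y) \<and> (\<forall>z. z < v * n \<longrightarrow> ar t 17 z = ar s 17 z)) \<and>
     tk t \<le> tk s + n * (2 * QT P \<phi> + n * 58 + 63) + QT P \<phi> + n * 27 + 20"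
    have "wp (For 5 (Va 0) (Sto 8 (Va 5) (Ar 14 (Va 5)))) (wp (query P) (wp (IfR (RAr 2 (Va 2)) (RV 1) (Sto 16 (Va 2) (Co 0)) (make_chain P)) ?Q)) t2"
    proof (rule wp_conseq[OF f], goal_cases)
      case (1 t3)
      have st3: "stok t3" using 1(2) v2 by (simp add: frm_def stok_def vctx_def)
      have v3: "vctx v r0 a c t3" using vctx_frm[OF 1(2) _ _ _ _ _ _ _ _ _ _ _ _ _ _ v2 st3] by simp
      have f3: "ar t3 16 = ar s 16" "ar t3 17 = ar s 17" using 1(2) f1 t2 by (simp_all add: frm_def)
      define r where "r = ar t3 8"
      have rr: "r y = r0 y" if "y < n" for y using 1(1) that by (simp add: r_def)
      have rep: "repr r" "r a = a" "r v = v" using R(1,2) rr an v ra by (auto simp: repr_def)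
      have clr: "closed r X = closed r0 X" for X using rr by (simp add: closed_def)
      have tk3: "tk t3 \<le> tk s + n * 19 + 6" using 1(1) t2 tk1 by simp
      have V3: "env t3" "sc t3 20 = a" "sc t3 21 = v" "sc t3 2 = v" "ra t3 2 v = c" using v3 by (simp_all add: vctx_def)
      have q: "wp (query P) (\<lambda>t. \<exists>W. sep a v W \<and> closed r W \<and> bounded_by r a v (d W) \<and> rs t 1 = d W \<and>
        (\<forall>y<n. ar t 12 y = of_bool ((y \<in> W) \<noteq> (0 \<in> W))) \<and> stok t \<and> tk t \<le> tk t3 + QT P \<phi>) t3"
        by (rule query_correct[OF P V3(1) r_def[symmetric] rep(1) st3 V3(2,3) an(1) v(3) an(2) rep(2,3)])
      show ?case
      proof (rule wp_conseq[OF q], goal_cases)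
        case (1 t4)
        then obtain W where W: "sep a v W" "closed r0 W" "bounded_by r0 a v (d W)" "rs t4 1 = d W"
          "\<forall>y<n. ar t4 12 y = of_bool ((y \<in> W) \<noteq> (0 \<in> W))" "stok t4" "tk t4 \<le> tk t3 + QT P \<phi>"
          unfolding clr bounded_by_def by blast
        have v4: "vctx v r0 a c t4" using vctx_frm[OF 1(2) _ _ _ _ _ _ _ _ _ _ _ _ _ _ v3 W(6)] by simp
        have f4: "ar t4 16 = ar s 16" "ar t4 17 = ar s 17" using 1(2) f3 by (simp_all add: frm_def)
        have V4: "sc t4 2 = v" "ra t4 2 v = c" using v4 by (simp_all add: vctx_def)
        show ?case
        proof (cases "c < d W")
          case True
          have "fam r0 a v c = {}" using W(3) True by (fastforce simp: fam_def bounded_by_def)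
          then have row: "rowok (ar s 13) (ra s 2) v 0 L" for L using R(4) by (simp add: rowok_def)
          have "tk t4 + 4 \<le> tk s + n * (2 * QT P \<phi> + n * 58 + 63) + QT P \<phi> + n * 27 + 20" using W(7) tk3 by simp
          moreover have "\<exists>k L. (ar s 16)(v := 0) = (ar s 16)(v := k) \<and> rowok (ar s 13) (ra s 2) v k L \<and>
             (\<forall>y<n. ar s 17 (v * n + y) = L y) \<and> (\<forall>z. z < v * n \<longrightarrow> ar s 17 z = ar s 17 z)"
            using row by (intro exI[of _ 0] exI[of _ "\<lambda>y. ar s 17 (v * n + y)"]) simp
          ultimately show ?thesis using True V4 W(4,6) f4 by (simp add: stok_def)
        next
          case False
          have "c \<le> d W" using R(5) W(1,2) by (simp add: bounded_by_def)
          then have WM: "W \<in> fam r0 a v c" using False W(1,2) by (simp add: fam_def)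
          let ?t = "tick (length (cr 0 0 (RAr 2 (Va 2)) @ cr 0 1 (RV 1)) + 1) t4"
          have vt: "vctx v r0 a c ?t" using v4 by (simp add: vctx_def env_def)
          have "wp (make_chain P) (\<lambda>t. stok t \<and> (\<exists>k L. ar t 16 = (ar ?t 16)(v := k) \<and> rowok (ar s 13) (ra s 2) v k L \<and>
             (\<forall>y<n. ar t 17 (v * n + y) = L y) \<and> (\<forall>z. z < v * n \<longrightarrow> ar t 17 z = ar ?t 17 z)) \<and>
            tk t \<le> tk ?t + n * (2 * QT P \<phi> + n * 58 + 63) + n * 8 + 8) ?t"
            by (rule make_chain_correct[OF P vt refl WM _ R(4)]) (use W(5) in simp)
          then have "wp (make_chain P) (\<lambda>t. ?Q (tick 1 t)) ?t"
            by (rule wp_mono) (use f4 W(7) tk3 in auto)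
          then show ?thesis using False V4 W(4) by simp
        qed
      qed
    qed
    then show ?case using f1 by (simp add: t2_def a_def)
  qed
qed

lemma phase1b_sets [simp]:
  "x \<in> {0, 1} \<Longrightarrow> x \<notin> wsc (phase1b P)" "k < 8 \<or> k = 13 \<or> 17 < k \<and> k < 20 \<Longrightarrow> k \<notin> war (phase1b P)"
  "k \<noteq> 20 \<Longrightarrow> k \<notin> wra (phase1b P)" "silent (phase1b P)"
  by (auto simp: phase1b_def)

lemma phase1b_correct:
  assumes P: "min_st_cut_program P \<phi>" and env: "env s" and st: "stok s"
    and par: "parents (ar s 13) (ra s 2)"
  shows "wp (phase1b P) (\<lambda>t. stok t \<and>
    (\<forall>v. 0 < v \<and> v < n \<longrightarrow> rowok (ar s 13) (ra s 2) v (ar t 16 v) (\<lambda>y. ar t 17 (v * n + y))) \<and>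
    tk t \<le> tk s + n * (n * (2 * QT P \<phi> + n * 58 + 63) + QT P \<phi> + n * 27 + 25) + 2) s"
  unfolding phase1b_def
proof (rule wp_mono[OF wp_For[where N = n and B = "n * (2 * QT P \<phi> + n * 58 + 63) + QT P \<phi> + n * 27 + 22" and
        J = "\<lambda>i t. stok t \<and> (\<forall>v. 0 < v \<and> v < i \<longrightarrow> rowok (ar s 13) (ra s 2) v (ar t 16 v) (\<lambda>y. ar t 17 (v * n + y)))"]], goal_cases)
  case 1 show ?case using st by simp
next
  case (2 i t) then show ?case using env by (simp add: frm_def env_def)
next
  case 3 show ?case by simp
next
  case (4 v t)
  have e: "env t" using env_frm[OF 4(4) _ _ _ _ _ _ _ _ _ env] by simp
  have f: "ar t 13 = ar s 13" "ra t 2 = ra s 2" using 4(4) by (simp_all add: frm_def)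
  show ?case
  proof (cases "v = 0")
    case True then show ?thesis using 4(2,3) by simp
  next
    case False
    let ?t = "tick (length (cn 0 (Va 2)) + 2) t"
    have et: "env ?t" "stok ?t" "parents (ar ?t 13) (ra ?t 2)" "sc ?t 2 = v" "0 < v"
      using e 4(2,3) par f False by (simp_all add: env_def)
    have "wp (one_vertex P) (\<lambda>t'. tk t' \<le> tk t + (n * (2 * QT P \<phi> + n * 58 + 63) + QT P \<phi> + n * 27 + 22) \<and> stok t' \<and>
       (\<forall>w. 0 < w \<and> w < Suc v \<longrightarrow> rowok (ar s 13) (ra s 2) w (ar t' 16 w) (\<lambda>y. ar t' 17 (w * n + y)))) ?t"
    proof (rule wp_mono[OF one_vertex_correct[OF P et(1,2,3,4,5) 4(1)]], goal_cases)
      case (1 t')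
      then obtain k L where kL: "ar t' 16 = (ar t 16)(v := k)" "rowok (ar s 13) (ra s 2) v k L"
        "\<And>y. y < n \<Longrightarrow> ar t' 17 (v * n + y) = L y" "\<And>z. z < v * n \<Longrightarrow> ar t' 17 z = ar t 17 z" using f by auto
      have "rowok (ar s 13) (ra s 2) w (ar t' 16 w) (\<lambda>y. ar t' 17 (w * n + y))" if w: "0 < w" "w < Suc v" for w
      proof (cases "w = v")
        case True
        then show ?thesis using kL(1,2) rowok_cong[of "\<lambda>y. ar t' 17 (v * n + y)" L] kL(3) by simp
      next
        case False
        then have wv: "w < v" using w by simp
        \<comment> \<open>Row \<open>w\<close> of array 17 ends before \<open>v * n\<close>, where
          the new row begins.\<close>
        have "ar t' 17 (w * n + y) = ar t 17 (w * n + y)" if "y < n" for y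
        proof (rule kL(4))
          have "w * n + y < Suc w * n" using that by simp
          also have "\<dots> \<le> v * n" using wv by (intro mult_le_mono1) simp
          finally show "w * n + y < v * n" .
        qed
        then have "rowok (ar s 13) (ra s 2) w (ar t 16 w) (\<lambda>y. ar t' 17 (w * n + y)) =
            rowok (ar s 13) (ra s 2) w (ar t 16 w) (\<lambda>y. ar t 17 (w * n + y))" by (rule rowok_cong)
        then show ?thesis using 4(2) w(1) wv kL(1) by simp
      qed
      then show ?case using 1 by simp
    qed
    then show ?thesis using False 4(3) by simp
  qed
next
  case (5 i t v a b) then show ?case by simp
next
  case (6 t) then show ?case by (simp add: algebra_simps)
qed

end

section \<open>Writing the cuts\<close>

text \<open>Outputs of a command are logged between its start and its end, so a tick bound for the
  command also bounds the times of its outputs.\<close>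

lemma big_log:
  "big c s s' \<Longrightarrow> tk s \<le> tk s' \<and>
     (\<exists>b. lg s' = lg s @ b \<and> (\<forall>x\<in>set b. tk s \<le> snd (snd x) \<and> snd (snd x) \<le> tk s'))"
proof (induction rule: big.induct)
  case (Seq c1 s s1 c2 s2)
  then obtain a b where "lg s1 = lg s @ a" "\<forall>x\<in>set a. tk s \<le> snd (snd x) \<and> snd (snd x) \<le> tk s1"
    "lg s2 = lg s1 @ b" "\<forall>x\<in>set b. tk s1 \<le> snd (snd x) \<and> snd (snd x) \<le> tk s2" by blast
  then show ?case using Seq by (intro conjI exI[of _ "a @ b"]) force+
next
  case (WhileT e s c s1 s2)
  then obtain a b where "lg s1 = lg s @ a" "\<forall>x\<in>set a. Suc (tk s) \<le> snd (snd x) \<and> snd (snd x) \<le> tk s1"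
    "lg s2 = lg s1 @ b" "\<forall>x\<in>set b. Suc (tk s1) \<le> snd (snd x) \<and> snd (snd x) \<le> tk s2" by auto
  then show ?case using WhileT by (intro conjI exI[of _ "a @ b"]) force+
qed fastforce+

lemma wp_log:
  assumes "wp c q s"
  shows "wp c (\<lambda>t. q t \<and> tk s \<le> tk t \<and>
    (\<exists>b. lg t = lg s @ b \<and> (\<forall>x\<in>set b. tk s \<le> snd (snd x) \<and> snd (snd x) \<le> tk t))) s"
  using assms big_log unfolding wp_def by blast

definition outcut :: cmd where
  "outcut = For 10 (Va 1) (Out (Neq (Ar 19 (Ar 15 (Ar 1 (Va 10)))) (Ar 19 (Ar 15 (Ar 2 (Va 10))))))"

text \<open>Clears the flag if an edge joins the tested label to a smaller one outside the current
  ideal; the caller tries both orders of the ends.\<close>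

definition chk :: "nat \<Rightarrow> nat \<Rightarrow> cmd" where
  "chk a b = Ite (Eq (Va b) (Va 5)) (Ite (Lt (Va a) (Va 5)) (Ite (Ar 19 (Va a)) Skip (Asg 9 (Co 0))) Skip) Skip"

definition test_label :: cmd where
  "test_label = Asg 9 (Co 1) ;; For 10 (Va 1) (IfR (RC 0) (RAr 1 (Va 10))
     (Asg 11 (Ar 15 (Ar 1 (Va 10))) ;; Asg 12 (Ar 15 (Ar 2 (Va 10))) ;; chk 11 12 ;; chk 12 11) Skip)"

text \<open>Up to \<open>n\<close> labels are each tested against all \<open>m\<close> edges. This
  search for the largest addable label is the source of the \<open>O(n m)\<close> delay.\<close>

definition nextset :: cmd where
  "nextset = Asg 8 (Co 0) ;;
     For 5 (Va 6) (Ite (Va 5) (Ite (Ar 19 (Va 5)) Skip (test_label ;; Ite (Va 9) (Asg 8 (Va 5)) Skip)) Skip) ;;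
     Asg 7 (Va 8) ;;
     Ite (Va 8) (Sto 19 (Va 8) (Co 1) ;; For 5 (Va 6) (Ite (Lt (Va 8) (Va 5)) (Sto 19 (Va 5) (Co 0)) Skip)) Skip"

text \<open>Entry \<open>k\<close> of array 19 is cleared as well, since the vertices of the sink
  block look it up when a cut is written.\<close>

definition enum :: cmd where
  "enum = Asg 6 (Ar 16 (Va 3)) ;; For 5 (Va 0) (Sto 15 (Va 5) (Ar 17 (Add (Ar 3 (Va 3)) (Va 5)))) ;;
     For 5 (Va 6) (Sto 19 (Va 5) (Eq (Va 5) (Co 0))) ;; Sto 19 (Va 6) (Co 0) ;; Asg 7 (Co 1) ;;
     Wh (Va 7) (outcut ;; nextset)"

text \<open>Vertex 0 has no parent and is never selected, so 0 can mean that nothing has been found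
  yet.\<close>

definition select :: cmd where
  "select = Asg 3 (Co 0) ;; For 4 (Va 0) (Ite (Va 4) (Ite (Ar 18 (Va 4)) Skip (Ite (Va 3)
     (IfR (RAr 2 (Va 4)) (RAr 2 (Va 3)) (Asg 3 (Va 4)) Skip) (Asg 3 (Va 4)))) Skip)"

definition phase2 :: cmd where
  "phase2 = For 2 (Sub (Va 0) (Co 1)) (select ;; Sto 18 (Va 3) (Co 1) ;; Ite (Ar 16 (Va 3)) enum Skip)"

section \<open>Writing a cut and stepping to the next ideal\<close>

context connected_wgraph
begin

definition bits :: "nat set set \<Rightarrow> nat list" where
  "bits C = map (\<lambda>i. of_bool ({ea i, eb i} \<in> C)) [0..<m]"

text \<open>The tick of the last symbol of the \<open>k\<close>-th cut. The convention that
  \<open>k = 0\<close> means the start time \<open>T\<close> lets the first output be treated like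
  every later gap.\<close>

definition ltick :: "nat \<Rightarrow> (nat \<times> nat \<times> nat) list \<Rightarrow> nat \<Rightarrow> nat" where
  "ltick T l k = (if k = 0 then T else snd (snd (l ! (k * m - 1))))"

definition glog :: "nat \<Rightarrow> nat \<Rightarrow> nat set set list \<Rightarrow> (nat \<times> nat \<times> nat) list \<Rightarrow> bool" where
  "glog T D cs l \<longleftrightarrow> map fst l = concat (map bits cs) \<and>
     (\<forall>k<length cs. ltick T l (Suc k) \<le> ltick T l k + D)"

lemma glog_length: "map fst l = concat (map bits cs) \<Longrightarrow> length l = length cs * m"
proof -
  assume a: "map fst l = concat (map bits cs)"
  have "length (concat (map bits cs)) = length cs * m" by (induction cs) (auto simp: bits_def)
  then show ?thesis using a by (metis length_map)
qed

lemma ltick_append: "length l = K * m \<Longrightarrow> k \<le> K \<Longrightarrow> ltick T (l @ b) k = ltick T l k"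
proof -
  assume a: "length l = K * m" "k \<le> K"
  have "k * m - 1 < length l" if "0 < k" using that a m_pos mult_le_mono1[OF a(2), of m]
    by (metis diff_less less_le_trans nat_0_less_mult_iff zero_less_one)
  then show ?thesis by (simp add: ltick_def nth_append)
qed

text \<open>The last symbol of the new cut is among the entries of \<open>b\<close>, which is
  nonempty because \<open>m\<close> is positive; its tick therefore lies between \<open>t0\<close>
  and \<open>t\<close>.\<close>

lemma glog_snoc:
  assumes g: "glog T D cs l" and b: "map fst b = bits C"
    and t: "\<And>x. x \<in> set b \<Longrightarrow> t0 \<le> snd (snd x) \<and> snd (snd x) \<le> t" "t \<le> ltick T l (length cs) + D"
  shows "glog T D (cs @ [C]) (l @ b)" "t0 \<le> ltick T (l @ b) (Suc (length cs))"
proof -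
  have l: "length l = length cs * m" using g glog_length unfolding glog_def by blast
  have lb: "length b = m" using b by (metis bits_def length_map length_upt minus_nat.diff_0)
  have "Suc (length cs) * m - 1 = length l + (m - 1)" using m_pos l by simp
  then have "(l @ b) ! (Suc (length cs) * m - 1) = b ! (m - 1)" by (simp only: nth_append_length_plus)
  moreover have "b ! (m - 1) \<in> set b" using lb m_pos by (intro nth_mem) simp
  ultimately have last: "ltick T (l @ b) (Suc (length cs)) \<le> t" "t0 \<le> ltick T (l @ b) (Suc (length cs))"
    using t(1) by (simp_all add: ltick_def)
  have "ltick T (l @ b) (Suc k) \<le> ltick T (l @ b) k + D" if k: "k < Suc (length cs)" for k
  proof (cases "k = length cs")
    case True then show ?thesis using last t(2) ltick_append[OF l, of "length cs"] by simp
  next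
    case False
    then have "ltick T (l @ b) (Suc k) = ltick T l (Suc k)" "ltick T (l @ b) k = ltick T l k"
      using k by (auto intro!: ltick_append[OF l])
    then show ?thesis using g k False by (simp add: glog_def)
  qed
  then show "glog T D (cs @ [C]) (l @ b)" using g b by (simp add: glog_def)
  show "t0 \<le> ltick T (l @ b) (Suc (length cs))" by (rule last)
qed

definition xok :: "(nat \<Rightarrow> nat) \<Rightarrow> nat \<Rightarrow> nat set \<Rightarrow> (nat \<Rightarrow> nat) \<Rightarrow> bool" where
  "xok L k I X \<longleftrightarrow> (\<forall>j\<le>k. X j = of_bool (j \<in> I)) \<and> (\<forall>y<n. L y \<le> k) \<and> I \<subseteq> {..<k}"

lemma outcut_correct:
  assumes env: "env s" and x: "xok (ar s 15) k I (ar s 19)"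
  shows "wp outcut (\<lambda>t. (\<exists>b. lg t = lg s @ b \<and> map fst b = bits (cut {y. y < n \<and> ar s 15 y \<in> I})) \<and>
    tk t \<le> tk s + m * 4 + 2) s"
proof -
  let ?X = "{y. y < n \<and> ar s 15 y \<in> I}"
  have "wp outcut (\<lambda>t. (\<exists>b. lg t = lg s @ b \<and> map fst b = map (\<lambda>i. of_bool ({ea i, eb i} \<in> cut ?X)) [0..<m]) \<and> sc t 10 = m \<and>
     frm outcut s t \<and> tk t \<le> tk s + m * (1 + 3) + 2) s"
    unfolding outcut_def
  proof (rule wp_For[where J = "\<lambda>i t. \<exists>b. lg t = lg s @ b \<and> map fst b = map (\<lambda>i. of_bool ({ea i, eb i} \<in> cut ?X)) [0..<i]"], goal_cases)
    case (2 i t) then show ?case using env by (simp add: env_def frm_def)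
  next
    case (4 i t)
    then obtain b where b: "lg t = lg s @ b" "map fst b = map (\<lambda>i. of_bool ({ea i, eb i} \<in> cut ?X)) [0..<i]" by auto
    have e: "ar t 1 i = ea i" "ar t 2 i = eb i" "ar t 15 = ar s 15" "ar t 19 = ar s 19" "sc t 10 = i"
      using 4 env by (simp_all add: env_def frm_def)
    have "ea i < n" "eb i < n" using ends[OF 4(1)] by auto
    then have "ar s 19 (ar s 15 (ea i)) = of_bool (ea i \<in> ?X)" "ar s 19 (ar s 15 (eb i)) = of_bool (eb i \<in> ?X)"
      using x by (auto simp: xok_def)
    then show ?case using b e cut_iff[OF 4(1), of ?X] by (simp add: ev_Neq)
  qed auto
  then show ?thesis by (rule wp_mono) (auto simp: bits_def)
qed

lemma ideal_edge_subset:
  "ideal_edge L j \<subseteq> I \<longleftrightarrow> (\<forall>i<m. 0 < wt i \<longrightarrow> (L (eb i) = j \<longrightarrow> L (ea i) < j \<longrightarrow> L (ea i) \<in> I) \<and>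
     (L (ea i) = j \<longrightarrow> L (eb i) < j \<longrightarrow> L (eb i) \<in> I))"
proof -
  have "ideal_edge L j \<subseteq> I \<longleftrightarrow> (\<forall>i<m. \<forall>a<j. 0 < wt i \<longrightarrow>
      (L (ea i) = a \<and> L (eb i) = j \<or> L (ea i) = j \<and> L (eb i) = a) \<longrightarrow> a \<in> I)"
  proof -
    have "(\<forall>t. t < j \<and> (\<exists>i<m. A i \<and> Q i t) \<longrightarrow> t \<in> I) \<longleftrightarrow> (\<forall>i<m. \<forall>a<j. A i \<longrightarrow> Q i a \<longrightarrow> a \<in> I)" for A Q
      by blast
    then show ?thesis unfolding ideal_edge_def subset_iff mem_Collect_eq .
  qed
  then show ?thesis by auto
qed

lemma test_label_correct:
  assumes env: "env s" and x: "xok (ar s 15) k I (ar s 19)" and j: "sc s 5 = j" "j < k"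
  shows "wp test_label (\<lambda>t. sc t 9 = of_bool (ideal_edge (ar s 15) j \<subseteq> I) \<and> tk t \<le> tk s + m * 14 + 3) s"
proof -
  let ?L = "ar s 15"
  let ?ok = "\<lambda>i. 0 < wt i \<longrightarrow> (?L (eb i) = j \<longrightarrow> ?L (ea i) < j \<longrightarrow> ?L (ea i) \<in> I) \<and>
     (?L (ea i) = j \<longrightarrow> ?L (eb i) < j \<longrightarrow> ?L (eb i) \<in> I)"
  let ?c = "IfR (RC 0) (RAr 1 (Va 10)) (Asg 11 (Ar 15 (Ar 1 (Va 10))) ;; Asg 12 (Ar 15 (Ar 2 (Va 10))) ;; chk 11 12 ;; chk 12 11) Skip"
  let ?s = "tick (cost (Asg 9 (Co 1))) (s\<lparr>sc := (sc s)(9 := 1)\<rparr>)"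
  have "wp (For 10 (Va 1) ?c) (\<lambda>t. sc t 9 = of_bool (\<forall>i<m. ?ok i) \<and> sc t 10 = m \<and>
     frm (For 10 (Va 1) ?c) ?s t \<and> tk t \<le> tk ?s + m * (11 + 3) + 2) ?s"
  proof (rule wp_For[where J = "\<lambda>i t. sc t 9 = of_bool (\<forall>a<i. ?ok a)"], goal_cases)
    case (2 i t) then show ?case using env by (simp add: env_def frm_def chk_def)
  next
    case (4 i t)
    have e: "ar t 1 i = ea i" "ar t 2 i = eb i" "ar t 15 = ?L" "ar t 19 = ar s 19" "sc t 10 = i" "sc t 5 = j" "ra t 1 i = wt i"
      using 4 env j by (simp_all add: env_def frm_def chk_def)
    have X: "ar s 19 a = of_bool (a \<in> I)" if "a < j" for a using x that j by (auto simp: xok_def)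
    have s: "(\<forall>a<Suc i. ?ok a) \<longleftrightarrow> (\<forall>a<i. ?ok a) \<and> ?ok i" by (auto simp: less_Suc_eq)
    show ?case using e X s 4(2) by (auto simp: chk_def ev_Lt ev_Eq)
  qed (auto simp: chk_def)
  then show ?thesis unfolding test_label_def by (auto elim!: wp_mono simp: ideal_edge_subset)
qed

lemma nextset_sets [simp]:
  "x \<notin> {5, 7, 8, 9, 10, 11, 12} \<Longrightarrow> x \<notin> wsc nextset" "k \<noteq> 19 \<Longrightarrow> k \<notin> war nextset" "k \<notin> wra nextset" "silent nextset"
  by (auto simp: nextset_def test_label_def chk_def)

text \<open>The upward scan overwrites scalar 8 with each addable label, so the largest one remains.
  Adding it and clearing all entries above it produces the lexicographic successor.\<close>

lemma nextset_correct:
  assumes env: "env s" and x: "xok (ar s 15) k I (ar s 19)" and k: "sc s 6 = k" "k \<le> n"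
    and cand: "\<And>j. cand j \<longleftrightarrow> 1 \<le> j \<and> j < k \<and> j \<notin> I \<and> ideal_edge (ar s 15) j \<subseteq> I"
  shows "wp nextset (\<lambda>t. (if sc t 7 = 0 then \<forall>j. \<not> cand j
      else \<exists>j. cand j \<and> (\<forall>i>j. \<not> cand i) \<and> xok (ar s 15) k (insert j (I \<inter> {..<j})) (ar t 19)) \<and>
    tk t \<le> tk s + n * (m * 14 + 17) + 10) s"
proof -
  let ?b = "Ite (Va 5) (Ite (Ar 19 (Va 5)) Skip (test_label ;; Ite (Va 9) (Asg 8 (Va 5)) Skip)) Skip"
  let ?J = "\<lambda>i t. (sc t 8 = 0 \<or> sc t 8 < i \<and> cand (sc t 8)) \<and> (\<forall>j. sc t 8 < j \<and> j < i \<longrightarrow> \<not> cand j)"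
  let ?s = "tick (cost (Asg 8 (Co 0))) (s\<lparr>sc := (sc s)(8 := ev (Co 0) s)\<rparr>)"
  have e0: "env ?s" using env by (simp add: env_def)
  have loop: "wp (For 5 (Va 6) ?b) (\<lambda>t. ?J k t \<and> sc t 5 = k \<and> frm (For 5 (Va 6) ?b) ?s t \<and> tk t \<le> tk ?s + k * (m * 14 + 9 + 3) + 2) ?s"
  proof (rule wp_For[where J = ?J], goal_cases)
    case (2 i t) then show ?case using k by (simp add: frm_def test_label_def chk_def)
  next
    case 3 show ?case by (simp add: test_label_def chk_def)
  next
    case (4 i t)
    have et: "env t" using env_frm[OF 4(4) _ _ _ _ _ _ _ _ _ e0] by (simp add: test_label_def chk_def)
    have f: "ar t 15 = ar s 15" "ar t 19 = ar s 19" using 4(4) by (simp_all add: frm_def test_label_def chk_def)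
    have xi: "ar s 19 i = of_bool (i \<in> I)" using x 4(1) by (simp add: xok_def)
    show ?case
    proof (cases "0 < i \<and> i \<notin> I")
      case False
      then have "\<not> cand i" using cand by auto
      then have "?J (Suc i) t" using 4(2) less_Suc_eq by metis
      then show ?thesis using False 4(3) f xi by auto
    next
      case True
      let ?t = "tick (length (cn 0 (Ar 19 (Va 5))) + 2) (tick (length (cn 0 (Va 5)) + 2) t)"
      have et': "env ?t" using et by (simp add: env_def)
      have "wp test_label (wp (Ite (Va 9) (Asg 8 (Va 5)) Skip) (\<lambda>t'. tk t' + 2 \<le> tk t + (m * 14 + 10) \<and> ?J (Suc i) t')) ?t"
      proof (rule wp_conseq[OF test_label_correct[OF et', of k I i]], goal_cases)
        case (4 t')
        have "sc t' 8 = sc t 8" "sc t' 5 = i" using 4(2) \<open>sc t 5 = i\<close> by (simp_all add: frm_def test_label_def chk_def)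
        moreover have "sc t' 9 = of_bool (cand i)" using 4(1) f cand[of i] True \<open>i < k\<close> by simp
        moreover have "?J i t" using \<open>?J i t\<close> .
        moreover have "tk t' \<le> tk t + (m * 14 + 5)" using 4(1) by simp
        ultimately show ?case using \<open>i < k\<close> True less_Suc_eq by (cases "cand i") auto
      qed (use x f 4 in auto)
      then have "wp test_label (wp (Ite (Va 9) (Asg 8 (Va 5)) Skip) (\<lambda>t'. tk (tick 1 t') \<le> tk t + (m * 14 + 9) \<and> ?J (Suc i) (tick 1 t'))) ?t"
        by (rule wp_mono) (auto split: if_splits)
      then show ?thesis using True 4(3) f xi by simp
    qed
  qed auto
  let ?c = "Ite (Lt (Va 8) (Va 5)) (Sto 19 (Va 5) (Co 0)) Skip"
  let ?Q = "\<lambda>t. (if sc t 7 = 0 then \<forall>j. \<not> cand j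
      else \<exists>j. cand j \<and> (\<forall>i>j. \<not> cand i) \<and> xok (ar s 15) k (insert j (I \<inter> {..<j})) (ar t 19)) \<and>
    tk t \<le> tk s + n * (m * 14 + 17) + 10"
  have kn: "k * (m * 14 + 12) + k * 5 \<le> n * (m * 14 + 17)"
    using mult_le_mono1[OF k(2), of "m * 14 + 17"] by (simp add: algebra_simps)
  show ?thesis unfolding nextset_def wp_simps(9,2)
  proof (rule wp_mono[OF loop], goal_cases)
    case (1 t)
    then have Jt: "?J k t" and fr: "frm (For 5 (Va 6) ?b) ?s t" by blast+
    have tt: "tk t \<le> tk s + k * (m * 14 + 12) + 3" using 1 by (simp add: algebra_simps)
    have f: "ar t 19 = ar s 19" "sc t 6 = k" using fr k by (simp_all add: frm_def test_label_def chk_def)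
    define j where "j = sc t 8"
    show ?case
    proof (cases "j = 0")
      case True
      have "\<not> cand i" for i
      proof (cases "0 < i \<and> i < k")
        case T: True then show ?thesis using Jt True unfolding j_def by metis
      qed (use cand in auto)
      then show ?thesis using True tt kn by (simp add: j_def)
    next
      case False
      have cj: "cand j" "\<forall>i>j. \<not> cand i" using Jt False cand unfolding j_def by blast+
      then have jk: "j < k" using cand by blast
      define t1 where "t1 = tick (cost (Sto 19 (Va 8) (Co 1))) (tick (length (cn 0 (Va 8)) + 2)
        (tick (cost (Asg 7 (Va 8))) (t\<lparr>sc := (sc t)(7 := j)\<rparr>))\<lparr>ar := (ar t)(19 := (ar t 19)(j := 1))\<rparr>)"
      have t1: "sc t1 7 = j" "sc t1 8 = j" "ar t1 19 = (ar s 19)(j := 1)" "sc t1 6 = k" "tk t1 = tk t + 3"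
        using f by (simp_all add: t1_def j_def)
      have "wp (For 5 (Va 6) ?c) (\<lambda>t. (\<forall>z. ar t 19 z = (if j < z \<and> z < k then 0 else ar t1 19 z)) \<and> sc t 5 = k \<and>
          frm (For 5 (Va 6) ?c) t1 t \<and> tk t \<le> tk t1 + k * (2 + 3) + 2) t1"
      proof (rule wp_For[where J = "\<lambda>i t. \<forall>z. ar t 19 z = (if j < z \<and> z < i then 0 else ar t1 19 z)"], goal_cases)
        case (2 i u) then show ?case using t1 by (simp add: frm_def)
      next
        case (4 i u)
        have "sc u 8 = j" "sc u 5 = i" using 4 t1 by (simp_all add: frm_def)
        then show ?case using 4(2) by (auto simp: less_Suc_eq)
      qed auto
      then have "wp (For 5 (Va 6) ?c) ?Q t1"
      proof (rule wp_mono, goal_cases)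
        case (1 u)
        then have u: "\<And>z. ar u 19 z = (if j < z \<and> z < k then 0 else ar t1 19 z)" by blast
        have "sc u 7 = j" using 1 t1 by (simp add: frm_def)
        moreover have "xok (ar s 15) k (insert j (I \<inter> {..<j})) (ar u 19)"
          using x jk by (auto simp: xok_def u t1)
        moreover have "tk u \<le> tk s + n * (m * 14 + 17) + 10" using 1 tt kn t1(5) by simp
        ultimately show ?case using cj False by auto
      qed
      then show ?thesis using False by (simp add: t1_def j_def tick_def)
    qed
  qed
qed

lemma ideal_enum_edge: "1 \<le> k \<Longrightarrow> ideal_enum (ideal_edge L) k (ideals (ideal_edge L) k)"
  by unfold_locales (auto simp: ideal_edge_def ideals_def)

definition nexttime :: nat where
  "nexttime = n * (m * 14 + 17) + m * 4 + 20"

end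

section \<open>Listing all relevant cuts in order of weight\<close>

context connected_wgraph
begin

text \<open>The invariant says that the \<open>\<kappa>\<close> ideals written are those strictly
  before the current one. The slack \<open>A\<close>, time already spent since the last output,
  concerns the first round only; from then on \<open>nexttime\<close> takes its place.\<close>

lemma enum_loop_correct:
  assumes env: "env s" and hk: "sc s 6 = k" "1 \<le> k" "k \<le> n" and go: "sc s 7 = 1"
    and x: "xok (ar s 15) k {0} (ar s 19)"
    and g: "glog T D cs (lg s)" and tk: "tk s \<le> ltick T (lg s) (length cs) + A"
    and D: "A + m * 4 + 3 \<le> D" "nexttime + m * 4 + 3 \<le> D"
    and f: "f = (\<lambda>I. {y. y < n \<and> ar s 15 y \<in> I})"
  shows "wp (Wh (Va 7) (outcut ;; nextset)) (\<lambda>t. env t \<and> (\<exists>ds. distinct ds \<and> set ds = ideals (ideal_edge (ar s 15)) k \<and>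
    glog T D (cs @ map (\<lambda>I. cut (f I)) ds) (lg t) \<and> tk t \<le> ltick T (lg t) (length cs + length ds) + nexttime)) s"
proof -
  define L where "L = ar s 15"
  define G where "G = ideals (ideal_edge L) k"
  interpret ideal_enum "ideal_edge L" k G unfolding G_def by (rule ideal_enum_edge[OF hk(2)])
  define Inv where "Inv \<kappa> u \<longleftrightarrow> env u \<and> sc u 6 = k \<and> ar u 15 = L \<and> (\<exists>ds. length ds = \<kappa> \<and> distinct ds \<and> set ds \<subseteq> G \<and>
      glog T D (cs @ map (\<lambda>I. cut (f I)) ds) (lg u) \<and>
      tk u + (if \<kappa> = 0 then 0 else 2) \<le> ltick T (lg u) (length cs + \<kappa>) + (if \<kappa> = 0 then A else nexttime) \<and>
      (if sc u 7 = 0 then set ds = G \<and> 0 < \<kappa> else \<exists>I\<in>G. I \<notin> set ds \<and> insert I (set ds) = upto I \<and> xok L k I (ar u 19)))"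
    for \<kappa> and u :: hstate
  show ?thesis
  proof (rule wp_Wh_upto[where I = Inv and T = "card G" and k = 0], goal_cases)
    case 1
    show ?case unfolding Inv_def
      apply (intro conjI exI[of _ "[]"])
      subgoal using env by simp
      subgoal using hk by simp
      subgoal by (simp add: L_def)
      subgoal by simp
      subgoal by simp
      subgoal by simp
      subgoal using g by simp
      subgoal using tk by simp
      subgoal using go x first_in upto_first by (auto simp: L_def intro!: bexI[of _ "{0}"])
      done
  next
    case 2 show ?case by simp
  next
    case (3 \<kappa> u)
    then have "sc u 7 = 0" by simp
    then obtain ds where ds: "length ds = \<kappa>" "distinct ds" "set ds = G" "0 < \<kappa>" "env u" "glog T D (cs @ map (\<lambda>I. cut (f I)) ds) (lg u)"
      "tk u + 2 \<le> ltick T (lg u) (length cs + \<kappa>) + nexttime"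
      using 3(2) unfolding Inv_def by (auto split: if_splits)
    have "env (tick (length (cn 0 (Va 7)) + 3) u)" using ds(5) by (simp add: env_def)
    then show ?case using ds by (auto intro!: exI[of _ ds] simp: G_def L_def)
  next
    case (4 \<kappa> u)
    then have "sc u 7 \<noteq> 0" by simp
    then obtain ds I where ds: "length ds = \<kappa>" "distinct ds" "set ds \<subseteq> G" "glog T D (cs @ map (\<lambda>I. cut (f I)) ds) (lg u)"
      and tku: "tk u \<le> ltick T (lg u) (length cs + \<kappa>) + (if \<kappa> = 0 then A else nexttime)"
      and I: "I \<in> G" "I \<notin> set ds" "insert I (set ds) = upto I" "xok L k I (ar u 19)"
      and u: "env u" "sc u 6 = k" "ar u 15 = L"
      using 4(2) unfolding Inv_def by auto
    let ?ds = "ds @ [I]"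
    \<comment> \<open>The ideals written so far and the current one are distinct members of the
      finite set \<open>G\<close>.\<close>
    have lt: "\<kappa> < card G"
    proof -
      have "card (insert I (set ds)) \<le> card G" using I ds finite_G by (intro card_mono) auto
      then show ?thesis using I(2) ds distinct_card[of ds] by simp
    qed
    let ?u = "tick (length (cn 0 (Va 7)) + 2) u"
    have eu: "env ?u" using u by (simp add: env_def)
    have xu: "xok (ar ?u 15) k I (ar ?u 19)" using I u by simp
    have "wp outcut (wp nextset (\<lambda>t. Inv (Suc \<kappa>) (tick 1 t))) ?u"
    proof (rule wp_conseq[OF wp_log[OF outcut_correct[OF eu xu]]], goal_cases)
      case (1 u1)
      then obtain b where b: "lg u1 = lg u @ b" "map fst b = bits (cut (f I))"
          "\<forall>x\<in>set b. Suc (tk u) \<le> snd (snd x) \<and> snd (snd x) \<le> tk u1" and tk1: "tk u1 \<le> tk u + m * 4 + 3"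
        using u f by (auto simp: L_def)
      have fr: "frm outcut ?u u1" using 1 by blast
      have e1: "env u1" using env_frm[OF fr _ _ _ _ _ _ _ _ _ eu] by (simp add: outcut_def)
      have f1: "ar u1 15 = L" "ar u1 19 = ar u 19" "sc u1 6 = k" using fr u by (simp_all add: frm_def outcut_def)
      have "tk u1 \<le> ltick T (lg u) (length (cs @ map (\<lambda>I. cut (f I)) ds)) + D"
        using tk1 tku D ds(1) by (auto split: if_splits)
      note gs = glog_snoc[OF ds(4) b(2) b(3)[rule_format] this]
      define cand where "cand j \<longleftrightarrow> 1 \<le> j \<and> j < k \<and> j \<notin> I \<and> ideal_edge (ar u1 15) j \<subseteq> I" for j
      have x1: "xok (ar u1 15) k I (ar u1 19)" using I f1 by simp
      show ?case
      proof (rule wp_conseq[OF nextset_correct[OF e1 x1 f1(3) hk(3) cand_def]], goal_cases)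
        case (1 u2)
        have e2: "env u2" using env_frm[OF 1(2) _ _ _ _ _ _ _ _ _ e1] by simp
        have f2: "ar u2 15 = L" "sc u2 6 = k" "lg u2 = lg u @ b" using 1(2) f1 b by (simp_all add: frm_def)
        have "tk u2 + 3 \<le> ltick T (lg u @ b) (Suc (length (cs @ map (\<lambda>I. cut (f I)) ds))) + nexttime"
          using gs(2) tk1 1(1) by (simp add: nexttime_def)
        moreover have "if sc u2 7 = 0 then set ?ds = G \<and> 0 < Suc \<kappa> else \<exists>I\<in>G. I \<notin> set ?ds \<and> insert I (set ?ds) = upto I \<and> xok L k I (ar u2 19)"
        proof (cases "sc u2 7 = 0")
          case True
          then have "\<not> cand j" for j using 1(1) by auto
          then have "upto I = G" by (intro upto_last[OF I(1)]) (auto simp: cand_def f1)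
          then show ?thesis using True I(3) by simp
        next
          case False
          then obtain j where j: "cand j" "\<forall>i>j. \<not> cand i" "xok L k (insert j (I \<inter> {..<j})) (ar u2 19)" using 1(1) f1 by auto
          have "1 \<le> j" "j < k" "j \<notin> I" "ideal_edge L j \<subseteq> I" using j(1) by (simp_all add: cand_def f1)
          note un = upto_next[OF I(1) this _ refl]
          have mx: "\<not> ideal_edge L i \<subseteq> I" if "j < i" "i < k" "i \<notin> I" for i using j(2) that by (auto simp: cand_def f1)
          have "insert j (I \<inter> {..<j}) \<in> G" "upto (insert j (I \<inter> {..<j})) = insert (insert j (I \<inter> {..<j})) (upto I)"
            "insert j (I \<inter> {..<j}) \<notin> upto I" using un mx by blast+
          then show ?thesis using False I(3) j(3) by (auto intro!: bexI[of _ "insert j (I \<inter> {..<j})"])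
        qed
        moreover have "env (tick 1 u2)" using e2 by (simp add: env_def)
        ultimately show ?case unfolding Inv_def using f2 ds gs(1) I(1,2) by (auto intro!: exI[of _ ?ds])
      qed
    qed
    then show ?case using lt by simp
  qed
qed

lemma enum_sets [simp]:
  "x \<notin> {5, 6, 7, 8, 9, 10, 11, 12} \<Longrightarrow> x \<notin> wsc enum" "k \<noteq> 15 \<Longrightarrow> k \<noteq> 19 \<Longrightarrow> k \<notin> war enum" "k \<notin> wra enum"
  by (auto simp: enum_def outcut_def nextset_def test_label_def chk_def)

lemma enum_correct:
  assumes env: "env s" and v: "sc s 3 = v" "v < n" and k: "ar s 16 v = k" "k \<noteq> 0"
    and row: "rowok par Lam v k (\<lambda>y. ar s 17 (v * n + y))"
    and g: "glog T D cs (lg s)" and tk: "tk s \<le> ltick T (lg s) (length cs) + A"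
    and D: "A + n * 8 + m * 4 + 20 \<le> D" "nexttime + m * 4 + 3 \<le> D"
  shows "wp enum (\<lambda>t. env t \<and> (\<exists>ds. distinct ds \<and> set ds = emitted par Lam v \<and>
    glog T D (cs @ map cut ds) (lg t) \<and> tk t \<le> ltick T (lg t) (length cs + length ds) + nexttime)) s"
proof -
  have R: "emitted par Lam v = (\<lambda>I. {y. y < n \<and> ar s 17 (v * n + y) \<in> I}) ` ideals (ideal_edge (\<lambda>y. ar s 17 (v * n + y))) k"
     "inj_on (\<lambda>I. {y. y < n \<and> ar s 17 (v * n + y) \<in> I}) (ideals (ideal_edge (\<lambda>y. ar s 17 (v * n + y))) k)"
     "k < n" "\<forall>y<n. ar s 17 (v * n + y) \<le> k" using row k(2) unfolding rowok_def by simp_all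
  have S: "sc s 0 = n" "ar s 3 v = v * n" using env v by (simp_all add: env_def)
  let ?s = "tick (cost (Asg 6 (Ar 16 (Va 3)))) (s\<lparr>sc := (sc s)(6 := k)\<rparr>)"
  have e0: "env ?s" using env by (simp add: env_def)
  have f: "wp (For 5 (Va 0) (Sto 15 (Va 5) (Ar 17 (Add (Ar 3 (Va 3)) (Va 5))))) (\<lambda>t. (\<forall>i<n. ar t 15 i = ar s 17 (v * n + i)) \<and>
      (\<forall>z. z \<notin> (\<lambda>i. i) ` {..<n} \<longrightarrow> ar t 15 z = ar ?s 15 z) \<and> tk t \<le> tk ?s + n * 4 + 2) ?s"
    by (rule fill) (use S v in auto)
  let ?Q = "\<lambda>t. env t \<and> (\<exists>ds. distinct ds \<and> set ds = emitted par Lam v \<and>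
    glog T D (cs @ map cut ds) (lg t) \<and> tk t \<le> ltick T (lg t) (length cs + length ds) + nexttime)"
  have "wp (For 5 (Va 0) (Sto 15 (Va 5) (Ar 17 (Add (Ar 3 (Va 3)) (Va 5))))) (wp (For 5 (Va 6) (Sto 19 (Va 5) (Eq (Va 5) (Co 0))))
     (wp (Sto 19 (Va 6) (Co 0)) (wp (Asg 7 (Co 1)) (wp (Wh (Va 7) (outcut ;; nextset)) ?Q)))) ?s"
  proof (rule wp_conseq[OF f], goal_cases)
    case (1 t1)
    have e1: "env t1" using env_frm[OF 1(2) _ _ _ _ _ _ _ _ _ e0] by simp
    have f1: "sc t1 6 = k" "lg t1 = lg s" using 1(2) by (simp_all add: frm_def)
    have L: "ar t1 15 y = ar s 17 (v * n + y)" if "y < n" for y using 1(1) that by blast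
    have g1: "wp (For 5 (Va 6) (Sto 19 (Va 5) (Eq (Va 5) (Co 0)))) (\<lambda>t. (\<forall>i<k. ar t 19 i = of_bool (i = 0)) \<and>
      (\<forall>z. z \<notin> (\<lambda>i. i) ` {..<k} \<longrightarrow> ar t 19 z = ar t1 19 z) \<and> tk t \<le> tk t1 + k * 4 + 2) t1"
      by (rule fill) (use f1 in auto)
    show ?case
    proof (rule wp_conseq[OF g1], goal_cases)
      case (1 t2)
      have e2: "env t2" using env_frm[OF 1(2) _ _ _ _ _ _ _ _ _ e1] by simp
      have f2: "sc t2 6 = k" "lg t2 = lg s" "ar t2 15 = ar t1 15" using 1(2) f1 by (simp_all add: frm_def)
      let ?t = "tick (cost (Asg 7 (Co 1))) (tick (cost (Sto 19 (Va 6) (Co 0)))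
         (t2\<lparr>ar := (ar t2)(19 := (ar t2 19)(k := 0))\<rparr>)\<lparr>sc := (sc t2)(7 := 1)\<rparr>)"
      have e3: "env ?t" using e2 by (simp add: env_def)
      have x: "xok (ar ?t 15) k {0} (ar ?t 19)" using 1(1) L R(4) k(2) f2 by (auto simp: xok_def)
      have tk3: "tk ?t \<le> ltick T (lg ?t) (length cs) + (A + n * 8 + 10)"
      proof -
        have "tk t1 \<le> tk s + n * 4 + 3" using \<open>(\<forall>i<n. ar t1 15 i = _ i) \<and> _\<close> by simp
        moreover have "tk t2 \<le> tk t1 + k * 4 + 2" using 1(1) by simp
        ultimately show ?thesis using tk f2 R(3) by simp
      qed
      have F: "(\<lambda>I. {y. y < n \<and> ar s 17 (v * n + y) \<in> I}) = (\<lambda>I. {y. y < n \<and> ar t1 15 y \<in> I})" using L by auto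
      have Ie: "ideal_edge (\<lambda>y. ar s 17 (v * n + y)) = ideal_edge (ar t1 15)" using L by (intro ideal_edge_cong) simp
      note R' = R(1,2)[unfolded Ie F]
      have kk: "1 \<le> k" "k \<le> n" using k R by auto
      have D1: "A + n * 8 + 10 + m * 4 + 3 \<le> D" using D by simp
      have "wp (Wh (Va 7) (outcut ;; nextset)) ?Q ?t"
      proof (rule wp_mono[OF enum_loop_correct[OF e3 _ kk _ x _ tk3 D1 D(2) refl]], goal_cases)
        case (4 t)
        then obtain ds where ds: "distinct ds" "set ds = ideals (ideal_edge (ar t1 15)) k"
          "glog T D (cs @ map (\<lambda>I. cut {y. y < n \<and> ar t1 15 y \<in> I}) ds) (lg t)"
          "tk t \<le> ltick T (lg t) (length cs + length ds) + nexttime" and "env t" using f2 by auto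
        let ?ds = "map (\<lambda>I. {y. y < n \<and> ar t1 15 y \<in> I}) ds"
        have "distinct ?ds" "set ?ds = emitted par Lam v" using ds R' by (auto simp: distinct_map)
        then show ?case using ds \<open>env t\<close> by (auto intro!: exI[of _ ?ds] simp: comp_def)
      qed (use f2 g in auto)
      then show ?case using f2 by simp
    qed
  qed
  then show ?thesis unfolding enum_def using v k by simp
qed

definition marked :: "hstate \<Rightarrow> nat set" where
  "marked s = {v. 1 \<le> v \<and> v < n \<and> ar s 18 v \<noteq> 0}"

lemma select_correct:
  assumes n0: "sc s 0 = n" and left: "\<exists>v. 1 \<le> v \<and> v < n \<and> v \<notin> marked s"
  shows "wp select (\<lambda>t. 1 \<le> sc t 3 \<and> sc t 3 < n \<and> sc t 3 \<notin> marked s \<and>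
    (\<forall>v. 1 \<le> v \<and> v < n \<and> v \<notin> marked s \<longrightarrow> ra s 2 (sc t 3) \<le> ra s 2 v) \<and> tk t \<le> tk s + n * 10 + 3) s"
proof -
  let ?b = "Ite (Va 4) (Ite (Ar 18 (Va 4)) Skip (Ite (Va 3)
     (IfR (RAr 2 (Va 4)) (RAr 2 (Va 3)) (Asg 3 (Va 4)) Skip) (Asg 3 (Va 4)))) Skip"
  let ?s = "tick (cost (Asg 3 (Co 0))) (s\<lparr>sc := (sc s)(3 := 0)\<rparr>)"
  let ?J = "\<lambda>i t. (if sc t 3 = 0 then \<forall>v. 1 \<le> v \<and> v < i \<longrightarrow> v \<in> marked s
     else sc t 3 < i \<and> sc t 3 \<notin> marked s \<and> (\<forall>v. 1 \<le> v \<and> v < i \<and> v \<notin> marked s \<longrightarrow> ra s 2 (sc t 3) \<le> ra s 2 v))"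
  have "wp (For 4 (Va 0) ?b) (\<lambda>t. ?J n t \<and> sc t 4 = n \<and> frm (For 4 (Va 0) ?b) ?s t \<and> tk t \<le> tk ?s + n * (7 + 3) + 2) ?s"
  proof (rule wp_For[where J = ?J], goal_cases)
    case (2 i t) then show ?case using n0 by (simp add: frm_def)
  next
    case (4 i t)
    have f: "ar t 18 = ar s 18" "ra t 2 = ra s 2" "sc t 4 = i" using 4 by (simp_all add: frm_def)
    have mi: "i \<in> marked s \<longleftrightarrow> 0 < i \<and> ar s 18 i \<noteq> 0" using 4(1) by (auto simp: marked_def)
    show ?case
    proof (cases "0 < i \<and> i \<notin> marked s")
      case False
      then have "?J (Suc i) t" using 4(2) by (auto simp: less_Suc_eq split: if_splits)
      then show ?thesis using f mi False by auto
    next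
      case True
      show ?thesis
      proof (cases "sc t 3 = 0")
        case T: True then show ?thesis using f mi True 4(2) by (auto simp: less_Suc_eq)
      next
        case F: False
        then have J: "sc t 3 < i" "sc t 3 \<notin> marked s" "\<And>v. 1 \<le> v \<Longrightarrow> v < i \<Longrightarrow> v \<notin> marked s \<Longrightarrow> ra s 2 (sc t 3) \<le> ra s 2 v"
          using 4(2) by auto
        show ?thesis
        proof (cases "ra s 2 i < ra s 2 (sc t 3)")
          case l: True
          have "ra s 2 i \<le> ra s 2 v" if "1 \<le> v" "v < Suc i" "v \<notin> marked s" for v
            using J(3)[of v] that l by (cases "v = i") auto
          then show ?thesis using f mi True F l by simp
        next
          case l: False
          have "ra s 2 (sc t 3) \<le> ra s 2 v" if "1 \<le> v" "v < Suc i" "v \<notin> marked s" for v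
            using J(3)[of v] that l by (cases "v = i") auto
          then show ?thesis using f mi True F l J by simp
        qed
      qed
    qed
  qed auto
  then have "wp (For 4 (Va 0) ?b) (\<lambda>t. 1 \<le> sc t 3 \<and> sc t 3 < n \<and> sc t 3 \<notin> marked s \<and>
    (\<forall>v. 1 \<le> v \<and> v < n \<and> v \<notin> marked s \<longrightarrow> ra s 2 (sc t 3) \<le> ra s 2 v) \<and> tk t \<le> tk s + n * 10 + 3) ?s"
    by (rule wp_mono) (use left in \<open>auto split: if_splits\<close>)
  then show ?thesis unfolding select_def by simp
qed

lemma select_sets [simp]: "x \<notin> {3, 4} \<Longrightarrow> x \<notin> wsc select" "k \<notin> war select" "k \<notin> wra select" "silent select"
  by (auto simp: select_def)

text \<open>The first term pays for all selection rounds together, because many vertices in a row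
  may have no cuts. The other terms cover the end of one enumeration, the set-up of the next and the
  writing of a cut.\<close>

definition delaytime :: nat where
  "delaytime = n * (n * 10 + 12) + nexttime + n * 8 + m * 4 + 40"

definition rows_ok :: "(nat \<Rightarrow> nat) \<Rightarrow> (nat \<Rightarrow> real) \<Rightarrow> hstate \<Rightarrow> bool" where
  "rows_ok par Lam s \<longleftrightarrow> (\<forall>v. 0 < v \<and> v < n \<longrightarrow> rowok par Lam v (ar s 16 v) (\<lambda>y. ar s 17 (v * n + y)))"

text \<open>The slack since the last output grows with the number \<open>i\<close> of all vertices
  treated and is never reset; as there are fewer than \<open>n\<close> rounds, its total is still
  within \<open>delaytime\<close>.\<close>

definition done_inv :: "(nat \<Rightarrow> nat) \<Rightarrow> (nat \<Rightarrow> real) \<Rightarrow> nat \<Rightarrow> nat \<Rightarrow> hstate \<Rightarrow> bool" where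
  "done_inv par Lam T i u \<longleftrightarrow> env u \<and> rows_ok par Lam u \<and> ra u 2 = Lam \<and> card (marked u) = i \<and>
     (\<forall>v\<in>marked u. \<forall>v'. 1 \<le> v' \<and> v' < n \<and> v' \<notin> marked u \<longrightarrow> Lam v \<le> Lam v') \<and>
     (\<exists>cs. distinct cs \<and> set cs = cut ` (\<Union>v\<in>marked u. emitted par Lam v) \<and> sorted (map (cut_weight w) cs) \<and>
        glog T delaytime cs (lg u) \<and> tk u \<le> ltick T (lg u) (length cs) + i * (n * 10 + 12) + nexttime)"

text \<open>All cuts charged to a vertex weigh its \<open>Lam\<close>, so sortedness reduces to the
  order of selection. Distinctness within one vertex and across vertices is
  \<open>emitted_cut_inj\<close>.\<close>

lemma emitted_append:
  assumes P: "parents par Lam" and M: "M \<subseteq> {1..<n}" and v: "1 \<le> v" "v < n" "v \<notin> M"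
    and ord: "\<And>u. u \<in> M \<Longrightarrow> Lam u \<le> Lam v"
    and cs: "distinct cs" "set cs = cut ` (\<Union>v\<in>M. emitted par Lam v)" "sorted (map (cut_weight w) cs)"
    and ds: "distinct ds" "set ds = emitted par Lam v"
  shows "distinct (cs @ map cut ds)" "set (cs @ map cut ds) = cut ` (\<Union>v\<in>insert v M. emitted par Lam v)"
    "sorted (map (cut_weight w) (cs @ map cut ds))"
proof -
  have vn: "v \<in> {1..<n}" using v by simp
  have "inj_on cut (set ds)"
  proof (rule inj_onI)
    fix X Y assume "X \<in> set ds" "Y \<in> set ds" "cut X = cut Y"
    then show "X = Y" using emitted_cut_inj[OF P vn vn, of X Y] ds(2) by metis
  qed
  moreover have "set cs \<inter> cut ` set ds = {}"
  proof -
    have False if X: "X \<in> emitted par Lam v" and u: "u \<in> M" "Y \<in> emitted par Lam u" "cut X = cut Y" for X Y u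
    proof -
      have "u \<in> {1..<n}" using u(1) M by blast
      then have "v = u" using emitted_cut_inj[OF P vn _ X u(2,3)] by blast
      then show False using u(1) v(3) by blast
    qed
    then show ?thesis
    proof (intro equals0I, goal_cases)
      case (1 C)
      then obtain X where X: "C = cut X" "X \<in> emitted par Lam v" "C \<in> set cs" using ds(2) by blast
      then obtain u Y where "u \<in> M" "Y \<in> emitted par Lam u" "C = cut Y" using cs(2) by blast
      then show False using 1(1)[OF X(2)] X(1) by metis
    qed
  qed
  ultimately show "distinct (cs @ map cut ds)" using cs ds by (simp add: distinct_map)
  show "set (cs @ map cut ds) = cut ` (\<Union>v\<in>insert v M. emitted par Lam v)" using cs ds by auto
  have dw: "cut_weight w (cut X) = Lam u" if "X \<in> emitted par Lam u" for X u
    using that cut_weight_cut by (simp add: emitted_def)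
  have "map (cut_weight w) (map cut ds) = map (\<lambda>_. Lam v) ds" using dw ds(2) by simp
  then have "sorted (map (cut_weight w) (map cut ds))" by (simp only: map_replicate_const sorted_replicate)
  moreover have "cut_weight w C \<le> cut_weight w C'" if "C \<in> set cs" "C' \<in> set (map cut ds)" for C C'
    using that cs(2) ds(2) dw ord by auto
  ultimately show "sorted (map (cut_weight w) (cs @ map cut ds))" using cs(3) by (auto simp: sorted_append)
qed

text \<open>The two final ticks anticipate the increment and the backward jump of the surrounding
  loop.\<close>

lemma phase2_step:
  assumes P: "parents par Lam" and u: "done_inv par Lam T i u" and i: "i < n - 1"
  shows "wp (select ;; Sto 18 (Va 3) (Co 1) ;; Ite (Ar 16 (Va 3)) enum Skip)
     (\<lambda>t. done_inv par Lam T (Suc i) (tick 1 (tick 1 t))) (tick e0 u)"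
proof -
  have e: "env u" "rows_ok par Lam u" "ra u 2 = Lam" "card (marked u) = i"
    using u unfolding done_inv_def by simp_all
  have "\<forall>v\<in>marked u. \<forall>v'. 1 \<le> v' \<and> v' < n \<and> v' \<notin> marked u \<longrightarrow> Lam v \<le> Lam v'"
    using u unfolding done_inv_def by (elim conjE)
  then have ord: "\<And>v v'. v \<in> marked u \<Longrightarrow> 1 \<le> v' \<Longrightarrow> v' < n \<Longrightarrow> v' \<notin> marked u \<Longrightarrow> Lam v \<le> Lam v'" by blast
  have "\<exists>cs. distinct cs \<and> set cs = cut ` (\<Union>v\<in>marked u. emitted par Lam v) \<and> sorted (map (cut_weight w) cs) \<and>
        glog T delaytime cs (lg u) \<and> tk u \<le> ltick T (lg u) (length cs) + i * (n * 10 + 12) + nexttime"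
    using u unfolding done_inv_def by (elim conjE)
  then obtain cs where
    cs: "distinct cs" "set cs = cut ` (\<Union>v\<in>marked u. emitted par Lam v)" "sorted (map (cut_weight w) cs)"
    and g: "glog T delaytime cs (lg u)" and tu: "tk u \<le> ltick T (lg u) (length cs) + i * (n * 10 + 12) + nexttime"
    by (elim exE conjE)
  have n0: "sc u 0 = n" using e by (simp add: env_def)
  have M: "marked u \<subseteq> {1..<n}" "finite (marked u)" by (auto simp: marked_def)
  have "\<exists>v. 1 \<le> v \<and> v < n \<and> v \<notin> marked u"
  proof (rule ccontr)
    assume "\<not> ?thesis"
    then have "{1..<n} \<subseteq> marked u" by auto
    then have "card {1..<n} \<le> i" using M e(4) card_mono by metis
    then show False using i by simp
  qed
  moreover have mk: "marked (tick e0 u) = marked u" by (simp add: marked_def)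
  ultimately have sel: "wp select (\<lambda>t. 1 \<le> sc t 3 \<and> sc t 3 < n \<and> sc t 3 \<notin> marked u \<and>
    (\<forall>v. 1 \<le> v \<and> v < n \<and> v \<notin> marked u \<longrightarrow> ra u 2 (sc t 3) \<le> ra u 2 v) \<and> tk t \<le> tk u + n * 10 + 4) (tick e0 u)"
    using n0 by (intro wp_mono[OF select_correct]) (simp_all add: mk)
  have eu: "env (tick e0 u)" using e(1) by (simp add: env_def)
  show ?thesis unfolding wp_simps(9)
  proof (rule wp_conseq[OF sel], goal_cases)
    case (1 t)
    define v where "v = sc t 3"
    have v: "1 \<le> v" "v < n" "v \<notin> marked u" "\<And>v'. 1 \<le> v' \<Longrightarrow> v' < n \<Longrightarrow> v' \<notin> marked u \<Longrightarrow> Lam v \<le> Lam v'"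
      and tt: "tk t \<le> tk u + n * 10 + 4" using 1(1) e(3) by (auto simp: v_def)
    have ft: "ar t = ar u" "ra t = ra u" "lg t = lg u" using 1(2) by (auto simp: frm_def)
    have et: "env t" using env_frm[OF 1(2) _ _ _ _ _ _ _ _ _ eu] by simp
    let ?t = "tick (cost (Sto 18 (Va 3) (Co 1))) (t\<lparr>ar := (ar t)(18 := (ar t 18)(v := 1))\<rparr>)"
    have fin: "done_inv par Lam T (Suc i) (tick 1 (tick 1 q))"
      if q: "env q" "ar q 18 = (ar u 18)(v := 1)" "ar q 16 = ar u 16" "ar q 17 = ar u 17" "ra q 2 = ra u 2"
        and ds: "distinct ds" "set ds = emitted par Lam v" and gq: "glog T delaytime (cs @ map cut ds) (lg q)"
        and tq: "tk q + 2 \<le> ltick T (lg q) (length cs + length ds) + Suc i * (n * 10 + 12) + nexttime" for q ds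
    proof -
      have mq: "marked (tick 1 (tick 1 q)) = insert v (marked u)" using q(2) v by (auto simp: marked_def)
      have "env (tick 1 (tick 1 q))" using q(1) by (simp add: env_def)
      moreover have "rows_ok par Lam (tick 1 (tick 1 q))" using e(2) q by (simp add: rows_ok_def)
      moreover have "card (insert v (marked u)) = Suc i" using e(4) v M by simp
      moreover have "\<forall>x\<in>insert v (marked u). \<forall>v'. 1 \<le> v' \<and> v' < n \<and> v' \<notin> insert v (marked u) \<longrightarrow> Lam x \<le> Lam v'"
        using v ord by auto
      moreover note E = emitted_append[OF P M(1) v(1-3) ord[OF _ v(1-3)] cs ds]
      define cs' where "cs' = cs @ map cut ds"
      have E': "distinct cs'" "set cs' = cut ` (\<Union>v\<in>insert v (marked u). emitted par Lam v)" "sorted (map (cut_weight w) cs')"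
        unfolding cs'_def by (rule E, assumption)+
      have "tk (tick 1 (tick 1 q)) \<le> ltick T (lg q) (length cs') + Suc i * (n * 10 + 12) + nexttime"
        using tq by (simp add: cs'_def)
      moreover have "ra (tick 1 (tick 1 q)) 2 = Lam" "glog T delaytime cs' (lg (tick 1 (tick 1 q)))"
        using gq e(3) q(5) by (simp_all add: cs'_def)
      ultimately show ?thesis unfolding done_inv_def mq by (intro conjI exI[of _ cs'] E') simp_all
    qed
    define k where "k = ar u 16 v"
    have row: "rowok par Lam v k (\<lambda>y. ar u 17 (v * n + y))" using e(2) v by (simp add: rows_ok_def k_def)
    have e3: "env ?t" using et by (simp add: env_def)
    have "wp (Ite (Ar 16 (Va 3)) enum Skip) (\<lambda>t. done_inv par Lam T (Suc i) (tick 1 (tick 1 t))) ?t"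
    proof (cases "k = 0")
      case True
      then have em: "emitted par Lam v = {}" using row by (simp add: rowok_def)
      let ?q = "tick 1 (tick (length (cn 0 (Ar 16 (Va 3))) + 2) ?t)"
      have eq: "env ?q" using e3 by (simp add: env_def)
      have "done_inv par Lam T (Suc i) (tick 1 (tick 1 ?q))"
        by (rule fin[OF eq, of "[]"]) (use ft em g tu tt in auto)
      then show ?thesis using True ft by (simp add: v_def[symmetric] k_def)
    next
      case False
      let ?q = "tick (length (cn 0 (Ar 16 (Va 3))) + 2) ?t"
      have eq: "env ?q" using e3 by (simp add: env_def)
      have i1: "Suc i * (n * 10 + 12) \<le> n * (n * 10 + 12)" using i by (intro mult_le_mono1) simp
      have tq: "tk ?q \<le> ltick T (lg ?q) (length cs) + (Suc i * (n * 10 + 12) + nexttime)" using tt tu ft by simp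
      have D: "Suc i * (n * 10 + 12) + nexttime + n * 8 + m * 4 + 20 \<le> delaytime" "nexttime + m * 4 + 3 \<le> delaytime"
        using i1 unfolding delaytime_def by linarith+
      have q1: "sc ?q 3 = v" and q2: "ar ?q 16 v = k" and q3: "rowok par Lam v k (\<lambda>y. ar ?q 17 (v * n + y))"
        and q4: "glog T delaytime cs (lg ?q)" using ft row g by (simp_all add: v_def k_def)
      have "wp enum (\<lambda>t. done_inv par Lam T (Suc i) (tick 1 (tick 1 t))) ?q"
      proof (rule wp_conseq[OF enum_correct[OF eq q1 v(2) q2 False q3 q4 tq D]], goal_cases)
        case (1 q)
        then obtain ds where ds: "env q" "distinct ds" "set ds = emitted par Lam v" "glog T delaytime (cs @ map cut ds) (lg q)"
          "tk q \<le> ltick T (lg q) (length cs + length ds) + nexttime" by blast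
        show ?case by (rule fin[OF ds(1) _ _ _ _ ds(2,3,4)]) (use 1(2) ft ds(5) in \<open>simp_all add: frm_def\<close>)
      qed
      then show ?thesis using False ft by (simp add: v_def[symmetric] k_def)
    qed
    then show ?case unfolding wp_simps(3) ev.simps v_def .
  qed
qed

lemma done_inv_sc:
  "done_inv par Lam T i (tick 1 (tick 1 t)) \<Longrightarrow> done_inv par Lam T i (tick 1 (tick c (t\<lparr>sc := (sc t)(2 := x)\<rparr>)))"
  by (simp add: done_inv_def env_def rows_ok_def marked_def)

theorem phase2_correct:
  assumes env: "env s" and P: "parents par (ra s 2)" and rows: "rows_ok par (ra s 2) s"
    and z: "ar s 18 = (\<lambda>_. 0)" and l: "lg s = []"
  shows "wp phase2 (\<lambda>t. \<exists>cs. distinct cs \<and> set cs = {C. relevant_cut {..<n} edges w C} \<and> sorted (map (cut_weight w) cs) \<and>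
     glog (tk s) delaytime cs (lg t) \<and> tk t \<le> ltick (tk s) (lg t) (length cs) + delaytime) s"
proof -
  define Lam where "Lam = ra s 2"
  define I where "I i u \<longleftrightarrow> sc u 2 = i \<and> done_inv par Lam (tk s) i u" for i and u :: hstate
  let ?s = "tick (cost (Asg 2 (Co 0))) (s\<lparr>sc := (sc s)(2 := 0)\<rparr>)"
  have m0: "marked ?s = {}" by (simp add: marked_def z)
  have "env ?s" "rows_ok par Lam ?s" "ra ?s 2 = Lam" using env rows by (simp_all add: env_def rows_ok_def Lam_def)
  then have "done_inv par Lam (tk s) 0 ?s"
    using l unfolding done_inv_def m0 by (auto simp: glog_def ltick_def nexttime_def)
  then have I0: "I 0 ?s" by (simp add: I_def)
  let ?c = "(select ;; Sto 18 (Va 3) (Co 1) ;; Ite (Ar 16 (Va 3)) enum Skip)"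
  let ?Q = "\<lambda>t. \<exists>cs. distinct cs \<and> set cs = {C. relevant_cut {..<n} edges w C} \<and> sorted (map (cut_weight w) cs) \<and>
     glog (tk s) delaytime cs (lg t) \<and> tk t \<le> ltick (tk s) (lg t) (length cs) + delaytime"
  have "wp (Wh (Lt (Va 2) (Sub (Va 0) (Co 1))) (?c ;; Asg 2 (Add (Va 2) (Co 1)))) ?Q ?s"
  proof (rule wp_Wh_upto[where I = I and T = "n - 1" and k = 0], goal_cases)
    case 1 show ?case by (rule I0)
  next
    case 2 show ?case by simp
  next
    case (3 i u)
    then have d: "done_inv par Lam (tk s) i u" and "sc u 2 = i" "sc u 0 = n" by (auto simp: I_def done_inv_def env_def)
    then have i: "i = n - 1" using 3 by (simp split: if_splits)
    have "marked u \<subseteq> {1..<n}" by (auto simp: marked_def)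
    moreover have "card (marked u) = card {1..<n}" using d i by (simp add: done_inv_def)
    ultimately have mu: "marked u = {1..<n}" by (simp add: card_subset_eq)
    have R: "{C. relevant_cut {..<n} edges w C} = cut ` (\<Union>v\<in>{1..<n}. emitted par Lam v)"
      by (rule relevant_cuts_eq) (use P in \<open>simp add: Lam_def\<close>)
    have le: "i * (n * 10 + 12) \<le> n * (n * 10 + 12)" using i by (intro mult_le_mono1) simp
    obtain cs where "distinct cs" "set cs = cut ` (\<Union>v\<in>{1..<n}. emitted par Lam v)" "sorted (map (cut_weight w) cs)"
        "glog (tk s) delaytime cs (lg u)" "tk u \<le> ltick (tk s) (lg u) (length cs) + i * (n * 10 + 12) + nexttime"
      using d unfolding done_inv_def mu by (elim exE conjE)
    moreover from this(5) have "tk (tick (length (cn 0 (Lt (Va 2) (Sub (Va 0) (Co 1)))) + 3) u) \<le> ltick (tk s) (lg u) (length cs) + delaytime"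
      using le unfolding delaytime_def tick_simps by linarith
    ultimately show ?case unfolding R by (intro exI[of _ cs]) simp
  next
    case (4 i u)
    then have d: "done_inv par Lam (tk s) i u" and u: "sc u 2 = i" "sc u 0 = n" by (auto simp: I_def done_inv_def env_def)
    then have i: "i < n - 1" using 4 by (simp split: if_splits)
    have Pl: "parents par Lam" using P by (simp add: Lam_def)
    show ?case
    proof (intro conjI i)
      let ?u = "tick (length (cn 0 (Lt (Va 2) (Sub (Va 0) (Co 1)))) + 2) u"
      have "wp ?c (\<lambda>t. done_inv par Lam (tk s) (Suc i) (tick 1 (tick 1 t)) \<and> sc t 2 = i) ?u"
        by (rule wp_conseq[OF phase2_step[OF Pl d i]]) (use u in \<open>simp add: frm_def\<close>)
      then have "wp ?c (wp (Asg 2 (Add (Va 2) (Co 1))) (\<lambda>s'. I (Suc i) (tick 1 s'))) ?u"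
        by (rule wp_mono) (auto simp: I_def intro!: done_inv_sc[simplified])
      then show "wp (?c ;; Asg 2 (Add (Va 2) (Co 1))) (\<lambda>s'. I (Suc i) (tick 1 s')) ?u" by simp
    qed
  qed
  then show ?thesis unfolding phase2_def For_def by simp
qed

end

section \<open>Running times\<close>

text \<open>The guard catches the graph with a single vertex, for which the start-up code leaves 0
  in scalar 0.\<close>

definition main :: "program \<Rightarrow> cmd" where
  "main P = Ite (Lt (Co 1) (Va 0)) (copyin ;; rows ;; tree ;; phase1a P ;; phase1b P ;; phase2) Skip"

lemma wfc_query: "wfc (query P)"
  by (simp add: query_def build_def build_edge_def decode_def cutval_def For_def Lt_def Neq_def Eq_def wrN_def wrR_def rdN_def rdR_def inc_def)

lemma wfc_main: "wfc (main P)"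
proof -
  have "wfc copyin" by (simp add: copyin_def For_def Lt_def Neq_def Eq_def)
  moreover have "wfc rows" by (simp add: rows_def For_def Lt_def Neq_def Eq_def)
  moreover have "wfc tree" by (simp add: tree_def tree_find_def tree_add_def For_def Lt_def Neq_def Eq_def)
  moreover have "wfc (phase1a P)" by (simp add: phase1a_def lam_step_def wfc_query For_def Lt_def)
  moreover have "wfc (trysplit P)"
    by (simp add: trysplit_def set_split_def do_split_def wfc_query For_def Lt_def Neq_def Eq_def)
  then have "wfc (phase1b P)"
    by (simp add: phase1b_def one_vertex_def make_chain_def refine_def find_anchor_def set_r0_def wfc_query For_def Lt_def Neq_def Eq_def)
  moreover have "wfc phase2"
    by (simp add: phase2_def select_def enum_def nextset_def test_label_def chk_def outcut_def For_def Lt_def Neq_def Eq_def)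
  ultimately show ?thesis by (simp add: main_def Lt_def)
qed

lemma tape_run_le: "length (tape (run P x t)) \<le> t"
proof (induction t)
  case 0 show ?case by (simp add: run_def init_config_def)
next
  case (Suc t)
  then show ?case using tape_step_le[of P "run P x t"] by (simp add: run_def)
qed

section \<open>Size bounds and asymptotic estimates\<close>

context connected_wgraph
begin

text \<open>The program has to write one symbol per edge and writes at most one per step; the
  trivial contraction provides an instance with these \<open>n\<close> and \<open>m\<close>.\<close>

lemma m_le_phi:
  assumes P: "min_st_cut_program P \<phi>"
  shows "m \<le> \<phi> n m"
proof -
  have r: "repr id" by (simp add: repr_def)
  have "0 < n" "1 < n" "(0::nat) \<noteq> 1" using two by auto
  from min_cut_call[OF P r this refl] obtain T X where T: "T \<le> \<phi> n m"
    "tape (run P (n # m # 0 # 1 # encode_edges (map (cends id) [0..<m]), map (cwt id m) [0..<m]) T) =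
      map (\<lambda>i. of_bool ((fst (cends id i) \<in> X) \<noteq> (snd (cends id i) \<in> X))) [0..<m]" by blast
  have "m \<le> T" using tape_run_le[of P "(n # m # 0 # 1 # encode_edges (map (cends id) [0..<m]), map (cwt id m) [0..<m])" T] T(2) by simp
  then show ?thesis using T(1) by simp
qed

text \<open>The \<open>n - 1\<close> tree edges are distinct: the child of a later edge is new and
  hence differs from both ends of an earlier edge.\<close>

lemma tree_card:
  assumes "tree_ok tp tc te"
  shows "n \<le> m + 1"
proof -
  have T: "\<And>j. j < n - 1 \<Longrightarrow> te j < m \<and> {tp j, tc j} = {ea (te j), eb (te j)} \<and> tp j \<in> insert 0 (tc ` {..<j})"
    and U: "insert 0 (tc ` {..<n-1}) = {..<n}" using assms unfolding tree_ok_def by blast+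
  have c: "card (tc ` {..<n-1}) \<le> n - 1" using card_image_le[of "{..<n-1}" tc] by simp
  have cn: "card (insert 0 (tc ` {..<n-1})) = n" using U by simp
  have z: "0 \<notin> tc ` {..<n-1}"
  proof
    assume "0 \<in> tc ` {..<n-1}"
    then have "card (tc ` {..<n-1}) = n" using cn by (simp add: insert_absorb)
    then show False using c two by simp
  qed
  then have "card (tc ` {..<n-1}) = card {..<n-1}" using cn by simp
  then have inj: "inj_on tc {..<n-1}" by (rule eq_card_imp_inj_on[rotated]) simp
  have neq: "te i \<noteq> te j" if ij: "i < j" "j < n - 1" for i j
  proof
    assume "te i = te j"
    then have "{tp i, tc i} = {tp j, tc j}" using T[of i] T[of j] ij by auto
    then have "tc j = tc i \<or> tc j = tp i" by blast
    moreover have "tc j \<noteq> tc i" using inj ij by (auto dest: inj_onD)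
    moreover have "tc j \<noteq> tp i"
    proof
      assume e: "tc j = tp i"
      have "tp i \<in> insert 0 (tc ` {..<i})" using T[of i] ij by simp
      then consider "tc j = 0" | k where "k < i" "tc j = tc k" using e by auto
      then show False
      proof cases
        case 1 then show False using z ij by force
      next
        case (2 k) then show False using inj_onD[OF inj, of j k] ij by auto
      qed
    qed
    ultimately show False by blast
  qed
  have "inj_on te {..<n-1}"
    by (rule linorder_inj_onI) (use neq in \<open>auto\<close>)
  moreover have "te ` {..<n-1} \<subseteq> {..<m}" using T by auto
  ultimately have "card {..<n-1} \<le> card {..<m}" by (intro card_inj_on_le) auto
  then show ?thesis by simp
qed

text \<open>Each edge accounts for two ordered pairs of vertices.\<close>

lemma edges_le_square: "2 * m \<le> n * n"
proof -
  let ?f = "\<lambda>(i, b). if b then (ea i, eb i) else (eb i, ea i)"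
  have "inj_on ?f ({..<m} \<times> UNIV)"
  proof (rule inj_onI)
    fix p q :: "nat \<times> bool"
    assume p: "p \<in> {..<m} \<times> UNIV" and q: "q \<in> {..<m} \<times> UNIV" and eq: "?f p = ?f q"
    obtain i b j c where s: "p = (i, b)" "q = (j, c)" by fastforce
    have "{ea i, eb i} = {ea j, eb j}" using eq unfolding s by (auto split: if_splits)
    then have "i = j" using simple[of i j] p q s by auto
    then show "p = q" using eq ends[of i] p unfolding s by (auto split: if_splits)
  qed
  moreover have "?f ` ({..<m} \<times> UNIV) \<subseteq> {..<n} \<times> {..<n}" using ends by (auto split: if_splits)
  ultimately have "card ({..<m} \<times> (UNIV :: bool set)) \<le> card ({..<n} \<times> {..<n})"
    by (intro card_inj_on_le) auto
  then show ?thesis by (simp add: card_cartesian_product)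
qed

text \<open>No earlier vertex has a parent, so every minimum cut between 0 and 1 is charged to
  vertex 1. Hence at least one cut is written, and the bound on the first output speaks of an actual
  output.\<close>

lemma emitted_first: "parents par Lam \<Longrightarrow> emitted par Lam 1 \<noteq> {}"
proof -
  assume P: "parents par Lam"
  have "par 1 < 1" "Lam 1 = lam (par 1) 1" using parentsD[OF P, of 1] two by auto
  then show ?thesis using lam_attained[of 0 1] two by (auto simp: emitted_def)
qed

definition inittime :: "program \<Rightarrow> (nat \<Rightarrow> nat \<Rightarrow> nat) \<Rightarrow> nat" where
  "inittime P \<phi> = m * 20 + n * 6 + n * (m * 6 + 20) + n * (n * (QT P \<phi> + n * 4 + 13) + 6) +
     n * (n * (2 * QT P \<phi> + n * 58 + 63) + QT P \<phi> + n * 27 + 25) + 20"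

lemma main_correct:
  assumes P: "min_st_cut_program P \<phi>" and i: "inited x n m s" and l: "lg s = []"
    and x: "\<forall>e<m. fst x ! (2 * e + 2) = ea e \<and> fst x ! (2 * e + 3) = eb e \<and> snd x ! e = wt e"
  shows "wp (main P) (\<lambda>t. n \<le> m + 1 \<and> (\<exists>cs T. cs \<noteq> [] \<and> distinct cs \<and> set cs = {C. relevant_cut {..<n} edges w C} \<and>
     sorted (map (cut_weight w) cs) \<and> glog T delaytime cs (lg t) \<and> T \<le> tk s + inittime P \<phi> \<and>
     tk t \<le> ltick T (lg t) (length cs) + delaytime)) s"
proof -
  let ?s = "tick (length (cn 0 (Lt (Co 1) (Va 0))) + 2) s"
  let ?Q = "\<lambda>t. n \<le> m + 1 \<and> (\<exists>cs T. cs \<noteq> [] \<and> distinct cs \<and> set cs = {C. relevant_cut {..<n} edges w C} \<and>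
     sorted (map (cut_weight w) cs) \<and> glog T delaytime cs (lg t) \<and> T \<le> tk s + inittime P \<phi> \<and>
     tk t \<le> ltick T (lg t) (length cs) + delaytime)"
  have i': "inited x n m ?s" using i unfolding inited_def tick_simps .
  have s0: "sc s 0 = n" "sc s 1 = m" "\<And>k. 1 \<le> k \<Longrightarrow> k < 32 \<Longrightarrow> ar s k = (\<lambda>_. 0)" using i by (auto simp: inited_def)
  have "wp copyin (wp rows (wp tree (wp (phase1a P) (wp (phase1b P) (wp phase2 ?Q))))) ?s"
  proof (rule wp_conseq[OF copyin_correct[OF i' x[rule_format]]], goal_cases)
    case (2 t1)
    have f1: "sc t1 0 = n" "sc t1 1 = m" "lg t1 = []" "\<And>k. 3 \<le> k \<Longrightarrow> k < 32 \<Longrightarrow> ar t1 k = (\<lambda>_. 0)"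
      using 2(2) s0 l by (auto simp: frm_def copyin_def)
    have c1: "\<forall>e<m. ar t1 1 e = ea e \<and> ar t1 2 e = eb e \<and> ra t1 1 e = wt e" "tk t1 \<le> tk s + m * 20 + 3" using 2(1) by auto
    show ?case
    proof (rule wp_conseq[OF rows_correct[OF f1(1)]], goal_cases)
      case (1 t2)
      have f2: "sc t2 0 = n" "sc t2 1 = m" "lg t2 = []" "\<And>k. 4 \<le> k \<Longrightarrow> k < 32 \<Longrightarrow> ar t2 k = (\<lambda>_. 0)"
        "ar t2 1 = ar t1 1" "ar t2 2 = ar t1 2" "ra t2 1 = ra t1 1"
        using 1(2) f1 by (auto simp: frm_def rows_def)
      have c2: "\<forall>i<n. ar t2 3 i = i * n" "tk t2 \<le> tk t1 + n * 6 + 4" using 1(1) by auto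
      have tr: "wp tree (\<lambda>t. tree_ok (ar t 5) (ar t 6) (ar t 7) \<and> tk t \<le> tk t2 + n * (m * 6 + 20) + 4) t2"
        by (rule tree_correct) (use f2 c1 in auto)
      show ?case
      proof (rule wp_conseq[OF tr], goal_cases)
        case (1 t3)
        have f3: "sc t3 0 = n" "sc t3 1 = m" "lg t3 = []" "\<And>k. 8 \<le> k \<Longrightarrow> k < 32 \<Longrightarrow> ar t3 k = (\<lambda>_. 0)"
          "ar t3 1 = ar t1 1" "ar t3 2 = ar t1 2" "ra t3 1 = ra t1 1" "ar t3 3 = ar t2 3"
          using 1(2) f2 by (auto simp: frm_def tree_def tree_find_def tree_add_def)
        have e3: "env t3" using f3 c1 c2 1(1) by (simp add: env_def)
        have s3: "stok t3" using f3(4) by (simp add: stok_def)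
        have k3: "tk t3 \<le> tk s + m * 20 + n * 6 + n * (m * 6 + 20) + 11" using 1(1) c1 c2 by simp
        have nm: "n \<le> m + 1" using tree_card e3 unfolding env_def by blast
        show ?case
        proof (rule wp_conseq[OF phase1a_correct[OF P e3 s3]], goal_cases)
          case (1 t4)
          have e4: "env t4" using env_frm[OF 1(2) _ _ _ _ _ _ _ _ _ e3] by simp
          have f4: "lg t4 = []" "ar t4 18 = (\<lambda>_. 0)" using 1(2) f3 by (simp_all add: frm_def)
          have c4: "stok t4" "parents (ar t4 13) (ra t4 2)" "tk t4 \<le> tk t3 + n * (n * (QT P \<phi> + n * 4 + 13) + 6) + 2"
            using 1(1) by auto
          show ?case
          proof (rule wp_conseq[OF phase1b_correct[OF P e4 c4(1,2)]], goal_cases)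
            case (1 t5)
            have e5: "env t5" using env_frm[OF 1(2) _ _ _ _ _ _ _ _ _ e4] by simp
            have f5: "lg t5 = []" "ar t5 18 = (\<lambda>_. 0)" "ra t5 2 = ra t4 2" using 1(2) f4 by (simp_all add: frm_def)
            have P5: "parents (ar t4 13) (ra t5 2)" using c4 f5 by simp
            have r5: "rows_ok (ar t4 13) (ra t5 2) t5" using 1(1) f5 by (simp add: rows_ok_def)
            have k5: "tk t5 \<le> tk s + inittime P \<phi>" using 1(1) c4(3) k3 by (simp add: inittime_def)
            have ne: "{C. relevant_cut {..<n} edges w C} \<noteq> {}"
            proof -
              have "1 \<in> {1..<n}" using two by simp
              then show ?thesis unfolding relevant_cuts_eq[OF P5] using emitted_first[OF P5] by blast
            qed
            show ?case
            proof (rule wp_mono[OF phase2_correct[OF e5 P5 r5 f5(2,1)]], goal_cases)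
              case (1 t6)
              then obtain cs where cs: "distinct cs" "set cs = {C. relevant_cut {..<n} edges w C}" "sorted (map (cut_weight w) cs)"
                "glog (tk t5) delaytime cs (lg t6)" "tk t6 \<le> ltick (tk t5) (lg t6) (length cs) + delaytime" by (elim exE conjE)
              have "cs \<noteq> []" using ne cs(2) by (metis empty_set)
              then show ?case using cs k5 nm by blast
            qed
          qed
        qed
      qed
    qed
  qed
  then show ?thesis unfolding main_def using s0 two by simp
qed

lemma delaytime_le:
  assumes "n \<le> m + 1"
  shows "delaytime \<le> 160 * (n * m)"
proof -
  have n2: "n \<le> 2 * m" using assms m_pos by simp
  have "n * n \<le> n * (2 * m)" using n2 by (rule mult_le_mono2)
  moreover have "n \<le> n * m" "m \<le> n * m" "1 \<le> n * m" using m_pos two by simp_all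
  moreover have "delaytime = 10 * (n * n) + 37 * n + 14 * (n * m) + 8 * m + 60"
    by (simp add: delaytime_def nexttime_def algebra_simps)
  moreover have "n * (2 * m) = 2 * (n * m)" by simp
  ultimately show ?thesis by linarith
qed

text \<open>Everything is compared with \<open>A\<close>, which is \<open>n^2\<close> times the
  bound of one query; \<open>m \<le> \<phi> n m\<close> and \<open>n \<le> 2 * \<phi> n m\<close>
  absorb the terms without \<open>\<phi>\<close>. The factor \<open>2 * length P + 20\<close> is the
  price of one simulated step.\<close>

lemma inittime_le:
  assumes P: "min_st_cut_program P \<phi>" and nm: "n \<le> m + 1"
  shows "inittime P \<phi> + delaytime \<le> 2000 * (2 * length P + 20) * (n * n * \<phi> n m)"
proof -
  define f q where "f = \<phi> n m" and "q = 2 * length P + 20"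
  have mf: "m \<le> f" using m_le_phi[OF P] by (simp add: f_def)
  have f1: "1 \<le> f" using mf m_pos by simp
  have n2: "n \<le> 2 * f" using nm mf m_pos by simp
  define A where "A = n * n * f"
  have n0: "1 \<le> n" using two by simp
  have a1: "n * n \<le> A" using f1 by (simp add: A_def)
  have a2: "n * n * n \<le> 2 * A" using mult_le_mono2[OF n2, of "n * n"] by (simp add: A_def algebra_simps)
  have a3: "n * n * m \<le> A" using mult_le_mono2[OF mf, of "n * n"] by (simp add: A_def)
  have a4: "n \<le> A" using a1 n0 by (metis le_trans mult_le_mono2 mult.right_neutral)
  have a5: "1 \<le> A" using a4 n0 by simp
  have a6: "n * m \<le> A" using a3 n0 by (metis le_trans mult_le_mono1 mult_le_mono2 mult.right_neutral)
  have a7: "m \<le> A" using a6 n0 by (metis le_trans mult_le_mono1 mult_1)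
  define B where "B = A * q"
  have AB: "A \<le> B" by (simp add: B_def q_def)
  define QQ where "QQ = QT P \<phi>"
  have "n * n * ((f + 1) * q) \<le> n * n * ((2 * f) * q)" using f1 by (intro mult_le_mono2 mult_le_mono1) simp
  then have b1: "n * n * ((f + 1) * q) \<le> 2 * B" by (simp add: B_def A_def algebra_simps)
  have "n * n * QQ = 49 * (n * n * m) + 13 * (n * n * n) + 26 * (n * n) + n * n * ((f + 1) * q)"
    by (simp add: QQ_def QT_def f_def q_def algebra_simps)
  then have b2: "n * n * QQ \<le> 110 * B" using a1 a2 a3 b1 AB by linarith
  have "n * QQ \<le> n * n * QQ" using n0 by simp
  then have b3: "n * QQ \<le> 110 * B" using b2 by (rule le_trans)
  have "inittime P \<phi> = m * 20 + n * 57 + 6 * (n * m) + 3 * (n * n * QQ) + n * QQ + 62 * (n * n * n) + 103 * (n * n) + 20"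
    by (simp add: inittime_def QQ_def algebra_simps)
  then have "inittime P \<phi> \<le> 1000 * B" using a1 a2 a4 a5 a6 a7 b2 b3 AB by linarith
  moreover have "delaytime \<le> 160 * B" using delaytime_le[OF nm] a6 AB by linarith
  ultimately show ?thesis by (simp add: B_def A_def q_def f_def algebra_simps)
qed

end

section \<open>From ticks to machine times of the whole program\<close>

context connected_wgraph
begin

text \<open>The \<open>k\<close>-th cut is complete with the symbol of index
  \<open>k * m - 1\<close>. \<open>glog\<close> bounds the ticks between such symbols, and
  \<open>pace\<close> turns them into machine steps.\<close>

lemma main_times:
  assumes P: "min_st_cut_program P \<phi>" and u: "bnd u (main P)" "0 < u"
    and x: "x = (n # m # ys, ws)" "length ys = 2 * m" "length ws = m"
    and xe: "\<forall>e<m. fst x ! (2 * e + 2) = ea e \<and> fst x ! (2 * e + 3) = eb e \<and> snd x ! e = wt e"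
    and Q: "Q = prog (main P)"
  shows "\<exists>cs. distinct cs \<and> set cs = {C. relevant_cut {..<n} edges w C} \<and> sorted (map (cut_weight w) cs) \<and>
    halts_with_output Q x (concat (map bits cs)) \<and> n \<le> m + 1 \<and>
    cut_time Q x m 1 \<le> u * (length pro + inittime P \<phi> + delaytime) \<and>
    (\<forall>k\<in>{1..<length cs}. cut_time Q x m (Suc k) \<le> cut_time Q x m k + u * delaytime) \<and>
    halt_time Q x \<le> cut_time Q x m (length cs) + u * delaytime"
proof -
  have "n = 1 \<and> m = 0 \<or> 2 \<le> n \<and> 1 \<le> m" using two m_pos by simp
  from prog_start[OF x this, of "main P"] obtain s where
    s: "sync (prog (main P)) x s (length pro)" "lg s = []" "clk s = length pro" "tk s = length pro" "inited x n m s"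
    using two by auto
  from main_correct[OF P s(5,2) xe] obtain s' cs T where b: "big (main P) s s'" and nm: "n \<le> m + 1"
    and cs: "cs \<noteq> []" "distinct cs" "set cs = {C. relevant_cut {..<n} edges w C}" "sorted (map (cut_weight w) cs)"
    and g: "glog T delaytime cs (lg s')" and T: "T \<le> tk s + inittime P \<phi>"
    and fin: "tk s' \<le> ltick T (lg s') (length cs) + delaytime"
    unfolding wp_def by (elim exE conjE)
  note R = prog_result[OF s(1-4) b wfc_main u]
  define l where "l = lg s'"
  have g1: "map fst l = concat (map bits cs)" and g2: "\<And>k. k < length cs \<Longrightarrow> ltick T l (Suc k) \<le> ltick T l k + delaytime"
    using g by (auto simp: glog_def l_def)
  have len: "length l = length cs * m" by (rule glog_length[OF g1])
  define p where "p k = snd (l ! (k * m - 1))" for k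
  have idx: "k * m - 1 < length l" "Suc (k * m - 1) = k * m" if "1 \<le> k" "k \<le> length cs" for k
  proof -
    have "k * m \<le> length l" using len that by simp
    moreover have "0 < k * m" using that m_pos by simp
    ultimately show "k * m - 1 < length l" "Suc (k * m - 1) = k * m" by linarith+
  qed
  have ct: "cut_time Q x m k = fst (p k)" "snd (p k) = ltick T l k" if k: "1 \<le> k" "k \<le> length cs" for k
    using R(3)[of "k * m - 1"] idx[OF k] k by (simp_all add: cut_time_def Q p_def l_def ltick_def)
  have so: "sorted_wrt (pace u) ((0, 0) # map snd l @ [(clk s', tk s')])" using R(4) by (simp add: paced_def l_def)
  have p0: "pace u (0, 0) (p k)" and pe: "pace u (p k) (clk s', tk s')" if k: "1 \<le> k" "k \<le> length cs" for k
    using so idx[OF k] by (auto simp: p_def sorted_wrt_append)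
  have pp: "pace u (p k) (p (Suc k))" if k: "1 \<le> k" "Suc k \<le> length cs" for k
  proof -
    have "sorted_wrt (pace u) (map snd l)" using so by (simp add: sorted_wrt_append)
    moreover have "k * m - 1 < Suc k * m - 1" using k m_pos by (simp add: less_diff_conv)
    ultimately have "pace u (map snd l ! (k * m - 1)) (map snd l ! (Suc k * m - 1))"
      using idx(1)[of "Suc k"] k by (intro sorted_wrt_nth_less) auto
    then show ?thesis using idx(1)[of k] idx(1)[of "Suc k"] k by (simp add: p_def)
  qed
  have L: "1 \<le> length cs" using cs(1) by (cases cs) auto
  have ub: "fst b \<le> fst a + u * t" if "pace u a b" "snd b \<le> snd a + t" for a b t
  proof -
    have "fst b \<le> fst a + u * (snd b - snd a)" using that(1) by (simp add: pace_def)
    also have "\<dots> \<le> fst a + u * t" using that(2) by (intro add_left_mono mult_le_mono2) simp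
    finally show ?thesis .
  qed
  have "cut_time Q x m 1 \<le> u * (length pro + inittime P \<phi> + delaytime)"
  proof -
    have "snd (p 1) \<le> T + delaytime" using g2[of 0] ct(2)[of 1] L cs(1) by (simp add: ltick_def)
    then have "snd (p 1) \<le> snd (0::nat, 0::nat) + (length pro + inittime P \<phi> + delaytime)" using T s(4) by simp
    from ub[OF p0[of 1] this] show ?thesis using ct(1)[of 1] L by simp
  qed
  moreover have "cut_time Q x m (Suc k) \<le> cut_time Q x m k + u * delaytime" if k: "k \<in> {1..<length cs}" for k
    using ub[OF pp[of k], of delaytime] g2[of k] ct[of k] ct[of "Suc k"] k by simp
  moreover have "halt_time Q x \<le> cut_time Q x m (length cs) + u * delaytime"
    using R(2) ub[OF pe[of "length cs"], of delaytime] fin ct[of "length cs"] L by (simp add: Q l_def)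
  moreover have "halts_with_output Q x (concat (map bits cs))" using R(1) g1 by (simp add: Q l_def)
  ultimately show ?thesis using cs nm by blast
qed

end

text \<open>A set crossed by no edge is closed under reachability; if it were neither empty nor
  everything, a path from inside to outside would give a contradiction.\<close>

lemma connected_wgraph_edge_list:
  assumes c: "connected_ugraph {..<n} E" and w: "\<forall>e\<in>E. 0 \<le> w e" and es: "edge_list E es" and n: "2 \<le> n"
  shows "connected_wgraph n (length es) (\<lambda>i. fst (es ! i)) (\<lambda>i. snd (es ! i)) (\<lambda>i. w {fst (es ! i), snd (es ! i)}) w"
    and "wgraph.edges (length es) (\<lambda>i. fst (es ! i)) (\<lambda>i. snd (es ! i)) = E"
proof -
  let ?e = "\<lambda>i. {fst (es ! i), snd (es ! i)}"
  have m: "map (\<lambda>(u, v). {u, v}) es = map ?e [0..<length es]"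
    by (rule nth_equalityI) (auto simp: case_prod_beta)
  have d: "distinct (map ?e [0..<length es])" and E: "E = ?e ` {..<length es}"
    using es unfolding edge_list_def m by (auto simp: atLeast0LessThan)
  have inj: "inj_on ?e {..<length es}" using d by (simp add: distinct_map atLeast0LessThan)
  have ug: "\<And>e. e \<in> E \<Longrightarrow> e \<subseteq> {..<n} \<and> card e = 2" using c by (auto simp: connected_ugraph_def ugraph_def)
  interpret wgraph n "length es" "\<lambda>i. fst (es ! i)" "\<lambda>i. snd (es ! i)" "\<lambda>i. w {fst (es ! i), snd (es ! i)}"
  proof
    fix i assume i: "i < length es"
    then have e: "?e i \<in> E" using E by blast
    show "fst (es ! i) < n \<and> snd (es ! i) < n \<and> fst (es ! i) \<noteq> snd (es ! i)" using ug[OF e] by (auto simp: card_2_iff)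
    show "0 \<le> w (?e i)" using w e by blast
    fix j assume "j < length es" "?e i = ?e j"
    then show "i = j" using inj i by (auto dest: inj_onD)
  qed
  show "edges = E" unfolding edges_def E ..
  show "connected_wgraph n (length es) (\<lambda>i. fst (es ! i)) (\<lambda>i. snd (es ! i)) (\<lambda>i. w {fst (es ! i), snd (es ! i)}) w"
  proof
    show "2 \<le> n" by (rule n)
    fix X assume X: "X \<subseteq> {..<n}" "X \<noteq> {}" "X \<noteq> {..<n}"
    show "\<exists>i<length es. (fst (es ! i) \<in> X) \<noteq> (snd (es ! i) \<in> X)"
    proof (rule ccontr)
      assume none: "\<not> ?thesis"
      have st: "v \<in> X" if uv: "u \<in> X" "{u, v} \<in> E" for u v
      proof -
        obtain i where i: "i < length es" "{u, v} = ?e i" using uv(2) E by blast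
        then have "(fst (es ! i) \<in> X) = (snd (es ! i) \<in> X)" using none by blast
        then show ?thesis using i(2) uv(1) by (auto simp: doubleton_eq_iff)
      qed
      obtain a b where ab: "a \<in> X" "b < n" "b \<notin> X" using X by blast
      have "(a, b) \<in> {(u, v). {u, v} \<in> E}\<^sup>*" using c ab X(1) unfolding connected_ugraph_def by blast
      then have "b \<in> X" by (induction rule: rtrancl_induct) (use ab st in auto)
      then show False using ab by blast
    qed
  qed simp
qed

lemma no_relevant_cut_singleton: "{C. relevant_cut {..<Suc 0} E w C} = {}"
proof -
  have "\<not> is_cut {..<Suc 0} E C" for C unfolding is_cut_def by (auto simp: lessThan_Suc)
  then show ?thesis unfolding relevant_cut_def min_cut_basis_def cut_basis_def by auto
qed

text \<open>The hypothesis, valid for simple graphs, makes the argument of the binary logarithm at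
  least 2.\<close>

lemma log_square_ratio_ge_1:
  assumes "1 \<le> m" "2 * m \<le> n * n"
  shows "1 \<le> log 2 ((real n)\<^sup>2 / real m)"
proof -
  have "2 * real m \<le> (real n)\<^sup>2" using assms(2) by (metis of_nat_le_iff of_nat_mult of_nat_numeral power2_eq_square)
  then have "2 \<le> (real n)\<^sup>2 / real m" using assms(1) by (simp add: field_simps)
  then have "log 2 2 \<le> log 2 ((real n)\<^sup>2 / real m)" by (intro log_mono) auto
  then show ?thesis by simp
qed

theorem theorem3:
  fixes \<phi> :: "nat \<Rightarrow> nat \<Rightarrow> nat" and P :: program
  assumes "min_st_cut_program P \<phi>"
  shows "\<exists>(Q :: program) (K :: real).
    \<forall>(n :: nat) (E :: nat set set) (w :: nat set \<Rightarrow> real) (es :: (nat \<times> nat) list).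
      connected_ugraph {..<n} E \<and> (\<forall>e\<in>E. 0 \<le> w e) \<and> edge_list E es \<longrightarrow>
      (let m = card E;
           x = graph_input n es w;
           delay = K * (real n * real m * log 2 ((real n)\<^sup>2 / real m))
       in \<exists>cs :: nat set set list.
            distinct cs \<and>
            set cs = {C. relevant_cut {..<n} E w C} \<and>
            sorted (map (cut_weight w) cs) \<and>
            halts_with_output Q x (concat (map (encode_cut es) cs)) \<and>
            (m > 0 \<longrightarrow>
               real (cut_time Q x m 1) \<le> K * ((real n)\<^sup>2 * real (\<phi> n m)) \<and>
               (\<forall>k\<in>{1..<length cs}.
                  real (cut_time Q x m (Suc k)) - real (cut_time Q x m k) \<le> delay) \<and>
               real (halt_time Q x) - real (cut_time Q x m (length cs)) \<le> delay))"
proof -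
  obtain u0 where "bnd u0 (main P)" using bnd_exists by blast
  then have u: "bnd (Suc u0) (main P)" "0 < Suc u0" using bnd_mono[of u0 "main P" "Suc u0"] by simp_all
  \<comment> \<open>All four depend on \<open>P\<close> alone, as required by their position before
    the quantifiers over graphs. \<open>u\<close> bounds the steps per tick, and \<open>q\<close>
    collects the constants of start-up, initial phase and delay.\<close>
  define u Q q K where "u = Suc u0" and "Q = prog (main P)" and "q = length pro + 2000 * (2 * length P + 20)"
    and "K = real (u * q)"
  show ?thesis
  proof (intro exI[of _ Q] exI[of _ K] allI impI, elim conjE)
    fix n E and w :: "nat set \<Rightarrow> real" and es :: "(nat \<times> nat) list"
    assume c: "connected_ugraph {..<n} E" and wn: "\<forall>e\<in>E. 0 \<le> w e" and es: "edge_list E es"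
    define m where "m = length es"
    define x where "x = graph_input n es w"
    have cm: "card E = m" using es distinct_card unfolding edge_list_def m_def by fastforce
    have x0: "x = (n # m # encode_edges es, encode_weights w es)" "length (encode_edges es) = 2 * m"
      "length (encode_weights w es) = m"
      by (simp_all add: x_def graph_input_def m_def encode_edges_nth encode_weights_def)
    have n1: "n \<noteq> 0" using c by (auto simp: connected_ugraph_def)
    have goal: "\<exists>cs. distinct cs \<and> set cs = {C. relevant_cut {..<n} E w C} \<and> sorted (map (cut_weight w) cs) \<and>
      halts_with_output Q x (concat (map (encode_cut es) cs)) \<and> (m > 0 \<longrightarrow>
        real (cut_time Q x m 1) \<le> K * ((real n)\<^sup>2 * real (\<phi> n m)) \<and>
        (\<forall>k\<in>{1..<length cs}. real (cut_time Q x m (Suc k)) - real (cut_time Q x m k) \<le>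
           K * (real n * real m * log 2 ((real n)\<^sup>2 / real m))) \<and>
        real (halt_time Q x) - real (cut_time Q x m (length cs)) \<le> K * (real n * real m * log 2 ((real n)\<^sup>2 / real m)))"
    proof (cases "n = 1")
      \<comment> \<open>One vertex admits neither edges nor cuts: the program only has to halt
        without output, and the time bounds are vacuous.\<close>
      case True
      have "e \<notin> E" for e
      proof
        assume "e \<in> E"
        then have "e \<subseteq> {0}" "card e = 2" using c True by (auto simp: connected_ugraph_def ugraph_def lessThan_Suc)
        then show False using card_mono[of "{0::nat}" e] by simp
      qed
      then have "E = {}" by blast
      then have m0: "m = 0" using cm by simp
      from prog_start[OF x0, of "main P"] True m0 obtain s where
        s: "sync (prog (main P)) x s (length pro)" "lg s = []" "clk s = length pro" "tk s = length pro" "sc s 0 = 0"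
        by auto
      have "wp (main P) (\<lambda>t. lg t = []) s" using s by (simp add: main_def)
      then obtain s' where s': "big (main P) s s'" "lg s' = []" unfolding wp_def by blast
      have "halts_with_output Q x []" using prog_result(1)[OF s(1-4) s'(1) wfc_main u] s'(2) by (simp add: Q_def)
      then show ?thesis using True m0 no_relevant_cut_singleton by (intro exI[of _ "[]"]) simp
    next
      case False
      then have n2: "2 \<le> n" using n1 by simp
      interpret connected_wgraph n m "\<lambda>i. fst (es ! i)" "\<lambda>i. snd (es ! i)" "\<lambda>i. w {fst (es ! i), snd (es ! i)}" w
        unfolding m_def by (rule connected_wgraph_edge_list(1)[OF c wn es n2])
      have ed: "edges = E" using connected_wgraph_edge_list(2)[OF c wn es n2] by (simp add: m_def)
      have be: "bits = encode_cut es"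
      proof
        fix C show "bits C = encode_cut es C" unfolding bits_def encode_cut_def
          by (rule nth_equalityI) (auto simp: case_prod_beta m_def)
      qed
      have xe: "fst x ! (2 * e + 2) = fst (es ! e) \<and> fst x ! (2 * e + 3) = snd (es ! e) \<and> snd x ! e = w {fst (es ! e), snd (es ! e)}"
        if "e < m" for e
      proof -
        have "2 * e + 2 = Suc (Suc (2 * e))" "2 * e + 3 = Suc (Suc (Suc (2 * e)))" by simp_all
        then show ?thesis using that encode_edges_nth(2,3)[of e es, folded mult_2]
          by (simp add: x0(1) m_def encode_weights_def case_prod_beta)
      qed
      then have "\<forall>e<m. fst x ! (2 * e + 2) = fst (es ! e) \<and> fst x ! (2 * e + 3) = snd (es ! e) \<and> snd x ! e = w {fst (es ! e), snd (es ! e)}"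
        by blast
      from main_times[OF assms u x0 this Q_def] obtain cs where
        cs: "distinct cs" "set cs = {C. relevant_cut {..<n} edges w C}" "sorted (map (cut_weight w) cs)"
          "halts_with_output Q x (concat (map bits cs))" and nm: "n \<le> m + 1"
        and t1: "cut_time Q x m 1 \<le> u * (length pro + inittime P \<phi> + delaytime)"
        and t2: "\<And>k. k\<in>{1..<length cs} \<Longrightarrow> cut_time Q x m (Suc k) \<le> cut_time Q x m k + u * delaytime"
        and t3: "halt_time Q x \<le> cut_time Q x m (length cs) + u * delaytime"
        unfolding u_def by blast
      define A where "A = n * n * \<phi> n m"
      have "1 \<le> A" using n2 m_pos m_le_phi[OF assms] by (simp add: A_def)
      then have "length pro \<le> length pro * A" by simp
      then have "length pro + inittime P \<phi> + delaytime \<le> q * A"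
        using inittime_le[OF assms nm] unfolding q_def A_def[symmetric] distrib_right by linarith
      then have "cut_time Q x m 1 \<le> u * (q * A)" by (rule le_trans[OF t1 mult_le_mono2])
      then have "real (cut_time Q x m 1) \<le> real (u * (q * A))" by (rule of_nat_mono)
      then have T1: "real (cut_time Q x m 1) \<le> K * ((real n)\<^sup>2 * real (\<phi> n m))"
        by (simp add: K_def A_def power2_eq_square mult.assoc)
      have D: "real (u * delaytime) \<le> K * (real n * real m * log 2 ((real n)\<^sup>2 / real m))"
      proof -
        have "delaytime \<le> q * (n * m)"
        proof -
          have "160 \<le> q" by (simp add: q_def)
          then have "160 * (n * m) \<le> q * (n * m)" by (rule mult_le_mono1)
          then show ?thesis using delaytime_le[OF nm] by (rule le_trans[rotated])
        qed
        then have "u * delaytime \<le> u * (q * (n * m))" by (rule mult_le_mono2)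
        then have "real (u * delaytime) \<le> real (u * (q * (n * m)))" by (rule of_nat_mono)
        then have "real (u * delaytime) \<le> K * (real n * real m)" by (simp add: K_def mult.assoc)
        also have "\<dots> = K * (real n * real m * 1)" by simp
        \<comment> \<open>The bound \<open>O(n m)\<close> is weakened by the logarithmic factor,
          which is at least 1.\<close>
        also have "\<dots> \<le> K * (real n * real m * log 2 ((real n)\<^sup>2 / real m))"
          using log_square_ratio_ge_1[OF _ edges_le_square] m_pos by (intro mult_left_mono) (auto simp: K_def)
        finally show ?thesis .
      qed
      have D2: "real (cut_time Q x m (Suc k)) - real (cut_time Q x m k) \<le> real (u * delaytime)" if "k \<in> {1..<length cs}" for k
        using t2[OF that] by linarith
      have D3: "real (halt_time Q x) - real (cut_time Q x m (length cs)) \<le> real (u * delaytime)" using t3 by linarith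
      show ?thesis using cs T1 order_trans[OF D2 D] order_trans[OF D3 D] unfolding ed be by (intro exI[of _ cs]) blast
    qed
    then show "let m = card E; x = graph_input n es w; delay = K * (real n * real m * log 2 ((real n)\<^sup>2 / real m))
       in \<exists>cs. distinct cs \<and> set cs = {C. relevant_cut {..<n} E w C} \<and> sorted (map (cut_weight w) cs) \<and>
            halts_with_output Q x (concat (map (encode_cut es) cs)) \<and>
            (m > 0 \<longrightarrow> real (cut_time Q x m 1) \<le> K * ((real n)\<^sup>2 * real (\<phi> n m)) \<and>
               (\<forall>k\<in>{1..<length cs}. real (cut_time Q x m (Suc k)) - real (cut_time Q x m k) \<le> delay) \<and>
               real (halt_time Q x) - real (cut_time Q x m (length cs)) \<le> delay)"
      unfolding Let_def cm x_def .
  qed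
qed

end
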